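(* There exists a constant $\varepsilon_0 > 0$ such that for every integer $d \geq 1$, $$\mathcal{L}_d \cap \left[0,\ d\sqrt{5} + \frac{\varepsilon_0}{d}\right] = \left\{d\sqrt{5}\right\}.$$ Moreover, for every integer $d\ge 1$ and every permutation $\pi \in S_{d+1}$ such that $\pi(1) = d+1$, the length vector $\lambda = \left(\frac{\sqrt{5}+1}{2},1,1,\ldots,1\right)\in\mathbb{R}_+^{d+1}$ is such that the interval exchange transformation $T_{\pi,\lambda}$ satisfies the Keane condition and $L(T_{\pi,\lambda}) = d\sqrt{5}$.
   Context: Given $k\ge 2$, a permutation $\pi\in S_k$ and a vector $\lambda=(\lambda_1,\dots,\lambda_k)$ with positive entries, put $|\lambda|=\lambda_1+\dots+\lambda_k$. The $k$-interval exchange transformation ($k$-i.e.t.) $T_{\pi,\lambda}\colon[0,|\lambda|)\to[0,|\lambda|)$ is defined by $$T_{\pi,\lambda}(x) = x - \sum_{j<i}\lambda_j + \sum_{\pi(j)<\pi(i)}\lambda_j \quad\text{if } x\in[\lambda_1+\dots+\lambda_{i-1},\ \lambda_1+\dots+\lambda_i).$$ The singularities of $T=T_{\pi,\lambda}$ are the points $x_i=\sum_{j\le i}\lambda_j$, $i=1,\dots,k-1$. $T$ satisfies the Keane condition (is without connection) if there is no pair of singularities $x,y$ of $T$ (possibly equal) with $T^n x=y$ for some $n\ge1$. If $T$ satisfies the Keane condition, then $T^n$ is an i.e.t. on $(k-1)n+1$ intervals, namely the intervals into which $[0,|\lambda|)$ is cut by the points $T^{-j}(x_i)$, $0\le j\le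 n-1$, $1\le i\le k-1$. Let $\varepsilon_n(T)$ be the smallest length of these intervals. Define $$\mathcal{E}(T)=\liminf_{n\to\infty}\frac{n\,\varepsilon_n(T)}{|\lambda|},\qquad L(T)=\mathcal{E}(T)^{-1}\in(0,+\infty]$$ ($L(T)$ is the Lagrange constant of $T$). For $d\ge1$, the Lagrange spectrum of $(d+1)$-i.e.t.s is $$\mathcal{L}_d=\{L(T) : T \text{ is a } (d+1)\text{-i.e.t. satisfying the Keane condition and } L(T)<\infty\}.$$ *)

theory Defs
  imports Complex_Main "HOL-Library.Extended_Real" "HOL-Combinatorics.Permutations"
begin

text \<open>
  A \<open>k\<close>-interval exchange transformation is given by a permutation \<open>\<pi>\<close> of \<open>{1..k}\<close> and a length
  vector \<open>lam\<close>, of which only the entries with index in \<open>{1..k}\<close> are relevant.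
\<close>

definition iet_data :: "nat \<Rightarrow> (nat \<Rightarrow> nat) \<Rightarrow> (nat \<Rightarrow> real) \<Rightarrow> bool" where
  "iet_data k \<pi> lam \<longleftrightarrow> 2 \<le> k \<and> \<pi> permutes {1..k} \<and> (\<forall>i\<in>{1..k}. 0 < lam i)"

definition total_length :: "nat \<Rightarrow> (nat \<Rightarrow> real) \<Rightarrow> real" where
  "total_length k lam = (\<Sum>j=1..k. lam j)"

definition singularity :: "(nat \<Rightarrow> real) \<Rightarrow> nat \<Rightarrow> real" where
  "singularity lam i = (\<Sum>j=1..i. lam j)"

definition iet_index :: "nat \<Rightarrow> (nat \<Rightarrow> real) \<Rightarrow> real \<Rightarrow> nat" where
  "iet_index k lam x = (THE i. i \<in> {1..k} \<and> (\<Sum>j=1..<i. lam j) \<le> x \<and> x < (\<Sum>j=1..i. lam j))"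

text \<open>The value of \<open>iet k \<pi> lam x\<close> is meaningful only for \<open>x \<in> {0..<total_length k lam}\<close>.\<close>

definition iet :: "nat \<Rightarrow> (nat \<Rightarrow> nat) \<Rightarrow> (nat \<Rightarrow> real) \<Rightarrow> real \<Rightarrow> real" where
  "iet k \<pi> lam x = (let i = iet_index k lam x in
     x - (\<Sum>j=1..<i. lam j) + (\<Sum>j | j \<in> {1..k} \<and> \<pi> j < \<pi> i. lam j))"

definition keane :: "nat \<Rightarrow> (nat \<Rightarrow> nat) \<Rightarrow> (nat \<Rightarrow> real) \<Rightarrow> bool" where
  "keane k \<pi> lam \<longleftrightarrow>
     \<not> (\<exists>i\<in>{1..k-1}. \<exists>j\<in>{1..k-1}. \<exists>n\<ge>1. (iet k \<pi> lam ^^ n) (singularity lam i) = singularity lam j)"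

text \<open>
  The cut points \<open>T\<^sup>-\<^sup>j(x\<^sub>i)\<close>, together with the two end points of the domain; the intervals into
  which the domain is cut are those between neighbouring points of this set.
\<close>

definition cut_points :: "nat \<Rightarrow> (nat \<Rightarrow> nat) \<Rightarrow> (nat \<Rightarrow> real) \<Rightarrow> nat \<Rightarrow> real set" where
  "cut_points k \<pi> lam n = {0, total_length k lam} \<union>
     {y \<in> {0..<total_length k lam}. \<exists>j<n. \<exists>i\<in>{1..k-1}. (iet k \<pi> lam ^^ j) y = singularity lam i}"

definition min_length :: "nat \<Rightarrow> (nat \<Rightarrow> nat) \<Rightarrow> (nat \<Rightarrow> real) \<Rightarrow> nat \<Rightarrow> real" where
  "min_length k \<pi> lam n = Min {b - a | a b. a \<in> cut_points k \<pi> lam n \<and> b \<in> cut_points k \<pi> lam n \<and>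
     a < b \<and> {a<..<b} \<inter> cut_points k \<pi> lam n = {}}"

definition iet_E :: "nat \<Rightarrow> (nat \<Rightarrow> nat) \<Rightarrow> (nat \<Rightarrow> real) \<Rightarrow> ereal" where
  "iet_E k \<pi> lam = liminf (\<lambda>n. ereal (real n * min_length k \<pi> lam n / total_length k lam))"

text \<open>In \<^typ>\<open>ereal\<close> the inverse of \<open>0\<close> is \<open>\<infinity>\<close>, as required.\<close>

definition lagrange_const :: "nat \<Rightarrow> (nat \<Rightarrow> nat) \<Rightarrow> (nat \<Rightarrow> real) \<Rightarrow> ereal" where
  "lagrange_const k \<pi> lam = inverse (iet_E k \<pi> lam)"

definition lagrange_spectrum :: "nat \<Rightarrow> real set" where
  "lagrange_spectrum d = {x. \<exists>\<pi> lam. iet_data (d+1) \<pi> lam \<and> keane (d+1) \<pi> lam \<and>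
     lagrange_const (d+1) \<pi> lam = ereal x}"

end

theory Submission
  imports Defs
begin

text \<open>
  Give every cut point the age \<open>\<tau>\<close>, the weighted number of steps that it needs to reach a
  singularity, and draw the graph whose edges join neighbouring cut points in the plane of positions
  and ages.  At each time \<open>n\<close> there are \<open>d\<close> triangles formed by the new cut points with their
  neighbours and \<open>d\<close> triangles formed by the discontinuities of the inverse map; their doubled areas
  add up to twice the weighted total length, up to the mesh size.  A triangle whose three edges
  \<open>(\<Delta>x, \<Delta>\<tau>)\<close> all satisfy \<open>\<bar>\<Delta>x \<Delta>\<tau>\<bar> \<ge> c\<close> has doubled area at least \<open>\<surd>5 c\<close>, with near equality only for
  edge ratios near the golden ratio.  This yields \<open>L \<ge> d \<surd>5\<close>.

  If \<open>L\<close> is close to \<open>d \<surd>5\<close>, all triangles are nearly golden at all late times.  The edges at the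
  singularities are then indexed by integer levels such that an edge of level \<open>p\<close> is cut into edges
  of the levels \<open>p + 1\<close> and \<open>p + 2\<close>, and lengths and ages satisfy Fibonacci recurrences coupled by
  permutations of the singularities.  After rescaling by powers of the golden ratio these recurrences
  are averages, so the sum of squares is monotone and all values merge.  Hence all edges
  have asymptotically equal \<open>\<bar>\<Delta>x \<Delta>\<tau>\<bar>\<close>, and the area identity forces \<open>L = d \<surd>5\<close>.

  For the golden length vector the first interval gets weight \<open>0\<close>.  Then \<open>\<bar>\<Delta>x \<Delta>\<tau>\<bar>\<close> is
  asymptotically at least \<open>1/\<surd>5\<close> by the norm form of \<open>\<int>[(1+\<surd>5)/2]\<close>, which is optimal for the
  weighted total length \<open>d\<close>.  So the merging argument applies, and gives the result for unit weights.
\<close>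

section \<open>Interval exchanges without connections\<close>

text \<open>Ages replace the time \<open>n\<close> because an edge can be moved along its orbits
  until its end of smaller order is a singularity, without change of its length or its age
  difference. For unit weights this difference is, up to one, the time from which the moved edge is
  a gap, so the product of length and age difference measures \<open>n * gap_min n\<close>. The
  obstacle is that nearly golden triangles fix ratios of lengths only locally. Errors add up along
  chains of edges, and two singularities may be joined only by a chain of length of order
  \<open>d\<close>. Since one triangle may carry the whole surplus of area, that surplus has to be
  small compared with \<open>1 / d\<close>, which is why the isolated interval has length
  \<open>\<epsilon>\<^sub>0 / d\<close>. Once integer levels exist, errors no longer accumulate,
  because the recurrences are exact. Two weights occur because the norm form controls the
  coefficient of the golden ratio in a displacement, not the number of steps. One weight certifies
  the golden shapes and so fixes the network of edges; the ages of any other weight obey the same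
  recurrences on this network.\<close>

locale interval_exchange =
  fixes d :: nat and \<pi> :: "nat \<Rightarrow> nat" and lam :: "nat \<Rightarrow> real"
  assumes d_pos: "1 \<le> d"
    and perm: "\<pi> permutes {1..Suc d}"
    and lam_pos: "\<And>i. i \<in> {1..Suc d} \<Longrightarrow> 0 < lam i"
begin

definition X :: "nat \<Rightarrow> real" where "X i = (\<Sum>j=1..i. lam j)"

text \<open>Partition points of the image: interval \<open>i\<close> is moved onto the one from
  \<open>Y (\<pi> i - 1)\<close> to \<open>Y (\<pi> i)\<close>, so the interior values are the
  possible discontinuities of the inverse of \<open>T\<close>.\<close>

definition Y :: "nat \<Rightarrow> real" where "Y s = (\<Sum>j | j \<in> {1..Suc d} \<and> \<pi> j \<le> s. lam j)"

definition \<Lambda> :: real where "\<Lambda> = X (Suc d)"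

definition T :: "real \<Rightarrow> real" where "T = iet (Suc d) \<pi> lam"

definition idx :: "real \<Rightarrow> nat" where "idx = iet_index (Suc d) lam"

lemma X_0 [simp]: "X 0 = 0"
  by (simp add: X_def)

lemma X_Suc: "X (Suc i) = X i + lam (Suc i)"
  by (simp add: X_def)

lemma X_less: "i < j \<Longrightarrow> j \<le> Suc d \<Longrightarrow> X i < X j"
proof (induction j)
  case (Suc j)
  have "X j < X (Suc j)"
    using lam_pos[of "Suc j"] Suc.prems by (simp add: X_Suc)
  then show ?case
    using Suc by (cases "i = j") auto
qed simp

lemma X_le: "i \<le> j \<Longrightarrow> j \<le> Suc d \<Longrightarrow> X i \<le> X j"
  using X_less by (cases "i = j") (auto simp: le_less)

lemma X_inj: "i \<le> Suc d \<Longrightarrow> j \<le> Suc d \<Longrightarrow> X i = X j \<longleftrightarrow> i = j"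
  by (metis X_less less_irrefl linorder_neqE_nat)

lemma \<pi>_mem: "\<pi> i \<in> {1..Suc d} \<longleftrightarrow> i \<in> {1..Suc d}"
  using perm by (rule permutes_in_image)

lemma \<pi>_inj: "\<pi> i = \<pi> j \<longleftrightarrow> i = j"
  using permutes_inj[OF perm] by (auto dest: injD)

lemma \<pi>_surj: "s \<in> {1..Suc d} \<Longrightarrow> \<exists>i\<in>{1..Suc d}. \<pi> i = s"
  using permutes_image[OF perm] by (metis imageE)

lemma Y_step: assumes "i \<in> {1..Suc d}" shows "Y (\<pi> i) = Y (\<pi> i - 1) + lam i"
proof -
  have "1 \<le> \<pi> i" using \<pi>_mem[of i] assms by auto
  then have "(j \<in> {1..Suc d} \<and> \<pi> j \<le> \<pi> i) = (j = i \<or> (j \<in> {1..Suc d} \<and> \<pi> j \<le> \<pi> i - 1))" for j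
    using \<pi>_inj[of j i] assms by (cases "j = i") (simp, linarith)
  then have "{j. j \<in> {1..Suc d} \<and> \<pi> j \<le> \<pi> i} = insert i {j. j \<in> {1..Suc d} \<and> \<pi> j \<le> \<pi> i - 1}"
    by blast
  moreover have "i \<notin> {j. j \<in> {1..Suc d} \<and> \<pi> j \<le> \<pi> i - 1}"
    using \<open>1 \<le> \<pi> i\<close> by auto
  ultimately show ?thesis
    by (simp add: Y_def)
qed

lemma Y_0 [simp]: "Y 0 = 0"
proof -
  have "\<not> \<pi> j \<le> 0" if "j \<in> {1..Suc d}" for j using \<pi>_mem[of j] that by auto
  then have "{j. j \<in> {1..Suc d} \<and> \<pi> j \<le> 0} = {}" by blast
  then show ?thesis by (simp only: Y_def sum.empty)
qed

lemma Y_top: "Y (Suc d) = \<Lambda>"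
proof -
  have "\<pi> j \<le> Suc d" if "j \<in> {1..Suc d}" for j using \<pi>_mem[of j] that by auto
  then have "{j. j \<in> {1..Suc d} \<and> \<pi> j \<le> Suc d} = {1..Suc d}" by blast
  then show ?thesis by (simp only: Y_def \<Lambda>_def X_def)
qed

lemma Y_less: "i < j \<Longrightarrow> j \<le> Suc d \<Longrightarrow> Y i < Y j"
proof (induction j)
  case (Suc j)
  obtain l where l: "l \<in> {1..Suc d}" "\<pi> l = Suc j"
    using \<pi>_surj[of "Suc j"] Suc.prems by auto
  have "Y j < Y (Suc j)"
    using Y_step[OF l(1)] lam_pos[OF l(1)] l(2) by simp
  then show ?case
    using Suc by (cases "i = j") auto
qed simp

lemma Y_le: "i \<le> j \<Longrightarrow> j \<le> Suc d \<Longrightarrow> Y i \<le> Y j"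
  using Y_less by (cases "i = j") (auto simp: le_less)

lemma Y_inj: "i \<le> Suc d \<Longrightarrow> j \<le> Suc d \<Longrightarrow> Y i = Y j \<longleftrightarrow> i = j"
  by (metis Y_less less_irrefl linorder_neqE_nat)

lemma \<Lambda>_pos: "0 < \<Lambda>"
  using X_less[of 0 "Suc d"] by (simp add: \<Lambda>_def)

lemma X_range: "i \<le> Suc d \<Longrightarrow> 0 \<le> X i \<and> X i \<le> \<Lambda>"
  using X_le[of 0 i] X_le[of i "Suc d"] by (simp add: \<Lambda>_def)

lemma X_interior: "q \<in> {1..d} \<Longrightarrow> 0 < X q \<and> X q < \<Lambda>"
  using X_less[of 0 q] X_less[of q "Suc d"] by (simp add: \<Lambda>_def)

lemma Y_range: "i \<le> Suc d \<Longrightarrow> 0 \<le> Y i \<and> Y i \<le> \<Lambda>"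
  using Y_le[of 0 i] Y_le[of i "Suc d"] by (simp add: Y_top)

lemma Y_interior: "q \<in> {1..d} \<Longrightarrow> 0 < Y q \<and> Y q < \<Lambda>"
  using Y_less[of 0 q] Y_less[of q "Suc d"] by (simp add: Y_top)

lemma step_function_index:
  fixes f :: "nat \<Rightarrow> real"
  assumes "f 0 \<le> x" "x < f n"
  shows "\<exists>i\<in>{1..n}. f (i - 1) \<le> x \<and> x < f i"
proof -
  define i where "i = (LEAST i. x < f i)"
  have i: "x < f i" "i \<le> n"
    unfolding i_def using assms(2) by (auto intro: LeastI Least_le)
  moreover have "i \<noteq> 0" using i assms(1) by (cases i) auto
  moreover have "f (i - 1) \<le> x"
    using not_less_Least[of "i - 1" "\<lambda>i. x < f i"] \<open>i \<noteq> 0\<close> by (fold i_def) auto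
  ultimately show ?thesis by (intro bexI[of _ i]) auto
qed

abbreviation D :: "real set" where "D \<equiv> {0..<\<Lambda>}"

lemma X_interval:
  assumes "x \<in> D" obtains i where "i \<in> {1..Suc d}" "X (i - 1) \<le> x" "x < X i"
proof -
  have "\<exists>i\<in>{1..Suc d}. X (i - 1) \<le> x \<and> x < X i"
    using assms by (intro step_function_index) (auto simp: \<Lambda>_def)
  then show ?thesis using that by blast
qed

lemma Y_interval:
  assumes "x \<in> D" obtains i where "i \<in> {1..Suc d}" "Y (\<pi> i - 1) \<le> x" "x < Y (\<pi> i)"
proof -
  have "\<exists>i\<in>{1..Suc d}. Y (i - 1) \<le> x \<and> x < Y i"
    using assms by (intro step_function_index) (auto simp: Y_top)
  then show ?thesis using that \<pi>_surj by metis
qed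

lemma X_interval_unique:
  assumes "i \<in> {1..Suc d}" "X (i - 1) \<le> x" "x < X i" "j \<in> {1..Suc d}" "X (j - 1) \<le> x" "x < X j"
  shows "i = j"
proof (rule ccontr)
  assume "i \<noteq> j"
  then consider "i \<le> j - 1" | "j \<le> i - 1" using assms by force
  then show False
  proof cases
    case 1
    then have "X i \<le> X (j - 1)" using assms by (intro X_le) auto
    then show False using assms by linarith
  next
    case 2
    then have "X j \<le> X (i - 1)" using assms by (intro X_le) auto
    then show False using assms by linarith
  qed
qed

lemma Y_interval_unique:
  assumes "i \<in> {1..Suc d}" "Y (i - 1) \<le> x" "x < Y i" "j \<in> {1..Suc d}" "Y (j - 1) \<le> x" "x < Y j"
  shows "i = j"
proof (rule ccontr)
  assume "i \<noteq> j"
  then consider "i \<le> j - 1" | "j \<le> i - 1" using assms by force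
  then show False
  proof cases
    case 1
    then have "Y i \<le> Y (j - 1)" using assms by (intro Y_le) auto
    then show False using assms by linarith
  next
    case 2
    then have "Y j \<le> Y (i - 1)" using assms by (intro Y_le) auto
    then show False using assms by linarith
  qed
qed

lemma idx_eq:
  assumes "i \<in> {1..Suc d}" "X (i - 1) \<le> x" "x < X i" shows "idx x = i"
proof -
  have *: "(\<Sum>j=1..<m. lam j) = X (m - 1)" if "m \<in> {1..Suc d}" for m
    unfolding X_def by (rule sum.cong) (use that in auto)
  have "\<And>m. m \<in> {1..Suc d} \<and> (\<Sum>j=1..<m. lam j) \<le> x \<and> x < (\<Sum>j=1..m. lam j)
      \<longleftrightarrow> m \<in> {1..Suc d} \<and> X (m - 1) \<le> x \<and> x < X m"
    using * by (auto simp: X_def)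
  then have "idx x = (THE m. m \<in> {1..Suc d} \<and> X (m - 1) \<le> x \<and> x < X m)"
    by (simp add: idx_def iet_index_def)
  also have "\<dots> = i"
    using assms X_interval_unique by (intro the_equality) blast+
  finally show ?thesis .
qed

lemma T_eq:
  assumes "i \<in> {1..Suc d}" "X (i - 1) \<le> x" "x < X i"
  shows "T x = x - X (i - 1) + Y (\<pi> i - 1)"
proof -
  have 1: "(\<Sum>j=1..<i. lam j) = X (i - 1)"
    unfolding X_def by (rule sum.cong) (use assms in auto)
  have "1 \<le> \<pi> i" using \<pi>_mem[of i] assms by auto
  then have 2: "{j. j \<in> {1..Suc d} \<and> \<pi> j < \<pi> i} = {j. j \<in> {1..Suc d} \<and> \<pi> j \<le> \<pi> i - 1}"
    by auto
  show ?thesis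
    using idx_eq[OF assms] 1 2 by (simp add: T_def iet_def idx_def Y_def)
qed

lemma T_image_interval:
  assumes "i \<in> {1..Suc d}" "X (i - 1) \<le> x" "x < X i"
  shows "Y (\<pi> i - 1) \<le> T x \<and> T x < Y (\<pi> i)"
  using T_eq[OF assms] Y_step[OF assms(1)] X_Suc[of "i - 1"] assms by auto

lemma T_mem: assumes "x \<in> D" shows "T x \<in> D"
proof -
  obtain i where i: "i \<in> {1..Suc d}" "X (i - 1) \<le> x" "x < X i" using X_interval assms by metis
  then have "\<pi> i \<in> {1..Suc d}" using \<pi>_mem by blast
  then show ?thesis
    using T_image_interval[OF i] Y_range[of "\<pi> i - 1"] Y_range[of "\<pi> i"] by force
qed

lemma T_inj: assumes "x \<in> D" "y \<in> D" "T x = T y" shows "x = y"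
proof -
  obtain i where i: "i \<in> {1..Suc d}" "X (i - 1) \<le> x" "x < X i" using X_interval assms by metis
  obtain j where j: "j \<in> {1..Suc d}" "X (j - 1) \<le> y" "y < X j" using X_interval assms by metis
  have "\<pi> i = \<pi> j"
    using T_image_interval[OF i] T_image_interval[OF j] \<pi>_mem i(1) j(1) assms(3)
    by (intro Y_interval_unique[of "\<pi> i" "T x" "\<pi> j"]) simp_all
  then have "i = j" using \<pi>_inj by simp
  then have "T y = y - X (i - 1) + Y (\<pi> i - 1)" using T_eq[OF j] by (simp only:)
  with T_eq[OF i] assms(3) show ?thesis by linarith
qed

lemma T_surj_interval:
  assumes "i \<in> {1..Suc d}" "Y (\<pi> i - 1) \<le> y" "y < Y (\<pi> i)"
  shows "X (i - 1) \<le> y - Y (\<pi> i - 1) + X (i - 1)" "y - Y (\<pi> i - 1) + X (i - 1) < X i"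
    "T (y - Y (\<pi> i - 1) + X (i - 1)) = y"
proof -
  show a: "X (i - 1) \<le> y - Y (\<pi> i - 1) + X (i - 1)" "y - Y (\<pi> i - 1) + X (i - 1) < X i"
    using Y_step[OF assms(1)] X_Suc[of "i - 1"] assms by auto
  show "T (y - Y (\<pi> i - 1) + X (i - 1)) = y"
    using T_eq[OF assms(1) a] by simp
qed

lemma T_surj: assumes "y \<in> D" shows "\<exists>x\<in>D. T x = y"
proof -
  obtain i where i: "i \<in> {1..Suc d}" "Y (\<pi> i - 1) \<le> y" "y < Y (\<pi> i)" using Y_interval assms by metis
  have "X i \<le> \<Lambda>" "0 \<le> X (i - 1)" using X_range[of i] X_range[of "i - 1"] i by auto
  then show ?thesis
    using T_surj_interval[OF i] by (intro bexI[of _ "y - Y (\<pi> i - 1) + X (i - 1)"]) auto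
qed

lemma bij_T: "bij_betw T D D"
proof (rule bij_betw_imageI)
  show "inj_on T D" using T_inj by (auto simp: inj_on_def)
  show "T ` D = D"
  proof (intro set_eqI iffI)
    fix y assume "y \<in> D"
    then show "y \<in> T ` D" using T_surj[of y] by blast
  qed (use T_mem in blast)
qed

lemma bij_T_pow: "bij_betw (T ^^ n) D D"
  by (rule bij_betw_funpow[OF bij_T])

lemma T_pow_mem: "x \<in> D \<Longrightarrow> (T ^^ n) x \<in> D"
  using bij_T_pow[of n] by (auto simp: bij_betw_def)

lemma T_pow_inj: "x \<in> D \<Longrightarrow> y \<in> D \<Longrightarrow> (T ^^ n) x = (T ^^ n) y \<Longrightarrow> x = y"
  using bij_T_pow[of n] by (auto simp: bij_betw_def inj_on_def)

lemma T_pow_add: "(T ^^ (m + n)) x = (T ^^ m) ((T ^^ n) x)"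
  by (simp add: funpow_add)

lemma T_X: assumes "i \<le> d" shows "T (X i) = Y (\<pi> (Suc i) - 1)"
  using T_eq[of "Suc i" "X i"] X_less[of i "Suc i"] assms by auto

lemma X_D: "q \<in> {1..d} \<Longrightarrow> X q \<in> D"
  using X_interior by force

end

section \<open>Orbits of the singularities and of the end points\<close>

locale keane_iet = interval_exchange +
  assumes no_connection: "keane (Suc d) \<pi> lam"
begin

lemma keane: assumes "p \<in> {1..d}" "q \<in> {1..d}" "1 \<le> n" shows "(T ^^ n) (X p) \<noteq> X q"
  using no_connection assms unfolding keane_def T_def X_def singularity_def by auto

text \<open>If the first interval stayed in place, its right end \<open>X 1 = Y 1\<close> would be
  the image of the singularity before the interval that is put second, which is a
  connection.\<close>

lemma \<pi>_first: "\<pi> 1 \<noteq> 1"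
proof
  assume 1: "\<pi> 1 = 1"
  obtain i where i: "i \<in> {1..Suc d}" "\<pi> i = 2" using \<pi>_surj[of 2] d_pos by auto
  then have "i \<noteq> 1" using 1 by auto
  then have im: "i - 1 \<in> {1..d}" "Suc (i - 1) = i" using i by auto
  have "T (X (i - 1)) = Y 1" using T_X[of "i - 1"] im i by auto
  also have "Y 1 = X 1" using Y_step[of 1] 1 X_Suc[of 0] by simp
  finally show False using keane[of "i - 1" 1 1] im d_pos by auto
qed

lemma \<pi>_last: "\<pi> (Suc d) \<noteq> Suc d"
proof
  assume 1: "\<pi> (Suc d) = Suc d"
  have "Y d = X d" using Y_step[of "Suc d"] 1 X_Suc[of d] Y_top by (simp add: \<Lambda>_def)
  then have "T (X d) = X d" using T_X[of d] 1 by simp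
  then show False using keane[of d d 1] d_pos by auto
qed

text \<open>The point \<open>0\<close> is not a singularity, but it is the image of one. Hence the
  Keane condition also governs the orbit of \<open>0\<close>, and with it the orbits of all interior
  \<open>Y s\<close>.\<close>

definition l0 :: nat where "l0 = (SOME i. i \<in> {1..d} \<and> \<pi> (Suc i) = 1)"

lemma l0: "l0 \<in> {1..d}" "\<pi> (Suc l0) = 1" "T (X l0) = 0"
proof -
  obtain i where i: "i \<in> {1..Suc d}" "\<pi> i = 1" using \<pi>_surj[of 1] by auto
  then have "i \<noteq> 1" using \<pi>_first by auto
  then have "i - 1 \<in> {1..d} \<and> \<pi> (Suc (i - 1)) = 1" using i by auto
  then have "l0 \<in> {1..d} \<and> \<pi> (Suc l0) = 1" unfolding l0_def by (rule someI)
  then show "l0 \<in> {1..d}" "\<pi> (Suc l0) = 1" by auto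
  then show "T (X l0) = 0" using T_X[of l0] by auto
qed

lemma orbit_0: assumes "q \<in> {1..d}" shows "(T ^^ n) 0 \<noteq> X q"
proof
  assume "(T ^^ n) 0 = X q"
  then have "(T ^^ Suc n) (X l0) = X q" by (simp add: funpow_Suc_right l0(3) del: funpow.simps)
  then show False using keane[of l0 q "Suc n"] l0 assms by auto
qed

lemma orbit_0_0: assumes "1 \<le> n" shows "(T ^^ n) 0 \<noteq> 0"
proof
  assume a: "(T ^^ n) 0 = 0"
  obtain m where m: "n = Suc m" using assms by (cases n) auto
  have "0 \<in> D" using \<Lambda>_pos by auto
  then have "(T ^^ m) 0 = X l0"
    using a m l0(3) T_inj[of "(T ^^ m) 0" "X l0"] T_pow_mem X_D[OF l0(1)] by auto
  then show False using orbit_0 l0 by auto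
qed

lemma Y_orbit: assumes "s \<in> {1..d}" "q \<in> {1..d}" shows "(T ^^ n) (Y s) \<noteq> X q"
proof
  assume a: "(T ^^ n) (Y s) = X q"
  obtain i where i: "i \<in> {1..Suc d}" "\<pi> i = Suc s" using \<pi>_surj[of "Suc s"] assms by auto
  have "T (X (i - 1)) = Y s" using T_X[of "i - 1"] i by auto
  then have b: "(T ^^ Suc n) (X (i - 1)) = X q"
    using a by (simp add: funpow_Suc_right del: funpow.simps)
  show False
  proof (cases "i = 1")
    case True
    then show ?thesis using b orbit_0[OF assms(2)] by (metis X_0 diff_self_eq_0)
  next
    case False
    then have "i - 1 \<in> {1..d}" using i by auto
    then show ?thesis using b keane[of "i - 1" q "Suc n"] assms by auto
  qed
qed

lemma X_top: "X (Suc d) = \<Lambda>"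
  by (simp add: \<Lambda>_def)

section \<open>Cut points as iterated preimages of the singularities\<close>

definition cut :: "nat \<Rightarrow> nat \<Rightarrow> real" where "cut q j = inv_into D (T ^^ j) (X q)"

lemma T_pow_cut: assumes "q \<in> {1..d}" shows "(T ^^ j) (cut q j) = X q" "cut q j \<in> D"
proof -
  have "X q \<in> (T ^^ j) ` D"
    using X_D[OF assms] bij_T_pow[of j] by (simp add: bij_betw_def)
  then show "(T ^^ j) (cut q j) = X q" "cut q j \<in> D"
    unfolding cut_def by (rule f_inv_into_f, rule inv_into_into)
qed

lemma cut_eqI: assumes "q \<in> {1..d}" "y \<in> D" "(T ^^ j) y = X q" shows "cut q j = y"
  using T_pow_inj[of "cut q j" y j] T_pow_cut[OF assms(1)] assms by simp

lemma cut_0 [simp]: "q \<in> {1..d} \<Longrightarrow> cut q 0 = X q"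
  using X_D by (intro cut_eqI) auto

lemma T_cut: assumes "q \<in> {1..d}" shows "(T ^^ i) (cut q (i + j)) = cut q j"
  using T_pow_cut[OF assms, of "i + j"] T_pow_mem assms
  by (intro cut_eqI[symmetric]) (simp_all add: T_pow_add[symmetric] add.commute)

text \<open>A common value of two such preimages gives a singularity that is mapped to a singularity
  in \<open>\<bar>j - i\<bar>\<close> steps, which the Keane condition allows only for
  \<open>i = j\<close>. This makes \<open>ord\<close> and \<open>qof\<close> well defined.\<close>

lemma cut_inj:
  assumes "p \<in> {1..d}" "q \<in> {1..d}" "cut p i = cut q j" shows "p = q \<and> i = j"
proof -
  have *: "p = q \<and> i = j" if "p \<in> {1..d}" "q \<in> {1..d}" "cut p i = cut q j" "i \<le> j" for p q i j
  proof -
    have a: "(T ^^ (j - i)) (X p) = X q"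
      using T_pow_cut(1)[OF that(1), of i] T_pow_cut(1)[OF that(2), of j] that T_pow_add[of "j - i" i] by simp
    then have "\<not> 1 \<le> j - i" using keane that by blast
    then show ?thesis using a that X_inj[of p q] by auto
  qed
  show ?thesis
  proof (cases "i \<le> j")
    case True then show ?thesis using * assms by blast
  next
    case False
    then have "q = p \<and> j = i" using *[of q p j i] assms by auto
    then show ?thesis by simp
  qed
qed

lemma cut_range: assumes "q \<in> {1..d}" shows "0 < cut q j" "cut q j < \<Lambda>"
proof -
  have "cut q j \<noteq> 0" using T_pow_cut(1)[OF assms, of j] orbit_0[OF assms, of j] by metis
  then show "0 < cut q j" "cut q j < \<Lambda>" using T_pow_cut(2)[OF assms, of j] by auto
qed

definition cuts :: "real set" where "cuts = {cut q j | q j. q \<in> {1..d}}"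

definition ord :: "real \<Rightarrow> nat" where
  "ord y = (if y \<in> cuts then THE j. \<exists>q\<in>{1..d}. y = cut q j else 0)"

text \<open>The ends get the artificial indices \<open>0\<close> and \<open>Suc d\<close>, so that
  \<open>X (qof a)\<close> is the base of an edge at \<open>a\<close> in these cases too.\<close>

definition qof :: "real \<Rightarrow> nat" where
  "qof y = (if y \<in> cuts then THE q. q \<in> {1..d} \<and> (\<exists>j. y = cut q j) else if y = 0 then 0 else Suc d)"

definition C :: "nat \<Rightarrow> real set" where
  "C n = {0, \<Lambda>} \<union> (\<lambda>(q, j). cut q j) ` ({1..d} \<times> {..<n})"

lemma cut_cuts [simp]: "q \<in> {1..d} \<Longrightarrow> cut q j \<in> cuts"
  by (auto simp: cuts_def)

lemma ord_cut [simp]: assumes "q \<in> {1..d}" shows "ord (cut q j) = j"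
proof -
  have "(THE i. \<exists>p\<in>{1..d}. cut q j = cut p i) = j"
    using assms cut_inj by (intro the_equality) blast+
  then show ?thesis using assms by (simp add: ord_def)
qed

lemma qof_cut [simp]: assumes "q \<in> {1..d}" shows "qof (cut q j) = q"
proof -
  have "(THE p. p \<in> {1..d} \<and> (\<exists>i. cut q j = cut p i)) = q"
    using assms cut_inj by (intro the_equality) blast+
  then show ?thesis using assms by (simp add: qof_def)
qed

lemma cuts_eq: assumes "y \<in> cuts" shows "qof y \<in> {1..d}" "y = cut (qof y) (ord y)"
  using assms by (auto simp: cuts_def simp del: atLeastAtMost_iff)

lemma cuts_range: "y \<in> cuts \<Longrightarrow> 0 < y \<and> y < \<Lambda>"
  using cut_range by (auto simp: cuts_def simp del: atLeastAtMost_iff)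

lemma cuts_D: "y \<in> cuts \<Longrightarrow> y \<in> D"
  using cuts_range by force

lemma ends_not_cuts [simp]: "0 \<notin> cuts" "\<Lambda> \<notin> cuts"
  using cuts_range by auto

lemma ord_ends [simp]: "ord 0 = 0" "ord \<Lambda> = 0"
  by (simp_all add: ord_def)

lemma qof_ends [simp]: "qof 0 = 0" "qof \<Lambda> = Suc d"
  using \<Lambda>_pos by (simp_all add: qof_def)

lemma C_mem: "y \<in> C n \<longleftrightarrow> y = 0 \<or> y = \<Lambda> \<or> (y \<in> cuts \<and> ord y < n)"
proof
  assume "y \<in> C n" then show "y = 0 \<or> y = \<Lambda> \<or> (y \<in> cuts \<and> ord y < n)"
    by (auto simp: C_def)
next
  assume "y = 0 \<or> y = \<Lambda> \<or> (y \<in> cuts \<and> ord y < n)"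
  then show "y \<in> C n"
    using cuts_eq[of y] by (auto simp: C_def image_iff intro!: bexI[of _ "(qof y, ord y)"])
qed

lemma C_finite [simp]: "finite (C n)"
  by (simp add: C_def)

lemma C_mono: "m \<le> n \<Longrightarrow> C m \<subseteq> C n"
  by (auto simp: C_mem)

lemma C_range: "y \<in> C n \<Longrightarrow> 0 \<le> y \<and> y \<le> \<Lambda>"
  using cuts_range[of y] \<Lambda>_pos by (auto simp: C_mem)

lemma C_ends [simp]: "0 \<in> C n" "\<Lambda> \<in> C n"
  by (auto simp: C_mem)

lemma X_cuts: "q \<in> {1..d} \<Longrightarrow> X q \<in> cuts \<and> ord (X q) = 0 \<and> qof (X q) = q"
  using cut_cuts[of q 0] ord_cut[of q 0] qof_cut[of q 0] by simp

lemma X_C: assumes "i \<le> Suc d" "1 \<le> n" shows "X i \<in> C n"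
proof -
  consider "i = 0" | "i = Suc d" | "i \<in> {1..d}" using assms by force
  then show ?thesis using X_cuts assms by cases (auto simp: C_mem \<Lambda>_def)
qed

lemma X_qof: assumes "a \<in> C n" shows "qof a \<le> Suc d" "a \<noteq> \<Lambda> \<Longrightarrow> (T ^^ ord a) a = X (qof a)"
proof -
  show "qof a \<le> Suc d" using assms cuts_eq[of a] by (auto simp: C_mem)
  show "(T ^^ ord a) a = X (qof a)" if "a \<noteq> \<Lambda>"
    using assms that cuts_eq[of a] T_pow_cut(1)[of "qof a" "ord a"] by (auto simp: C_mem)
qed

lemma T_pow_cuts: assumes "y \<in> cuts" "j \<le> ord y"
  shows "(T ^^ j) y \<in> cuts" "ord ((T ^^ j) y) = ord y - j" "qof ((T ^^ j) y) = qof y"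
proof -
  have "(T ^^ j) y = cut (qof y) (ord y - j)"
    using T_cut[OF cuts_eq(1)[OF assms(1)], of j "ord y - j"] cuts_eq(2)[OF assms(1)] assms(2) by simp
  then show "(T ^^ j) y \<in> cuts" "ord ((T ^^ j) y) = ord y - j" "qof ((T ^^ j) y) = qof y"
    using cuts_eq(1)[OF assms(1)] by simp_all
qed

lemma T_pow_cuts_conv:
  assumes "x \<in> D" "(T ^^ j) x \<in> cuts"
  shows "x \<in> cuts" "ord x = ord ((T ^^ j) x) + j" "qof x = qof ((T ^^ j) x)"
proof -
  let ?y = "(T ^^ j) x"
  have "cut (qof ?y) (ord ?y + j) = x"
    using cuts_eq[OF assms(2)] T_pow_cut(1)[of "qof ?y" "ord ?y"] assms(1)
    by (intro cut_eqI) (auto simp: T_pow_add)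
  then show "x \<in> cuts" "ord x = ord ?y + j" "qof x = qof ?y"
    using cuts_eq(1)[OF assms(2)] by (metis cut_cuts, metis ord_cut, metis qof_cut)
qed

text \<open>No cut point lies strictly between \<open>a\<close> and \<open>b\<close>; the end points need not be cut points.\<close>

definition free :: "nat \<Rightarrow> real \<Rightarrow> real \<Rightarrow> bool" where
  "free n a b \<longleftrightarrow> 0 \<le> a \<and> a < b \<and> b \<le> \<Lambda> \<and> (\<forall>y\<in>C n. y \<le> a \<or> b \<le> y)"

lemma free_mono: "free n a b \<Longrightarrow> m \<le> n \<Longrightarrow> free m a b"
  using C_mono[of m n] by (auto simp: free_def)

lemma free_sub: "free n a b \<Longrightarrow> a \<le> a' \<Longrightarrow> a' < b' \<Longrightarrow> b' \<le> b \<Longrightarrow> free n a' b'"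
  unfolding free_def by fastforce

text \<open>By induction on \<open>j\<close>: if the translated interval reached beyond the end
  \<open>X i\<close> of its interval of continuity, the point that lands on \<open>X i\<close> would
  be a cut point of order \<open>j < n\<close> strictly between \<open>a\<close> and
  \<open>b\<close>.\<close>

lemma free_translate:
  assumes "free n a b" "j \<le> n"
  shows "\<And>x. a \<le> x \<Longrightarrow> x < b \<Longrightarrow> (T ^^ j) x = (T ^^ j) a + (x - a)"
    "\<And>x i. a \<le> x \<Longrightarrow> x < b \<Longrightarrow> i < j \<Longrightarrow> idx ((T ^^ i) x) = idx ((T ^^ i) a)"
    "(T ^^ j) a + (b - a) \<le> \<Lambda>"
proof -
  have "(\<forall>x. a \<le> x \<and> x < b \<longrightarrow> (T ^^ j) x = (T ^^ j) a + (x - a) \<and>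
         (\<forall>i<j. idx ((T ^^ i) x) = idx ((T ^^ i) a))) \<and> (T ^^ j) a + (b - a) \<le> \<Lambda>"
    using assms(2)
  proof (induction j)
    case 0 then show ?case using assms(1) by (auto simp: free_def)
  next
    case (Suc j)
    let ?a = "(T ^^ j) a"
    note IH = Suc.IH[OF Suc_leD[OF Suc.prems]]
    have IH1: "(T ^^ j) x = ?a + (x - a)" if "a \<le> x" "x < b" for x using IH that by blast
    have IH2: "?a + (b - a) \<le> \<Lambda>" using IH by blast
    have ab: "0 \<le> a" "a < b" "b \<le> \<Lambda>" using assms(1) by (auto simp: free_def)
    have aD: "?a \<in> D" using ab by (intro T_pow_mem) auto
    then obtain i where i: "i \<in> {1..Suc d}" "X (i - 1) \<le> ?a" "?a < X i" using X_interval by metis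
    have b: "?a + (b - a) \<le> X i"
    proof (rule ccontr)
      assume n: "\<not> ?thesis"
      then have "i \<noteq> Suc d" using IH2 X_top by auto
      then have q: "i \<in> {1..d}" using i by auto
      let ?x = "a + (X i - ?a)"
      have x: "a < ?x" "?x < b" using n i by auto
      then have "(T ^^ j) ?x = X i" using IH1[of ?x] by linarith
      then have "cut i j = ?x" using q x ab by (intro cut_eqI) auto
      moreover have "cut i j \<in> C n" using q Suc.prems by (simp add: C_mem)
      ultimately have "?x \<in> C n" by simp
      then show False using x assms(1) by (force simp: free_def)
    qed
    have *: "T ((T ^^ j) x) = T ?a + (x - a) \<and> idx ((T ^^ j) x) = idx ?a" if "a \<le> x" "x < b" for x
    proof -
      have e: "(T ^^ j) x = ?a + (x - a)" using IH1 that by blast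
      have r: "X (i - 1) \<le> (T ^^ j) x" "(T ^^ j) x < X i" using e b i that by auto
      show ?thesis
        using T_eq[OF i(1) r] T_eq[OF i] idx_eq[OF i(1) r] idx_eq[OF i] e by linarith
    qed
    have "Y (\<pi> i) \<le> \<Lambda>" using \<pi>_mem[of i] i(1) Y_range[of "\<pi> i"] by auto
    moreover have "T ?a + (b - a) \<le> Y (\<pi> i)"
      using T_eq[OF i] Y_step[OF i(1)] X_Suc[of "i - 1"] i(1) b by auto
    ultimately have "(T ^^ Suc j) a + (b - a) \<le> \<Lambda>" by simp
    moreover have "(T ^^ Suc j) x = (T ^^ Suc j) a + (x - a) \<and>
        (\<forall>i<Suc j. idx ((T ^^ i) x) = idx ((T ^^ i) a))" if "a \<le> x \<and> x < b" for x
    proof -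
      have "(T ^^ Suc j) x = (T ^^ Suc j) a + (x - a)" using *[of x] that by simp
      moreover have "\<forall>i<j. idx ((T ^^ i) x) = idx ((T ^^ i) a)" using IH that by blast
      moreover have "idx ((T ^^ j) x) = idx ((T ^^ j) a)" using *[of x] that by blast
      ultimately show ?thesis using less_Suc_eq by metis
    qed
    ultimately show ?case by blast
  qed
  then show "\<And>x. a \<le> x \<Longrightarrow> x < b \<Longrightarrow> (T ^^ j) x = (T ^^ j) a + (x - a)"
    "\<And>x i. a \<le> x \<Longrightarrow> x < b \<Longrightarrow> i < j \<Longrightarrow> idx ((T ^^ i) x) = idx ((T ^^ i) a)"
    "(T ^^ j) a + (b - a) \<le> \<Lambda>" by blast+
qed

lemma free_image:
  assumes "free n a b" "j \<le> n"
  shows "free (n - j) ((T ^^ j) a) ((T ^^ j) a + (b - a))"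
proof -
  let ?a = "(T ^^ j) a"
  have ab: "0 \<le> a" "a < b" "b \<le> \<Lambda>" using assms(1) by (auto simp: free_def)
  have aD: "?a \<in> D" using ab by (intro T_pow_mem) auto
  have "y \<le> ?a \<or> ?a + (b - a) \<le> y" if y: "y \<in> C (n - j)" for y
  proof (rule ccontr)
    assume n: "\<not> ?thesis"
    let ?x = "a + (y - ?a)"
    have x: "a < ?x" "?x < b" "(T ^^ j) ?x = y" using n free_translate(1)[OF assms, of ?x] by auto
    have "y \<noteq> 0" "y \<noteq> \<Lambda>" using n aD free_translate(3)[OF assms] by auto
    then have yc: "y \<in> cuts" "ord y < n - j" using y by (auto simp: C_mem)
    have "?x \<in> cuts" "ord ?x = ord y + j"
      using T_pow_cuts_conv[of ?x j] x(3) yc(1) x ab by auto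
    then have "?x \<in> C n" using yc by (auto simp: C_mem)
    then show False using x assms(1) by (force simp: free_def)
  qed
  then show ?thesis using ab aD free_translate(3)[OF assms] by (auto simp: free_def)
qed

text \<open>A right end that is a cut point of order at least \<open>j\<close> is not among the cuts
  of order below \<open>j\<close>, so the interval on which \<open>T ^^ j\<close> is a translation
  extends beyond it. This adds the end \<open>b\<close> itself to the half-open statement.\<close>

lemma free_extend:
  assumes "free n a b" "j \<le> n" "b \<in> cuts" "j \<le> ord b"
  shows "\<exists>b'>b. free j a b'"
proof -
  define b' where "b' = Min {y \<in> C j. b < y}"
  have ne: "\<Lambda> \<in> {y \<in> C j. b < y}" using cuts_range[OF assms(3)] by auto
  have b': "b' \<in> {y \<in> C j. b < y}" unfolding b'_def using ne by (intro Min_in) (simp, blast)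
  have "y \<le> a \<or> b' \<le> y" if "y \<in> C j" for y
  proof (cases "b < y")
    case True then show ?thesis using that unfolding b'_def by (auto intro: Min_le)
  next
    case False
    moreover have "y \<noteq> b" using that assms(3,4) cuts_range by (auto simp: C_mem)
    moreover have "y \<in> C n" using that C_mono[OF assms(2)] by auto
    ultimately show ?thesis using assms(1) by (force simp: free_def)
  qed
  moreover have "b' \<le> \<Lambda>" using b' C_range by blast
  ultimately show ?thesis using b' assms(1) by (intro exI[of _ b']) (auto simp: free_def)
qed

lemma free_translate_closed:
  assumes "free n a b" "j \<le> n" "b \<in> cuts" "j \<le> ord b"
  shows "(T ^^ j) b = (T ^^ j) a + (b - a)" "\<And>i. i < j \<Longrightarrow> idx ((T ^^ i) b) = idx ((T ^^ i) a)"
proof -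
  obtain b' where b': "b < b'" "free j a b'" using free_extend[OF assms] by blast
  have "a \<le> b" using assms(1) by (auto simp: free_def)
  then show "(T ^^ j) b = (T ^^ j) a + (b - a)" "\<And>i. i < j \<Longrightarrow> idx ((T ^^ i) b) = idx ((T ^^ i) a)"
    by (rule free_translate[OF b'(2) order_refl], intro b'(1), rule free_translate(2)[OF b'(2) order_refl _ b'(1)])
qed

definition \<tau> :: "(nat \<Rightarrow> real) \<Rightarrow> real \<Rightarrow> real" where
  "\<tau> w y = (\<Sum>i<ord y. w (idx ((T ^^ i) y)))"

lemma \<tau>_ends [simp]: "\<tau> w 0 = 0" "\<tau> w \<Lambda> = 0"
  by (simp_all add: \<tau>_def)

lemma \<tau>_X: "q \<in> {1..d} \<Longrightarrow> \<tau> w (X q) = 0"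
  using X_cuts by (simp add: \<tau>_def)

lemma sum_split_lessThan: "(\<Sum>i<m + n. f i) = (\<Sum>i<m. f i) + (\<Sum>i<n. f (m + i))" for f :: "nat \<Rightarrow> real"
  by (induction n) (auto simp: algebra_simps)

lemma \<tau>_split: assumes "y \<in> cuts" "j \<le> ord y"
  shows "\<tau> w y = (\<Sum>i<j. w (idx ((T ^^ i) y))) + \<tau> w ((T ^^ j) y)"
proof -
  have "(T ^^ (j + i)) y = (T ^^ i) ((T ^^ j) y)" for i
    by (metis T_pow_add add.commute)
  moreover have "ord ((T ^^ j) y) = ord y - j" using T_pow_cuts[OF assms] by simp
  ultimately show ?thesis
    using sum_split_lessThan[where f = "\<lambda>i. w (idx ((T ^^ i) y))" and m = j and n = "ord y - j"] assms(2)
    by (simp add: \<tau>_def)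
qed

text \<open>The unordered form of \<open>free\<close>: the end of smaller order, from which an edge
  is measured, may be on either side.\<close>

definition nb :: "nat \<Rightarrow> real \<Rightarrow> real \<Rightarrow> bool" where
  "nb n a b \<longleftrightarrow> free n (min a b) (max a b)"

lemma nb_sym: "nb n a b \<longleftrightarrow> nb n b a"
  by (simp add: nb_def min.commute max.commute)

lemma nb_mono: "nb n a b \<Longrightarrow> m \<le> n \<Longrightarrow> nb m a b"
  by (auto simp: nb_def intro: free_mono)

lemma nb_neq: "nb n a b \<Longrightarrow> a \<noteq> b"
  by (auto simp: nb_def free_def)

text \<open>An edge is moved along the orbits until its end point of smaller order becomes a singularity.\<close>

lemma push:
  assumes "a \<in> C n" "b \<in> C n" "nb n a b" "ord a < ord b" "j \<le> ord a" "a \<noteq> \<Lambda> \<or> j = 0"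
  shows "(T ^^ j) b - (T ^^ j) a = b - a" "nb (n - j) ((T ^^ j) a) ((T ^^ j) b)"
    "(T ^^ j) b \<in> cuts" "ord ((T ^^ j) b) = ord b - j" "qof ((T ^^ j) b) = qof b"
    "\<tau> w ((T ^^ j) b) - \<tau> w ((T ^^ j) a) = \<tau> w b - \<tau> w a"
proof -
  have bc: "b \<in> cuts" "ord b < n" using assms by (auto simp: C_mem)
  show "(T ^^ j) b \<in> cuts" "ord ((T ^^ j) b) = ord b - j" "qof ((T ^^ j) b) = qof b"
    using T_pow_cuts[OF bc(1), of j] assms(4,5) by auto
  have jn: "j \<le> n" "j \<le> ord b" using assms(4,5) bc by auto
  have "j = 0 \<or> a \<in> cuts"
    using assms by (auto simp: C_mem)
  moreover
  have "(T ^^ j) b - (T ^^ j) a = b - a \<and> nb (n - j) ((T ^^ j) a) ((T ^^ j) b) \<and>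
     \<tau> w ((T ^^ j) b) - \<tau> w ((T ^^ j) a) = \<tau> w b - \<tau> w a" if ac: "a \<in> cuts"
  proof (cases "a < b")
    case True
    then have f: "free n a b" using assms(3) by (simp add: nb_def)
    have 1: "(T ^^ j) b = (T ^^ j) a + (b - a)" "\<And>i. i < j \<Longrightarrow> idx ((T ^^ i) b) = idx ((T ^^ i) a)"
      using free_translate_closed[OF f jn(1) bc(1) jn(2)] by auto
    have 2: "nb (n - j) ((T ^^ j) a) ((T ^^ j) b)"
      using free_image[OF f jn(1)] 1(1) True by (simp add: nb_def min_def max_def)
    show ?thesis
      using 1 2 \<tau>_split[OF bc(1) jn(2), of w] \<tau>_split[OF ac assms(5), of w] by simp
  next
    case False
    then have ab: "b < a" using assms(4) by (cases "a = b") auto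
    then have f: "free n b a" using assms(3) by (simp add: nb_def)
    have 1: "(T ^^ j) a = (T ^^ j) b + (a - b)" "\<And>i. i < j \<Longrightarrow> idx ((T ^^ i) a) = idx ((T ^^ i) b)"
      using free_translate_closed[OF f jn(1) ac assms(5)] by auto
    have 2: "nb (n - j) ((T ^^ j) a) ((T ^^ j) b)"
      using free_image[OF f jn(1)] 1(1) ab by (simp add: nb_def min_def max_def)
    show ?thesis
      using 1 2 \<tau>_split[OF bc(1) jn(2), of w] \<tau>_split[OF ac assms(5), of w] by simp
  qed
  moreover have "(T ^^ j) b - (T ^^ j) a = b - a \<and> nb (n - j) ((T ^^ j) a) ((T ^^ j) b) \<and>
     \<tau> w ((T ^^ j) b) - \<tau> w ((T ^^ j) a) = \<tau> w b - \<tau> w a" if "j = 0"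
    using that assms(3) by simp
  ultimately show "(T ^^ j) b - (T ^^ j) a = b - a" "nb (n - j) ((T ^^ j) a) ((T ^^ j) b)"
    "\<tau> w ((T ^^ j) b) - \<tau> w ((T ^^ j) a) = \<tau> w b - \<tau> w a" by blast+
qed

lemma push_base:
  assumes "a \<in> C n" "b \<in> C n" "nb n a b" "ord a < ord b"
  defines "b' \<equiv> (T ^^ ord a) b"
  shows "b' - X (qof a) = b - a" "nb (n - ord a) (X (qof a)) b'"
    "b' \<in> cuts" "ord b' = ord b - ord a" "qof b' = qof b" "\<tau> w b' = \<tau> w b - \<tau> w a"
proof -
  note p = push[OF assms(1-4) order_refl, folded b'_def]
  have "a \<noteq> \<Lambda> \<or> ord a = 0" by auto
  moreover have base: "(T ^^ ord a) a = X (qof a)"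
    using X_qof(2)[OF assms(1)] by (cases "a = \<Lambda>") (simp_all add: X_top)
  moreover have "\<tau> w (X (qof a)) = 0"
  proof -
    consider "qof a = 0" | "qof a = Suc d" | "qof a \<in> {1..d}" using X_qof(1)[OF assms(1)] by force
    then show ?thesis using \<tau>_X by cases (auto simp: X_top)
  qed
  ultimately show "b' - X (qof a) = b - a" "nb (n - ord a) (X (qof a)) b'"
    "b' \<in> cuts" "ord b' = ord b - ord a" "qof b' = qof b" "\<tau> w b' = \<tau> w b - \<tau> w a"
    using p(1-5) p(6)[of w] by auto
qed

definition lmin :: real where "lmin = Min (lam ` {1..Suc d})"

lemma lmin: "0 < lmin" "i \<in> {1..Suc d} \<Longrightarrow> lmin \<le> lam i"
proof -
  have "lmin \<in> lam ` {1..Suc d}" unfolding lmin_def by (intro Min_in) auto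
  then show "0 < lmin" using lam_pos by auto
  show "i \<in> {1..Suc d} \<Longrightarrow> lmin \<le> lam i" unfolding lmin_def by (intro Min_le) auto
qed

lemma X_gap: assumes "i < j" "j \<le> Suc d" shows "lmin \<le> X j - X i"
proof -
  have "X (Suc i) \<le> X j" using assms by (intro X_le) auto
  moreover have "lmin \<le> lam (Suc i)" using assms by (intro lmin) auto
  ultimately show ?thesis by (simp add: X_Suc)
qed

lemma Y_gap: assumes "i < j" "j \<le> Suc d" shows "lmin \<le> Y j - Y i"
proof -
  obtain l where l: "l \<in> {1..Suc d}" "\<pi> l = j" using \<pi>_surj[of j] assms by auto
  have "Y i \<le> Y (j - 1)" using assms by (intro Y_le) auto
  then show ?thesis using Y_step[OF l(1)] l lmin(2)[OF l(1)] by simp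
qed

text \<open>Moved along by their common order both ends become points \<open>X i\<close>, and
  distinct ones are at least \<open>lmin\<close> apart. So once the mesh is below
  \<open>lmin\<close>, neighbouring cut points have different orders.\<close>

lemma equal_ord:
  assumes "a \<in> C n" "b \<in> C n" "nb n a b" "ord a = ord b"
  shows "lmin \<le> \<bar>b - a\<bar>"
proof -
  have *: "lmin \<le> b - a" if ab: "a < b" "a \<in> C n" "b \<in> C n" "nb n a b" "ord a = ord b" for a b
  proof (cases "ord a = 0")
    case True
    then have "a = X (qof a)" "b = X (qof b)" "qof a \<le> Suc d" "qof b \<le> Suc d"
      using X_qof[of a n] X_qof[of b n] ab by (cases "a = \<Lambda>"; cases "b = \<Lambda>"; auto simp: X_top)+
    moreover have "qof a < qof b"
      using X_le[of "qof b" "qof a"] calculation ab(1) by force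
    ultimately show ?thesis using X_gap[of "qof a" "qof b"] by metis
  next
    case False
    then have c: "a \<in> cuts" "b \<in> cuts" "ord a < n" using ab by (auto simp: C_mem)
    have f: "free n a b" using ab by (simp add: nb_def)
    have "(T ^^ ord a) b = (T ^^ ord a) a + (b - a)"
      using free_translate_closed[OF f _ c(2)] ab c(3) by auto
    moreover have "a \<noteq> \<Lambda>" "b \<noteq> \<Lambda>" using c ends_not_cuts by metis+
    then have "(T ^^ ord a) a = X (qof a)" "(T ^^ ord b) b = X (qof b)"
      using X_qof(2)[OF ab(2)] X_qof(2)[OF ab(3)] by auto
    ultimately have e: "b - a = X (qof b) - X (qof a)" using ab by simp
    then have "qof a < qof b"
      using X_le[of "qof b" "qof a"] X_qof(1)[OF ab(2)] ab(1) by force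
    then show ?thesis using e X_gap X_qof(1)[OF ab(3)] by simp
  qed
  have "a \<noteq> b" using nb_neq assms by blast
  then show ?thesis
    using *[of a b] *[of b a] assms nb_sym[of n a b] by (cases "a < b") auto
qed

subsection \<open>The cut points become dense\<close>

text \<open>All images of a never cut interval are never cut and have the same length, so two of
  them meet, and some power \<open>T ^^ p\<close> moves the interval onto an overlapping one. The
  union is never cut; maximality makes \<open>T ^^ p\<close> the identity on the interval, and an
  extension to the left contradicts maximality.\<close>

lemma uncut_periodic:
  assumes J: "a < b" "0 \<le> a" "b \<le> \<Lambda>" "\<And>n. free n a b"
    and maxl: "\<And>a' b'. a' \<le> a \<Longrightarrow> b \<le> b' \<Longrightarrow> (\<And>n. free n a' b') \<Longrightarrow> a' = a \<and> b' = b"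
  shows False
proof -
  let ?l = "b - a"
  let ?I = "\<lambda>k. {(T ^^ k) a..<(T ^^ k) a + ?l}"
  have fI: "free n ((T ^^ k) a) ((T ^^ k) a + ?l)" for n k
    using free_image[OF J(4)[of "n + k"], of k] by simp
  have aD: "a \<in> D" using J by auto
  have "\<exists>i j. i < j \<and> ?I i \<inter> ?I j \<noteq> {}"
  proof (rule ccontr)
    assume n: "\<not> ?thesis"
    have dj: "\<bar>(T ^^ i) a - (T ^^ j) a\<bar> \<ge> ?l" if "i \<noteq> j" for i j
    proof -
      have "?I i \<inter> ?I j = {}"
        using n that by (metis (no_types, lifting) Int_commute linorder_neqE_nat)
      then have "\<not> ((T ^^ i) a \<in> ?I j)" "\<not> ((T ^^ j) a \<in> ?I i)" using J(1) by auto
      then show ?thesis by auto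
    qed
    \<comment> \<open>Left ends at mutual distance at least the length have different integer parts
      after scaling, but only finitely many integer parts are possible.\<close>
    define f where "f i = \<lfloor>(T ^^ i) a / ?l\<rfloor>" for i
    have "inj f"
    proof (rule injI, rule ccontr)
      fix i j assume e: "f i = f j" "i \<noteq> j"
      have "\<bar>(T ^^ i) a / ?l - (T ^^ j) a / ?l\<bar> < 1"
        using e(1) unfolding f_def by linarith
      then have "\<bar>((T ^^ i) a - (T ^^ j) a) / ?l\<bar> < 1" by (simp add: diff_divide_distrib)
      then have "\<bar>(T ^^ i) a - (T ^^ j) a\<bar> < ?l" using J(1) by (simp add: abs_divide)
      then show False using dj[OF e(2)] by linarith
    qed
    moreover have "range f \<subseteq> {0..\<lfloor>\<Lambda> / ?l\<rfloor>}"
    proof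
      fix z assume "z \<in> range f"
      then obtain i where z: "z = \<lfloor>(T ^^ i) a / ?l\<rfloor>" by (auto simp: f_def)
      have "0 \<le> (T ^^ i) a / ?l" "(T ^^ i) a / ?l \<le> \<Lambda> / ?l"
        using T_pow_mem[OF aD, of i] J(1) by (auto intro!: divide_right_mono)
      then show "z \<in> {0..\<lfloor>\<Lambda> / ?l\<rfloor>}" using z floor_mono by auto
    qed
    ultimately show False
      using finite_subset[of "range f" "{0..\<lfloor>\<Lambda> / ?l\<rfloor>}"] finite_imageD[of f UNIV] by auto
  qed
  then obtain i j x where ij: "i < j" "x \<in> ?I i" "x \<in> ?I j" by blast
  define p where "p = j - i"
  define x1 where "x1 = a + (x - (T ^^ i) a)"
  define x2 where "x2 = a + (x - (T ^^ j) a)"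
  have x1: "a \<le> x1" "x1 < b" "(T ^^ i) x1 = x"
    using ij free_translate(1)[OF J(4)[of i] order_refl, of x1] by (auto simp: x1_def)
  have x2: "a \<le> x2" "x2 < b" "(T ^^ j) x2 = x"
    using ij free_translate(1)[OF J(4)[of j] order_refl, of x2] by (auto simp: x2_def)
  have "(T ^^ i) ((T ^^ p) x2) = (T ^^ i) x1"
    using x1 x2 ij(1) T_pow_add[of i p x2] by (simp add: p_def)
  moreover have "x2 \<in> D" "x1 \<in> D" using x1 x2 J by auto
  ultimately have "(T ^^ p) x2 = x1"
    using T_pow_inj[of "(T ^^ p) x2" x1 i] T_pow_mem by blast
  then have e: "x1 = (T ^^ p) a + (x2 - a)"
    using free_translate(1)[OF J(4)[of p] order_refl x2(1,2)] by simp
  define u where "u = (T ^^ p) a"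
  define a' b' where "a' = min a u" and "b' = max b (u + ?l)"
  have ov: "max a u < min b (u + ?l)" using e x1 x2 unfolding u_def by auto
  have "free n a' b'" for n
  proof -
    have f1: "free n a b" "free n u (u + ?l)" using J(4) fI[of n p] by (auto simp: u_def)
    have "y \<le> a' \<or> b' \<le> y" if "y \<in> C n" for y
    proof -
      have "y \<le> a \<or> b \<le> y" "y \<le> u \<or> u + ?l \<le> y"
        using f1 that by (auto simp: free_def)
      then show ?thesis using ov unfolding a'_def b'_def by auto
    qed
    moreover have "a' < b'" using J(1) unfolding a'_def b'_def by auto
    ultimately show ?thesis using f1 J(2,3) unfolding free_def a'_def b'_def by auto
  qed
  then have "a' = a \<and> b' = b" using maxl[of a' b'] by (auto simp: a'_def b'_def)
  then have u: "u = a" unfolding a'_def b'_def by auto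
  have p1: "1 \<le> p" using ij by (auto simp: p_def)
  have a0: "a \<noteq> 0"
    using orbit_0_0[OF p1] u unfolding u_def by auto
  have ac: "a \<notin> cuts"
  proof
    assume c: "a \<in> cuts"
    have "a \<noteq> \<Lambda>" using c ends_not_cuts by metis
    then have e: "(T ^^ ord a) a = X (qof a)" using X_qof(2)[of a "Suc (ord a)"] c by (auto simp: C_mem)
    have "(T ^^ p) (X (qof a)) = (T ^^ ord a) ((T ^^ p) a)"
      using e by (metis T_pow_add add.commute)
    then show False using u e keane[of "qof a" "qof a" p] cuts_eq[OF c] p1 unfolding u_def by simp
  qed
  \<comment> \<open>The end \<open>a\<close> has period \<open>p\<close>, so it is neither
    \<open>0\<close> nor a cut point, and \<open>m < a\<close> is the nearest point to the left
    where \<open>T ^^ p\<close> may cease to be the identity. A cut point between \<open>m\<close>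
    and \<open>b\<close> would be fixed by \<open>T ^^ p\<close> and give a connection.\<close>
  define m where "m = Max {y \<in> C p. y < a}"
  have "0 \<in> {y \<in> C p. y < a}" using a0 J by auto
  then have m: "m \<in> {y \<in> C p. y < a}" unfolding m_def by (intro Max_in) (simp, blast)
  have fm: "free p m b"
  proof -
    have "y \<le> m \<or> b \<le> y" if "y \<in> C p" for y
    proof (cases "y < a")
      case True then show ?thesis using that unfolding m_def by (auto intro!: Max_ge)
    next
      case False
      moreover have "y \<noteq> a" using that ac a0 J by (auto simp: C_mem)
      ultimately show ?thesis using that J(4)[of p] by (force simp: free_def)
    qed
    then show ?thesis using m J C_range[of m p] by (auto simp: free_def)
  qed
  have id: "(T ^^ p) y = y" if "m \<le> y" "y < b" for y
    using free_translate(1)[OF fm order_refl, of y] free_translate(1)[OF fm order_refl, of a] that m J u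
    by (auto simp: u_def)
  have "free n m b" for n
  proof -
    have "y \<le> m \<or> b \<le> y" if y: "y \<in> C n" for y
    proof (rule ccontr)
      assume c: "\<not> ?thesis"
      then have "y \<noteq> 0" "y \<noteq> \<Lambda>" using m C_range[of m p] J by auto
      then have yc: "y \<in> cuts" using y by (auto simp: C_mem)
      have e: "(T ^^ ord y) y = X (qof y)"
        using X_qof(2)[of y "Suc (ord y)"] yc \<open>y \<noteq> \<Lambda>\<close> by (auto simp: C_mem)
      have "(T ^^ p) (X (qof y)) = (T ^^ ord y) ((T ^^ p) y)"
        using e by (metis T_pow_add add.commute)
      then show False
        using e id[of y] c keane[of "qof y" "qof y" p] cuts_eq[OF yc] p1 by simp
    qed
    then show ?thesis using fm J(1) unfolding free_def by auto
  qed
  then show False using maxl[of m b] m by auto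
qed

lemma no_uncut_interval: assumes "\<And>n. free n a b" shows False
proof -
  let ?A = "{x. 0 \<le> x \<and> x \<le> a \<and> (\<forall>n. free n x b)}"
  let ?B = "{x. b \<le> x \<and> x \<le> \<Lambda> \<and> (\<forall>n. free n a x)}"
  have ab: "0 \<le> a" "a < b" "b \<le> \<Lambda>" using assms by (auto simp: free_def)
  define a' b' where "a' = Inf ?A" and "b' = Sup ?B"
  have aA: "a \<in> ?A" and bB: "b \<in> ?B" using ab assms by auto
  have bdA: "bdd_below ?A" and bdB: "bdd_above ?B" by (auto intro: bdd_belowI[of _ 0] bdd_aboveI[of _ \<Lambda>])
  have le: "0 \<le> a'" "a' \<le> a" "b \<le> b'" "b' \<le> \<Lambda>"
    unfolding a'_def b'_def using aA bB bdA bdB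
    by (auto intro!: cInf_greatest cInf_lower cSup_least cSup_upper)
  have f: "free n a' b'" for n
  proof -
    have "y \<le> a' \<or> b' \<le> y" if y: "y \<in> C n" for y
    proof (rule ccontr)
      assume c: "\<not> ?thesis"
      then obtain x where x: "x \<in> ?A" "x < y" using cInf_lessD[of ?A y] aA unfolding a'_def by auto
      obtain z where z: "z \<in> ?B" "y < z" using c less_cSupD[of ?B y] bB unfolding b'_def by auto
      have "free n x b" "free n a z" using x z by auto
      then have "y \<le> x \<or> b \<le> y" "y \<le> a \<or> z \<le> y" using y unfolding free_def by blast+
      then show False using x z ab by linarith
    qed
    then show ?thesis using le ab by (auto simp: free_def)
  qed
  show False
  proof (rule uncut_periodic[of a' b'])
    fix a'' b'' assume *: "a'' \<le> a'" "b' \<le> b''" "\<And>n. free n a'' b''"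
    have "0 \<le> a''" "b'' \<le> \<Lambda>" using *(3)[of 0] by (auto simp: free_def)
    then have "a'' \<in> ?A" "b'' \<in> ?B"
      using * le ab free_sub[OF *(3)] by auto
    then have "a' \<le> a''" "b'' \<le> b'" unfolding a'_def b'_def using bdA bdB by (auto intro: cInf_lower cSup_upper)
    then show "a'' = a' \<and> b'' = b'" using * by auto
  qed (use le ab f in auto)
qed

text \<open>An interval of length at least \<open>e\<close> contains a cell of the grid of step
  \<open>e / 2\<close>. With finitely many cells, some cell would be free at infinitely many times,
  hence at all times.\<close>

lemma mesh:
  assumes "0 < e" shows "\<exists>N. \<forall>n\<ge>N. \<forall>a b. free n a b \<longrightarrow> b - a < e"
proof (rule ccontr)
  assume neg: "\<not> ?thesis"
  have ex: "\<exists>a b. free n a b \<and> e \<le> b - a" for n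
  proof -
    obtain m a b where "n \<le> m" "free m a b" "\<not> b - a < e" using neg by blast
    then show ?thesis using free_mono by (meson not_less)
  qed
  define g where "g i = real i * (e / 2)" for i :: nat
  define M where "M = nat \<lceil>\<Lambda> / (e / 2)\<rceil>"
  have cell: "\<exists>i\<le>M. free n (g i) (g (Suc i))" for n
  proof -
    obtain a b where ab: "free n a b" "e \<le> b - a" using ex by blast
    have a0: "0 \<le> a" "b \<le> \<Lambda>" using ab by (auto simp: free_def)
    define i where "i = nat \<lceil>a / (e / 2)\<rceil>"
    have "0 \<le> a / (e / 2)" using a0 assms by simp
    then have r: "a / (e / 2) \<le> real i" "real i < a / (e / 2) + 1" unfolding i_def by linarith+
    have h: "a \<le> g i" "g i < a + e / 2" using r assms by (simp_all add: g_def field_simps)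
    have h2: "g (Suc i) = g i + e / 2" by (simp add: g_def algebra_simps)
    have "i \<le> M" unfolding i_def M_def using a0 ab assms
      by (intro nat_mono ceiling_mono divide_right_mono) auto
    then show ?thesis using free_sub[OF ab(1), of "g i" "g (Suc i)"] h h2 ab assms by auto
  qed
  then obtain c where c: "\<And>n. c n \<le> M \<and> free n (g (c n)) (g (Suc (c n)))" by metis
  have "finite (range c)" using c by (intro finite_subset[of "range c" "{..M}"]) auto
  then obtain i where i: "infinite {n. c n = i}"
    using pigeonhole_infinite[of "UNIV :: nat set" c] by auto
  have "free n (g i) (g (Suc i))" for n
  proof -
    obtain m where "m \<ge> n" "c m = i" using i unfolding infinite_nat_iff_unbounded_le by auto
    then show ?thesis using c[of m] free_mono by auto
  qed
  then show False by (rule no_uncut_interval)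
qed

end

section \<open>Sums over the gaps of a finite set\<close>

definition gaps :: "real set \<Rightarrow> (real \<times> real) set" where
  "gaps A = {(a, b). a \<in> A \<and> b \<in> A \<and> a < b \<and> (\<forall>y\<in>A. y \<le> a \<or> b \<le> y)}"

definition below :: "real set \<Rightarrow> real \<Rightarrow> real" where "below A x = Max {y \<in> A. y < x}"

definition above :: "real set \<Rightarrow> real \<Rightarrow> real" where "above A x = Min {y \<in> A. x < y}"

lemma finite_gaps: "finite A \<Longrightarrow> finite (gaps A)"
  by (rule finite_subset[of _ "A \<times> A"]) (auto simp: gaps_def)

lemma below:
  assumes "finite A" "l \<in> A" "l < x"
  shows "below A x \<in> A" "below A x < x" "\<And>y. y \<in> A \<Longrightarrow> y < x \<Longrightarrow> y \<le> below A x"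
proof -
  have "below A x \<in> {y \<in> A. y < x}"
    unfolding below_def by (rule Max_in) (use assms in auto)
  then show "below A x \<in> A" "below A x < x" by auto
  show "\<And>y. y \<in> A \<Longrightarrow> y < x \<Longrightarrow> y \<le> below A x"
    unfolding below_def using assms(1) by (auto intro: Max_ge)
qed

lemma above:
  assumes "finite A" "h \<in> A" "x < h"
  shows "above A x \<in> A" "x < above A x" "\<And>y. y \<in> A \<Longrightarrow> x < y \<Longrightarrow> above A x \<le> y"
proof -
  have "above A x \<in> {y \<in> A. x < y}"
    unfolding above_def by (rule Min_in) (use assms in auto)
  then show "above A x \<in> A" "x < above A x" by auto
  show "\<And>y. y \<in> A \<Longrightarrow> x < y \<Longrightarrow> above A x \<le> y"
    unfolding above_def using assms(1) by (auto intro: Min_le)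
qed

lemma gaps_around:
  assumes "finite A" "l \<in> A" "l < x" "h \<in> A" "x < h" "x \<notin> A"
  shows "(below A x, above A x) \<in> gaps A"
proof -
  note b = below[OF assms(1-3)] and a = above[OF assms(1,4,5)]
  have "y \<le> below A x \<or> above A x \<le> y" if "y \<in> A" for y
    using a(3)[OF that] b(3)[OF that] assms(6) that by (cases "y < x") (auto simp: not_less le_less)
  then show ?thesis using a b by (auto simp: gaps_def)
qed

lemma gap_unique:
  assumes "(a, b) \<in> gaps A" "(a', b') \<in> gaps A" "a < x" "x < b" "a' < x" "x < b'"
  shows "a = a' \<and> b = b'"
  using assms unfolding gaps_def by fastforce

lemma below_above_eq:
  assumes "finite A" "(a, b) \<in> gaps A" "a < x" "x < b"
  shows "below A x = a" "above A x = b"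
proof -
  have "x \<notin> A" using assms by (auto simp: gaps_def)
  then have "(below A x, above A x) \<in> gaps A"
    using assms by (intro gaps_around[of A a x b]) (auto simp: gaps_def)
  moreover have "below A x < x" "x < above A x"
    using below(2)[of A a x] above(2)[of A b x] assms by (auto simp: gaps_def)
  ultimately show "below A x = a" "above A x = b" using gap_unique[OF _ assms(2) _ _ assms(3,4)] by blast+
qed

lemma sum_gaps_insert:
  fixes f :: "real \<times> real \<Rightarrow> real"
  assumes "finite A" "l \<in> A" "l < x" "h \<in> A" "x < h" "x \<notin> A"
  shows "sum f (gaps (insert x A)) = sum f (gaps A)
           + (f (below A x, x) + f (x, above A x) - f (below A x, above A x))"
proof -
  let ?a = "below A x" and ?b = "above A x"
  note b = below[OF assms(1-3)] and a = above[OF assms(1,4,5)] and g = gaps_around[OF assms]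
  have "gaps (insert x A) = (gaps A - {(?a, ?b)}) \<union> {(?a, x), (x, ?b)}"
  proof (intro set_eqI iffI)
    fix p assume "p \<in> gaps (insert x A)"
    then obtain u v where p: "p = (u, v)" "u \<in> insert x A" "v \<in> insert x A" "u < v"
      "\<And>y. y \<in> insert x A \<Longrightarrow> y \<le> u \<or> v \<le> y" by (auto simp: gaps_def)
    consider "u = x" | "v = x" | "u \<noteq> x" "v \<noteq> x" by blast
    then show "p \<in> (gaps A - {(?a, ?b)}) \<union> {(?a, x), (x, ?b)}"
    proof cases
      case 1
      then have "v \<in> A" using p by auto
      then have "v = ?b" using a(3)[of v] p(5)[of ?b] a(1,2) 1 p(4) by force
      then show ?thesis using 1 p by auto
    next
      case 2
      then have "u \<in> A" using p by auto
      then have "u = ?a" using b(3)[of u] p(5)[of ?a] b(1,2) 2 p(4) by force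
      then show ?thesis using 2 p by auto
    next
      case 3
      then have "(u, v) \<in> gaps A" using p by (auto simp: gaps_def)
      moreover have "(u, v) \<noteq> (?a, ?b)" using p(5)[of x] a(2) b(2) by auto
      ultimately show ?thesis using p by auto
    qed
  next
    fix p assume "p \<in> (gaps A - {(?a, ?b)}) \<union> {(?a, x), (x, ?b)}"
    then consider "p = (?a, x)" | "p = (x, ?b)" | "p \<in> gaps A" "p \<noteq> (?a, ?b)" by blast
    then show "p \<in> gaps (insert x A)"
    proof cases
      case 1
      then show ?thesis using b by (force simp: gaps_def)
    next
      case 2
      then show ?thesis using a by (force simp: gaps_def)
    next
      case 3
      then obtain u v where p: "p = (u, v)" "(u, v) \<in> gaps A" by (cases p) auto
      have "\<not> (u < x \<and> x < v)" using gap_unique[OF p(2) g _ _ b(2) a(2)] 3 p by blast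
      then show ?thesis using p by (auto simp: gaps_def)
    qed
  qed
  moreover have "(?a, x) \<noteq> (x, ?b)" "(?a, x) \<notin> gaps A" "(x, ?b) \<notin> gaps A"
    using assms(6) a b by (auto simp: gaps_def)
  ultimately have "sum f (gaps (insert x A)) = sum f (gaps A - {(?a, ?b)}) + (f (?a, x) + f (x, ?b))"
    using finite_gaps[OF assms(1)] by (simp add: sum.union_disjoint)
  also have "sum f (gaps A - {(?a, ?b)}) = sum f (gaps A) - f (?a, ?b)"
    using finite_gaps[OF assms(1)] g by (simp add: sum_diff1)
  finally show ?thesis by simp
qed

text \<open>With an old point between any two new ones, each old gap is divided at most once, so
  every new point can be compared with its neighbours in \<open>A\<close> rather than in the growing
  union.\<close>

lemma sum_gaps_Un:
  fixes f :: "real \<times> real \<Rightarrow> real"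
  assumes "finite B" "finite A" "A \<inter> B = {}"
    and "\<And>x. x \<in> B \<Longrightarrow> \<exists>l\<in>A. \<exists>h\<in>A. l < x \<and> x < h"
    and "\<And>x y. x \<in> B \<Longrightarrow> y \<in> B \<Longrightarrow> x < y \<Longrightarrow> \<exists>c\<in>A. x < c \<and> c < y"
  shows "sum f (gaps (A \<union> B)) = sum f (gaps A)
     + (\<Sum>x\<in>B. f (below A x, x) + f (x, above A x) - f (below A x, above A x))"
  using assms(1,3-)
proof (induction B rule: finite_induct)
  case (insert x B)
  obtain l h where lh: "l \<in> A" "h \<in> A" "l < x" "x < h" using insert.prems(2)[of x] by auto
  have xA: "x \<notin> A" using insert.prems(1) by auto
  note g = gaps_around[OF assms(2) lh(1,3,2,4) xA]
  have "(below A x, above A x) \<in> gaps (A \<union> B)"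
  proof -
    have "y \<le> below A x \<or> above A x \<le> y" if y: "y \<in> B" for y
    proof (cases "y < x")
      case True
      then obtain c where "c \<in> A" "y < c" "c < x" using insert.prems(3)[of y x] y by auto
      then show ?thesis using below(3)[OF assms(2) lh(1,3), of c] by auto
    next
      case False
      then have "x < y" using y insert.hyps(2) by (cases "x = y") auto
      then obtain c where "c \<in> A" "x < c" "c < y" using insert.prems(3)[of x y] y by auto
      then show ?thesis using above(3)[OF assms(2) lh(2,4), of c] by auto
    qed
    then show ?thesis using g by (auto simp: gaps_def)
  qed
  then have "below (A \<union> B) x = below A x" "above (A \<union> B) x = above A x"
    using below_above_eq[of "A \<union> B"] below(2)[OF assms(2) lh(1,3)] above(2)[OF assms(2) lh(2,4)]
      assms(2) insert.hyps(1) by auto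
  moreover have "sum f (gaps (A \<union> B)) = sum f (gaps A)
     + (\<Sum>x\<in>B. f (below A x, x) + f (x, above A x) - f (below A x, above A x))"
    using insert.prems by (intro insert.IH) auto
  moreover have "sum f (gaps (insert x (A \<union> B))) = sum f (gaps (A \<union> B))
     + (f (below (A \<union> B) x, x) + f (x, above (A \<union> B) x) - f (below (A \<union> B) x, above (A \<union> B) x))"
    using lh xA insert.hyps assms(2) by (intro sum_gaps_insert[of _ l _ h]) auto
  ultimately show ?case using insert.hyps by simp
qed simp

lemma sum_gaps_length:
  assumes "finite A" "l \<in> A" "h \<in> A" "l < h" "\<And>y. y \<in> A \<Longrightarrow> l \<le> y \<and> y \<le> h"
  shows "(\<Sum>(a, b)\<in>gaps A. b - a) = h - l"
proof -
  have *: "(\<Sum>(a, b)\<in>gaps ({l, h} \<union> F). b - a) = h - l" if "finite F" "F \<subseteq> {l<..<h}" for F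
    using that
  proof (induction F rule: finite_induct)
    case empty
    have "gaps ({l, h} \<union> {}) = {(l, h)}" using assms(4) by (auto simp: gaps_def)
    then show ?case by simp
  next
    case (insert x F)
    have "(\<Sum>(a, b)\<in>gaps (insert x ({l, h} \<union> F)). b - a) = (\<Sum>(a, b)\<in>gaps ({l, h} \<union> F). b - a)"
      using sum_gaps_insert[of "{l, h} \<union> F" l x h "\<lambda>(a, b). b - a"] insert by auto
    then show ?case using insert by simp
  qed
  have "A = {l, h} \<union> (A - {l, h})" using assms by auto
  moreover have "A - {l, h} \<subseteq> {l<..<h}" using assms(5) by force
  ultimately show ?thesis using *[of "A - {l, h}"] assms(1) by simp
qed

lemma sum_gaps_two:
  fixes f :: "real \<times> real \<Rightarrow> real"
  assumes "finite A" "m \<in> A"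
  shows "sum f (gaps A) = sum f (gaps (A \<inter> {..m})) + sum f (gaps (A \<inter> {m..}))"
proof -
  have "gaps A = gaps (A \<inter> {..m}) \<union> gaps (A \<inter> {m..})"
  proof (intro set_eqI iffI)
    fix p assume "p \<in> gaps A"
    then show "p \<in> gaps (A \<inter> {..m}) \<union> gaps (A \<inter> {m..})" using assms(2) by (force simp: gaps_def)
  next
    fix p assume "p \<in> gaps (A \<inter> {..m}) \<union> gaps (A \<inter> {m..})"
    then show "p \<in> gaps A" by (fastforce simp: gaps_def)
  qed
  moreover have "gaps (A \<inter> {..m}) \<inter> gaps (A \<inter> {m..}) = {}" by (auto simp: gaps_def)
  ultimately show ?thesis
    using finite_gaps assms by (simp add: sum.union_disjoint)
qed

lemma sum_gaps_split:
  fixes f :: "real \<times> real \<Rightarrow> real"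
  assumes "finite A" "\<And>i. i \<le> k \<Longrightarrow> p i \<in> A" "\<And>i. i < k \<Longrightarrow> p i < p (Suc i)"
  shows "sum f (gaps (A \<inter> {p 0..p k})) = (\<Sum>i=1..k. sum f (gaps (A \<inter> {p (i - 1)..p i})))"
  using assms(2,3)
proof (induction k)
  case 0
  have "gaps (A \<inter> {p 0..p 0}) = {}" by (auto simp: gaps_def)
  then show ?case by simp
next
  case (Suc k)
  have "p 0 \<le> p k" using Suc.prems(2)
  proof (induction k)
    case (Suc k)
    then have "p 0 \<le> p k" by simp
    then show ?case using Suc.prems[of k] by simp
  qed simp
  then have *: "A \<inter> {p 0..p (Suc k)} \<inter> {..p k} = A \<inter> {p 0..p k}"
     "A \<inter> {p 0..p (Suc k)} \<inter> {p k..} = A \<inter> {p k..p (Suc k)}"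
    using Suc.prems(2)[of k] by auto
  have "sum f (gaps (A \<inter> {p 0..p (Suc k)})) = sum f (gaps (A \<inter> {p 0..p k})) + sum f (gaps (A \<inter> {p k..p (Suc k)}))"
    using sum_gaps_two[of "A \<inter> {p 0..p (Suc k)}" "p k" f] assms(1) Suc.prems \<open>p 0 \<le> p k\<close> less_imp_le[OF Suc.prems(2)[of k]]
    unfolding * by auto
  then show ?case using Suc by simp
qed

lemma sum_gaps_translate:
  fixes f :: "real \<times> real \<Rightarrow> real"
  shows "sum f (gaps ((\<lambda>x. x + v) ` A)) = (\<Sum>(a, b)\<in>gaps A. f (a + v, b + v))"
proof -
  have "gaps ((\<lambda>x. x + v) ` A) = (\<lambda>(a, b). (a + v, b + v)) ` gaps A"
    by (auto simp: gaps_def image_iff)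
  moreover have "inj_on (\<lambda>(a, b). (a + v, b + v)) (gaps A)" by (auto simp: inj_on_def)
  ultimately show ?thesis by (simp add: sum.reindex case_prod_unfold)
qed

lemma gap_same_end:
  assumes "(a, b) \<in> gaps A" "(a', b') \<in> gaps A" "a = a' \<or> b = b'" shows "a = a' \<and> b = b'"
proof -
  have "b \<le> a' \<or> b' \<le> b" "b' \<le> a \<or> b \<le> b'" "a' \<le> a \<or> b \<le> a'" "a \<le> a' \<or> b' \<le> a" "a < b" "a' < b'"
    using assms(1,2) by (auto simp: gaps_def)
  then show ?thesis using assms(3) by linarith
qed

text \<open>At most one gap begins, and at most one ends, at a given point, so each sum has at most
  one nonzero term.\<close>

lemma sum_gaps_end:
  assumes "finite A" "\<And>a b. (a, b) \<in> gaps A \<Longrightarrow> b - a \<le> e" "0 \<le> e"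
  shows "(\<Sum>(a, b)\<in>gaps A. if a = u then b - a else 0) \<le> e"
    "(\<Sum>(a, b)\<in>gaps A. if b = u then b - a else 0) \<le> e"
proof -
  have *: "sum f G \<le> e" if "finite G" "\<And>p. p \<in> G \<Longrightarrow> f p \<le> e"
    "\<And>p q. p \<in> G \<Longrightarrow> q \<in> G \<Longrightarrow> f p \<noteq> 0 \<Longrightarrow> f q \<noteq> 0 \<Longrightarrow> p = q" for f :: "real \<times> real \<Rightarrow> real" and G
  proof (cases "\<exists>p\<in>G. f p \<noteq> 0")
    case True
    then obtain p where p: "p \<in> G" "f p \<noteq> 0" by auto
    have "sum f G = sum f {p}"
      using that(1,3) p by (intro sum.mono_neutral_right ballI) (simp, simp, blast)
    then show ?thesis using that(2)[OF p(1)] by simp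
  next
    case False then show ?thesis using assms(3) by simp
  qed
  show "(\<Sum>(a, b)\<in>gaps A. if a = u then b - a else 0) \<le> e"
  proof (rule *)
    show "finite (gaps A)" using finite_gaps[OF assms(1)] .
    show "(case p of (a, b) \<Rightarrow> if a = u then b - a else 0) \<le> e" if "p \<in> gaps A" for p
      using that assms(2)[of "fst p" "snd p"] assms(3) by (cases p) auto
    show "p = q" if "p \<in> gaps A" "q \<in> gaps A" "(case p of (a, b) \<Rightarrow> if a = u then b - a else 0) \<noteq> 0"
      "(case q of (a, b) \<Rightarrow> if a = u then b - a else 0) \<noteq> 0" for p q
    proof -
      obtain a1 b1 a2 b2 where pq: "p = (a1, b1)" "q = (a2, b2)" by (metis surj_pair)
      then have "a1 = u" "a2 = u" using that(3,4) by (simp_all split: if_splits)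
      then show ?thesis using gap_same_end[of a1 b1 A a2 b2] that(1,2) pq by simp
    qed
  qed
  show "(\<Sum>(a, b)\<in>gaps A. if b = u then b - a else 0) \<le> e"
  proof (rule *)
    show "finite (gaps A)" using finite_gaps[OF assms(1)] .
    show "(case p of (a, b) \<Rightarrow> if b = u then b - a else 0) \<le> e" if "p \<in> gaps A" for p
      using that assms(2)[of "fst p" "snd p"] assms(3) by (cases p) auto
    show "p = q" if "p \<in> gaps A" "q \<in> gaps A" "(case p of (a, b) \<Rightarrow> if b = u then b - a else 0) \<noteq> 0"
      "(case q of (a, b) \<Rightarrow> if b = u then b - a else 0) \<noteq> 0" for p q
    proof -
      obtain a1 b1 a2 b2 where pq: "p = (a1, b1)" "q = (a2, b2)" by (metis surj_pair)
      then have "b1 = u" "b2 = u" using that(3,4) by (simp_all split: if_splits)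
      then show ?thesis using gap_same_end[of a1 b1 A a2 b2] that(1,2) pq by simp
    qed
  qed
qed

section \<open>The area identity\<close>

context keane_iet
begin

lemma index3: "s \<le> Suc d \<Longrightarrow> s = 0 \<or> s = Suc d \<or> s \<in> {1..d}"
  by auto

abbreviation pr :: "nat \<Rightarrow> real \<Rightarrow> real" where "pr n \<equiv> below (C n)"
abbreviation sc :: "nat \<Rightarrow> real \<Rightarrow> real" where "sc n \<equiv> above (C n)"

definition fine :: "nat \<Rightarrow> real \<Rightarrow> bool" where
  "fine n e \<longleftrightarrow> (\<forall>a b. free n a b \<longrightarrow> b - a < e)"

lemma fine_mono: "fine n e \<Longrightarrow> n \<le> m \<Longrightarrow> fine m e"
  using free_mono by (auto simp: fine_def)

lemma fine_exists: "0 < e \<Longrightarrow> \<exists>N. \<forall>n\<ge>N. fine n e"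
  using mesh by (simp add: fine_def)

lemma gaps_C: "(a, b) \<in> gaps (C n) \<longleftrightarrow> a \<in> C n \<and> b \<in> C n \<and> free n a b"
  using C_range by (auto simp: gaps_def free_def)

lemma pr_sc:
  assumes "0 < x" "x < \<Lambda>"
  shows "pr n x \<in> C n" "pr n x < x" "sc n x \<in> C n" "x < sc n x"
    "x \<notin> C n \<Longrightarrow> free n (pr n x) (sc n x)"
proof -
  show "pr n x \<in> C n" "pr n x < x" "sc n x \<in> C n" "x < sc n x"
    using below(1,2)[of "C n" 0 x] above(1,2)[of "C n" \<Lambda> x] assms by auto
  show "free n (pr n x) (sc n x)" if "x \<notin> C n"
    using gaps_around[of "C n" 0 x \<Lambda>] assms that gaps_C by auto
qed

lemma pr_sc_eq:
  assumes "a \<in> C n" "b \<in> C n" "free n a b" "a < x" "x < b"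
  shows "pr n x = a" "sc n x = b"
  using below_above_eq[of "C n" a b x] gaps_C assms by auto

text \<open>Doubled areas in the plane of positions and ages; \<open>fwd w n q\<close> belongs to the triangle of \<open>cut q n\<close>
  and its neighbours.  For \<open>bwd w n s\<close> the apex \<open>Y s\<close> gets age \<open>0\<close>.\<close>

definition area :: "(nat \<Rightarrow> real) \<Rightarrow> nat \<Rightarrow> real" where
  "area w n = (\<Sum>(a, b)\<in>gaps (C n). (b - a) * (\<tau> w a + \<tau> w b))"

definition fwd :: "(nat \<Rightarrow> real) \<Rightarrow> nat \<Rightarrow> nat \<Rightarrow> real" where
  "fwd w n q = (let y = cut q n; a = pr n y; b = sc n y in
     (y - a) * (\<tau> w y - \<tau> w b) + (b - y) * (\<tau> w y - \<tau> w a))"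

definition bwd :: "(nat \<Rightarrow> real) \<Rightarrow> nat \<Rightarrow> nat \<Rightarrow> real" where
  "bwd w n s = (let z = Y s; a = pr n z; b = sc n z in (z - a) * \<tau> w b + (b - z) * \<tau> w a)"

lemma C_Suc: "C (Suc n) = C n \<union> (\<lambda>q. cut q n) ` {1..d}"
proof -
  have "{1..d} \<times> {..<Suc n} = {1..d} \<times> {..<n} \<union> (\<lambda>q. (q, n)) ` {1..d}"
    by (auto simp: less_Suc_eq)
  then show ?thesis by (simp add: C_def image_Un image_image Un_assoc del: lessThan_Suc)
qed

lemma same_order_gap:
  assumes "p \<in> {1..d}" "q \<in> {1..d}" "free n (cut p n) (cut q n)"
  shows "lmin \<le> cut q n - cut p n"
proof -
  have "(T ^^ n) (cut q n) = (T ^^ n) (cut p n) + (cut q n - cut p n)"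
    using free_translate_closed[OF assms(3) order_refl] assms(2) by simp
  then have e: "cut q n - cut p n = X q - X p" using T_pow_cut assms by simp
  moreover have "cut p n < cut q n" using assms(3) by (simp add: free_def)
  ultimately have "p < q" using X_le[of q p] assms by force
  then show ?thesis using e X_gap[of p q] assms by simp
qed

text \<open>\<open>area\<close> sums doubled trapezoids under the polygon of the graph; cutting a
  gap at \<open>y\<close> adds the doubled triangle with apex \<open>y\<close>. Two new cuts in one
  gap would both have order \<open>n\<close> and be at least \<open>lmin\<close> apart.\<close>

lemma area_fwd:
  assumes "fine n lmin"
  shows "area w (Suc n) = area w n + (\<Sum>q=1..d. fwd w n q)"
proof -
  let ?B = "(\<lambda>q. cut q n) ` {1..d}"
  let ?f = "\<lambda>(a, b). (b - a) * (\<tau> w a + \<tau> w b)"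
  have "sum ?f (gaps (C n \<union> ?B)) = sum ?f (gaps (C n))
     + (\<Sum>x\<in>?B. ?f (pr n x, x) + ?f (x, sc n x) - ?f (pr n x, sc n x))"
  proof (rule sum_gaps_Un)
    have "cut q n \<notin> C n" if "q \<in> {1..d}" for q
      using cut_range[OF that, of n] ord_cut[OF that, of n] by (auto simp: C_mem)
    then show "C n \<inter> ?B = {}" by blast
    show "\<exists>l\<in>C n. \<exists>h\<in>C n. l < x \<and> x < h" if "x \<in> ?B" for x
    proof -
      have "0 < x" "x < \<Lambda>" using that cut_range by (auto simp del: atLeastAtMost_iff)
      then show ?thesis using C_ends by blast
    qed
    show "\<exists>c\<in>C n. x < c \<and> c < y" if xy: "x \<in> ?B" "y \<in> ?B" "x < y" for x y
    proof (rule ccontr)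
      assume c: "\<not> ?thesis"
      obtain p q where pq: "p \<in> {1..d}" "x = cut p n" "q \<in> {1..d}" "y = cut q n" using xy by blast
      have "free n x y"
        using c xy(3) cut_range[OF pq(1), of n] cut_range[OF pq(3), of n] pq by (auto simp: free_def)
      then show False using same_order_gap[of p q n] pq assms by (force simp: fine_def)
    qed
  qed auto
  also have "(\<Sum>x\<in>?B. ?f (pr n x, x) + ?f (x, sc n x) - ?f (pr n x, sc n x)) = (\<Sum>q=1..d. fwd w n q)"
  proof (subst sum.reindex)
    show "inj_on (\<lambda>q. cut q n) {1..d}" using cut_inj by (blast intro: inj_onI)
    show "(sum ((\<lambda>x. ?f (pr n x, x) + ?f (x, sc n x) - ?f (pr n x, sc n x)) \<circ> (\<lambda>q. cut q n)) {1..d})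
      = (\<Sum>q=1..d. fwd w n q)"
      by (rule sum.cong) (auto simp: fwd_def Let_def algebra_simps)
  qed
  finally show ?thesis by (simp add: area_def C_Suc)
qed

section \<open>The same growth of the area, computed from the images under \<open>T\<close>\<close>

definition Z :: "real set" where "Z = Y ` {1..d}"

lemma Z_cuts: "z \<in> Z \<Longrightarrow> z \<notin> cuts"
proof
  assume z: "z \<in> Z" "z \<in> cuts"
  then obtain s where s: "s \<in> {1..d}" "z = Y s" by (auto simp: Z_def)
  have "(T ^^ ord z) z = X (qof z)" using T_pow_cut(1) cuts_eq[OF z(2)] by metis
  then show False using Y_orbit[OF s(1) cuts_eq(1)[OF z(2)], of "ord z"] s(2) by simp
qed

lemma Z_C: "Z \<inter> C n = {}"
  using Z_cuts Y_interior by (force simp: C_mem Z_def)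

lemma cut_inside_interval:
  assumes i: "i \<in> {1..Suc d}" and x: "X (i - 1) < x" "x < X i" and xC: "x \<in> C n"
  shows "x \<in> cuts" "1 \<le> ord x" "ord x < n" "T x = x - X (i - 1) + Y (\<pi> i - 1)" "T x \<in> cuts"
    "ord (T x) = ord x - 1" "\<tau> w x = w i + \<tau> w (T x)"
proof -
  have "0 \<le> X (i - 1)" "X i \<le> \<Lambda>" using X_range[of "i - 1"] X_range[of i] i by auto
  then have "x \<noteq> 0" "x \<noteq> \<Lambda>" using x by auto
  then show c: "x \<in> cuts" "ord x < n" using xC by (auto simp: C_mem)
  show o: "1 \<le> ord x"
  proof (rule ccontr)
    assume "\<not> 1 \<le> ord x"
    then have "ord x = 0" by simp
    then have e: "x = X (qof x)" "qof x \<in> {1..d}"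
      using cuts_eq[OF c(1)] cut_0[of "qof x"] by metis+
    show False
    proof (cases "qof x \<le> i - 1")
      case True
      then have "X (qof x) \<le> X (i - 1)" using i by (intro X_le) auto
      then show False using x e by linarith
    next
      case False
      then have "X i \<le> X (qof x)" using i e(2) by (intro X_le) auto
      then show False using x e by linarith
    qed
  qed
  show Tx: "T x = x - X (i - 1) + Y (\<pi> i - 1)" using T_eq[OF i, of x] x by simp
  show "T x \<in> cuts" "ord (T x) = ord x - 1"
    using T_pow_cuts[OF c(1), of 1] o by auto
  show "\<tau> w x = w i + \<tau> w (T x)"
    using \<tau>_split[OF c(1) o, of w] idx_eq[OF i, of x] x by simp
qed

lemma Y_less_iff: "i \<le> Suc d \<Longrightarrow> j \<le> Suc d \<Longrightarrow> Y i < Y j \<longleftrightarrow> i < j"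
  by (metis Y_le Y_less not_le)

lemma Y_mem: assumes "s \<le> Suc d" shows "Y s \<in> C n \<union> Z"
  using index3[OF assms]
proof (elim disjE)
  assume "s \<in> {1..d}" then show ?thesis unfolding Z_def by blast
qed (simp_all add: Y_top)

text \<open>Inside interval \<open>i\<close> every cut point has positive order, which
  \<open>T\<close> lowers by one. The two ends go to points \<open>Y s\<close>, whose interior ones
  form \<open>Z\<close> and are not cut points.\<close>

lemma T_image_C:
  assumes i: "i \<in> {1..Suc d}"
  shows "(\<lambda>x. x + (Y (\<pi> i - 1) - X (i - 1))) ` (C (Suc n) \<inter> {X (i - 1)..X i})
     = (C n \<union> Z) \<inter> {Y (\<pi> i - 1)..Y (\<pi> i)}" (is "?f ` ?L = ?R")
proof -
  have pi: "\<pi> i \<in> {1..Suc d}" using i \<pi>_mem by blast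
  have len: "X i - X (i - 1) = Y (\<pi> i) - Y (\<pi> i - 1)" "X (i - 1) < X i"
    using Y_step[OF i] X_Suc[of "i - 1"] i lam_pos[OF i] by auto
  note YC = Y_mem[of _ n]
  have Xs: "X (i - 1) \<in> C (Suc n)" "X i \<in> C (Suc n)" using X_C i by auto
  show ?thesis
  proof (intro set_eqI iffI)
    fix y assume "y \<in> ?f ` ?L"
    then obtain x where x: "x \<in> C (Suc n)" "X (i - 1) \<le> x" "x \<le> X i" "y = ?f x" by auto
    have r: "Y (\<pi> i - 1) \<le> y" "y \<le> Y (\<pi> i)" using x len by auto
    consider "x = X (i - 1)" | "x = X i" | "X (i - 1) < x" "x < X i" using x by force
    then have "y \<in> C n \<union> Z"
    proof cases
      case 1 then show ?thesis using x YC[of "\<pi> i - 1"] pi by auto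
    next
      case 2
      then have "y = Y (\<pi> i)" using x len by auto
      then show ?thesis using YC[of "\<pi> i"] pi by simp
    next
      case 3
      note c = cut_inside_interval[OF i 3 x(1)]
      have "y = T x" using c(4) x(4) by simp
      moreover have "T x \<in> C n" using c(2,3,5,6) by (simp add: C_mem) arith
      ultimately show ?thesis by simp
    qed
    then show "y \<in> ?R" using r by auto
  next
    fix y assume y: "y \<in> ?R"
    let ?x = "y - Y (\<pi> i - 1) + X (i - 1)"
    have xr: "X (i - 1) \<le> ?x" "?x \<le> X i" using y len by auto
    consider "y = Y (\<pi> i - 1)" | "y = Y (\<pi> i)" | "Y (\<pi> i - 1) < y" "y < Y (\<pi> i)" using y by force
    then have "?x \<in> C (Suc n)"
    proof cases
      case 1 then show ?thesis using Xs by auto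
    next
      case 2
      then have "?x = X i" using len by auto
      then show ?thesis using Xs by auto
    next
      case 3
      have "y \<notin> Z"
      proof
        assume "y \<in> Z"
        then obtain s where s: "s \<in> {1..d}" "y = Y s" by (auto simp: Z_def)
        then have "\<pi> i - 1 < s" "s < \<pi> i"
          using 3 pi Y_less_iff[of "\<pi> i - 1" s] Y_less_iff[of s "\<pi> i"] by auto
        then show False by linarith
      qed
      moreover have "0 \<le> Y (\<pi> i - 1)" "Y (\<pi> i) \<le> \<Lambda>" using Y_range[of "\<pi> i - 1"] Y_range[of "\<pi> i"] pi by auto
      ultimately have yc: "y \<in> cuts" "ord y < n" using 3 y by (auto simp: C_mem)
      have "T ?x = y" "?x < X i" using T_surj_interval[OF i, of y] 3 by auto
      moreover have "?x \<in> D" using xr \<open>?x < X i\<close> X_range[of "i - 1"] X_range[of i] i by auto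
      ultimately have "?x \<in> cuts" "ord ?x = ord y + 1" using T_pow_cuts_conv[of ?x 1] yc by auto
      then show ?thesis using yc by (auto simp: C_mem)
    qed
    then show "y \<in> ?f ` ?L" using xr by (intro image_eqI[of _ _ ?x]) auto
  qed
qed

definition \<Omega> :: "(nat \<Rightarrow> real) \<Rightarrow> real" where "\<Omega> w = (\<Sum>i=1..Suc d. w i * lam i)"

text \<open>The gaps at the ends of the exchanged intervals, which are counted once instead of twice in the area.\<close>

definition bdry :: "(nat \<Rightarrow> real) \<Rightarrow> nat \<Rightarrow> real" where
  "bdry w n = (\<Sum>i=1..Suc d. w i * (\<Sum>(a, b)\<in>gaps (C (Suc n) \<inter> {X (i - 1)..X i}).
      (if a = X (i - 1) then b - a else 0) + (if b = X i then b - a else 0)))"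

lemma sum_affine:
  "(\<Sum>p\<in>G. F p + k * (2 * L p - E p)) = sum F G + k * (2 * sum L G - sum E G)" for k :: real
  by (simp add: sum.distrib sum_subtractf flip: sum_distrib_left)

text \<open>On each exchanged interval \<open>T\<close> is a translation that lowers the ages inside
  by \<open>w i\<close>. This accounts for \<open>w i\<close> times twice the length, up to the gaps
  at the ends, whose outer ages are already \<open>0\<close>. The translated pieces are the gaps of
  \<open>C n\<close> refined by \<open>Z\<close>, and removing \<open>Z\<close> gives the triangles
  with apex of age \<open>0\<close>.\<close>

lemma area_bwd:
  assumes "fine n lmin"
  shows "area w (Suc n) = area w n + 2 * \<Omega> w - bdry w n - (\<Sum>s=1..d. bwd w n s)"
proof -
  \<comment> \<open>Age \<open>0\<close> at \<open>Y s\<close> matches the age \<open>0\<close> of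
    the points \<open>X i\<close> that are translated there.\<close>
  define \<tau>z where "\<tau>z y = (if y \<in> Z then 0 else \<tau> w y)" for y
  define f where "f = (\<lambda>(a, b). (b - a) * (\<tau>z a + \<tau>z b))"
  let ?f = "\<lambda>(a, b). (b - a) * (\<tau> w a + \<tau> w b)"
  let ?G = "\<lambda>i. gaps (C (Suc n) \<inter> {X (i - 1)..X i})"
  let ?e = "\<lambda>i (a, b). (if a = X (i - 1) then b - a else 0) + (if b = X i then b - a else 0)"
  have \<tau>zY: "\<tau>z (Y s) = 0" if "s \<le> Suc d" for s
  proof -
    have "s \<in> {1..d} \<Longrightarrow> Y s \<in> Z" by (simp add: Z_def)
    then show ?thesis using index3[OF that] by (elim disjE) (simp_all add: Y_top \<tau>z_def)
  qed
  have per: "sum ?f (?G i) = sum f (gaps ((C n \<union> Z) \<inter> {Y (\<pi> i - 1)..Y (\<pi> i)}))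
      + (2 * (w i * lam i) - w i * sum (?e i) (?G i))" if i: "i \<in> {1..Suc d}" for i
  proof -
    let ?v = "Y (\<pi> i - 1) - X (i - 1)"
    have pi: "\<pi> i \<in> {1..Suc d}" using i \<pi>_mem by blast
    have len: "X i + ?v = Y (\<pi> i)" "X (i - 1) < X i" "X i - X (i - 1) = lam i"
      using Y_step[OF i] X_Suc[of "i - 1"] i lam_pos[OF i] by auto
    have inner: "\<tau> w x = (if x = X (i - 1) \<or> x = X i then 0 else w i) + \<tau>z (x + ?v)"
      if x: "x \<in> C (Suc n)" "X (i - 1) \<le> x" "x \<le> X i" for x
    proof -
      have \<tau>X: "\<tau> w (X j) = 0" if "j \<le> Suc d" for j
      proof -
        show ?thesis using index3[OF that] \<tau>_X[of j w] by (elim disjE) (simp_all add: X_top)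
      qed
      consider "x = X (i - 1)" | "x = X i" | "X (i - 1) < x" "x < X i" using x by force
      then show ?thesis
      proof cases
        case 1 then show ?thesis using \<tau>X[of "i - 1"] \<tau>zY[of "\<pi> i - 1"] i pi by auto
      next
        case 2 then show ?thesis using \<tau>X[of i] \<tau>zY[of "\<pi> i"] len i pi by auto
      next
        case 3
        note c = cut_inside_interval[OF i 3 x(1)]
        have "T x = x + ?v" using c(4) by simp
        moreover have "T x \<notin> Z" using c(5) Z_cuts by blast
        ultimately show ?thesis using c(7)[of w] 3 by (simp add: \<tau>z_def)
      qed
    qed
    let ?F = "\<lambda>(a, b). f (a + ?v, b + ?v)" and ?L = "\<lambda>(a, b). b - a :: real"
    have "sum ?f (?G i) = (\<Sum>p\<in>?G i. ?F p + w i * (2 * ?L p - ?e i p))"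
    proof (rule sum.cong[OF refl])
      fix p assume p: "p \<in> ?G i"
      obtain a b where ab: "p = (a, b)" by (cases p)
      have r: "a \<in> C (Suc n)" "X (i - 1) \<le> a" "a \<le> X i" "b \<in> C (Suc n)" "X (i - 1) \<le> b" "b \<le> X i" "a < b"
        using p ab by (auto simp: gaps_def)
      have \<tau>a: "\<tau> w a = (if a = X (i - 1) then 0 else w i) + \<tau>z (a + ?v)" using inner[of a] r by simp
      have \<tau>b: "\<tau> w b = (if b = X i then 0 else w i) + \<tau>z (b + ?v)" using inner[of b] r by simp
      have "(b - a) * (\<tau> w a + \<tau> w b) = f (a + ?v, b + ?v) + w i * (2 * (b - a) - ?e i (a, b))"
        unfolding \<tau>a \<tau>b f_def by (cases "a = X (i - 1)"; cases "b = X i") (simp_all add: algebra_simps)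
      then show "?f p = ?F p + w i * (2 * ?L p - ?e i p)"
        by (simp add: ab)
    qed
    also have "\<dots> = (\<Sum>(a, b)\<in>?G i. f (a + ?v, b + ?v)) + w i * (2 * (\<Sum>(a, b)\<in>?G i. b - a) - sum (?e i) (?G i))"
      by (rule sum_affine)
    also have "(\<Sum>(a, b)\<in>?G i. b - a) = X i - X (i - 1)"
    proof (rule sum_gaps_length)
      show "X (i - 1) \<in> C (Suc n) \<inter> {X (i - 1)..X i}" "X i \<in> C (Suc n) \<inter> {X (i - 1)..X i}"
        using X_C[of "i - 1" "Suc n"] X_C[of i "Suc n"] i len(2) by auto
      show "X (i - 1) < X i" using len(2) .
    qed simp_all
    also have "X i - X (i - 1) = lam i" using len(3) .
    also have "(\<Sum>(a, b)\<in>?G i. f (a + ?v, b + ?v)) = sum f (gaps ((C n \<union> Z) \<inter> {Y (\<pi> i - 1)..Y (\<pi> i)}))"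
      unfolding T_image_C[OF i, of n, symmetric] by (rule sum_gaps_translate[symmetric])
    finally show ?thesis by (simp add: algebra_simps)
  qed
  have "C (Suc n) \<inter> {X 0..X (Suc d)} = C (Suc n)" using C_range by (auto simp: X_top)
  then have "area w (Suc n) = (\<Sum>i=1..Suc d. sum ?f (?G i))"
    using sum_gaps_split[of "C (Suc n)" "Suc d" X ?f] X_C X_less by (simp add: area_def)
  also have "\<dots> = (\<Sum>i=1..Suc d. sum f (gaps ((C n \<union> Z) \<inter> {Y (\<pi> i - 1)..Y (\<pi> i)})))
      + (2 * \<Omega> w - bdry w n)"
    using per by (simp add: sum.distrib sum_subtractf sum_distrib_left \<Omega>_def bdry_def case_prod_unfold del: sum.cl_ivl_Suc)
  also have "(\<Sum>i=1..Suc d. sum f (gaps ((C n \<union> Z) \<inter> {Y (\<pi> i - 1)..Y (\<pi> i)})))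
      = (\<Sum>s=1..Suc d. sum f (gaps ((C n \<union> Z) \<inter> {Y (s - 1)..Y s})))"
    using sum.permute[OF perm, of "\<lambda>s. sum f (gaps ((C n \<union> Z) \<inter> {Y (s - 1)..Y s}))"] by (simp add: o_def del: sum.cl_ivl_Suc)
  also have "\<dots> = sum f (gaps (C n \<union> Z))"
  proof -
    note YC = Y_mem[of _ n]
    have "(C n \<union> Z) \<inter> {Y 0..Y (Suc d)} = C n \<union> Z" using C_range Y_range by (auto simp: Y_top Z_def)
    then show ?thesis
      using sum_gaps_split[of "C n \<union> Z" "Suc d" Y f] YC Y_less by (simp add: Z_def)
  qed
  also have "\<dots> = sum f (gaps (C n)) + (\<Sum>x\<in>Z. f (pr n x, x) + f (x, sc n x) - f (pr n x, sc n x))"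
  proof (rule sum_gaps_Un)
    show "finite Z" "finite (C n)" "C n \<inter> Z = {}" using Z_C by (auto simp: Z_def)
    show "\<exists>l\<in>C n. \<exists>h\<in>C n. l < x \<and> x < h" if "x \<in> Z" for x
    proof -
      have "0 < x" "x < \<Lambda>" using that Y_interior by (auto simp: Z_def simp del: atLeastAtMost_iff)
      then show ?thesis using C_ends by blast
    qed
    show "\<exists>c\<in>C n. x < c \<and> c < y" if xy: "x \<in> Z" "y \<in> Z" "x < y" for x y
    proof (rule ccontr)
      assume c: "\<not> ?thesis"
      obtain p q where pq: "p \<in> {1..d}" "x = Y p" "q \<in> {1..d}" "y = Y q" using xy by (auto simp: Z_def)
      have "free n x y"
        using c xy(3) Y_interior[OF pq(1)] Y_interior[OF pq(3)] pq by (auto simp: free_def)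
      moreover have "p < q" using Y_le[of q p] pq xy(3) by force
      ultimately show False using Y_gap[of p q] pq assms by (force simp: fine_def)
    qed
  qed
  also have "(\<Sum>x\<in>Z. f (pr n x, x) + f (x, sc n x) - f (pr n x, sc n x)) = (\<Sum>s=1..d. - bwd w n s)"
    unfolding Z_def
  proof (subst sum.reindex)
    show "inj_on Y {1..d}" using Y_inj by (auto simp: inj_on_def)
    have "\<tau>z (pr n (Y s)) = \<tau> w (pr n (Y s)) \<and> \<tau>z (sc n (Y s)) = \<tau> w (sc n (Y s)) \<and> \<tau>z (Y s) = 0"
      if "s \<in> {1..d}" for s
      using pr_sc[of "Y s" n] Y_interior[OF that] Z_C[of n] \<tau>zY[of s] that by (auto simp: \<tau>z_def)
    then show "sum ((\<lambda>x. f (pr n x, x) + f (x, sc n x) - f (pr n x, sc n x)) \<circ> Y) {1..d} = (\<Sum>s=1..d. - bwd w n s)"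
      by (intro sum.cong) (auto simp: f_def bwd_def Let_def algebra_simps)
  qed
  also have "sum f (gaps (C n)) = area w n"
    unfolding area_def using Z_C[of n] by (intro sum.cong) (auto simp: f_def \<tau>z_def gaps_def)
  finally show ?thesis by (simp add: sum_negf)
qed

lemma bdry_nonneg: assumes "\<And>i. i \<in> {1..Suc d} \<Longrightarrow> 0 \<le> w i" shows "0 \<le> bdry w n"
  unfolding bdry_def using assms
  by (intro sum_nonneg mult_nonneg_nonneg) (auto simp: gaps_def)

lemma bdry_le:
  assumes "\<And>i. i \<in> {1..Suc d} \<Longrightarrow> 0 \<le> w i" "fine (Suc n) e" "0 \<le> e"
  shows "bdry w n \<le> 2 * e * (\<Sum>i=1..Suc d. w i)"
proof -
  have "bdry w n \<le> (\<Sum>i=1..Suc d. w i * (2 * e))"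
    unfolding bdry_def
  proof (intro sum_mono mult_left_mono)
    fix i assume i: "i \<in> {1..Suc d}"
    let ?A = "C (Suc n) \<inter> {X (i - 1)..X i}"
    have "X (i - 1) \<in> C (Suc n)" "X i \<in> C (Suc n)" using X_C i by auto
    then have "free (Suc n) a b" if "(a, b) \<in> gaps ?A" for a b
      using that C_range[of a "Suc n"] C_range[of b "Suc n"] by (fastforce simp: gaps_def free_def)
    then have g: "b - a \<le> e" if "(a, b) \<in> gaps ?A" for a b
      using that assms(2) less_imp_le unfolding fine_def by blast
    have "(\<Sum>(a, b)\<in>gaps ?A. (if a = X (i - 1) then b - a else 0) + (if b = X i then b - a else 0))
       = (\<Sum>(a, b)\<in>gaps ?A. if a = X (i - 1) then b - a else 0) + (\<Sum>(a, b)\<in>gaps ?A. if b = X i then b - a else 0)"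
      by (simp add: case_prod_unfold sum.distrib)
    also have "\<dots> \<le> e + e"
      using g assms(3) by (intro add_mono sum_gaps_end) auto
    finally show "(\<Sum>(a, b)\<in>gaps ?A. (if a = X (i - 1) then b - a else 0) + (if b = X i then b - a else 0)) \<le> 2 * e"
      by simp
  qed (use assms in auto)
  then show ?thesis by (simp add: sum_distrib_left mult.commute del: sum.cl_ivl_Suc)
qed

text \<open>Both computations of the growth of \<open>area\<close> agree, so \<open>area\<close>
  itself cancels and only triangles and the total length remain.\<close>

theorem area_identity:
  assumes "fine n lmin"
  shows "(\<Sum>q=1..d. fwd w n q) + (\<Sum>s=1..d. bwd w n s) = 2 * \<Omega> w - bdry w n"
  using area_fwd[OF assms, of w] area_bwd[OF assms, of w] by linarith

end

section \<open>Triangles\<close>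

definition gr :: real where "gr = (1 + sqrt 5) / 2"

lemma sqrt5_bounds: "2.236 < sqrt 5" "sqrt 5 < 2.2361"
  by (rule real_less_rsqrt, simp add: power2_eq_square, rule real_less_lsqrt, simp_all add: power2_eq_square)

lemma gr: "gr * gr = gr + 1" "1.618 < gr" "gr < 1.6181" "sqrt 5 = 2 * gr - 1"
  using sqrt5_bounds by (auto simp: gr_def field_simps)

text \<open>\<open>P\<close>, \<open>Q\<close>, \<open>R\<close> stand for the products of length
  and age difference of the three edges divided by their minimum, \<open>U\<close> and
  \<open>V\<close> for the two mixed products, whose sum is the doubled area. The square of
  \<open>U + V\<close> is \<open>(R - P + Q)\<^sup>2 + 4 * (P * Q)\<close>, which is least at
  \<open>P = Q = R = 1\<close>, with value 5 and \<open>U = gr\<close>.\<close>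

lemma triangle_normal_form:
  fixes P Q R U V :: real
  assumes "1 \<le> P" "1 \<le> Q" "1 \<le> R" "U * V = P * Q" "U - V = R - P + Q" "0 < U" "0 < V"
  shows "sqrt 5 \<le> U + V"
    "U + V \<le> sqrt 5 + e \<Longrightarrow> 0 \<le> e \<Longrightarrow> e \<le> 1/10 \<Longrightarrow>
      P \<le> 1 + 3 * e \<and> Q \<le> 1 + e \<and> R \<le> 1 + 3 * e \<and> \<bar>U - gr\<bar> \<le> 3 * e"
proof -
  have sq: "(U + V)\<^sup>2 = (R - P + Q)\<^sup>2 + 4 * (P * Q)"
  proof -
    have "(U + V)\<^sup>2 = (U - V)\<^sup>2 + 4 * (U * V)" by (simp add: power2_eq_square algebra_simps)
    then show ?thesis using assms by simp
  qed
  have PQ: "1 \<le> P * Q" "P \<le> P * Q" "P + Q \<le> P * Q + 1"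
    using assms(1,2) mult_mono[of 1 P 1 Q] mult_left_mono[of 1 Q P] mult_nonneg_nonneg[of "P - 1" "Q - 1"]
    by (auto simp: algebra_simps)
  \<comment> \<open>Lower bounds linear in the excesses of the edges, so that a small excess of the
    area makes these small. If \<open>P > 1 + Q\<close>, then \<open>P \<ge> 2\<close> and
    \<open>4 * (P * Q)\<close> alone exceeds 5.\<close>
  have main: "5 + 2 * (P - 1) + 6 * (Q - 1) \<le> (U + V)\<^sup>2 \<and> 5 + 2 * (R - 1) + 2 * (P - 1) + 6 * (Q - 1) \<le> (U + V)\<^sup>2"
    if "P \<le> 1 + Q"
  proof -
    have "0 \<le> R - P + Q" "1 - P + Q \<le> R - P + Q" "0 \<le> 1 - P + Q" using assms(3) that by auto
    then have "(1 - P + Q)\<^sup>2 \<le> (R - P + Q)\<^sup>2" by (intro power_mono) auto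
    moreover have "(1 - P + Q)\<^sup>2 + 4 * (P * Q) = 5 + 2 * (P - 1) + 6 * (Q - 1) + (P + Q - 2)\<^sup>2"
      by (simp add: power2_eq_square algebra_simps)
    moreover have "1 + 2 * (R - 1 - P + Q) \<le> (R - P + Q)\<^sup>2"
    proof -
      have "(R - P + Q)\<^sup>2 = 1 + 2 * (R - 1 - P + Q) + (R - 1 - P + Q)\<^sup>2"
        by (simp add: power2_eq_square algebra_simps)
      then show ?thesis by simp
    qed
    ultimately have "5 + 2 * (P - 1) + 6 * (Q - 1) \<le> (R - P + Q)\<^sup>2 + 4 * (P * Q)"
      and "5 + 2 * (R - 1) + 2 * (P - 1) + 6 * (Q - 1) \<le> (R - P + Q)\<^sup>2 + 4 * (P * Q)"
      using PQ(3) zero_le_power2[of "P + Q - 2"] by argo+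
    then show ?thesis using sq by simp
  qed
  have ge: "5 \<le> (U + V)\<^sup>2"
  proof (cases "P \<le> 1 + Q")
    case True then show ?thesis using main assms by auto
  next
    case False
    then have "2 \<le> P" using assms by auto
    then show ?thesis using sq PQ(2) zero_le_power2[of "R - P + Q"] by argo
  qed
  then show 1: "sqrt 5 \<le> U + V" using assms(6,7) by (intro real_le_lsqrt) auto
  show "P \<le> 1 + 3 * e \<and> Q \<le> 1 + e \<and> R \<le> 1 + 3 * e \<and> \<bar>U - gr\<bar> \<le> 3 * e"
    if e: "U + V \<le> sqrt 5 + e" "0 \<le> e" "e \<le> 1/10"
  proof -
    have "(U + V)\<^sup>2 \<le> (sqrt 5 + e)\<^sup>2" using e assms(6,7) by (intro power_mono) auto
    also have "\<dots> = 5 + (2 * sqrt 5 + e) * e" by (simp add: power2_eq_square algebra_simps)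
    also have "(2 * sqrt 5 + e) * e \<le> 5 * e"
      using sqrt5_bounds e by (intro mult_right_mono) auto
    finally have up: "(U + V)\<^sup>2 \<le> 5 + 5 * e" by simp
    have "4 * P \<le> 5 + 5 * e" using up sq PQ(2) by (smt (verit) zero_le_power2)
    then have "P \<le> 1 + Q" using e assms(2) by auto
    note m = main[OF this]
    have PQR: "P - 1 \<le> 5/2 * e" "Q - 1 \<le> 5/6 * e" "R - 1 \<le> 5/2 * e"
      using m up assms(1-3) by argo+
    moreover have "2 * U = (U + V) + (R - P + Q)" using assms(5) by simp
    ultimately show ?thesis using 1 e assms(1-3) gr(4) by (auto simp: abs_le_iff)
  qed
qed

lemma triangle_area:
  fixes x y u v c :: real
  assumes "0 < c" "0 < x" "0 < y" "0 < u" "0 < v" "c \<le> x * u" "c \<le> y * v" "c \<le> (x + y) * \<bar>u - v\<bar>"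
  shows "sqrt 5 * c \<le> x * v + y * u"
proof -
  have *: "sqrt 5 * c \<le> x * v + y * u"
    if "0 < x" "0 < y" "0 < u" "0 < v" "c \<le> x * u" "c \<le> y * v" "c \<le> (x + y) * (u - v)" for x y u v
  proof -
    have "sqrt 5 \<le> y * u / c + x * v / c"
      by (rule triangle_normal_form(1)[of "x * u / c" "y * v / c" "(x + y) * (u - v) / c"])
        (use that assms(1) in \<open>auto simp: field_simps\<close>)
    then show ?thesis using assms(1) by (simp add: field_simps)
  qed
  have "u \<noteq> v" using assms(1,8) by auto
  then show ?thesis
    using *[of x y u v] *[of y x v u] assms by (cases "v < u") (auto simp: algebra_simps)
qed

text \<open>Shape of a triangle of nearly minimal area; \<open>u\<close> and \<open>v\<close> are the ages of the end points
  seen from the apex, at distances \<open>x\<close> and \<open>y\<close>.\<close>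

lemma triangle_shape:
  fixes x y u v c e :: real
  assumes "0 < c" "0 < x" "0 < y" "0 < u" "0 < v" "c \<le> x * u" "c \<le> y * v" "c \<le> (x + y) * (u - v)"
    and "x * v + y * u \<le> (sqrt 5 + e) * c" "0 \<le> e" "e \<le> 1/10"
  shows "x * u \<le> (1 + 3 * e) * c" "y * v \<le> (1 + 3 * e) * c" "(x + y) * (u - v) \<le> (1 + 3 * e) * c"
    "\<bar>y / x - gr\<bar> \<le> 8 * e" "\<bar>u / v - gr\<bar> \<le> 8 * e"
proof -
  define U P Q where "U = y * u / c" and "P = x * u / c" and "Q = y * v / c"
  have N: "P \<le> 1 + 3 * e \<and> Q \<le> 1 + e \<and> (x + y) * (u - v) / c \<le> 1 + 3 * e \<and> \<bar>U - gr\<bar> \<le> 3 * e"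
    unfolding P_def Q_def U_def
    by (rule triangle_normal_form(2)[where V = "x * v / c"])
       (use assms in \<open>auto simp: field_simps\<close>)
  show "x * u \<le> (1 + 3 * e) * c" "(x + y) * (u - v) \<le> (1 + 3 * e) * c"
    using N assms(1) by (auto simp: P_def field_simps)
  have "Q * c \<le> (1 + e) * c" using N assms(1) by (intro mult_right_mono) auto
  then show "y * v \<le> (1 + 3 * e) * c" using assms by (auto simp: Q_def algebra_simps)
  have PQ1: "1 \<le> P" "1 \<le> Q" using assms by (auto simp: P_def Q_def field_simps)
  \<comment> \<open>Both ratios are \<open>U\<close> divided by an edge product between
    \<open>1\<close> and \<open>1 + 3 * e\<close>; the division costs at most \<open>5 * e\<close>
    on top of the error \<open>3 * e\<close> of \<open>U\<close>.\<close>
  have *: "\<bar>U / r - gr\<bar> \<le> 8 * e" if r: "1 \<le> r" "r \<le> 1 + 3 * e" for r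
  proof -
    have "0 < U" using assms by (simp add: U_def)
    have "U / r \<le> U" using r \<open>0 < U\<close> by (simp add: field_simps)
    moreover have "gr - 8 * e \<le> U / r"
    proof -
      have "(gr - 8 * e) * r \<le> U"
      proof (cases "gr - 8 * e \<le> 0")
        case True
        then have "(gr - 8 * e) * r \<le> 0" using r by (intro mult_nonpos_nonneg) auto
        then show ?thesis using \<open>0 < U\<close> by linarith
      next
        case False
        then have "(gr - 8 * e) * r \<le> (gr - 8 * e) * (1 + 3 * e)" using r by (intro mult_left_mono) auto
        also have "\<dots> = gr - 8 * e + 3 * (gr * e) - 24 * e * e" by (simp add: algebra_simps)
        also have "\<dots> \<le> gr - 3 * e"
        proof -
          have "gr * e \<le> (5 / 3) * e" using gr assms by (intro mult_right_mono) auto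
          moreover have "0 \<le> 24 * e * e" using assms(10) by simp
          ultimately show ?thesis using assms(10) by argo
        qed
        finally show ?thesis using N by linarith
      qed
      then show ?thesis using r by (simp add: field_simps)
    qed
    ultimately show ?thesis using N assms(10) by linarith
  qed
  have "y / x = U / P" "u / v = U / Q" using assms by (auto simp: U_def P_def Q_def field_simps)
  then show "\<bar>y / x - gr\<bar> \<le> 8 * e" "\<bar>u / v - gr\<bar> \<le> 8 * e"
    using *[of P] *[of Q] N PQ1 assms(10) by auto
qed

section \<open>The lower bound for the Lagrange constant\<close>

context keane_iet
begin

text \<open>For unit weights this is what a lower bound for \<open>n * gap_min n\<close> becomes
  when each edge is measured by its own age difference. In this form it applies to all three sides
  of a triangle.\<close>

definition sep :: "(nat \<Rightarrow> real) \<Rightarrow> real \<Rightarrow> nat \<Rightarrow> bool" where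
  "sep w c N \<longleftrightarrow> (\<forall>n\<ge>N. \<forall>a\<in>C n. \<forall>b\<in>C n. nb n a b \<longrightarrow> c \<le> \<bar>b - a\<bar> * \<bar>\<tau> w a - \<tau> w b\<bar>)"

definition weight :: "(nat \<Rightarrow> real) \<Rightarrow> bool" where
  "weight w \<longleftrightarrow> (\<forall>i. 0 \<le> w i \<and> w i \<le> 1)"

lemma weightD: "weight w \<Longrightarrow> 0 \<le> w i" "weight w \<Longrightarrow> w i \<le> 1"
  by (auto simp: weight_def)

lemma \<tau>_nonneg: "weight w \<Longrightarrow> 0 \<le> \<tau> w y"
  unfolding \<tau>_def by (intro sum_nonneg) (auto simp: weight_def)

lemma \<tau>_le_ord: "weight w \<Longrightarrow> \<tau> w y \<le> real (ord y)"
  unfolding \<tau>_def using sum_mono[of "{..<ord y}" "\<lambda>i. w (idx ((T ^^ i) y))" "\<lambda>_. 1"] by (auto simp: weight_def)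

lemma \<tau>_mono:
  assumes "weight w" "a \<in> C n" "b \<in> C n" "nb n a b" "ord a < ord b"
  shows "\<tau> w a \<le> \<tau> w b"
  using push_base(6)[OF assms(2-5), of w] \<tau>_nonneg[OF assms(1)] by (metis diff_ge_0_iff_ge)

lemma sep_pos:
  assumes "weight w" "sep w c N" "0 < c" "N \<le> n" "a \<in> C n" "b \<in> C n" "nb n a b" "ord a < ord b"
  shows "\<tau> w a < \<tau> w b" "c \<le> \<bar>b - a\<bar> * (\<tau> w b - \<tau> w a)"
proof -
  have "c \<le> \<bar>b - a\<bar> * \<bar>\<tau> w a - \<tau> w b\<bar>" using assms by (auto simp: sep_def)
  then have "\<tau> w a \<noteq> \<tau> w b" "c \<le> \<bar>b - a\<bar> * \<bar>\<tau> w a - \<tau> w b\<bar>" using assms(3) by auto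
  then show "\<tau> w a < \<tau> w b" "c \<le> \<bar>b - a\<bar> * (\<tau> w b - \<tau> w a)"
    using \<tau>_mono[OF assms(1,5-8)] by auto
qed

text \<open>No second cut point of order \<open>n\<close> falls into the gap around
  \<open>cut q n\<close>, since the mesh is below \<open>lmin\<close>. Hence the two ends of the gap
  are still neighbours of the apex at time \<open>Suc n\<close>.\<close>

lemma fwd_nb:
  assumes "fine n lmin" "q \<in> {1..d}" "1 \<le> n"
  defines "y \<equiv> cut q n" and "a \<equiv> pr n (cut q n)" and "b \<equiv> sc n (cut q n)"
  shows "a < y" "y < b" "a \<in> C n" "b \<in> C n" "y \<in> C (Suc n)" "free n a b" "nb n a b"
    "nb (Suc n) a y" "nb (Suc n) b y" "ord y = n" "ord a < n" "ord b < n"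
proof -
  have yr: "0 < y" "y < \<Lambda>" using cut_range[OF assms(2)] by (auto simp: y_def)
  have yn: "y \<notin> C n" using assms(2) yr by (auto simp: C_mem y_def)
  note p = pr_sc[OF yr, of n, folded y_def, folded a_def b_def]
  show ab: "a < y" "y < b" "a \<in> C n" "b \<in> C n" "free n a b"
    using p yn by (auto simp: a_def b_def y_def)
  show "nb n a b" using ab by (simp add: nb_def)
  show "y \<in> C (Suc n)" "ord y = n" using assms(2) by (auto simp: C_mem y_def)
  show "ord a < n" "ord b < n" using ab assms(3) by (auto simp: C_mem)
  have sepr: "\<not> (a < x \<and> x < b)" if "x \<in> C (Suc n)" "x \<noteq> y" for x
  proof
    assume x: "a < x \<and> x < b"
    have "x \<notin> C n" using x ab(5) by (auto simp: free_def)
    then have "x \<in> (\<lambda>q. cut q n) ` {1..d}" using that(1) C_Suc[of n] by blast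
    then obtain p' where p': "p' \<in> {1..d}" "x = cut p' n" by blast
    have "free n (min x y) (max x y)" using free_sub[OF ab(5), of "min x y" "max x y"] x ab that by auto
    then show False
      using same_order_gap[of p' q n] same_order_gap[of q p' n] p' assms(1,2)
      by (cases "x < y") (auto simp: y_def fine_def min_def max_def split: if_splits, force+)
  qed
  then have "free (Suc n) a y" "free (Suc n) y b"
    using ab yr unfolding free_def by force+
  then show "nb (Suc n) a y" "nb (Suc n) b y" using ab by (auto simp: nb_def)
qed

lemma fwd_ge:
  assumes "weight w" "sep w c N" "0 < c" "N \<le> n" "1 \<le> n" "fine n lmin" "q \<in> {1..d}"
  shows "sqrt 5 * c \<le> fwd w n q"
proof -
  note f = fwd_nb[OF assms(6,7,5)]
  let ?y = "cut q n" let ?a = "pr n ?y" and ?b = "sc n ?y"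
  have CS: "?a \<in> C (Suc n)" "?b \<in> C (Suc n)" using f(3,4) C_mono[of n "Suc n"] by auto
  have 1: "\<tau> w ?a < \<tau> w ?y" "c \<le> \<bar>?y - ?a\<bar> * (\<tau> w ?y - \<tau> w ?a)"
    using sep_pos[OF assms(1-3), of "Suc n" ?a ?y] f CS assms(4) by auto
  have 2: "\<tau> w ?b < \<tau> w ?y" "c \<le> \<bar>?y - ?b\<bar> * (\<tau> w ?y - \<tau> w ?b)"
    using sep_pos[OF assms(1-3), of "Suc n" ?b ?y] f CS assms(4) by auto
  have 3: "c \<le> (?b - ?a) * \<bar>\<tau> w ?a - \<tau> w ?b\<bar>"
  proof -
    have "c \<le> \<bar>?b - ?a\<bar> * \<bar>\<tau> w ?a - \<tau> w ?b\<bar>" using assms(2,4) f(3,4,7) unfolding sep_def by blast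
    moreover have "\<bar>?b - ?a\<bar> = ?b - ?a" using f(1,2) by linarith
    ultimately show ?thesis by simp
  qed
  have "sqrt 5 * c \<le> (?y - ?a) * (\<tau> w ?y - \<tau> w ?b) + (?b - ?y) * (\<tau> w ?y - \<tau> w ?a)"
    by (rule triangle_area[OF assms(3)]) (use 1 2 3 f(1,2) in \<open>auto simp: abs_minus_commute\<close>)
  then show ?thesis by (simp add: fwd_def Let_def)
qed

text \<open>A short gap that ends at \<open>Y (\<pi> j)\<close> lies in the image of interval
  \<open>j\<close>, and its preimage is a gap ending at \<open>X j\<close>. Edges at
  \<open>Y s\<close>, which is no cut point, are thereby replaced by edges at a singularity or an
  end point.\<close>

lemma pull_left:
  assumes "j \<in> {1..Suc d}" "a \<in> C n" "free n a (Y (\<pi> j))" "Y (\<pi> j) - a < lmin"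
  defines "a' \<equiv> a - Y (\<pi> j) + X j"
  shows "a' \<in> cuts" "T a' = a" "ord a' = Suc (ord a)" "qof a' = qof a" "free (Suc n) a' (X j)"
    "\<tau> w a' = w j + \<tau> w a" "X (j - 1) < a'" "a \<in> cuts"
proof -
  have len: "Y (\<pi> j) = Y (\<pi> j - 1) + lam j" "X j = X (j - 1) + lam j" "lmin \<le> lam j"
    using Y_step[OF assms(1)] X_Suc[of "j - 1"] assms(1) lmin(2)[OF assms(1)] by auto
  have pj: "\<pi> j \<in> {1..Suc d}" using \<pi>_mem assms(1) by blast
  have a: "Y (\<pi> j - 1) < a" "a < Y (\<pi> j)" using assms(3,4) len by (auto simp: free_def)
  have e: "a' = a - Y (\<pi> j - 1) + X (j - 1)" using len by (simp add: a'_def)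
  then show Ta: "T a' = a" and lo: "X (j - 1) < a'"
    using T_surj_interval[OF assms(1), of a] a by auto
  have hi: "a' < X j" using a unfolding a'_def by linarith
  have YR: "0 \<le> Y (\<pi> j - 1)" "Y (\<pi> j) \<le> \<Lambda>" using Y_range[of "\<pi> j - 1"] Y_range[of "\<pi> j"] pj by auto
  then show ac: "a \<in> cuts" using a assms(2) by (auto simp: C_mem)
  have XR: "0 \<le> X (j - 1)" "X j \<le> \<Lambda>" using X_range[of "j - 1"] X_range[of j] assms(1) by auto
  then have aD: "a' \<in> D" using lo hi by auto
  then show c: "a' \<in> cuts" "ord a' = Suc (ord a)" "qof a' = qof a"
    using T_pow_cuts_conv[of a' 1] Ta ac by auto
  show "\<tau> w a' = w j + \<tau> w a"
    using \<tau>_split[OF c(1), of 1 w] c(2) Ta idx_eq[OF assms(1), of a'] lo hi by simp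
  have "y \<le> a' \<or> X j \<le> y" if y: "y \<in> C (Suc n)" for y
  proof (rule ccontr)
    assume "\<not> ?thesis"
    then have yr: "X (j - 1) < y" "y < X j" "a' < y" using lo by auto
    note ci = cut_inside_interval[OF assms(1) yr(1,2) y]
    have "T y \<in> C n" using ci(2,3,5,6) by (simp add: C_mem) arith
    moreover have "a < T y" "T y < Y (\<pi> j)" using ci(4) yr e len by linarith+
    ultimately show False using assms(3) unfolding free_def by (meson not_le)
  qed
  then show "free (Suc n) a' (X j)" using aD hi XR by (auto simp: free_def)
qed

lemma pull_right:
  assumes "j \<in> {1..Suc d}" "b \<in> C n" "free n (Y (\<pi> j - 1)) b" "b - Y (\<pi> j - 1) < lmin"
  defines "b' \<equiv> b - Y (\<pi> j - 1) + X (j - 1)"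
  shows "b' \<in> cuts" "T b' = b" "ord b' = Suc (ord b)" "qof b' = qof b" "free (Suc n) (X (j - 1)) b'"
    "\<tau> w b' = w j + \<tau> w b" "b' < X j" "b \<in> cuts"
proof -
  have len: "Y (\<pi> j) = Y (\<pi> j - 1) + lam j" "X j = X (j - 1) + lam j" "lmin \<le> lam j"
    using Y_step[OF assms(1)] X_Suc[of "j - 1"] assms(1) lmin(2)[OF assms(1)] by auto
  have pj: "\<pi> j \<in> {1..Suc d}" using \<pi>_mem assms(1) by blast
  have b: "Y (\<pi> j - 1) < b" "b < Y (\<pi> j)" using assms(3,4) len by (auto simp: free_def)
  show Tb: "T b' = b" and hi: "b' < X j"
    using T_surj_interval[OF assms(1), of b] b by (auto simp: b'_def)
  have lo: "X (j - 1) < b'" using b by (simp add: b'_def)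
  have YR: "0 \<le> Y (\<pi> j - 1)" "Y (\<pi> j) \<le> \<Lambda>" using Y_range[of "\<pi> j - 1"] Y_range[of "\<pi> j"] pj by auto
  then show bc: "b \<in> cuts" using b assms(2) by (auto simp: C_mem)
  have XR: "0 \<le> X (j - 1)" "X j \<le> \<Lambda>" using X_range[of "j - 1"] X_range[of j] assms(1) by auto
  then have bD: "b' \<in> D" using lo hi by auto
  then show c: "b' \<in> cuts" "ord b' = Suc (ord b)" "qof b' = qof b"
    using T_pow_cuts_conv[of b' 1] Tb bc by auto
  show "\<tau> w b' = w j + \<tau> w b"
    using \<tau>_split[OF c(1), of 1 w] c(2) Tb idx_eq[OF assms(1), of b'] lo hi by simp
  have "y \<le> X (j - 1) \<or> b' \<le> y" if y: "y \<in> C (Suc n)" for y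
  proof (rule ccontr)
    assume "\<not> ?thesis"
    then have yr: "X (j - 1) < y" "y < X j" "y < b'" using hi by auto
    note ci = cut_inside_interval[OF assms(1) yr(1,2) y]
    have "T y \<in> C n" using ci(2,3,5,6) by (simp add: C_mem) arith
    moreover have "Y (\<pi> j - 1) < T y" "T y < b" using ci(4) yr unfolding b'_def by linarith+
    ultimately show False using assms(3) unfolding free_def by (meson not_le)
  qed
  then show "free (Suc n) (X (j - 1)) b'" using bD lo XR by (auto simp: free_def)
qed

lemma bwd_nb:
  assumes "fine n lmin" "s \<in> {1..d}"
  defines "z \<equiv> Y s" and "a \<equiv> pr n (Y s)" and "b \<equiv> sc n (Y s)"
  shows "a < z" "z < b" "a \<in> C n" "b \<in> C n" "free n a b" "nb n a b" "free n a z" "free n z b" "b - a < lmin"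
proof -
  have zr: "0 < z" "z < \<Lambda>" "z \<notin> C n"
    using Y_interior[OF assms(2)] Z_C[of n] imageI[OF assms(2), of Y] by (auto simp: z_def Z_def)
  note p = pr_sc[OF zr(1,2), of n, folded z_def, folded a_def b_def]
  show ab: "a < z" "z < b" "a \<in> C n" "b \<in> C n" "free n a b" using p zr(3) by (auto simp: a_def b_def z_def)
  show "nb n a b" using ab by (simp add: nb_def)
  show "free n a z" "free n z b" using free_sub[OF ab(5)] ab by auto
  show "b - a < lmin" using ab assms(1) by (auto simp: fine_def)
qed

lemma nb_free: assumes "free n a b" shows "nb n a b" "nb n b a"
proof -
  have "a < b" using assms by (simp add: free_def)
  then show "nb n a b" "nb n b a" using assms by (simp_all add: nb_def min_def max_def)
qed

lemma \<tau>_X0: assumes "i \<le> Suc d" shows "\<tau> w (X i) = 0"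
  using index3[OF assms] \<tau>_X[of i w] by (elim disjE) (simp_all add: X_top)

lemma sep_X:
  assumes "weight w" "sep w c N" "0 < c" "N \<le> Suc n" "i \<le> Suc d" "y \<in> cuts" "ord y \<le> n" "nb (Suc n) (X i) y"
  shows "c \<le> \<bar>y - X i\<bar> * \<tau> w y"
proof -
  have "X i \<in> C (Suc n)" "y \<in> C (Suc n)" using X_C assms by (auto simp: C_mem)
  then have "c \<le> \<bar>y - X i\<bar> * \<bar>\<tau> w (X i) - \<tau> w y\<bar>" using assms(2,4,8) by (auto simp: sep_def)
  then show ?thesis using \<tau>_X0[OF assms(5)] \<tau>_nonneg[OF assms(1)] by simp
qed

text \<open>The two edges at \<open>Y s\<close> are pulled back one step to edges at
  \<open>X j\<close> and \<open>X (i - 1)\<close>, where \<open>sep\<close> applies. The pull adds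
  at most \<open>1\<close> to the age, and the gap is shorter than \<open>e\<close>, so each product
  changes by at most \<open>e\<close>.\<close>

lemma bwd_edges:
  assumes "weight w" "sep w c N" "0 < c" "N \<le> n" "fine n e" "e \<le> lmin" "s \<in> {1..d}"
  defines "z \<equiv> Y s" and "a \<equiv> pr n (Y s)" and "b \<equiv> sc n (Y s)"
  shows "c - e \<le> (z - a) * \<tau> w a" "c - e \<le> (b - z) * \<tau> w b" "c \<le> (b - a) * \<bar>\<tau> w a - \<tau> w b\<bar>"
proof -
  have fl: "fine n lmin" using assms(5,6) by (force simp: fine_def)
  note f = bwd_nb[OF fl assms(7), folded z_def a_def b_def]
  show "c \<le> (b - a) * \<bar>\<tau> w a - \<tau> w b\<bar>" 
  proof -
    have "c \<le> \<bar>b - a\<bar> * \<bar>\<tau> w a - \<tau> w b\<bar>" using assms(2,4) f(3,4,6) unfolding sep_def by blast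
    moreover have "\<bar>b - a\<bar> = b - a" using f(1,2) by linarith
    ultimately show ?thesis by simp
  qed
  have ba: "b - a < e" using f(5) assms(5) by (auto simp: fine_def)
  obtain j where j: "j \<in> {1..Suc d}" "\<pi> j = s" using \<pi>_surj[of s] assms(7) by auto
  have "Y (\<pi> j) - a < lmin" using f j z_def by auto
  note pl = pull_left[OF j(1) f(3) _ this, unfolded j(2), folded z_def, OF f(7)]
  let ?a = "a - z + X j"
  have "c \<le> \<bar>?a - X j\<bar> * \<tau> w ?a"
  proof (rule sep_X[OF assms(1-3) _ _ pl(1)])
    show "ord ?a \<le> n" using pl(3,8) f(3) by (auto simp: C_mem)
  qed (use assms(4) j nb_free(2)[OF pl(5)] in auto)
  also have "\<bar>?a - X j\<bar> = z - a" using f(1) by simp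
  also have "(z - a) * \<tau> w ?a = (z - a) * \<tau> w a + (z - a) * w j" using pl(6)[of w] by (simp add: algebra_simps)
  also have "(z - a) * w j \<le> e * 1" using ba f(1,2) weightD[OF assms(1), of j] by (intro mult_mono) auto
  finally show "c - e \<le> (z - a) * \<tau> w a" by simp
  obtain i where i: "i \<in> {1..Suc d}" "\<pi> i = Suc s" using \<pi>_surj[of "Suc s"] assms(7) by auto
  have fz: "free n (Y (\<pi> i - 1)) b" "b - Y (\<pi> i - 1) < lmin" using f i z_def by auto
  note pu = pull_right[OF i(1) f(4) fz, unfolded i(2) diff_Suc_1, folded z_def]
  let ?b = "b - z + X (i - 1)"
  have "c \<le> \<bar>?b - X (i - 1)\<bar> * \<tau> w ?b"
  proof (rule sep_X[OF assms(1-3) _ _ pu(1)])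
    show "ord ?b \<le> n" using pu(3,8) f(4) by (auto simp: C_mem)
  qed (use assms(4) i nb_free(1)[OF pu(5)] in auto)
  also have "\<bar>?b - X (i - 1)\<bar> = b - z" using f(2) by simp
  also have "(b - z) * \<tau> w ?b = (b - z) * \<tau> w b + (b - z) * w i" using pu(6)[of w] by (simp add: algebra_simps)
  also have "(b - z) * w i \<le> e * 1" using ba f(1,2) weightD[OF assms(1), of i] by (intro mult_mono) auto
  finally show "c - e \<le> (b - z) * \<tau> w b" by simp
qed

lemma bwd_ge:
  assumes "weight w" "sep w c N" "0 < c" "N \<le> n" "fine n e" "e \<le> lmin" "0 < e" "e < c" "s \<in> {1..d}"
  shows "sqrt 5 * (c - e) \<le> bwd w n s"
proof -
  have fl: "fine n lmin" using assms(5,6) by (force simp: fine_def)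
  let ?a = "pr n (Y s)" and ?b = "sc n (Y s)"
  note f = bwd_nb[OF fl assms(9)] and g = bwd_edges[OF assms(1-6,9)]
  have "0 < (Y s - ?a) * \<tau> w ?a" "0 < (?b - Y s) * \<tau> w ?b" using g assms(8) by auto
  then have p: "0 < \<tau> w ?a" "0 < \<tau> w ?b" using f(1,2) by (auto simp: zero_less_mult_iff)
  have "sqrt 5 * (c - e) \<le> (Y s - ?a) * \<tau> w ?b + (?b - Y s) * \<tau> w ?a"
    by (rule triangle_area) (use p f(1,2) g assms(7,8) in auto)
  then show ?thesis by (simp add: bwd_def Let_def)
qed

text \<open>The total area \<open>2 * \<Omega> w\<close> is shared by \<open>2 * d\<close> triangles.\<close>

lemma sep_bound:
  assumes "weight w" "sep w c N" "0 < c" shows "real d * sqrt 5 * c \<le> \<Omega> w"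
proof (rule field_le_epsilon)
  fix \<epsilon> :: real assume \<epsilon>: "0 < \<epsilon>"
  define e where "e = Min {lmin, c / 2, \<epsilon> / (3 * real d)}"
  have e: "0 < e" "e \<le> lmin" "e < c" "e \<le> \<epsilon> / (3 * real d)"
    using lmin(1) assms(3) \<epsilon> d_pos by (auto simp: e_def min_less_iff_disj)
  obtain N' where N': "\<And>n. n \<ge> N' \<Longrightarrow> fine n e" using fine_exists[OF e(1)] by blast
  define n where "n = Max {N, N', 1}"
  have n: "N \<le> n" "fine n e" "1 \<le> n" using N' by (auto simp: n_def)
  have fl: "fine n lmin" using n e by (force simp: fine_def)
  have "(\<Sum>q=1..d. sqrt 5 * (c - e)) + (\<Sum>s=1..d. sqrt 5 * (c - e)) \<le> (\<Sum>q=1..d. fwd w n q) + (\<Sum>s=1..d. bwd w n s)"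
  proof (intro add_mono sum_mono)
    fix q assume q: "q \<in> {1..d}"
    have "sqrt 5 * (c - e) \<le> sqrt 5 * c" using e(1) by (intro mult_left_mono) simp_all
    then show "sqrt 5 * (c - e) \<le> fwd w n q" using fwd_ge[OF assms(1-3) n(1,3) fl q] by linarith
    show "sqrt 5 * (c - e) \<le> bwd w n q" using bwd_ge[OF assms(1-3) n(1,2) e(2,1,3) q] .
  qed
  also have "\<dots> \<le> 2 * \<Omega> w"
    using area_identity[OF fl, of w] bdry_nonneg[of w n] weightD[OF assms(1)] by auto
  finally have "real d * sqrt 5 * (c - e) \<le> \<Omega> w" by (simp add: algebra_simps)
  moreover have "real d * sqrt 5 * e \<le> \<epsilon>"
  proof -
    have "real d * sqrt 5 * e \<le> real d * 3 * e" using sqrt5_bounds e by (intro mult_right_mono mult_left_mono) auto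
    also have "\<dots> \<le> \<epsilon>" using e(4) d_pos by (simp add: field_simps)
    finally show ?thesis .
  qed
  ultimately show "real d * sqrt 5 * c \<le> \<Omega> w + \<epsilon>" by (simp add: algebra_simps)
qed

section \<open>From the smallest gap to separated edges\<close>

definition gap_min :: "nat \<Rightarrow> real" where "gap_min n = min_length (Suc d) \<pi> lam n"

lemma cut_points_eq: "cut_points (Suc d) \<pi> lam n = C n"
proof -
  have tl: "total_length (Suc d) lam = \<Lambda>" by (simp only: total_length_def \<Lambda>_def X_def)
  have si: "singularity lam i = X i" for i by (simp only: singularity_def X_def)
  have "y \<in> cut_points (Suc d) \<pi> lam n \<longleftrightarrow> y \<in> C n" for y
  proof -
    have "(y \<in> D \<and> (\<exists>j<n. \<exists>i\<in>{1..d}. (T ^^ j) y = X i)) \<longleftrightarrow> y \<in> cuts \<and> ord y < n"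
    proof
      assume "y \<in> D \<and> (\<exists>j<n. \<exists>i\<in>{1..d}. (T ^^ j) y = X i)"
      then obtain j i where "y \<in> D" "j < n" "i \<in> {1..d}" "(T ^^ j) y = X i" by blast
      moreover from this have "cut i j = y" by (intro cut_eqI)
      ultimately show "y \<in> cuts \<and> ord y < n" using cut_cuts[of i j] ord_cut[of i j] by auto
    next
      assume y: "y \<in> cuts \<and> ord y < n"
      then have "(T ^^ ord y) y = X (qof y)" using T_pow_cut(1) cuts_eq by metis
      then show "y \<in> D \<and> (\<exists>j<n. \<exists>i\<in>{1..d}. (T ^^ j) y = X i)"
        using cuts_eq(1) cuts_D y by blast
    qed
    then show ?thesis unfolding cut_points_def tl si C_mem T_def diff_Suc_1 by blast
  qed
  then show ?thesis by blast
qed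

lemma gap_min:
  shows "\<And>a b. (a, b) \<in> gaps (C n) \<Longrightarrow> gap_min n \<le> b - a" "\<exists>(a, b)\<in>gaps (C n). gap_min n = b - a"
proof -
  have e: "{b - a |a b. a \<in> C n \<and> b \<in> C n \<and> a < b \<and> {a<..<b} \<inter> C n = {}} = (\<lambda>(a, b). b - a) ` gaps (C n)"
    by (force simp: gaps_def image_iff)
  have g: "gap_min n = Min ((\<lambda>(a, b). b - a) ` gaps (C n))"
    by (simp only: gap_min_def min_length_def cut_points_eq e)
  have fin: "finite ((\<lambda>(a, b). b - a) ` gaps (C n))" using finite_gaps by simp
  show "gap_min n \<le> b - a" if "(a, b) \<in> gaps (C n)" for a b
    unfolding g using fin that by (intro Min_le) force+
  have "gaps (C n) \<noteq> {}"
  proof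
    assume "gaps (C n) = {}"
    then have "\<Lambda> - 0 = 0"
      using sum_gaps_length[of "C n" 0 \<Lambda>] \<Lambda>_pos C_range by simp
    then show False using \<Lambda>_pos by simp
  qed
  then have "gap_min n \<in> (\<lambda>(a, b). b - a) ` gaps (C n)" unfolding g using fin by (intro Min_in) auto
  then show "\<exists>(a, b)\<in>gaps (C n). gap_min n = b - a" by auto
qed

lemma gap_min_pos: "0 < gap_min n"
  using gap_min(2)[of n] by (auto simp: gaps_def)

lemma gap_min_dist: assumes "a \<in> C n" "b \<in> C n" "a \<noteq> b" shows "gap_min n \<le> \<bar>b - a\<bar>"
proof -
  have *: "gap_min n \<le> b - a" if "a \<in> C n" "b \<in> C n" "a < b" for a b
  proof -
    note ab = above[OF C_finite that(2,3)]
    have "(a, above (C n) a) \<in> gaps (C n)" using that ab by (auto simp: gaps_def) (meson leI)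
    then show ?thesis using gap_min(1) ab(3)[OF that(2,3)] by force
  qed
  show ?thesis using *[of a b] *[of b a] assms by (cases "a < b") auto
qed

text \<open>Moved to its base, an edge joins two points of \<open>C ?m\<close>, with
  \<open>?m\<close> one more than the difference of orders, so its length is at least
  \<open>gap_min ?m\<close>. A short edge forces \<open>?m\<close> to be large, and the extra one
  costs less than \<open>c - c'\<close>.\<close>

lemma sep_of_gap_min:
  assumes "\<And>n. N \<le> n \<Longrightarrow> c \<le> real n * gap_min n" "0 < c" "c' < c"
  shows "\<exists>N'. sep (\<lambda>_. 1) c' N'"
proof -
  define e where "e = Min {lmin, gap_min N, c - c'}"
  have e: "0 < e" "e \<le> lmin" "e \<le> gap_min N" "e \<le> c - c'"
    using lmin(1) gap_min_pos assms(3) by (auto simp: e_def)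
  obtain N' where N': "\<And>n. n \<ge> N' \<Longrightarrow> fine n e" using fine_exists[OF e(1)] by blast
  have \<tau>1: "\<tau> (\<lambda>_. 1) y = real (ord y)" for y by (simp add: \<tau>_def)
  have *: "c' \<le> \<bar>b - a\<bar> * (real (ord b) - real (ord a))"
    if n: "N' \<le> n" and ab: "a \<in> C n" "b \<in> C n" "nb n a b" "ord a < ord b" for n a b
  proof -
    note p = push_base[OF ab]
    let ?b = "(T ^^ ord a) b" let ?m = "Suc (ord b - ord a)"
    have small: "\<bar>b - a\<bar> < e"
      using N'[OF n] ab(3) unfolding fine_def nb_def by (auto simp: min_def max_def abs_if split: if_splits)
    have "?b \<in> C ?m" "X (qof a) \<in> C ?m" "?b \<noteq> X (qof a)"
      using p(3,4) X_C[OF X_qof(1)[OF ab(1)], of ?m] nb_neq[OF p(2)] by (auto simp: C_mem)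
    then have d: "gap_min k \<le> \<bar>b - a\<bar>" if "?m \<le> k" for k
      using gap_min_dist[of "X (qof a)" k ?b] C_mono[OF that] p(1) by auto
    have "N \<le> ?m" using d[of N] small e(3) by (cases "?m \<le> N") auto
    then have "c \<le> real ?m * gap_min ?m" using assms(1) by blast
    also have "\<dots> \<le> real ?m * \<bar>b - a\<bar>" using d[of ?m] by (intro mult_left_mono) auto
    also have "real ?m = real (ord b) - real (ord a) + 1" using ab(4) by simp
    finally show ?thesis using small e(4) by (simp add: algebra_simps)
  qed
  have "c' \<le> \<bar>b - a\<bar> * \<bar>\<tau> (\<lambda>_. 1) a - \<tau> (\<lambda>_. 1) b\<bar>" if "N' \<le> n" "a \<in> C n" "b \<in> C n" "nb n a b" for n a b
  proof -
    have "ord a \<noteq> ord b"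
    proof
      assume "ord a = ord b"
      then have "lmin \<le> \<bar>b - a\<bar>" using equal_ord that by blast
      moreover have "\<bar>b - a\<bar> < e"
        using N'[OF that(1)] that(4) unfolding fine_def nb_def by (auto simp: min_def max_def abs_if split: if_splits)
      ultimately show False using e by simp
    qed
    then consider "ord a < ord b" | "ord b < ord a" by linarith
    then show ?thesis
    proof cases
      case 1 then show ?thesis using *[OF that 1] \<tau>1 by simp
    next
      case 2 then show ?thesis using *[OF that(1,3,2) _ 2] that(4) nb_sym \<tau>1 by (simp add: abs_minus_commute)
    qed
  qed
  then show ?thesis unfolding sep_def by blast
qed

lemma \<Omega>_1: "\<Omega> (\<lambda>_. 1) = \<Lambda>"
  by (simp only: \<Omega>_def \<Lambda>_def X_def mult_1)

lemma iet_E_eq: "iet_E (Suc d) \<pi> lam = liminf (\<lambda>n. ereal (real n * gap_min n / \<Lambda>))"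
  by (simp only: iet_E_def gap_min_def total_length_def \<Lambda>_def X_def)

lemma iet_E_nonneg: "0 \<le> iet_E (Suc d) \<pi> lam"
  unfolding iet_E_eq
proof (intro Liminf_bounded eventually_sequentiallyI[of 0])
  fix n
  have "0 \<le> real n * gap_min n / \<Lambda>"
    using gap_min_pos[of n] \<Lambda>_pos by (intro divide_nonneg_nonneg mult_nonneg_nonneg) auto
  then show "0 \<le> ereal (real n * gap_min n / \<Lambda>)" by simp
qed

lemma sep_of_iet_E:
  assumes "ereal c < iet_E (Suc d) \<pi> lam" "0 < c"
  shows "\<exists>N. sep (\<lambda>_. 1) (c * \<Lambda>) N"
proof -
  obtain c2 where c2: "ereal c < c2" "c2 < iet_E (Suc d) \<pi> lam" using assms(1) dense by blast
  then obtain r where r: "c2 = ereal r" by (cases c2) auto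
  have "\<forall>\<^sub>F n in sequentially. ereal r < ereal (real n * gap_min n / \<Lambda>)"
    using c2(2) unfolding iet_E_eq r by (rule less_LiminfD)
  then obtain N where N: "\<And>n. N \<le> n \<Longrightarrow> r < real n * gap_min n / \<Lambda>" by (auto simp: eventually_sequentially)
  show ?thesis
  proof (rule sep_of_gap_min[of N "r * \<Lambda>"])
    show "r * \<Lambda> \<le> real n * gap_min n" if "N \<le> n" for n
      using N[OF that] \<Lambda>_pos by (simp add: field_simps)
    show "0 < r * \<Lambda>" "c * \<Lambda> < r * \<Lambda>" using c2(1) assms(2) \<Lambda>_pos by (auto simp: r)
  qed
qed

text \<open>This is \<open>L \<ge> d \<surd>5\<close>: a larger value would separate the edges by
  more than \<open>sep_bound\<close> permits.\<close>

theorem iet_E_le: "iet_E (Suc d) \<pi> lam \<le> ereal (1 / (real d * sqrt 5))"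
proof (rule ccontr)
  assume "\<not> ?thesis"
  then obtain c2 where c2: "ereal (1 / (real d * sqrt 5)) < c2" "c2 < iet_E (Suc d) \<pi> lam"
    using dense by (metis not_le)
  then obtain r where r: "c2 = ereal r" by (cases c2) auto
  have d5: "0 < real d * sqrt 5" using d_pos by simp
  have r1: "1 / (real d * sqrt 5) < r" using c2 r by simp
  then have r0: "0 < r" using d5 by (smt (verit) zero_less_divide_1_iff)
  obtain N where "sep (\<lambda>_. 1) (r * \<Lambda>) N" using sep_of_iet_E[OF _ r0] c2 r by auto
  then have "real d * sqrt 5 * (r * \<Lambda>) \<le> \<Lambda>"
    using sep_bound[of "\<lambda>_. 1" "r * \<Lambda>" N] r0 \<Lambda>_pos \<Omega>_1 by (simp add: weight_def)
  then have "(real d * sqrt 5 * r) * \<Lambda> \<le> 1 * \<Lambda>" by (simp add: mult.assoc)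
  then have "real d * sqrt 5 * r \<le> 1" using \<Lambda>_pos mult_le_cancel_right_pos by blast
  then show False using r1 d5 by (simp add: field_simps)
qed

section \<open>Nearly golden interval exchanges\<close>

text \<open>The first cut point that divides the edge from \<open>a\<close> to \<open>b\<close>.\<close>

definition apex :: "real \<Rightarrow> real \<Rightarrow> real" where
  "apex a b = (SOME y. \<exists>m q. q \<in> {1..d} \<and> y = cut q m \<and> min a b < y \<and> y < max a b \<and> nb m a b)"

lemma gap_is_cut:
  assumes "nb n a b"
  shows "\<exists>m q. n \<le> m \<and> q \<in> {1..d} \<and> min a b < cut q m \<and> cut q m < max a b \<and> nb m a b"
proof -
  let ?a = "min a b" and ?b = "max a b"
  have f: "free n ?a ?b" using assms by (simp add: nb_def)
  then have "0 < ?b - ?a" by (simp add: free_def)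
  then obtain M where "\<forall>k\<ge>M. fine k (?b - ?a)" using fine_exists by blast
  then have nf: "\<not> free M ?a ?b" by (auto simp: fine_def)
  define m where "m = (LEAST m. \<not> free (Suc m) ?a ?b)"
  have "M \<noteq> 0" using nf free_mono[OF f, of 0] by (cases M) auto
  then have "\<not> free (Suc (M - 1)) ?a ?b" using nf by simp
  then have m: "\<not> free (Suc m) ?a ?b" unfolding m_def by (rule LeastI)
  have fm: "free m ?a ?b"
  proof (cases "m \<le> n")
    case True then show ?thesis using free_mono[OF f] by blast
  next
    case False
    then have "\<not> \<not> free (Suc (m - 1)) ?a ?b"
      using not_less_Least[of "m - 1" "\<lambda>m. \<not> free (Suc m) ?a ?b", folded m_def] by linarith
    then show ?thesis using False by simp
  qed
  have nm: "n \<le> m" using m free_mono[OF f, of "Suc m"] by (meson not_less_eq_eq)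
  obtain y where y: "y \<in> C (Suc m)" "?a < y" "y < ?b"
    using m f unfolding free_def by (meson not_le)
  then have "y \<notin> C m" using fm unfolding free_def by (meson not_le)
  then have "y \<in> (\<lambda>q. cut q m) ` {1..d}" using y(1) C_Suc[of m] by blast
  then obtain q where "q \<in> {1..d}" "y = cut q m" by blast
  then show ?thesis using nm y fm nb_def by auto
qed

lemma nb_pr_sc:
  assumes "nb m a b" "a \<in> C m" "b \<in> C m" "min a b < y" "y < max a b"
  shows "pr m y = min a b" "sc m y = max a b"
  using pr_sc_eq[of "min a b" m "max a b" y] assms by (auto simp: nb_def min_def max_def)

text \<open>The choice in \<open>apex\<close> is unique: a different time contradicts that the gap
  is uncut until then, and two cuts of the same time in one gap are excluded by the mesh.\<close>

lemma apex_eq: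
  assumes "fine m lmin" "1 \<le> m" "q \<in> {1..d}" "nb m a b" "a \<in> C m" "b \<in> C m"
    "min a b < cut q m" "cut q m < max a b"
  shows "apex a b = cut q m"
proof -
  have "\<exists>y m q. q \<in> {1..d} \<and> y = cut q m \<and> min a b < y \<and> y < max a b \<and> nb m a b"
    using assms by blast
  then have "\<exists>m q. q \<in> {1..d} \<and> apex a b = cut q m \<and> min a b < apex a b \<and> apex a b < max a b \<and> nb m a b"
    unfolding apex_def by (rule someI_ex)
  then obtain m1 q1 where y1: "q1 \<in> {1..d}" "apex a b = cut q1 m1" "min a b < apex a b" "apex a b < max a b" "nb m1 a b"
    by blast
  have no: "y \<in> C k \<Longrightarrow> \<not> (min a b < y \<and> y < max a b)" if "nb k a b" for y k
    using that unfolding nb_def free_def by (meson not_le)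
  have "cut q1 m1 \<in> C m" if "m1 < m" using that y1(1) by (auto simp: C_mem)
  moreover have "cut q m \<in> C m1" if "m < m1" using that assms(3) by (auto simp: C_mem)
  ultimately have mm: "m1 = m" using no[OF assms(4)] no[OF y1(5)] y1 assms(7,8) by (metis linorder_neqE_nat)
  note f = fwd_nb[OF assms(1,3,2)]
  have ps: "pr m (cut q m) = min a b" "sc m (cut q m) = max a b"
    using nb_pr_sc[OF assms(4-8)] by auto
  have "cut q1 m \<in> C (Suc m)" using y1(1) by (auto simp: C_mem)
  moreover have "free (Suc m) (min a b) (cut q m)" "free (Suc m) (cut q m) (max a b)"
    using f(8,9) assms(7,8) unfolding ps nb_def by (auto simp: min_def max_def split: if_splits)
  ultimately show ?thesis using y1 mm unfolding free_def by (metis leD linorder_neqE not_le)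
qed

definition nbr :: "nat \<Rightarrow> bool \<Rightarrow> nat \<Rightarrow> real" where
  "nbr q r n = (if r then sc n (X q) else pr n (X q))"

lemma nbr:
  assumes "q \<in> {1..d}" "1 \<le> n"
  shows "nbr q r n \<in> C n" "nb n (X q) (nbr q r n)" "r \<longleftrightarrow> X q < nbr q r n"
proof -
  have x: "X q \<in> C n" using X_C[of q n] assms by auto
  have l: "0 < X q" "X q < \<Lambda>" using X_interior[OF assms(1)] by auto
  note p = below[OF C_finite[of n] C_ends(1) l(1)] and s = above[OF C_finite[of n] C_ends(2) l(2)]
  show "nbr q r n \<in> C n" "r \<longleftrightarrow> X q < nbr q r n" using p(1,2) s(1,2) by (auto simp: nbr_def)
  have "free n (pr n (X q)) (X q)"
    using p C_range[OF p(1)] C_range[OF x] unfolding free_def by (meson not_le)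
  moreover have "free n (X q) (sc n (X q))"
    using s C_range[OF s(1)] C_range[OF x] unfolding free_def by (meson not_le)
  ultimately show "nb n (X q) (nbr q r n)" using nb_free by (auto simp: nbr_def)
qed

lemma nbr_unique:
  assumes "q \<in> {1..d}" "1 \<le> n" "y \<in> C n" "nb n (X q) y" "r \<longleftrightarrow> X q < y"
  shows "y = nbr q r n"
proof (rule ccontr)
  assume ne: "y \<noteq> nbr q r n"
  note b = nbr[OF assms(1,2), of r]
  have no: "z \<in> C n \<Longrightarrow> \<not> (min (X q) y < z \<and> z < max (X q) y)"
    "z \<in> C n \<Longrightarrow> \<not> (min (X q) (nbr q r n) < z \<and> z < max (X q) (nbr q r n))" for z
    using assms(4) b(2) unfolding nb_def free_def by (meson not_le)+
  have "y \<noteq> X q" using nb_neq assms(4) by metis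
  moreover have "nbr q r n \<noteq> X q" using nb_neq b(2) by metis
  ultimately show False
    using no(1)[OF b(1)] no(2)[OF assms(3)] ne assms(5) b(3) by (cases r) (auto simp: min_def max_def split: if_splits)
qed

end

text \<open>Together with the lower bound in \<open>sep\<close>, the upper bound
  \<open>fwd_le\<close> makes the triangles nearly golden. The assumption \<open>ord_le\<close>
  compares orders with weighted ages: \<open>w\<close> may vanish on an interval, whereas the times
  of cuts are orders. Its constants suit the golden example.\<close>

locale nearly_golden = keane_iet +
  fixes w :: "nat \<Rightarrow> real" and c e :: real and N0 :: nat
  assumes w: "weight w" and c_pos: "0 < c" and N0: "1 \<le> N0"
    and sep: "sep w c N0"
    and fine0: "fine N0 lmin"
    and fwd_le: "\<And>n q. N0 \<le> n \<Longrightarrow> q \<in> {1..d} \<Longrightarrow> fwd w n q \<le> (sqrt 5 + e) * c"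
    and e: "0 \<le> e" "e \<le> 1 / 1000"
    and ord_le: "\<And>y. y \<in> cuts \<Longrightarrow> real (ord y) \<le> 3 * \<tau> w y + 3"
begin

lemma fineN: "N0 \<le> n \<Longrightarrow> fine n lmin"
  using fine0 fine_mono by blast

lemma nb_ord_neq:
  assumes "N0 \<le> n" "a \<in> C n" "b \<in> C n" "nb n a b" shows "ord a \<noteq> ord b"
proof
  assume "ord a = ord b"
  then have "lmin \<le> \<bar>b - a\<bar>" using equal_ord assms by blast
  moreover have "max a b - min a b < lmin" using fineN[OF assms(1)] assms(4) by (auto simp: fine_def nb_def)
  ultimately show False by (auto simp: max_def min_def split: if_splits)
qed

text \<open>The ages increase from \<open>lo\<close> to \<open>hi\<close> to the new point
  \<open>y\<close>, so the triangle is in the position of \<open>triangle_shape\<close> with apex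
  \<open>y\<close>: the gap is divided nearly in the golden ratio, with the shorter part at
  \<open>lo\<close>.\<close>

lemma fwd_shape:
  assumes n: "N0 \<le> n" and q: "q \<in> {1..d}" and g: "nb n lo hi" "lo \<in> C n" "hi \<in> C n" "ord lo < ord hi"
    and y: "min lo hi < cut q n" "cut q n < max lo hi"
  defines "y \<equiv> cut q n"
  shows "\<bar>y - lo\<bar> + \<bar>y - hi\<bar> = \<bar>hi - lo\<bar>" "\<tau> w lo < \<tau> w hi" "\<tau> w hi < \<tau> w y"
    "c \<le> \<bar>y - lo\<bar> * (\<tau> w y - \<tau> w lo)" "c \<le> \<bar>y - hi\<bar> * (\<tau> w y - \<tau> w hi)"
    "\<bar>y - lo\<bar> * (\<tau> w y - \<tau> w lo) \<le> (1 + 3 * e) * c"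
    "\<bar>y - hi\<bar> * (\<tau> w y - \<tau> w hi) \<le> (1 + 3 * e) * c"
    "\<bar>hi - lo\<bar> * (\<tau> w hi - \<tau> w lo) \<le> (1 + 3 * e) * c"
    "\<bar>\<bar>y - hi\<bar> / \<bar>y - lo\<bar> - gr\<bar> \<le> 8 * e"
    "0 < \<bar>y - lo\<bar>" "0 < \<bar>y - hi\<bar>" "nb (Suc n) lo y" "nb (Suc n) hi y"
    "y \<in> C (Suc n)" "y \<in> cuts" "ord y = n" "ord hi < n" "hi \<in> cuts"
proof -
  have n1: "1 \<le> n" using n N0 by simp
  note ps = nb_pr_sc[OF g(1-3) y, folded y_def]
  note f = fwd_nb[OF fineN[OF n] q n1, folded y_def, unfolded ps]
  have CS: "lo \<in> C (Suc n)" "hi \<in> C (Suc n)" using g C_mono[of n "Suc n"] by auto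
  show nbs: "nb (Suc n) lo y" "nb (Suc n) hi y"
    using f(8,9) by (auto simp: min_def max_def split: if_splits)
  show yC: "y \<in> C (Suc n)" "ord y = n" using f by auto
  show "y \<in> cuts" using q by (simp add: y_def)
  have o: "ord lo < n" "ord hi < n" using f(11,12) g(4) by (auto simp: min_def max_def split: if_splits)
  then show "ord hi < n" by simp
  show "hi \<in> cuts" using g by (auto simp: C_mem)
  have d1: "\<tau> w lo < \<tau> w y" "c \<le> \<bar>y - lo\<bar> * (\<tau> w y - \<tau> w lo)"
    using sep_pos[OF w sep c_pos _ CS(1) yC(1) nbs(1)] n o yC(2) by auto
  have d2: "\<tau> w hi < \<tau> w y" "c \<le> \<bar>y - hi\<bar> * (\<tau> w y - \<tau> w hi)"
    using sep_pos[OF w sep c_pos _ CS(2) yC(1) nbs(2)] n o yC(2) by auto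
  have d3: "\<tau> w lo < \<tau> w hi" "c \<le> \<bar>hi - lo\<bar> * (\<tau> w hi - \<tau> w lo)"
    using sep_pos[OF w sep c_pos n g(2,3,1,4)] by auto
  show s: "\<bar>y - lo\<bar> + \<bar>y - hi\<bar> = \<bar>hi - lo\<bar>" using f(1,2) by (auto simp: min_def max_def split: if_splits)
  show p: "0 < \<bar>y - lo\<bar>" "0 < \<bar>y - hi\<bar>" using f(1,2) by (auto simp: min_def max_def split: if_splits)
  have "fwd w n q = \<bar>y - lo\<bar> * (\<tau> w y - \<tau> w hi) + \<bar>y - hi\<bar> * (\<tau> w y - \<tau> w lo)"
  proof (cases "lo < hi")
    case True
    then have "pr n y = lo" "sc n y = hi" "lo < y" "y < hi" using ps f(1,2) by auto
    then show ?thesis by (simp add: fwd_def Let_def flip: y_def)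
  next
    case False
    then have "pr n y = hi" "sc n y = lo" "hi < y" "y < lo" using ps f(1,2) by auto
    then show ?thesis by (simp add: fwd_def Let_def flip: y_def)
  qed
  then have ar: "\<bar>y - lo\<bar> * (\<tau> w y - \<tau> w hi) + \<bar>y - hi\<bar> * (\<tau> w y - \<tau> w lo) \<le> (sqrt 5 + e) * c"
    using fwd_le[OF n q] by simp
  have c3: "c \<le> (\<bar>y - lo\<bar> + \<bar>y - hi\<bar>) * ((\<tau> w y - \<tau> w lo) - (\<tau> w y - \<tau> w hi))"
    using d3(2) s by simp
  have pu: "0 < \<tau> w y - \<tau> w lo" "0 < \<tau> w y - \<tau> w hi" using d1(1) d2(1) by auto
  have e10: "e \<le> 1 / 10" using e by simp
  note sh = triangle_shape[OF c_pos p pu d1(2) d2(2) c3 ar e(1) e10]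
  show "\<tau> w lo < \<tau> w hi" "\<tau> w hi < \<tau> w y" using d3 d2 by auto
  show "c \<le> \<bar>y - lo\<bar> * (\<tau> w y - \<tau> w lo)" "c \<le> \<bar>y - hi\<bar> * (\<tau> w y - \<tau> w hi)" using d1 d2 by auto
  show "\<bar>y - lo\<bar> * (\<tau> w y - \<tau> w lo) \<le> (1 + 3 * e) * c"
    "\<bar>y - hi\<bar> * (\<tau> w y - \<tau> w hi) \<le> (1 + 3 * e) * c"
    "\<bar>\<bar>y - hi\<bar> / \<bar>y - lo\<bar> - gr\<bar> \<le> 8 * e"
    using sh(1,2,4) by auto
  show "\<bar>hi - lo\<bar> * (\<tau> w hi - \<tau> w lo) \<le> (1 + 3 * e) * c" using sh(3) s by simp
qed

text \<open>The successive neighbours of \<open>X q\<close> on the right (\<open>r\<close>) or left (\<open>\<not> r\<close>) from time \<open>N0\<close> on.  \<open>U\<close> is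
  the distance to \<open>X q\<close>, \<open>En\<close> the singularity hit by the record, and \<open>mo\<close> the time at which it is
  replaced.\<close>

definition sq :: "nat \<Rightarrow> bool \<Rightarrow> nat \<Rightarrow> real" where
  "sq q r i = (apex (X q) ^^ i) (nbr q r N0)"

lemma sq_Suc: "sq q r (Suc i) = apex (X q) (sq q r i)"
  by (simp add: sq_def)

lemma next_record:
  assumes "q \<in> {1..d}" "N0 \<le> n" "y \<in> C n" "nb n (X q) y" "r \<longleftrightarrow> X q < y"
  shows "\<exists>m q'. n \<le> m \<and> q' \<in> {1..d} \<and> apex (X q) y = cut q' m \<and> y \<in> C m \<and> nb m (X q) y \<and>
     min (X q) y < cut q' m \<and> cut q' m < max (X q) y \<and>
     cut q' m \<in> C (Suc m) \<and> nb (Suc m) (X q) (cut q' m) \<and> (r \<longleftrightarrow> X q < cut q' m)"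
proof -
  obtain m q' where m: "n \<le> m" "q' \<in> {1..d}" "min (X q) y < cut q' m" "cut q' m < max (X q) y" "nb m (X q) y"
    using gap_is_cut[OF assms(4)] by blast
  have y: "y \<in> C m" "X q \<in> C m" "1 \<le> m"
    using assms(1-3) C_mono[OF m(1)] X_C[of q m] N0 m(1) by auto
  have fm: "fine m lmin" using fineN assms(2) m(1) by simp
  have a: "apex (X q) y = cut q' m"
    using apex_eq[OF fm y(3) m(2,5) y(2,1) m(3,4)] .
  have ox: "ord (X q) < ord y" using nb_ord_neq[OF _ y(2,1) m(5)] assms(2) m(1) X_cuts[OF assms(1)] by simp
  note f = fwd_shape[OF _ m(2,5) y(2,1) ox m(3,4)]
  have "r \<longleftrightarrow> X q < cut q' m"
    using assms(5) m(3,4) by (auto simp: min_def max_def split: if_splits)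
  then show ?thesis using m y a f(12,14) assms(2) by (intro exI[of _ m] exI[of _ q']) auto
qed

lemma sq_live:
  assumes "q \<in> {1..d}"
  shows "\<exists>n\<ge>N0. sq q r i \<in> C n \<and> nb n (X q) (sq q r i) \<and> (r \<longleftrightarrow> X q < sq q r i)"
proof (induction i)
  case 0
  show ?case using nbr[OF assms N0, of r] by (intro exI[of _ N0]) (auto simp: sq_def)
next
  case (Suc i)
  then obtain n where n: "n \<ge> N0" "sq q r i \<in> C n" "nb n (X q) (sq q r i)" "r \<longleftrightarrow> X q < sq q r i" by auto
  obtain m q' where "n \<le> m" "apex (X q) (sq q r i) = cut q' m" "cut q' m \<in> C (Suc m)"
    "nb (Suc m) (X q) (cut q' m)" "r \<longleftrightarrow> X q < cut q' m"
    using next_record[OF assms n] by blast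
  then show ?case using n(1) by (intro exI[of _ "Suc m"]) (auto simp: sq_Suc)
qed

definition mo :: "nat \<Rightarrow> bool \<Rightarrow> nat \<Rightarrow> nat" where "mo q r i = ord (sq q r (Suc i))"
definition En :: "nat \<Rightarrow> bool \<Rightarrow> nat \<Rightarrow> nat" where "En q r i = qof (sq q r i)"
definition U :: "nat \<Rightarrow> bool \<Rightarrow> nat \<Rightarrow> real" where "U q r i = \<bar>sq q r i - X q\<bar>"

lemma sq_step:
  fixes r i
  assumes "q \<in> {1..d}"
  defines "m \<equiv> mo q r i" and "q' \<equiv> En q r (Suc i)"
  shows "N0 \<le> m" "q' \<in> {1..d}" "sq q r (Suc i) = cut q' m" "sq q r i \<in> C m" "nb m (X q) (sq q r i)"
    "min (X q) (sq q r i) < cut q' m" "cut q' m < max (X q) (sq q r i)" "r \<longleftrightarrow> X q < sq q r i"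
    "ord (X q) < ord (sq q r i)" "X q \<in> C m" "sq q r i \<in> cuts"
proof -
  obtain n where n: "n \<ge> N0" "sq q r i \<in> C n" "nb n (X q) (sq q r i)" "r \<longleftrightarrow> X q < sq q r i"
    using sq_live[OF assms(1)] by blast
  obtain m1 q1 where m: "n \<le> m1" "q1 \<in> {1..d}" "apex (X q) (sq q r i) = cut q1 m1" "sq q r i \<in> C m1"
    "nb m1 (X q) (sq q r i)" "min (X q) (sq q r i) < cut q1 m1" "cut q1 m1 < max (X q) (sq q r i)"
    using next_record[OF assms(1) n] by blast
  have eq: "m = m1" "q' = q1"
    using m(2,3) by (auto simp: m_def q'_def mo_def En_def sq_Suc)
  show "N0 \<le> m" "q' \<in> {1..d}" "sq q r (Suc i) = cut q' m" "sq q r i \<in> C m" "nb m (X q) (sq q r i)"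
    "min (X q) (sq q r i) < cut q' m" "cut q' m < max (X q) (sq q r i)" "r \<longleftrightarrow> X q < sq q r i"
    using m n unfolding eq by (auto simp: sq_Suc)
  show x: "X q \<in> C m" using X_C[of q m] assms(1) \<open>N0 \<le> m\<close> N0 by auto
  then show o: "ord (X q) < ord (sq q r i)"
    using nb_ord_neq[OF \<open>N0 \<le> m\<close> x \<open>sq q r i \<in> C m\<close> \<open>nb m (X q) (sq q r i)\<close>] X_cuts[OF assms(1)] by simp
  then show "sq q r i \<in> cuts" using \<open>sq q r i \<in> C m\<close> by (auto simp: C_mem)
qed

text \<open>A neighbour of \<open>X q\<close> that is new at time \<open>Suc n\<close> has to cut
  the previous gap on that side, so it is the \<open>apex\<close> that defines the next record. Thus
  no neighbour after \<open>N0\<close> is missed.\<close>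

lemma sq_hit:
  assumes "q \<in> {1..d}" "N0 \<le> n" "y \<in> C n" "nb n (X q) y" "r \<longleftrightarrow> X q < y"
  shows "\<exists>i. sq q r i = y"
  using assms(2-5)
proof (induction n arbitrary: y rule: dec_induct)
  case base
  then show ?case using nbr_unique[OF assms(1) N0] by (intro exI[of _ 0]) (auto simp: sq_def)
next
  case (step n)
  show ?case
  proof (cases "y \<in> C n")
    case True
    then show ?thesis using step nb_mono[OF step.prems(2), of n] by auto
  next
    case False
    then have "y \<in> (\<lambda>q. cut q n) ` {1..d}" using step.prems(1) C_Suc[of n] by blast
    then obtain q' where q': "q' \<in> {1..d}" "y = cut q' n" by blast
    have n1: "1 \<le> n" using step N0 by simp
    let ?y0 = "nbr q r n"
    note b = nbr[OF assms(1) n1, of r]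
    obtain i where i: "sq q r i = ?y0" using step.IH[OF b] by blast
    have x: "X q \<in> C n" using X_C[of q n] assms(1) n1 by auto
    have y0S: "?y0 \<in> C (Suc n)" using b(1) C_mono[of n "Suc n"] by auto
    have ne: "?y0 \<noteq> y" "X q \<noteq> y" using b(1) x False by auto
    have "\<not> (min (X q) y < ?y0 \<and> ?y0 < max (X q) y)"
      using step.prems(2) y0S unfolding nb_def free_def by (meson not_le)
    moreover have yy: "X q < y \<longleftrightarrow> X q < ?y0" using step.prems(3) b(3) by simp
    moreover have "?y0 \<noteq> X q" using nb_neq[OF b(2)] by simp
    ultimately have "min (X q) ?y0 < y \<and> y < max (X q) ?y0"
      using ne by (cases "X q < y") (simp_all add: min_def max_def)
    then have "apex (X q) ?y0 = y"
      using apex_eq[OF fineN[OF step.hyps(1)] n1 q'(1) b(2) x b(1)] q'(2) by auto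
    then show ?thesis using i by (intro exI[of _ "Suc i"]) (simp add: sq_Suc)
  qed
qed

lemma U_shape:
  fixes r i
  assumes "q \<in> {1..d}"
  defines "t \<equiv> \<lambda>i. \<tau> w (sq q r i)"
  shows "0 < U q r i" "U q r (Suc i) < U q r i"
    "\<bar>(U q r i - U q r (Suc i)) / U q r (Suc i) - gr\<bar> \<le> 8 * e"
    "c \<le> U q r i * t i" "U q r i * t i \<le> (1 + 3 * e) * c" "0 < t i"
    "U q r i - U q r (Suc i) = \<bar>sq q r (Suc i) - sq q r i\<bar>"
proof -
  note s = sq_step[OF assms(1), of r i]
  note f = fwd_shape[OF s(1,2,5,10,4,9,6,7), folded s(3)]
  have x0: "\<tau> w (X q) = 0" using \<tau>_X[OF assms(1)] .
  show "0 < U q r i" "U q r (Suc i) < U q r i" using f(1,10,11) by (auto simp: U_def)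
  show u: "U q r i - U q r (Suc i) = \<bar>sq q r (Suc i) - sq q r i\<bar>" using f(1) by (auto simp: U_def)
  show "\<bar>(U q r i - U q r (Suc i)) / U q r (Suc i) - gr\<bar> \<le> 8 * e" using f(9) u by (simp add: U_def)
  show "U q r i * t i \<le> (1 + 3 * e) * c" using f(8) x0 by (simp add: U_def t_def)
  show "0 < t i" using f(2) x0 by (simp add: t_def)
  show "c \<le> U q r i * t i" using sep_pos(2)[OF w sep c_pos s(1,10,4,5,9)] x0 by (simp add: U_def t_def)
qed

text \<open>Here \<open>u / v\<close> is within \<open>8 * e\<close> of \<open>gr + 1\<close>, hence
  between 2.6 and 2.65; the bounds are convenient fractions.\<close>

lemma gr_ratio:
  assumes "\<bar>(u - v) / v - gr\<bar> \<le> 8 * e" "0 < v"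
  shows "(5 / 2) * v \<le> u" "u \<le> 3 * v" "u / 2 \<le> u - v" "v \<le> (5 / 8) * (u - v)" "u - v \<le> (63 / 100) * u"
proof -
  have "(u - v) / v = u / v - 1" using assms(2) by (simp add: field_simps)
  then have "2.6 \<le> u / v" "u / v \<le> 2.65" using assms(1) gr(2,3) e by (auto simp: abs_le_iff)
  then have "2.6 * v \<le> u" "u \<le> 2.65 * v" using assms(2) by (auto simp: field_simps)
  then show "(5 / 2) * v \<le> u" "u \<le> 3 * v" "u / 2 \<le> u - v" "v \<le> (5 / 8) * (u - v)" "u - v \<le> (63 / 100) * u"
    using assms(2) by auto
qed

lemmas U_ratio = gr_ratio[OF U_shape(3) U_shape(1)]

lemma U_le_power: assumes "q \<in> {1..d}" shows "U q r (i + k) * 2 ^ k \<le> U q r i"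
proof (induction k)
  case (Suc k)
  have "U q r (i + Suc k) * 2 \<le> U q r (i + k)"
    using U_ratio(1)[OF assms assms, of r "i + k"] U_shape(1)[OF assms, of r "i + Suc k"] by simp
  then have "U q r (i + Suc k) * 2 * 2 ^ k \<le> U q r (i + k) * 2 ^ k" by (intro mult_right_mono) auto
  also have "\<dots> \<le> U q r i" using Suc .
  finally show ?case by (simp add: mult.assoc)
qed simp

lemma U_antimono: assumes "q \<in> {1..d}" "i \<le> j" shows "U q r j \<le> U q r i"
  using assms(2)
proof (induction j rule: dec_induct)
  case (step j) then show ?case using U_shape(2)[OF assms(1), of r j] by simp
qed simp

lemma U_eventually_small:
  assumes "0 < \<eta>" shows "\<exists>I. \<forall>q\<in>{1..d}. \<forall>r. \<forall>i\<ge>I. U q r i < \<eta>"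
proof -
  have "\<exists>I. \<forall>i\<ge>I. U q r i < \<eta>" if q: "q \<in> {1..d}" for q r
  proof -
    obtain k where k: "U q r 0 / \<eta> < 2 ^ k" using real_arch_pow[of 2 "U q r 0 / \<eta>"] by auto
    have "U q r i < \<eta>" if "k \<le> i" for i
    proof -
      have "U q r k * 2 ^ k \<le> U q r 0" using U_le_power[OF q, of r 0 k] by simp
      also have "\<dots> < \<eta> * 2 ^ k" using k assms by (simp add: field_simps)
      finally have "U q r k < \<eta>" by simp
      then show ?thesis using U_antimono[OF q that, of r] by linarith
    qed
    then show ?thesis by blast
  qed
  then obtain I where I: "\<And>q r i. q \<in> {1..d} \<Longrightarrow> I q r \<le> i \<Longrightarrow> U q r i < \<eta>" by metis
  define J where "J = Max ((\<lambda>(q, r). I q r) ` ({1..d} \<times> UNIV))"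
  have "I q r \<le> J" if "q \<in> {1..d}" for q r
    unfolding J_def using that by (intro Max_ge) (auto simp: image_iff)
  then show ?thesis using I by (meson order_trans)
qed

lemma U_eventually_late:
  "\<exists>\<eta>>0. \<forall>q\<in>{1..d}. \<forall>r i. U q r i < \<eta> \<longrightarrow> I \<le> i"
proof -
  define \<eta> where "\<eta> = Min ((\<lambda>(q, r). U q r I) ` ({1..d} \<times> UNIV))"
  have ne: "(\<lambda>(q, r). U q r I) ` ({1..d} \<times> (UNIV :: bool set)) \<noteq> {}" using d_pos by auto
  have "\<eta> \<in> (\<lambda>(q, r). U q r I) ` ({1..d} \<times> UNIV)" unfolding \<eta>_def using ne by (intro Min_in) auto
  then have "0 < \<eta>" using U_shape(1) by auto
  moreover have "I \<le> i" if "q \<in> {1..d}" "U q r i < \<eta>" for q r i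
  proof (rule ccontr)
    assume "\<not> I \<le> i"
    then have "U q r I \<le> U q r i" using U_antimono[OF that(1)] by simp
    moreover have "\<eta> \<le> U q r I" unfolding \<eta>_def using that(1) by (intro Min_le) (auto simp: image_iff)
    ultimately show False using that(2) by simp
  qed
  ultimately show ?thesis by blast
qed

text \<open>From this time on all gaps are shorter than every gap at time \<open>N0\<close>, so an
  edge moved to its base still belongs to a time from \<open>N0\<close> on, where the records are
  defined. The bound \<open>c / 10\<close> absorbs additive errors.\<close>

definition N1 :: nat where "N1 = (SOME N. N0 \<le> N \<and> (\<forall>n\<ge>N. fine n (gap_min N0) \<and> fine n (c / 10)))"

lemma N1: "N0 \<le> N1" "N1 \<le> n \<Longrightarrow> fine n (gap_min N0)" "N1 \<le> n \<Longrightarrow> fine n (c / 10)"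
proof -
  obtain A where A: "\<forall>n\<ge>A. fine n (gap_min N0)" using fine_exists[OF gap_min_pos] by blast
  obtain B where B: "\<forall>n\<ge>B. fine n (c / 10)" using fine_exists[of "c / 10"] c_pos by auto
  have "\<exists>N. N0 \<le> N \<and> (\<forall>n\<ge>N. fine n (gap_min N0) \<and> fine n (c / 10))"
    using A B by (intro exI[of _ "Max {N0, A, B}"]) auto
  then have "N0 \<le> N1 \<and> (\<forall>n\<ge>N1. fine n (gap_min N0) \<and> fine n (c / 10))"
    unfolding N1_def by (rule someI_ex)
  then show "N0 \<le> N1" "N1 \<le> n \<Longrightarrow> fine n (gap_min N0)" "N1 \<le> n \<Longrightarrow> fine n (c / 10)" by auto
qed

lemma nb_fine: "nb n a b \<Longrightarrow> fine n x \<Longrightarrow> \<bar>b - a\<bar> < x"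
  by (auto simp: nb_def fine_def min_def max_def abs_if split: if_splits)

text \<open>If moving to the base led to a time before \<open>N0\<close>, both ends would lie in
  \<open>C N0\<close> and be at least \<open>gap_min N0\<close> apart. So the moved edge joins a
  singularity to a neighbour at a time from \<open>N0\<close> on and occurs among the
  records.\<close>

lemma edge_record:
  assumes n: "N1 \<le> n" and g: "a \<in> C n" "b \<in> C n" "nb n a b" "ord a < ord b" "a \<in> cuts"
  defines "r \<equiv> a < b"
  shows "\<exists>i. sq (qof a) r i = (T ^^ ord a) b \<and> U (qof a) r i = \<bar>b - a\<bar> \<and> En (qof a) r i = qof b \<and>
    (\<forall>v. \<tau> v (sq (qof a) r i) = \<tau> v b - \<tau> v a)"
proof -
  let ?b = "(T ^^ ord a) b" and ?m = "n - ord a"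
  note p = push_base[OF g(1-4)]
  have q: "qof a \<in> {1..d}" using cuts_eq[OF g(5)] by simp
  have on: "ord b < n" using g by (auto simp: C_mem)
  have "N0 \<le> ?m"
  proof (rule ccontr)
    assume "\<not> N0 \<le> ?m"
    then have "?b \<in> C N0" "X (qof a) \<in> C N0" using p(3,4) on g(4) X_C[of "qof a" N0] q N0 by (auto simp: C_mem)
    then have "gap_min N0 \<le> \<bar>?b - X (qof a)\<bar>" using gap_min_dist nb_neq[OF p(2)] by auto
    then show False using nb_fine[OF g(3) N1(2)[OF n]] p(1) by simp
  qed
  moreover have "?b \<in> C ?m" using p(3,4) on g(4) by (auto simp: C_mem)
  moreover have "r \<longleftrightarrow> X (qof a) < ?b" using p(1) by (auto simp: r_def)
  ultimately obtain i where "sq (qof a) r i = ?b" using sq_hit[OF q _ _ p(2)] by blast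
  then show ?thesis using p by (intro exI[of _ i]) (auto simp: U_def En_def)
qed

text \<open>The gap and its apex are moved to the base together, by the same number of steps, so the
  new cut point is the record after the one that belongs to the gap.\<close>

lemma apex_record:
  assumes n: "N1 \<le> n" and q: "q \<in> {1..d}" and g: "nb n lo hi" "lo \<in> C n" "hi \<in> C n" "ord lo < ord hi" "lo \<in> cuts"
    and y: "min lo hi < cut q n" "cut q n < max lo hi"
  defines "y \<equiv> cut q n" and "r \<equiv> lo < hi" and "p \<equiv> qof lo"
  shows "\<exists>i. U p r i = \<bar>hi - lo\<bar> \<and> U p r (Suc i) = \<bar>y - lo\<bar> \<and> En p r i = qof hi \<and> En p r (Suc i) = q \<and>
    (\<forall>v. \<tau> v (sq p r i) = \<tau> v hi - \<tau> v lo \<and> \<tau> v (sq p r (Suc i)) = \<tau> v y - \<tau> v lo)"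
proof -
  have n0: "N0 \<le> n" using N1(1) n by simp
  note f = fwd_shape[OF n0 q g(1-4) y, folded y_def]
  have p: "p \<in> {1..d}" using cuts_eq[OF g(5)] by (simp add: p_def)
  obtain i where i: "sq p r i = (T ^^ ord lo) hi" "U p r i = \<bar>hi - lo\<bar>" "En p r i = qof hi"
    "\<And>v. \<tau> v (sq p r i) = \<tau> v hi - \<tau> v lo"
    using edge_record[OF n g(2,3,1,4,5)] unfolding p_def r_def by blast
  have lS: "lo \<in> C (Suc n)" using g(2) C_mono[of n "Suc n"] by auto
  have oy: "ord lo < ord y" using f(16,17) g(4) by simp
  have n1S: "N1 \<le> Suc n" using n by simp
  have r: "r = (lo < y)" using y by (auto simp: r_def y_def min_def max_def split: if_splits)
  note pe = push_base[OF lS f(14,12) oy]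
  let ?y = "(T ^^ ord lo) y" let ?h = "(T ^^ ord lo) hi" let ?m = "n - ord lo"
  note ph = push_base[OF g(2,3,1,4)]
  have "N0 \<le> ?m"
  proof (rule ccontr)
    assume "\<not> N0 \<le> ?m"
    then have "?h \<in> C N0" "X p \<in> C N0" using ph(3,4) f(17) g(4) X_C[of p N0] p N0 by (auto simp: C_mem)
    then have "gap_min N0 \<le> \<bar>?h - X p\<bar>" using gap_min_dist nb_neq[OF ph(2)] by (auto simp: p_def)
    then show False using nb_fine[OF g(1) N1(2)[OF n]] ph(1) by (simp add: p_def)
  qed
  then have fm: "fine ?m lmin" "1 \<le> ?m" using fineN N0 by auto
  have yc: "?y = cut q ?m"
    using cuts_eq(2)[OF pe(3)] pe(4,5) f(16) q by (simp add: y_def)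
  have hC: "?h \<in> C ?m" using ph(3,4) f(17) g(4) by (auto simp: C_mem)
  have xC: "X p \<in> C ?m" using X_C[of p ?m] p fm(2) by auto
  have btw: "min (X p) ?h < ?y \<and> ?y < max (X p) ?h"
    using ph(1) pe(1) y by (auto simp: p_def y_def min_def max_def split: if_splits)
  have "apex (X p) ?h = ?y"
    using apex_eq[OF fm q, of "X p" ?h] ph(2) xC hC btw yc by (simp add: p_def)
  then have s: "sq p r (Suc i) = ?y" using i(1) by (simp add: sq_Suc)
  have "U p r (Suc i) = \<bar>y - lo\<bar>" "En p r (Suc i) = q"
    using s pe(1,5) q by (auto simp: U_def En_def p_def y_def)
  then show ?thesis using i s pe(6) by (intro exI[of _ i]) auto
qed

text \<open>The next record at \<open>X q\<close> divides the current edge. The part beyond it is an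
  edge whose end of smaller order is the old record; moved to its base it becomes a record of the
  singularity \<open>En q r i\<close>, on the opposite side. Both parts end at the same new cut
  point, hence the equal values of \<open>En\<close>.\<close>

lemma partner:
  assumes q: "q \<in> {1..d}" and late: "N1 \<le> mo q r i"
  shows "\<exists>j. U (En q r i) (\<not> r) j = U q r i - U q r (Suc i) \<and> En (En q r i) (\<not> r) j = En q r (Suc i) \<and>
    (\<forall>v. \<tau> v (sq (En q r i) (\<not> r) j) = \<tau> v (sq q r (Suc i)) - \<tau> v (sq q r i))"
proof -
  note s = sq_step[OF q, of r i]
  note f = fwd_shape[OF s(1,2,5,10,4,9,6,7), folded s(3)]
  have hS: "sq q r i \<in> C (Suc (mo q r i))" using s(4) C_mono[of "mo q r i" "Suc (mo q r i)"] by auto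
  have l: "N1 \<le> Suc (mo q r i)" using late by simp
  have "(sq q r i < sq q r (Suc i)) = (\<not> r)"
    using s(3,6,7,8) by (auto simp: min_def max_def split: if_splits)
  moreover have "ord (sq q r i) < ord (sq q r (Suc i))" using f(16,17) by simp
  ultimately obtain j where "U (En q r i) (\<not> r) j = \<bar>sq q r (Suc i) - sq q r i\<bar>"
    "En (En q r i) (\<not> r) j = En q r (Suc i)"
    "\<And>v. \<tau> v (sq (En q r i) (\<not> r) j) = \<tau> v (sq q r (Suc i)) - \<tau> v (sq q r i)"
    using edge_record[OF l hS f(14,13) _ s(11)] unfolding En_def by auto
  then show ?thesis using U_shape(7)[OF q, of r i] by (intro exI[of _ j]) simp
qed

lemma mo_late: "\<exists>I. \<forall>q\<in>{1..d}. \<forall>r. \<forall>i\<ge>I. M \<le> mo q r i"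
proof -
  obtain I where I: "\<And>q r i. q \<in> {1..d} \<Longrightarrow> I \<le> i \<Longrightarrow> U q r i < gap_min (Suc M)"
    using U_eventually_small[OF gap_min_pos] by blast
  have "M \<le> mo q r i" if q: "q \<in> {1..d}" "I \<le> i" for q r i
  proof (rule ccontr)
    assume "\<not> M \<le> mo q r i"
    then have "sq q r i \<in> C (Suc M)" "X q \<in> C (Suc M)"
      using sq_step(4,10)[OF q(1), of r i] C_mono[of "mo q r i" "Suc M"] by auto
    moreover have "sq q r i \<noteq> X q" using U_shape(1)[OF q(1), of r i] by (auto simp: U_def)
    ultimately have "gap_min (Suc M) \<le> U q r i"
      using gap_min_dist[of "X q" "Suc M" "sq q r i"] by (auto simp: U_def)
    then show False using I[OF q, of r] by simp
  qed
  then show ?thesis by blast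
qed

section \<open>Gaps at time \<open>n\<close> have length of order \<open>1 / n\<close>\<close>

lemma edge_ord_le:
  assumes "a \<in> C n" "b \<in> C n" "nb n a b" "ord a < ord b"
  shows "real (ord b) - real (ord a) \<le> 3 * (\<tau> w b - \<tau> w a) + 3"
  using ord_le[OF push_base(3)[OF assms]] push_base(4)[OF assms] push_base(6)[OF assms, of w] assms(4) by simp

lemma gap_lower:
  assumes "N0 \<le> n" "a \<in> C n" "b \<in> C n" "nb n a b"
  shows "c \<le> \<bar>b - a\<bar> * real n"
proof -
  have o: "ord x \<le> n" if "x \<in> C n" for x using that by (auto simp: C_mem)
  have "\<bar>\<tau> w a - \<tau> w b\<bar> \<le> real n"
    using \<tau>_nonneg[OF w, of a] \<tau>_nonneg[OF w, of b] \<tau>_le_ord[OF w, of a] \<tau>_le_ord[OF w, of b] o[OF assms(2)] o[OF assms(3)]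
    by linarith
  then have "\<bar>b - a\<bar> * \<bar>\<tau> w a - \<tau> w b\<bar> \<le> \<bar>b - a\<bar> * real n" by (intro mult_left_mono) auto
  moreover have "c \<le> \<bar>b - a\<bar> * \<bar>\<tau> w a - \<tau> w b\<bar>" using sep assms unfolding sep_def by blast
  ultimately show ?thesis by linarith
qed

text \<open>The triangle is nearly minimal, so the age difference between \<open>hi\<close> and the
  new point is of order \<open>c\<close> divided by the length of the gap; \<open>ord_le\<close>
  turns ages into orders.\<close>

lemma cut_delay:
  assumes "N1 \<le> n" "q \<in> {1..d}" "nb n lo hi" "lo \<in> C n" "hi \<in> C n" "ord lo < ord hi"
    "min lo hi < cut q n" "cut q n < max lo hi"
  shows "\<bar>hi - lo\<bar> * real n \<le> \<bar>hi - lo\<bar> * real (ord hi) + 7 * c"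
    "\<bar>cut q n - lo\<bar> \<le> (63 / 100) * \<bar>hi - lo\<bar>" "\<bar>cut q n - hi\<bar> \<le> (63 / 100) * \<bar>hi - lo\<bar>"
    "\<bar>hi - lo\<bar> \<le> 3 * \<bar>cut q n - lo\<bar>" "\<bar>hi - lo\<bar> \<le> 2 * \<bar>cut q n - hi\<bar>"
proof -
  have n0: "N0 \<le> n" using N1(1) assms(1) by simp
  let ?y = "cut q n" let ?l = "\<bar>hi - lo\<bar>"
  note f = fwd_shape[OF n0 assms(2-8)]
  have "?l - \<bar>?y - lo\<bar> = \<bar>?y - hi\<bar>" using f(1) by linarith
  then have "\<bar>(?l - \<bar>?y - lo\<bar>) / \<bar>?y - lo\<bar> - gr\<bar> \<le> 8 * e" using f(9) by simp
  note g = gr_ratio[OF this f(10)]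
  show r: "\<bar>?y - lo\<bar> \<le> (63 / 100) * ?l" "\<bar>?y - hi\<bar> \<le> (63 / 100) * ?l" "?l \<le> 3 * \<bar>?y - lo\<bar>" "?l \<le> 2 * \<bar>?y - hi\<bar>"
    using g f(1) by linarith+
  have hS: "hi \<in> C (Suc n)" using assms(5) C_mono[of n "Suc n"] by auto
  have "ord hi < ord ?y" using f(16,17) by simp
  note o = edge_ord_le[OF hS f(14,13) this]
  have l: "?l < c / 10" using nb_fine[OF assms(3) N1(3)[OF assms(1)]] .
  have "?l * (real n - real (ord hi)) \<le> ?l * (3 * (\<tau> w ?y - \<tau> w hi) + 3)"
    using o f(16) by (intro mult_left_mono) auto
  also have "\<dots> = 3 * (?l * (\<tau> w ?y - \<tau> w hi)) + 3 * ?l" by (simp add: algebra_simps)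
  also have "?l * (\<tau> w ?y - \<tau> w hi) \<le> (2 * \<bar>?y - hi\<bar>) * (\<tau> w ?y - \<tau> w hi)"
    using r(4) f(3) by (intro mult_right_mono) auto
  also have "\<dots> \<le> 2 * ((1 + 3 * e) * c)" using f(7) by simp
  also have "(1 + 3 * e) * c \<le> (11 / 10) * c" using e c_pos by (intro mult_right_mono) auto
  finally have "?l * (real n - real (ord hi)) \<le> 3 * (2 * ((11 / 10) * c)) + 3 * ?l" by simp
  moreover have "?l * (real n - real (ord hi)) = ?l * real n - ?l * real (ord hi)" by (simp add: algebra_simps)
  \<comment> \<open>\<open>6.6 * c\<close> from the triangle and less than \<open>0.3 * c\<close>
    from \<open>3 * ?l\<close> stay below \<open>7 * c\<close>.\<close>
  ultimately show "?l * real n \<le> ?l * real (ord hi) + 7 * c" using l c_pos by argo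
qed

text \<open>An edge is born with its end of larger order, as one part of an older edge. Induction
  over births: time multiplied by the length of the older edge is at most \<open>12 * c\<close> at
  its birth and grows by at most \<open>7 * c\<close> until it is cut, up to the \<open>N1\<close>
  term. The part has at most \<open>63 / 100\<close> of that length, and
  \<open>19 * 63 / 100 < 12\<close> closes the induction.\<close>

lemma gap_birth:
  assumes "N1 \<le> n" "a \<in> C n" "b \<in> C n" "nb n a b"
  shows "\<bar>b - a\<bar> * real (max (ord a) (ord b)) \<le> 12 * c + real N1 * \<bar>b - a\<bar>"
  using assms
proof (induction "max (ord a) (ord b)" arbitrary: a b n rule: less_induct)
  case less
  let ?B = "max (ord a) (ord b)"
  have ne: "ord a \<noteq> ord b" using nb_ord_neq less.prems N1(1) by (metis order_trans)
  define lo hi where "lo = (if ord a < ord b then a else b)" and "hi = (if ord a < ord b then b else a)"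
  have lh: "lo \<in> C n" "hi \<in> C n" "nb n lo hi" "ord lo < ord hi" "ord hi = ?B" "\<bar>b - a\<bar> = \<bar>hi - lo\<bar>"
    using less.prems ne nb_sym[of n a b] by (auto simp: lo_def hi_def)
  show ?case
  proof (cases "?B < N1")
    case True
    then have "\<bar>b - a\<bar> * real ?B \<le> \<bar>b - a\<bar> * real N1" by (intro mult_left_mono) auto
    then show ?thesis using c_pos by (simp add: mult.commute)
  next
    case False
    then have B: "N1 \<le> ?B" by (simp only: not_less)
    then have B1: "1 \<le> ?B" "N0 \<le> ?B" using N0 N1(1) by auto
    have hc: "hi \<in> cuts" "?B < n" using lh by (auto simp: C_mem)
    then have q: "qof hi \<in> {1..d}" "hi = cut (qof hi) ?B" using cuts_eq[OF hc(1)] lh(5) by auto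
    have lB: "lo \<in> C ?B" using lh by (auto simp: C_mem)
    have nbB: "nb ?B lo hi" using nb_mono[OF lh(3)] hc(2) by simp
    note f = fwd_nb[OF fineN[OF B1(2)] q(1) B1(1), folded q(2)]
    define o' where "o' = (if lo < hi then sc ?B hi else pr ?B hi)"
    have lo_eq: "lo = (if lo < hi then pr ?B hi else sc ?B hi)"
    proof -
      have hr: "0 < hi" "hi < \<Lambda>" using cuts_range[OF hc(1)] by auto
      have no: "x \<in> C ?B \<Longrightarrow> \<not> (min lo hi < x \<and> x < max lo hi)" for x
        using nbB unfolding nb_def free_def by (meson not_le)
      have "lo \<noteq> hi" using nb_neq lh(3) by metis
      moreover have "lo \<le> pr ?B hi" if "lo < hi"
        using below(3)[OF C_finite C_ends(1) hr(1) lB that] .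
      moreover have "sc ?B hi \<le> lo" if "hi < lo"
        using above(3)[OF C_finite C_ends(2) hr(2) lB that] .
      ultimately show ?thesis using no[OF f(3)] no[OF f(4)] f(1,2) by (auto simp: min_def max_def split: if_splits)
    qed
    have ol: "o' \<in> C ?B" "nb ?B lo o'" "min lo o' < hi" "hi < max lo o'" "ord o' < ?B" "ord lo < ?B"
      using lo_eq f lh(4,5) nb_sym by (auto simp: o'_def min_def max_def split: if_splits)
    have no: "ord lo \<noteq> ord o'" using nb_ord_neq[OF B1(2) lB ol(1,2)] .
    define l1 h1 where "l1 = (if ord lo < ord o' then lo else o')" and "h1 = (if ord lo < ord o' then o' else lo)"
    have h1: "l1 \<in> C ?B" "h1 \<in> C ?B" "nb ?B l1 h1" "ord l1 < ord h1" "min l1 h1 < hi" "hi < max l1 h1"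
      "ord h1 = max (ord lo) (ord o')" "\<bar>o' - lo\<bar> = \<bar>h1 - l1\<bar>" "lo = l1 \<or> lo = h1"
      using ol lB no nb_sym[of ?B lo o'] by (auto simp: l1_def h1_def min.commute max.commute)
    note cd = cut_delay[OF B q(1) h1(3,1,2,4), folded q(2), OF h1(5,6)]
    let ?l = "\<bar>hi - lo\<bar>" let ?L = "\<bar>h1 - l1\<bar>"
    have "?L * real (ord h1) \<le> 12 * c + real N1 * ?L"
      using less.hyps[OF _ B lB ol(1,2)] ol(5,6) h1(7,8) by simp
    then have A: "?L * real ?B \<le> 19 * c + real N1 * ?L" using cd(1) by simp
    have r: "?l \<le> (63 / 100) * ?L" using cd(2,3) h1(9) by metis
    have l0: "0 < ?L" using nb_neq[OF h1(3)] by auto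
    define \<rho> where "\<rho> = ?l / ?L"
    have \<rho>: "0 \<le> \<rho>" "\<rho> \<le> 63 / 100" "?l = \<rho> * ?L" using l0 r by (auto simp: \<rho>_def field_simps)
    have "?l * real ?B = \<rho> * (?L * real ?B)" using \<rho>(3) by simp
    also have "\<dots> \<le> \<rho> * (19 * c + real N1 * ?L)" using A \<rho>(1) by (rule mult_left_mono)
    also have "\<dots> = \<rho> * (19 * c) + real N1 * ?l" using \<rho>(3) by (simp add: algebra_simps)
    also have "\<rho> * (19 * c) \<le> (63 / 100) * (19 * c)" using \<rho>(2) c_pos by (intro mult_right_mono) auto
    finally show ?thesis using lh(6) c_pos by simp
  qed
qed

text \<open>A gap present at time \<open>n\<close> is cut at some time at least \<open>n\<close>,
  and, measured as time times length, this happens within \<open>7 * c\<close> of its birth.\<close>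

lemma gap_upper:
  assumes "N1 \<le> n" "a \<in> C n" "b \<in> C n" "nb n a b"
  shows "\<bar>b - a\<bar> * real n \<le> 19 * c + real N1 * \<bar>b - a\<bar>"
proof -
  obtain m q where m: "n \<le> m" "q \<in> {1..d}" "min a b < cut q m" "cut q m < max a b" "nb m a b"
    using gap_is_cut[OF assms(4)] by blast
  have ab: "a \<in> C m" "b \<in> C m" "N1 \<le> m" using assms m(1) C_mono[OF m(1)] by auto
  have ne: "ord a \<noteq> ord b" using nb_ord_neq ab m(5) N1(1) by (metis order_trans)
  have "\<bar>b - a\<bar> * real m \<le> \<bar>b - a\<bar> * real (max (ord a) (ord b)) + 7 * c"
  proof (cases "ord a < ord b")
    case True
    then show ?thesis using cut_delay(1)[OF ab(3) m(2,5) ab(1,2) True m(3,4)] by simp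
  next
    case False
    then have "ord b < ord a" using ne by simp
    then show ?thesis
      using cut_delay(1)[OF ab(3) m(2) _ ab(2,1), of] m(3-5) nb_sym[of m a b]
      by (simp add: min.commute max.commute abs_minus_commute)
  qed
  also have "\<dots> \<le> 19 * c + real N1 * \<bar>b - a\<bar>" using gap_birth[OF ab(3,1,2) m(5)] by simp
  finally have "\<bar>b - a\<bar> * real m \<le> 19 * c + real N1 * \<bar>b - a\<bar>" .
  moreover have "\<bar>b - a\<bar> * real n \<le> \<bar>b - a\<bar> * real m" using m(1) by (intro mult_left_mono) auto
  ultimately show ?thesis by linarith
qed

text \<open>Records exist only at singularities, but the end \<open>lo\<close> may be
  \<open>0\<close> or \<open>\<Lambda>\<close>. In that case the whole triangle is pulled back one
  step to the singularity whose image, or limit of images from the left, is that end; the ages of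
  \<open>hi\<close> and of the apex then grow by the same \<open>k\<close>, the weight of one
  step.\<close>

lemma fwd_lift:
  assumes n: "N1 \<le> n" and q: "q \<in> {1..d}"
  defines "y \<equiv> cut q n"
  shows "\<exists>lo hi p i. (lo = pr n y \<and> hi = sc n y \<or> lo = sc n y \<and> hi = pr n y) \<and> ord lo < ord hi \<and> nb n lo hi \<and>
    lo \<in> C n \<and> hi \<in> C n \<and> p \<in> {1..d} \<and>
    U p (lo < hi) i = \<bar>hi - lo\<bar> \<and> U p (lo < hi) (Suc i) = \<bar>y - lo\<bar> \<and> En p (lo < hi) (Suc i) = q \<and>
    (\<forall>v. \<exists>k. (weight v \<longrightarrow> 0 \<le> k \<and> k \<le> 1) \<and> \<tau> v (sq p (lo < hi) i) = \<tau> v hi - \<tau> v lo + k \<and>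
       \<tau> v (sq p (lo < hi) (Suc i)) = \<tau> v y - \<tau> v lo + k)"
proof -
  have n0: "N0 \<le> n" "1 \<le> n" using n N1(1) N0 by auto
  note f = fwd_nb[OF fineN[OF n0(1)] q n0(2), folded y_def]
  have ne: "ord (pr n y) \<noteq> ord (sc n y)" using nb_ord_neq[OF n0(1) f(3,4,7)] .
  define lo hi where "lo = (if ord (pr n y) < ord (sc n y) then pr n y else sc n y)"
    and "hi = (if ord (pr n y) < ord (sc n y) then sc n y else pr n y)"
  have lh: "lo = pr n y \<and> hi = sc n y \<or> lo = sc n y \<and> hi = pr n y" "ord lo < ord hi" "nb n lo hi"
    "lo \<in> C n" "hi \<in> C n" "min lo hi < y" "y < max lo hi"
    using f ne nb_sym[of n "pr n y" "sc n y"] by (auto simp: lo_def hi_def)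
  have small: "\<bar>hi - lo\<bar> < lmin" using nb_fine[OF lh(3) fineN[OF n0(1)]] .
  have yc: "y \<in> cuts" using q by (simp add: y_def)
  have "\<exists>p i. p \<in> {1..d} \<and>
    U p (lo < hi) i = \<bar>hi - lo\<bar> \<and> U p (lo < hi) (Suc i) = \<bar>y - lo\<bar> \<and> En p (lo < hi) (Suc i) = q \<and>
    (\<forall>v. \<exists>k. (weight v \<longrightarrow> 0 \<le> k \<and> k \<le> 1) \<and> \<tau> v (sq p (lo < hi) i) = \<tau> v hi - \<tau> v lo + k \<and>
       \<tau> v (sq p (lo < hi) (Suc i)) = \<tau> v y - \<tau> v lo + k)"
  proof (cases "lo \<in> cuts")
    case True
    obtain i where i: "U (qof lo) (lo < hi) i = \<bar>hi - lo\<bar>" "U (qof lo) (lo < hi) (Suc i) = \<bar>y - lo\<bar>"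
      "En (qof lo) (lo < hi) (Suc i) = q"
      "\<And>v. \<tau> v (sq (qof lo) (lo < hi) i) = \<tau> v hi - \<tau> v lo"
      "\<And>v. \<tau> v (sq (qof lo) (lo < hi) (Suc i)) = \<tau> v y - \<tau> v lo"
      using apex_record[OF n q lh(3-5,2) True, folded y_def, OF lh(6,7)] by blast
    show ?thesis
    proof (rule exI[of _ "qof lo"], rule exI[of _ i], intro conjI allI)
      show "\<exists>k. (weight v \<longrightarrow> 0 \<le> k \<and> k \<le> 1) \<and> \<tau> v (sq (qof lo) (lo < hi) i) = \<tau> v hi - \<tau> v lo + k \<and>
       \<tau> v (sq (qof lo) (lo < hi) (Suc i)) = \<tau> v y - \<tau> v lo + k" for v
        by (intro exI[of _ 0]) (simp add: i)
    qed (use i cuts_eq(1)[OF True] in simp_all)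
  next
    case False
    have lift: "\<exists>p i. p \<in> {1..d} \<and>
      U p (lo < hi) i = \<bar>hi - lo\<bar> \<and> U p (lo < hi) (Suc i) = \<bar>y - lo\<bar> \<and> En p (lo < hi) (Suc i) = q \<and>
      (\<forall>v. \<exists>k. (weight v \<longrightarrow> 0 \<le> k \<and> k \<le> 1) \<and> \<tau> v (sq p (lo < hi) i) = \<tau> v hi - \<tau> v lo + k \<and>
         \<tau> v (sq p (lo < hi) (Suc i)) = \<tau> v y - \<tau> v lo + k)"
      if b: "x \<in> {1..d}" "hi' \<in> cuts" "ord hi' = Suc (ord hi)" "nb (Suc n) (X x) hi'" "hi' - X x = hi - lo"
        and y': "y' \<in> cuts" "ord y' = Suc n" "qof y' = q" "y' - X x = y - lo"
        and t: "\<And>v. \<tau> v hi' = v j + \<tau> v hi" "\<And>v. \<tau> v y' = v j + \<tau> v y" for x hi' y' j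
    proof -
      have yc: "y' = cut q (Suc n)" using cuts_eq(2)[OF y'(1)] y'(2,3) by simp
      have xx: "X x \<in> C (Suc n)" "ord (X x) = 0" "X x \<in> cuts" "qof (X x) = x" using X_cuts[OF b(1)] by (auto simp: C_mem)
      have hC: "hi' \<in> C (Suc n)" using b(2,3) lh(2,5) by (auto simp: C_mem)
      have o: "ord (X x) < ord hi'" using xx b(3) by simp
      have m: "min (X x) hi' < cut q (Suc n)" "cut q (Suc n) < max (X x) hi'"
        using lh(6,7) b(5) y'(4) yc by (auto simp: min_def max_def split: if_splits)
      have s: "(X x < hi') = (lo < hi)" using b(5) by auto
      have "lo = 0 \<or> lo = \<Lambda>" using False lh(4) by (auto simp: C_mem)
      then have l0: "\<tau> v lo = 0" for v by auto
      have nS: "N1 \<le> Suc n" using n by simp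
      obtain i where i: "U x (lo < hi) i = \<bar>hi' - X x\<bar>" "U x (lo < hi) (Suc i) = \<bar>y' - X x\<bar>" "En x (lo < hi) (Suc i) = q"
        "\<And>v. \<tau> v (sq x (lo < hi) i) = \<tau> v hi' - \<tau> v (X x)" "\<And>v. \<tau> v (sq x (lo < hi) (Suc i)) = \<tau> v y' - \<tau> v (X x)"
        using apex_record[OF nS q b(4) xx(1) hC o xx(3) m] unfolding xx(4) s yc by blast
      show ?thesis
        by (intro exI[of _ x] exI[of _ i]) (use i b y'(4) t l0 \<tau>_X[OF b(1)] weightD in auto)
    qed
    consider "lo = 0" | "lo = \<Lambda>" using False lh(4) by (auto simp: C_mem)
    then show ?thesis
    proof cases
      case 1
      obtain j where j: "j \<in> {1..Suc d}" "\<pi> j = 1" using \<pi>_surj[of 1] by auto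
      then have j1: "j - 1 \<in> {1..d}" using \<pi>_first by (cases "j = 1") auto
      have hp: "0 < hi" using lh(5) C_range[OF lh(5)] nb_neq[OF lh(3)] 1 by auto
      then have fr: "free n (Y (\<pi> j - 1)) hi" using lh(3) 1 j by (simp add: nb_def)
      have sm: "hi - Y (\<pi> j - 1) < lmin" using small 1 j hp by simp
      note pu = pull_right[OF j(1) lh(5) fr sm]
      let ?h = "hi - Y (\<pi> j - 1) + X (j - 1)" let ?y = "y + X (j - 1)"
      have yr: "X (j - 1) \<le> ?y" "?y < X j" using lh(6,7) 1 hp pu(7) j by auto
      have Ty: "T ?y = y" using T_eq[OF j(1) yr] j by simp
      have "0 \<le> X (j - 1)" "X j \<le> \<Lambda>" using X_range[of "j - 1"] X_range[of j] j(1) by auto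
      then have yD: "?y \<in> D" using yr by auto
      have c: "?y \<in> cuts" "ord ?y = Suc n" "qof ?y = q"
        using T_pow_cuts_conv[OF yD, of 1] Ty yc f(10) q by (auto simp: y_def)
      show ?thesis
      proof (rule lift[of "j - 1" ?h ?y j])
        show "nb (Suc n) (X (j - 1)) ?h" using nb_free(1)[OF pu(5)] .
        show "\<tau> v ?y = v j + \<tau> v y" for v
          using \<tau>_split[OF c(1), of 1 v] c(2) Ty idx_eq[OF j(1) yr] by simp
      qed (use pu j j1 c 1 in auto)
    next
      case 2
      obtain j where j: "j \<in> {1..Suc d}" "\<pi> j = Suc d" using \<pi>_surj[of "Suc d"] by auto
      then have j1: "j \<in> {1..d}" using \<pi>_last by (cases "j = Suc d") auto
      have hp: "hi < \<Lambda>" using lh(5) C_range[OF lh(5)] nb_neq[OF lh(3)] 2 by auto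
      then have fr: "free n hi (Y (\<pi> j))" using lh(3) 2 j by (simp add: nb_def Y_top)
      have sm: "Y (\<pi> j) - hi < lmin" using small 2 j hp by (simp add: Y_top)
      note pu = pull_left[OF j(1) lh(5) fr sm]
      let ?h = "hi - Y (\<pi> j) + X j" let ?y = "y - Y (\<pi> j) + X j"
      have len: "X j - Y (\<pi> j) = X (j - 1) - Y (\<pi> j - 1)" using Y_step[OF j(1)] X_Suc[of "j - 1"] j by simp
      have yr: "X (j - 1) \<le> ?y" "?y < X j" using lh(6,7) 2 hp pu(7) j by (auto simp: Y_top)
      have Ty: "T ?y = y" using T_eq[OF j(1) yr] len by simp
      have "0 \<le> X (j - 1)" "X j \<le> \<Lambda>" using X_range[of "j - 1"] X_range[of j] j(1) by auto
      then have yD: "?y \<in> D" using yr by auto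
      have c: "?y \<in> cuts" "ord ?y = Suc n" "qof ?y = q"
        using T_pow_cuts_conv[OF yD, of 1] Ty yc f(10) q by (auto simp: y_def)
      show ?thesis
      proof (rule lift[of j ?h ?y j])
        show "nb (Suc n) (X j) ?h" using nb_free(2)[OF pu(5)] .
        show "\<tau> v ?y = v j + \<tau> v y" for v
          using \<tau>_split[OF c(1), of 1 v] c(2) Ty idx_eq[OF j(1) yr] by simp
      qed (use pu j j1 c 2 in \<open>auto simp: Y_top\<close>)
    qed
  qed
  then show ?thesis using lh by blast
qed

text \<open>One pull leads from \<open>Y s\<close> to \<open>X j\<close>. If \<open>X j\<close> is
  the end \<open>\<Lambda>\<close>, a second pull leads on to a singularity, because the last
  interval does not stay last. At most two steps are added, hence the \<open>2\<close>.\<close>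

lemma bwd_lift_left:
  assumes n: "N1 \<le> n" and s: "s \<in> {1..d}"
  defines "a \<equiv> pr n (Y s)"
  shows "\<exists>q\<in>{1..d}. \<exists>i. U q False i = Y s - a \<and>
    (\<forall>v. weight v \<longrightarrow> \<tau> v a \<le> \<tau> v (sq q False i) \<and> \<tau> v (sq q False i) \<le> \<tau> v a + 2)"
proof -
  have n0: "N0 \<le> n" using n N1(1) by simp
  note f = bwd_nb[OF fineN[OF n0] s, folded a_def]
  obtain j where j: "j \<in> {1..Suc d}" "\<pi> j = s" using \<pi>_surj[of s] s by auto
  have fr: "free n a (Y (\<pi> j))" and sm: "Y (\<pi> j) - a < lmin" using f j by auto
  note pl = pull_left[OF j(1) f(3) fr sm]
  let ?a = "a - Y (\<pi> j) + X j"
  have aC: "?a \<in> C (Suc n)" using pl(1,3,8) f(3) by (auto simp: C_mem)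
  show ?thesis
  proof (cases "j = Suc d")
    case False
    then have j1: "j \<in> {1..d}" using j by auto
    have ax: "?a < X j" using f(1) j by simp
    obtain i where i: "sq j False i = ?a"
      using sq_hit[OF j1, of "Suc n" ?a False] n0 aC nb_free(2)[OF pl(5)] ax by auto
    have "\<tau> v a \<le> \<tau> v ?a \<and> \<tau> v ?a \<le> \<tau> v a + 2" if "weight v" for v
      using pl(6)[of v] weightD[OF that, of j] by auto
    then show ?thesis using j1 j f(1) i by (intro bexI[of _ j] exI[of _ i]) (auto simp: U_def)
  next
    case True
    obtain j2 where j2: "j2 \<in> {1..Suc d}" "\<pi> j2 = Suc d" using \<pi>_surj[of "Suc d"] by auto
    then have j1: "j2 \<in> {1..d}" using \<pi>_last by (cases "j2 = Suc d") auto
    have top: "Y (\<pi> j2) = X j" using j2 True by (simp add: Y_top X_top)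
    have fr2: "free (Suc n) ?a (Y (\<pi> j2))" and sm2: "Y (\<pi> j2) - ?a < lmin" using pl(5) sm top by auto
    note p2 = pull_left[OF j2(1) aC fr2 sm2]
    let ?b = "?a - Y (\<pi> j2) + X j2"
    have bC: "?b \<in> C (Suc (Suc n))" using p2(1,3) pl(1) aC by (auto simp: C_mem)
    have ax: "?b < X j2" using f(1) j top by simp
    obtain i where i: "sq j2 False i = ?b"
      using sq_hit[OF j1, of "Suc (Suc n)" ?b False] n0 bC nb_free(2)[OF p2(5)] ax by auto
    have "\<tau> v a \<le> \<tau> v ?b \<and> \<tau> v ?b \<le> \<tau> v a + 2" if "weight v" for v
      using pl(6)[of v] p2(6)[of v] weightD[OF that, of j] weightD[OF that, of j2] by auto
    then show ?thesis using j1 i top j f(1) by (intro bexI[of _ j2] exI[of _ i]) (auto simp: U_def)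
  qed
qed

lemma bwd_lift_right:
  assumes n: "N1 \<le> n" and s: "s \<in> {1..d}"
  defines "b \<equiv> sc n (Y s)"
  shows "\<exists>q\<in>{1..d}. \<exists>i. U q True i = b - Y s \<and>
    (\<forall>v. weight v \<longrightarrow> \<tau> v b \<le> \<tau> v (sq q True i) \<and> \<tau> v (sq q True i) \<le> \<tau> v b + 2)"
proof -
  have n0: "N0 \<le> n" using n N1(1) by simp
  note f = bwd_nb[OF fineN[OF n0] s, folded b_def]
  obtain j where j: "j \<in> {1..Suc d}" "\<pi> j = Suc s" using \<pi>_surj[of "Suc s"] s by auto
  have fr: "free n (Y (\<pi> j - 1)) b" and sm: "b - Y (\<pi> j - 1) < lmin" using f j by auto
  note pl = pull_right[OF j(1) f(4) fr sm]
  let ?a = "b - Y (\<pi> j - 1) + X (j - 1)"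
  have aC: "?a \<in> C (Suc n)" using pl(1,3,8) f(4) by (auto simp: C_mem)
  show ?thesis
  proof (cases "j = 1")
    case False
    then have j1: "j - 1 \<in> {1..d}" using j by auto
    have ax: "X (j - 1) < ?a" using f(2) j by simp
    obtain i where i: "sq (j - 1) True i = ?a"
      using sq_hit[OF j1, of "Suc n" ?a True] n0 aC nb_free(1)[OF pl(5)] ax by auto
    have "\<tau> v b \<le> \<tau> v ?a \<and> \<tau> v ?a \<le> \<tau> v b + 2" if "weight v" for v
      using pl(6)[of v] weightD[OF that, of j] by auto
    then show ?thesis using j1 j f(2) i by (intro bexI[of _ "j - 1"] exI[of _ i]) (auto simp: U_def)
  next
    case True
    obtain j2 where j2: "j2 \<in> {1..Suc d}" "\<pi> j2 = 1" using \<pi>_surj[of 1] by auto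
    then have j1: "j2 - 1 \<in> {1..d}" using \<pi>_first by (cases "j2 = 1") auto
    have top: "Y (\<pi> j2 - 1) = X (j - 1)" using j2 True by simp
    have fr2: "free (Suc n) (Y (\<pi> j2 - 1)) ?a" and sm2: "?a - Y (\<pi> j2 - 1) < lmin" using pl(5) sm top by auto
    note p2 = pull_right[OF j2(1) aC fr2 sm2]
    let ?b = "?a - Y (\<pi> j2 - 1) + X (j2 - 1)"
    have bC: "?b \<in> C (Suc (Suc n))" using p2(1,3) pl(1) aC by (auto simp: C_mem)
    have ax: "X (j2 - 1) < ?b" using f(2) j top by simp
    obtain i where i: "sq (j2 - 1) True i = ?b"
      using sq_hit[OF j1, of "Suc (Suc n)" ?b True] n0 bC nb_free(1)[OF p2(5)] ax by auto
    have "\<tau> v b \<le> \<tau> v ?b \<and> \<tau> v ?b \<le> \<tau> v b + 2" if "weight v" for v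
      using pl(6)[of v] p2(6)[of v] weightD[OF that, of j] weightD[OF that, of j2] by auto
    then show ?thesis using j1 i top j f(2) by (intro bexI[of _ "j2 - 1"] exI[of _ i]) (auto simp: U_def)
  qed
qed

end

context keane_iet
begin

text \<open>Going right from a singularity in \<open>S\<close> towards one outside, the first cut
  point whose singularity is outside \<open>S\<close> has a left neighbour whose singularity is in
  \<open>S\<close>. Links of this kind connect all singularities.\<close>

lemma class_link:
  assumes "1 \<le> n" "q0 \<in> S" "q0 \<in> {1..d}" "q1 \<notin> S" "q1 \<in> {1..d}"
  shows "\<exists>a\<in>cuts. \<exists>b\<in>cuts. a \<in> C n \<and> b \<in> C n \<and> nb n a b \<and> qof a \<in> S \<and> qof b \<notin> S"
proof -
  have *: "\<exists>a\<in>cuts. \<exists>b\<in>cuts. a \<in> C n \<and> b \<in> C n \<and> nb n a b \<and> qof a \<in> S \<and> qof b \<notin> S"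
    if "q0 \<in> S" "q0 \<in> {1..d}" "q1 \<notin> S" "q1 \<in> {1..d}" "X q0 < X q1" for S q0 q1
  proof -
    let ?G = "{y \<in> C n. y \<in> cuts \<and> X q0 < y \<and> qof y \<notin> S}"
    have x: "X q0 \<in> C n" "X q1 \<in> C n" using X_C[of q0 n] X_C[of q1 n] that assms(1) by auto
    have "X q1 \<in> ?G" using x that X_cuts[of q1] by auto
    then have b: "Min ?G \<in> ?G" by (intro Min_in) (simp, blast)
    define b where "b = Min ?G"
    have bG: "b \<in> C n" "b \<in> cuts" "X q0 < b" "qof b \<notin> S" using b by (auto simp: b_def)
    note p = below[OF C_finite[of n] C_ends(1), of b]
    have b0: "0 < b" "b < \<Lambda>" using cuts_range[OF bG(2)] by auto
    let ?a = "pr n b"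
    have a: "?a \<in> C n" "?a < b" "X q0 \<le> ?a" using p(1,2)[OF b0(1)] p(3)[OF b0(1) x(1) bG(3)] by auto
    then have ac: "?a \<in> cuts" using b0 X_interior[OF that(2)] by (auto simp: C_mem)
    have "qof ?a \<in> S"
    proof (cases "?a = X q0")
      case True then show ?thesis using X_cuts[OF that(2)] that(1) by simp
    next
      case False
      show ?thesis
      proof (rule ccontr)
        assume "qof ?a \<notin> S"
        then have "?a \<in> ?G" using a ac False by auto
        then have "b \<le> ?a" unfolding b_def by (intro Min_le) auto
        then show False using a(2) by simp
      qed
    qed
    moreover have "free n ?a b"
      using a(2) p(3)[OF b0(1)] C_range[OF a(1)] C_range[OF bG(1)] unfolding free_def by (meson not_le)
    ultimately show ?thesis using a ac bG nb_free by blast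
  qed
  have "q0 \<noteq> q1" using assms by auto
  then have "X q0 \<noteq> X q1" using X_inj[of q0 q1] assms by auto
  then consider "X q0 < X q1" | "X q1 < X q0" by linarith
  then show ?thesis
  proof cases
    case 1 then show ?thesis using *[of q0 S q1] assms by blast
  next
    case 2
    then obtain a b where "a \<in> cuts" "b \<in> cuts" "a \<in> C n" "b \<in> C n" "nb n a b" "qof a \<in> - S" "qof b \<notin> - S"
      using *[of q1 "- S" q0] assms by blast
    then show ?thesis using nb_sym by blast
  qed
qed

end

context nearly_golden
begin

text \<open>Edges of the graph at time \<open>n\<close> have length of order \<open>1/n\<close>.\<close>

definition near :: "nat \<Rightarrow> real \<Rightarrow> bool" where
  "near n u \<longleftrightarrow> c \<le> 10 * (real n * u) \<and> real n * u \<le> 40 * c"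

lemma En_range: "q \<in> {1..d} \<Longrightarrow> En q r i \<in> {1..d}"
  using sq_step(11)[of q r i] cuts_eq(1) by (simp add: En_def)

lemma near_index_late: "\<exists>M. \<forall>n\<ge>M. \<forall>q\<in>{1..d}. \<forall>r i. near n (U q r i) \<longrightarrow> I \<le> i"
proof -
  obtain \<eta> where \<eta>: "\<eta> > 0" "\<And>q r i. q \<in> {1..d} \<Longrightarrow> U q r i < \<eta> \<Longrightarrow> I \<le> i"
    using U_eventually_late[of I] by blast
  obtain M :: nat where M: "40 * c / \<eta> < real M" using reals_Archimedean2 by blast
  have "I \<le> i" if n: "M \<le> n" "q \<in> {1..d}" "near n (U q r i)" for n q r i
  proof -
    have "40 * c / \<eta> < real n" using M n by simp
    then have *: "40 * c < real n * \<eta>" using \<eta>(1) by (simp add: field_simps)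
    have "real n * U q r i \<le> 40 * c" using n(3) by (simp add: near_def)
    then have "real n * U q r i < real n * \<eta>" using * by linarith
    then have "U q r i < \<eta>" using mult_less_cancel_left_pos[of "real n" "U q r i" \<eta>]
      by (cases "n = 0") auto
    then show ?thesis using \<eta>(2) n(2) by blast
  qed
  then show ?thesis by blast
qed

lemma near_gaps:
  "\<exists>M\<ge>N1. \<forall>n\<ge>M. \<forall>a\<in>C n. \<forall>b\<in>C n. nb n a b \<longrightarrow> c \<le> real n * \<bar>b - a\<bar> \<and> real n * \<bar>b - a\<bar> \<le> 20 * c"
proof -
  have "0 < c / (real N1 + 1)" using c_pos by simp
  then obtain M where M: "\<forall>n\<ge>M. fine n (c / (real N1 + 1))" using fine_exists by blast
  have "c \<le> real n * \<bar>b - a\<bar> \<and> real n * \<bar>b - a\<bar> \<le> 20 * c"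
    if n: "max M N1 \<le> n" and ab: "a \<in> C n" "b \<in> C n" "nb n a b" for n a b
  proof -
    have "N0 \<le> n" "N1 \<le> n" using n N1(1) by auto
    have "\<bar>b - a\<bar> < c / (real N1 + 1)" using nb_fine[OF ab(3)] M n by auto
    then have "real N1 * \<bar>b - a\<bar> + \<bar>b - a\<bar> < c" by (simp add: field_simps)
    then have "real N1 * \<bar>b - a\<bar> < c" by linarith
    then show ?thesis
      using gap_lower[OF \<open>N0 \<le> n\<close> ab] gap_upper[OF \<open>N1 \<le> n\<close> ab] by (simp add: mult.commute)
  qed
  then show ?thesis by (intro exI[of _ "max M N1"]) auto
qed

text \<open>A quantity on the edges that varies little from an edge to the two edges into which it is cut
  is almost constant on all edges of a given scale, because neighbouring cut points are
  joined by edges of that scale.\<close>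

lemma propagation:
  fixes val :: "nat \<Rightarrow> bool \<Rightarrow> nat \<Rightarrow> 'm :: metric_space"
  assumes A1: "\<And>q r i. q \<in> {1..d} \<Longrightarrow> I0 \<le> i \<Longrightarrow> dist (val q r i) (val q r (Suc i)) \<le> \<kappa>"
    and A2: "\<And>q r i j. q \<in> {1..d} \<Longrightarrow> I0 \<le> i \<Longrightarrow> U (En q r i) (\<not> r) j = U q r i - U q r (Suc i) \<Longrightarrow>
        dist (val q r i) (val (En q r i) (\<not> r) j) \<le> \<kappa>"
    and \<kappa>: "0 \<le> \<kappa>"
  shows "\<exists>M. \<forall>n\<ge>M. \<forall>q\<in>{1..d}. \<forall>q'\<in>{1..d}. \<forall>r r' i i'. near n (U q r i) \<longrightarrow> near n (U q' r' i') \<longrightarrow>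
    dist (val q r i) (val q' r' i') \<le> 50 * real d * \<kappa>"
proof -
  obtain I1 where I1: "\<And>q r i. q \<in> {1..d} \<Longrightarrow> I1 \<le> i \<Longrightarrow> N1 \<le> mo q r i" using mo_late[of N1] by blast
  obtain M1 where M1: "\<And>n q r i. M1 \<le> n \<Longrightarrow> q \<in> {1..d} \<Longrightarrow> near n (U q r i) \<Longrightarrow> max I0 I1 \<le> i"
    using near_index_late[of "max I0 I1"] by blast
  obtain M2 where M2: "N1 \<le> M2" "\<And>n a b. M2 \<le> n \<Longrightarrow> a \<in> C n \<Longrightarrow> b \<in> C n \<Longrightarrow> nb n a b \<Longrightarrow>
      c \<le> real n * \<bar>b - a\<bar> \<and> real n * \<bar>b - a\<bar> \<le> 20 * c"
    using near_gaps by blast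
  have main: "dist (val q r i) (val q' r' i') \<le> 50 * real d * \<kappa>"
    if n: "max M1 M2 \<le> n" and main_asms: "q \<in> {1..d}" "q' \<in> {1..d}" "near n (U q r i)" "near n (U q' r' i')" for n q q' r r' i i'
  proof -
    have nM: "M1 \<le> n" "M2 \<le> n" "N1 \<le> n" "1 \<le> n" using n M2(1) N1(1) N0 by auto
    have late: "I0 \<le> i" "N1 \<le> mo q r i" if "q \<in> {1..d}" "near n (U q r i)" for q r i
      using M1[OF nM(1) that] I1[OF that(1)] by auto
    \<comment> \<open>Consecutive records shrink by a factor of at least 2, and \<open>near\<close>
      admits only a factor of 400, which is below \<open>2 ^ 9\<close>. So at most 8 steps separate
      two near records of one side.\<close>
    have same: "dist (val q r i) (val q r i') \<le> 8 * \<kappa>"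
      if q: "q \<in> {1..d}" "near n (U q r i)" "near n (U q r i')" for q r i i'
    proof -
      have *: "dist (val q r i) (val q r i') \<le> 8 * \<kappa>"
        if le: "i \<le> i'" and q: "q \<in> {1..d}" "near n (U q r i)" "near n (U q r i')" for i i'
      proof -
        define k where "k = i' - i"
        have k: "i' = i + k" using le by (simp add: k_def)
        have st: "dist (val q r i) (val q r (i + k)) \<le> real k * \<kappa>" for k
        proof (induction k)
          case (Suc k)
          have "dist (val q r (i + k)) (val q r (Suc (i + k))) \<le> \<kappa>" using A1[OF q(1)] late(1)[OF q(1,2)] by simp
          then show ?case
            using Suc dist_triangle[of "val q r i" "val q r (i + Suc k)" "val q r (i + k)"] by (simp add: algebra_simps)
        qed simp
        have "c * 2 ^ k \<le> 10 * (real n * U q r (i + k)) * 2 ^ k"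
          using q(3) k by (intro mult_right_mono) (auto simp: near_def)
        also have "\<dots> = 10 * (real n * (U q r (i + k) * 2 ^ k))" by simp
        also have "\<dots> \<le> 10 * (real n * U q r i)"
          using U_le_power[OF q(1), of r i k] by (intro mult_left_mono) auto
        also have "\<dots> \<le> 400 * c" using q(2) by (simp add: near_def)
        finally have "(2::real) ^ k \<le> 400" using c_pos by (simp add: mult.commute)
        then have "k < 9"
          using power_increasing[of 9 k "2::real"] by (cases "k < 9") auto
        then have "real k * \<kappa> \<le> 8 * \<kappa>" using \<kappa> by (intro mult_right_mono) auto
        then show ?thesis using st[of k] k by simp
      qed
      show ?thesis
        using *[of i i'] *[of i' i] q by (cases "i \<le> i'") (auto simp: dist_commute)
    qed
    have part: "\<exists>j. near n (U (En q r i) (\<not> r) j) \<and> U (En q r i) (\<not> r) j = U q r i - U q r (Suc i) \<and>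
        U q r i / 2 \<le> U (En q r i) (\<not> r) j \<and>
        En (En q r i) (\<not> r) j = En q r (Suc i) \<and> dist (val q r i) (val (En q r i) (\<not> r) j) \<le> \<kappa>"
      if q: "q \<in> {1..d}" "near n (U q r i)" "c \<le> 5 * (real n * U q r i)" for q r i
    proof -
      obtain j where j: "U (En q r i) (\<not> r) j = U q r i - U q r (Suc i)" "En (En q r i) (\<not> r) j = En q r (Suc i)"
        using partner[OF q(1) late(2)[OF q(1,2)]] by blast
      have h: "U q r i / 2 \<le> U (En q r i) (\<not> r) j" "U (En q r i) (\<not> r) j \<le> U q r i"
        using U_ratio(3)[OF q(1) q(1), of r i] j(1) U_shape(1)[OF q(1), of r "Suc i"] by auto
      have "real n * U (En q r i) (\<not> r) j \<le> real n * U q r i" "real n * (U q r i / 2) \<le> real n * U (En q r i) (\<not> r) j"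
        using h by (intro mult_left_mono; simp)+
      then have "near n (U (En q r i) (\<not> r) j)" using q(2,3) by (auto simp: near_def)
      then show ?thesis using j h A2[OF q(1) late(1)[OF q(1,2)] j(1)] by blast
    qed
    \<comment> \<open>The two sides of \<open>X q\<close> are joined through the triangle of
      \<open>cut q n\<close>: both edges at its apex end at the singularity \<open>q\<close>, and
      their partners are records of \<open>X q\<close> on opposite sides. The chain has four
      steps.\<close>
    have two: "\<exists>jF jT. near n (U q False jF) \<and> near n (U q True jT) \<and> dist (val q False jF) (val q True jT) \<le> 4 * \<kappa>"
      if q: "q \<in> {1..d}" for q
    proof -
      obtain lo hi p i where L: "nb n lo hi" "lo \<in> C n" "hi \<in> C n" "p \<in> {1..d}"
        "U p (lo < hi) i = \<bar>hi - lo\<bar>" "En p (lo < hi) (Suc i) = q"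
        using fwd_lift[OF nM(3) q] by blast
      let ?r = "lo < hi" let ?l = "\<bar>hi - lo\<bar>"
      have l: "c \<le> real n * ?l" "real n * ?l \<le> 20 * c" using M2(2)[OF nM(2) L(2,3,1)] by auto
      have e: "near n (U p ?r i)" "c \<le> 5 * (real n * U p ?r i)" using l L(5) c_pos by (auto simp: near_def)
      have s1: "?l \<le> 3 * U p ?r (Suc i)" "U p ?r (Suc i) \<le> ?l"
        using U_ratio(2)[OF L(4) L(4), of ?r i] U_shape(2)[OF L(4), of ?r i] L(5) by auto
      have s1n: "real n * ?l \<le> 3 * (real n * U p ?r (Suc i))" "real n * U p ?r (Suc i) \<le> real n * ?l"
        using mult_left_mono[OF s1(1), of "real n"] mult_left_mono[OF s1(2), of "real n"] by auto
      have e1: "near n (U p ?r (Suc i))" "c \<le> 5 * (real n * U p ?r (Suc i))" using s1n l c_pos by (auto simp: near_def)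
      obtain j where j: "near n (U (En p ?r i) (\<not> ?r) j)" "U p ?r i / 2 \<le> U (En p ?r i) (\<not> ?r) j"
        "En (En p ?r i) (\<not> ?r) j = q" "dist (val p ?r i) (val (En p ?r i) (\<not> ?r) j) \<le> \<kappa>"
        using part[OF L(4) e] unfolding L(6) by blast
      have Ep: "En p ?r i \<in> {1..d}" using En_range[OF L(4)] .
      have "real n * (U p ?r i / 2) \<le> real n * U (En p ?r i) (\<not> ?r) j" using j(2) by (intro mult_left_mono) auto
      then have j5: "c \<le> 5 * (real n * U (En p ?r i) (\<not> ?r) j)" using l L(5) c_pos by auto
      obtain j1 where j1: "near n (U q (\<not> ?r) j1)" "dist (val p ?r (Suc i)) (val q (\<not> ?r) j1) \<le> \<kappa>"
        using part[OF L(4) e1] unfolding L(6) by blast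
      obtain j2 where j2: "near n (U q ?r j2)" "dist (val (En p ?r i) (\<not> ?r) j) (val q ?r j2) \<le> \<kappa>"
        using part[OF Ep j(1) j5] unfolding j(3) not_not by blast
      have "dist (val p ?r i) (val p ?r (Suc i)) \<le> \<kappa>" using A1[OF L(4)] late(1)[OF L(4) e(1)] by simp
      then have D: "dist (val q (\<not> ?r) j1) (val q ?r j2) \<le> 4 * \<kappa>"
        using j(4) j1(2) j2(2)
          dist_triangle[of "val q (\<not> ?r) j1" "val q ?r j2" "val p ?r (Suc i)"]
          dist_triangle[of "val p ?r (Suc i)" "val q ?r j2" "val p ?r i"]
          dist_triangle[of "val p ?r i" "val q ?r j2" "val (En p ?r i) (\<not> ?r) j"]
        by (simp add: dist_commute)
      show ?thesis
      proof (cases ?r)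
        case True then show ?thesis using D j1(1) j2(1) by (intro exI[of _ j1] exI[of _ j2]) simp
      next
        case False
        then show ?thesis using D j1(1) j2(1)
          by (intro exI[of _ j2] exI[of _ j1]) (simp add: dist_commute)
      qed
    qed
    have cls: "dist (val q r i) (val q r' i') \<le> 20 * \<kappa>"
      if q: "q \<in> {1..d}" "near n (U q r i)" "near n (U q r' i')" for q r r' i i'
    proof -
      obtain jF jT where j: "near n (U q False jF)" "near n (U q True jT)" "dist (val q False jF) (val q True jT) \<le> 4 * \<kappa>"
        using two[OF q(1)] by blast
      have *: "dist (val q False x) (val q True y) \<le> 20 * \<kappa>" if "near n (U q False x)" "near n (U q True y)" for x y
        using same[OF q(1) that(1) j(1)] same[OF q(1) j(2) that(2)] j(3)
          dist_triangle[of "val q False x" "val q True y" "val q False jF"]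
          dist_triangle[of "val q False jF" "val q True y" "val q True jT"] by simp
      show ?thesis
      proof (cases "r = r'")
        case True
        then show ?thesis using same[OF q(1), of r i i'] q(2,3) \<kappa> by simp
      next
        case False
        show ?thesis
        proof (cases r)
          case True
          then show ?thesis using *[of i' i] q(2,3) False by (simp add: dist_commute)
        next
          case r: False
          then show ?thesis using *[of i i'] q(2,3) False by simp
        qed
      qed
    qed
    define f where "f q = val q False (SOME i. near n (U q False i))" for q
    have fq: "dist (val q r i) (f q) \<le> 20 * \<kappa>" if "q \<in> {1..d}" "near n (U q r i)" for q r i
    proof -
      have "near n (U q False (SOME i. near n (U q False i)))" using two[OF that(1)] by (metis (mono_tags, lifting) someI_ex)
      then show ?thesis using cls that by (simp add: f_def)
    qed
    \<comment> \<open>Values at one singularity differ by at most \<open>8 + 4 + 8 = 20\<close>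
      steps. The edge from \<open>a\<close> to \<open>b\<close> and its partner at
      \<open>qof b\<close> add one step between the two singularities, which gives
      \<open>20 + 1 + 20\<close>.\<close>
    have link: "dist (f (qof a)) (f (qof b)) \<le> 41 * \<kappa>"
      if ab: "a \<in> C n" "b \<in> C n" "nb n a b" "a \<in> cuts" "b \<in> cuts" for a b
    proof -
      have *: "dist (f (qof a)) (f (qof b)) \<le> 41 * \<kappa>"
        if ab: "a \<in> C n" "b \<in> C n" "nb n a b" "a \<in> cuts" "b \<in> cuts" "ord a < ord b" for a b
      proof -
        have qa: "qof a \<in> {1..d}" "qof b \<in> {1..d}" using cuts_eq ab by auto
        obtain i where i: "U (qof a) (a < b) i = \<bar>b - a\<bar>" "En (qof a) (a < b) i = qof b"
          using edge_record[OF nM(3) ab(1,2,3,6,4)] by blast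
        have l: "c \<le> real n * \<bar>b - a\<bar>" "real n * \<bar>b - a\<bar> \<le> 20 * c" using M2(2)[OF nM(2) ab(1-3)] by auto
        have e: "near n (U (qof a) (a < b) i)" "c \<le> 5 * (real n * U (qof a) (a < b) i)" using l i c_pos by (auto simp: near_def)
        obtain j where j: "near n (U (qof b) (\<not> a < b) j)" "dist (val (qof a) (a < b) i) (val (qof b) (\<not> a < b) j) \<le> \<kappa>"
          using part[OF qa(1) e] unfolding i(2) by blast
        show ?thesis
          using fq[OF qa(1) e(1)] fq[OF qa(2) j(1)] j(2)
            dist_triangle[of "f (qof a)" "f (qof b)" "val (qof a) (a < b) i"]
            dist_triangle[of "val (qof a) (a < b) i" "f (qof b)" "val (qof b) (\<not> a < b) j"]
          by (simp add: dist_commute)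
      qed
      have "ord a \<noteq> ord b" using nb_ord_neq ab nM N1(1) by (metis order_trans)
      then show ?thesis using *[OF ab] *[OF ab(2,1) _ ab(5,4)] ab(3) nb_sym[of n a b]
        by (cases "ord a < ord b") (auto simp: dist_commute)
    qed
    have reach: "dist (f q0) (f q1) \<le> 41 * (real d - 1) * \<kappa>" if q01: "q0 \<in> {1..d}" "q1 \<in> {1..d}" for q0 q1
    proof -
      \<comment> \<open>Singularities reached by at most \<open>k\<close> links. As long as some
        singularity is missing, \<open>class_link\<close> adds a new one, so \<open>d - 1\<close>
        links suffice.\<close>
      define S where "S k = {p \<in> {1..d}. dist (f q0) (f p) \<le> 41 * real k * \<kappa>}" for k :: nat
      have fin: "finite (S k)" for k by (simp add: S_def)
      have mono: "S k \<subseteq> S (Suc k)" for k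
        using \<kappa> by (auto simp: S_def algebra_simps)
      have card: "min (Suc k) d \<le> card (S k)" for k
      proof (induction k)
        case 0
        have "q0 \<in> S 0" using q01 by (simp add: S_def)
        then have "1 \<le> card (S 0)" using fin[of 0] by (metis One_nat_def Suc_leI card_gt_0_iff empty_iff)
        then show ?case by simp
      next
        case (Suc k)
        show ?case
        proof (cases "S k = {1..d}")
          case True
          then have "S (Suc k) = {1..d}" using mono[of k] by (auto simp: S_def)
          then show ?thesis by simp
        next
          case False
          moreover have "S k \<subseteq> {1..d}" unfolding S_def by blast
          ultimately obtain p where p: "p \<in> {1..d}" "p \<notin> S k" by blast
          have "q0 \<in> S k" using q01 \<kappa> by (simp add: S_def)
          then obtain a b where ab: "a \<in> cuts" "b \<in> cuts" "a \<in> C n" "b \<in> C n" "nb n a b" "qof a \<in> S k" "qof b \<notin> S k"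
            using class_link[OF nM(4) _ q01(1) p(2,1)] by blast
          have "dist (f q0) (f (qof b)) \<le> 41 * real (Suc k) * \<kappa>"
            using link[OF ab(3-5,1,2)] ab(6) dist_triangle[of "f q0" "f (qof b)" "f (qof a)"] by (simp add: S_def algebra_simps)
          then have "qof b \<in> S (Suc k)" using cuts_eq(1)[OF ab(2)] by (simp add: S_def)
          then have "S k \<subset> S (Suc k)" using mono[of k] ab(7) by auto
          then have "card (S k) < card (S (Suc k))" by (rule psubset_card_mono[OF fin])
          then show ?thesis using Suc by simp
        qed
      qed
      have "card (S (d - 1)) = card {1..d}"
      proof -
        have "S (d - 1) \<subseteq> {1..d}" unfolding S_def by blast
        then have "card (S (d - 1)) \<le> d" using card_mono[of "{1..d}" "S (d - 1)"] by simp
        then show ?thesis using card[of "d - 1"] d_pos by simp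
      qed
      moreover have "S (d - 1) \<subseteq> {1..d}" unfolding S_def by blast
      ultimately have "S (d - 1) = {1..d}" using card_subset_eq[of "{1..d}" "S (d - 1)"] by simp
      then have "q1 \<in> S (d - 1)" using q01 by simp
      then have "dist (f q0) (f q1) \<le> 41 * real (d - 1) * \<kappa>" unfolding S_def by blast
      then show ?thesis using d_pos by (simp add: of_nat_diff)
    qed
    have "dist (val q r i) (val q' r' i') \<le> 20 * \<kappa> + 41 * (real d - 1) * \<kappa> + 20 * \<kappa>"
      using fq[OF main_asms(1,3)] fq[OF main_asms(2,4)] reach[OF main_asms(1,2)]
        dist_triangle[of "val q r i" "val q' r' i'" "f q"] dist_triangle[of "f q" "val q' r' i'" "f q'"]
      by (simp add: dist_commute)
    also have "\<dots> \<le> 50 * real d * \<kappa>"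
      using mult_right_mono[of "40 + 41 * (real d - 1)" "50 * real d" \<kappa>] d_pos \<kappa> by (simp add: algebra_simps)
    finally show ?thesis .
  qed
  show ?thesis by (intro exI[of _ "max M1 M2"] allI impI ballI main) auto
qed

end

section \<open>Golden recurrences along permutations\<close>

lemma gr_inv: "1 / gr = gr - 1" "1 / gr + (1 / gr)^2 = 1" "0 < gr" "1 < gr"
proof -
  show 0: "0 < gr" "1 < gr" using gr(2) by auto
  show 1: "1 / gr = gr - 1" using gr(1) 0 by (simp add: field_simps)
  show "1 / gr + (1 / gr)^2 = 1" unfolding 1 using gr(1) by (simp add: power2_eq_square algebra_simps)
qed

text \<open>The weights \<open>(1/gr)^2\<close> and \<open>1/gr\<close> add up to 1, so this is the
  convexity of the square with its exact defect, whose coefficient is the product of the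
  weights.\<close>

lemma convex_square:
  fixes x y :: real
  shows "((1/gr)^2 * x + (1/gr) * y)\<^sup>2 = (1/gr)^2 * x\<^sup>2 + (1/gr) * y\<^sup>2 - (1/gr)^3 * (x - y)\<^sup>2"
proof -
  define u where "u = 1 / gr"
  have u: "u + u^2 = 1" using gr_inv(2) by (simp add: u_def)
  have "(u^2 * x + u * y)\<^sup>2 = (u + u^2) * (u^2 * x\<^sup>2 + u * y\<^sup>2) - u^3 * (x - y)\<^sup>2"
    by (simp add: power2_eq_square power3_eq_cube algebra_simps)
  then show ?thesis using u by (simp add: u_def)
qed

lemma monotone_bounded_differences:
  fixes f g :: "nat \<Rightarrow> real"
  assumes "\<And>p. f (Suc p) = f p + g p" "\<And>p. 0 \<le> g p" "\<And>p. f p \<le> B"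
  shows "g \<longlonglongrightarrow> 0"
proof -
  have "incseq f" by (rule incseq_SucI) (use assms in simp)
  then obtain L where "f \<longlonglongrightarrow> L" using incseq_convergent[of f B] assms(3) by blast
  then have "(\<lambda>p. f (Suc p) - f p) \<longlonglongrightarrow> L - L" by (intro tendsto_diff LIMSEQ_Suc)
  then show ?thesis using assms(1) by simp
qed

text \<open>The sum of squares is monotone, so the increments along the recurrence are square summable.\<close>

lemma forward_recurrence:
  fixes b :: "nat \<Rightarrow> 's \<Rightarrow> real"
  assumes fin: "finite S" and bij: "\<And>p. bij_betw (E p) S S"
    and rec: "\<And>p q. q \<in> S \<Longrightarrow> b (p + 2) q = (1/gr)^2 * b p q + (1/gr) * b (Suc p) (E p q)"
    and q: "q \<in> S"
  shows "(\<lambda>p. b p q - b (Suc p) (E p q)) \<longlonglongrightarrow> 0"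
proof -
  define g where "g p = (1/gr)^3 * (\<Sum>q\<in>S. (b p q - b (Suc p) (E p q))\<^sup>2)" for p
  \<comment> \<open>The coefficient \<open>(1/gr)^2\<close> of the older level is the one for which
    the two-step recurrence telescopes, leaving \<open>g p\<close> as the whole change.\<close>
  define f where "f p = - ((\<Sum>q\<in>S. (b (Suc p) q)\<^sup>2) + (1/gr)^2 * (\<Sum>q\<in>S. (b p q)\<^sup>2))" for p
  have "f (Suc p) = f p + g p" for p
  proof -
    have "(\<Sum>q\<in>S. (b (p + 2) q)\<^sup>2) = (\<Sum>q\<in>S. (1/gr)^2 * (b p q)\<^sup>2 + (1/gr) * (b (Suc p) (E p q))\<^sup>2
        - (1/gr)^3 * (b p q - b (Suc p) (E p q))\<^sup>2)"
      by (intro sum.cong refl) (simp only: rec convex_square)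
    also have "\<dots> = (1/gr)^2 * (\<Sum>q\<in>S. (b p q)\<^sup>2) + (1/gr) * (\<Sum>q\<in>S. (b (Suc p) (E p q))\<^sup>2) - g p"
      by (simp add: sum.distrib sum_subtractf sum_distrib_left g_def)
    also have "(\<Sum>q\<in>S. (b (Suc p) (E p q))\<^sup>2) = (\<Sum>q\<in>S. (b (Suc p) q)\<^sup>2)"
      using sum.reindex_bij_betw[OF bij, of "\<lambda>q. (b (Suc p) q)\<^sup>2"] .
    finally have 1: "(\<Sum>q\<in>S. (b (p + 2) q)\<^sup>2) = (1/gr)^2 * (\<Sum>q\<in>S. (b p q)\<^sup>2) + (1/gr) * (\<Sum>q\<in>S. (b (Suc p) q)\<^sup>2) - g p" .
    have "(1/gr) * s + (1/gr)^2 * s = s" for s using gr_inv(2) by (metis distrib_right mult_1)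
    from this[of "\<Sum>q\<in>S. (b (Suc p) q)\<^sup>2"] show ?thesis using 1 by (simp add: f_def)
  qed
  moreover have "0 \<le> g p" for p unfolding g_def using gr_inv by (intro mult_nonneg_nonneg sum_nonneg) auto
  moreover have "f p \<le> 0" for p
  proof -
    have "0 \<le> (\<Sum>q\<in>S. (b (Suc p) q)\<^sup>2) + (1/gr)^2 * (\<Sum>q\<in>S. (b p q)\<^sup>2)"
      by (intro add_nonneg_nonneg mult_nonneg_nonneg sum_nonneg) auto
    then show ?thesis by (simp add: f_def)
  qed
  ultimately have g0: "g \<longlonglongrightarrow> 0" by (rule monotone_bounded_differences)
  have "(\<lambda>p. (b p q - b (Suc p) (E p q))\<^sup>2) \<longlonglongrightarrow> 0"
  proof (rule tendsto_sandwich[OF _ _ tendsto_const])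
    show "(\<lambda>p. gr ^ 3 * g p) \<longlonglongrightarrow> 0" using tendsto_mult[OF tendsto_const g0, of "gr ^ 3"] by simp
    have "(b p q - b (Suc p) (E p q))\<^sup>2 \<le> gr ^ 3 * g p" for p
    proof -
      have "gr ^ 3 * g p = (\<Sum>q\<in>S. (b p q - b (Suc p) (E p q))\<^sup>2)"
        using gr_inv(3) by (simp add: g_def power_divide)
      then show ?thesis using member_le_sum[OF q, of "\<lambda>q. (b p q - b (Suc p) (E p q))\<^sup>2"] fin by simp
    qed
    then show "\<forall>\<^sub>F p in sequentially. (b p q - b (Suc p) (E p q))\<^sup>2 \<le> gr ^ 3 * g p" by simp
  qed simp
  then have "(\<lambda>p. sqrt ((b p q - b (Suc p) (E p q))\<^sup>2)) \<longlonglongrightarrow> sqrt 0" by (rule tendsto_real_sqrt)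
  then show ?thesis by (simp add: tendsto_rabs_zero_iff)
qed

text \<open>Here the recurrence expresses the older level by the later ones, so the energy
  increases, and the bound \<open>K\<close> is what makes it converge.\<close>

lemma backward_recurrence:
  fixes a :: "nat \<Rightarrow> 's \<Rightarrow> real"
  assumes fin: "finite S" and bij: "\<And>p. bij_betw (E p) S S"
    and rec: "\<And>p q. q \<in> S \<Longrightarrow> a p q = (1/gr)^2 * a (p + 2) q + (1/gr) * a (Suc p) (E p q)"
    and bound: "\<And>p q. q \<in> S \<Longrightarrow> \<bar>a p q\<bar> \<le> K"
    and q: "q \<in> S"
  shows "(\<lambda>p. a (p + 2) q - a (Suc p) (E p q)) \<longlonglongrightarrow> 0"
proof -
  define g where "g p = (1/gr)^3 * (\<Sum>q\<in>S. (a (p + 2) q - a (Suc p) (E p q))\<^sup>2)" for p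
  define f where "f p = (\<Sum>q\<in>S. (a p q)\<^sup>2) + (1/gr)^2 * (\<Sum>q\<in>S. (a (Suc p) q)\<^sup>2)" for p
  have "f (Suc p) = f p + g p" for p
  proof -
    have "(\<Sum>q\<in>S. (a p q)\<^sup>2) = (\<Sum>q\<in>S. ((1/gr)^2 * a (p + 2) q + (1/gr) * a (Suc p) (E p q))\<^sup>2)"
      by (intro sum.cong refl arg_cong[where f = power2] rec)
    also have "\<dots> = (\<Sum>q\<in>S. (1/gr)^2 * (a (p + 2) q)\<^sup>2 + (1/gr) * (a (Suc p) (E p q))\<^sup>2
        - (1/gr)^3 * (a (p + 2) q - a (Suc p) (E p q))\<^sup>2)"
      by (simp only: convex_square)
    also have "\<dots> = (1/gr)^2 * (\<Sum>q\<in>S. (a (p + 2) q)\<^sup>2) + (1/gr) * (\<Sum>q\<in>S. (a (Suc p) (E p q))\<^sup>2) - g p"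
      by (simp add: sum.distrib sum_subtractf sum_distrib_left g_def)
    also have "(\<Sum>q\<in>S. (a (Suc p) (E p q))\<^sup>2) = (\<Sum>q\<in>S. (a (Suc p) q)\<^sup>2)"
      using sum.reindex_bij_betw[OF bij, of "\<lambda>q. (a (Suc p) q)\<^sup>2"] .
    finally have 1: "(\<Sum>q\<in>S. (a p q)\<^sup>2) = (1/gr)^2 * (\<Sum>q\<in>S. (a (p + 2) q)\<^sup>2) + (1/gr) * (\<Sum>q\<in>S. (a (Suc p) q)\<^sup>2) - g p" .
    have "(1/gr) * s + (1/gr)^2 * s = s" for s using gr_inv(2) by (metis distrib_right mult_1)
    from this[of "\<Sum>q\<in>S. (a (Suc p) q)\<^sup>2"] show ?thesis using 1 by (simp add: f_def)
  qed
  moreover have "0 \<le> g p" for p unfolding g_def using gr_inv by (intro mult_nonneg_nonneg sum_nonneg) auto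
  moreover have "f p \<le> real (card S) * K\<^sup>2 + (1/gr)^2 * (real (card S) * K\<^sup>2)" for p
  proof -
    have "(\<Sum>q\<in>S. (a p q)\<^sup>2) \<le> (\<Sum>q\<in>S. K\<^sup>2)" for p
      using bound by (intro sum_mono) (metis abs_ge_zero power2_abs power_mono)
    then show ?thesis unfolding f_def by (intro add_mono mult_left_mono) auto
  qed
  ultimately have g0: "g \<longlonglongrightarrow> 0" by (rule monotone_bounded_differences)
  have "(\<lambda>p. (a (p + 2) q - a (Suc p) (E p q))\<^sup>2) \<longlonglongrightarrow> 0"
  proof (rule tendsto_sandwich[OF _ _ tendsto_const])
    show "(\<lambda>p. gr ^ 3 * g p) \<longlonglongrightarrow> 0" using tendsto_mult[OF tendsto_const g0, of "gr ^ 3"] by simp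
    have "(a (p + 2) q - a (Suc p) (E p q))\<^sup>2 \<le> gr ^ 3 * g p" for p
    proof -
      have "gr ^ 3 * g p = (\<Sum>q\<in>S. (a (p + 2) q - a (Suc p) (E p q))\<^sup>2)"
        using gr_inv(3) by (simp add: g_def power_divide)
      then show ?thesis using member_le_sum[OF q, of "\<lambda>q. (a (p + 2) q - a (Suc p) (E p q))\<^sup>2"] fin by simp
    qed
    then show "\<forall>\<^sub>F p in sequentially. (a (p + 2) q - a (Suc p) (E p q))\<^sup>2 \<le> gr ^ 3 * g p" by simp
  qed simp
  then have "(\<lambda>p. sqrt ((a (p + 2) q - a (Suc p) (E p q))\<^sup>2)) \<longlonglongrightarrow> sqrt 0" by (rule tendsto_real_sqrt)
  then show ?thesis by (simp add: tendsto_rabs_zero_iff)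
qed

section \<open>Alignment of scales\<close>

lemma log_gr: "3 / 8 \<le> ln gr" "log gr gr = 1" "log gr (gr * gr) = 2"
proof -
  have "ln (1 / gr) \<le> 1 / gr - 1" using gr_inv by (intro ln_le_minus_one) auto
  moreover have "ln (1 / gr) = - ln gr" using gr_inv(3) by (simp add: ln_div)
  moreover have "gr < 81 / 50" using gr(3) by simp
  ultimately show "3 / 8 \<le> ln gr" using gr_inv(1) by linarith
  show "log gr gr = 1" "log gr (gr * gr) = 2" using gr_inv by (auto simp: log_mult)
qed

text \<open>Since \<open>x\<close> and \<open>z\<close> are at least \<open>1 / 2\<close>, the
  natural logarithm moves by at most \<open>2 * \<delta>\<close>; division by
  \<open>ln gr \<ge> 3 / 8\<close> gives the factor \<open>16 / 3 < 6\<close>.\<close>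

lemma log_close:
  assumes "1 \<le> z" "\<bar>x - z\<bar> \<le> \<delta>" "\<delta> \<le> 1 / 2"
  shows "\<bar>log gr x - log gr z\<bar> \<le> 6 * \<delta>"
proof -
  have x: "1 / 2 \<le> x" using assms by (auto simp: abs_le_iff)
  have "ln x - ln z = ln (x / z)" "ln z - ln x = ln (z / x)" using x assms by (auto simp: ln_div)
  moreover have "ln (x / z) \<le> x / z - 1" "ln (z / x) \<le> z / x - 1" using x assms by (auto intro: ln_le_minus_one)
  moreover have "x / z - 1 \<le> 2 * \<delta>"
  proof -
    have "x / z - 1 = (x - z) / z" using assms by (simp add: field_simps)
    also have "\<dots> \<le> \<bar>x - z\<bar> / 1" using assms by (intro frac_le) auto
    finally show ?thesis using assms by auto
  qed
  moreover have "z / x - 1 \<le> 2 * \<delta>"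
  proof -
    have "z / x - 1 = (z - x) / x" using x by (simp add: field_simps)
    also have "\<dots> \<le> \<bar>x - z\<bar> / (1 / 2)" using x by (intro frac_le) auto
    finally show ?thesis using assms by auto
  qed
  ultimately have 1: "\<bar>ln x - ln z\<bar> \<le> 2 * \<delta>" by linarith
  have "0 \<le> \<delta>" using assms(2) abs_ge_zero[of "x - z"] by linarith
  have "\<bar>log gr x - log gr z\<bar> = \<bar>ln x - ln z\<bar> / ln gr"
    using log_gr(1) by (simp add: log_def abs_divide flip: diff_divide_distrib)
  also have "\<dots> \<le> \<bar>ln x - ln z\<bar> / (3 / 8)"
    using log_gr(1) by (intro divide_left_mono) auto
  also have "\<dots> = (8 / 3) * \<bar>ln x - ln z\<bar>" by simp
  also have "\<dots> \<le> (8 / 3) * (2 * \<delta>)" using 1 by (intro mult_left_mono) auto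
  also have "\<dots> \<le> 6 * \<delta>" using \<open>0 \<le> \<delta>\<close> by simp
  finally show ?thesis .
qed

lemma dist_cis: "dist (cis a) (cis b) = 2 * \<bar>sin ((a - b) / 2)\<bar>"
proof -
  have "(dist (cis a) (cis b))\<^sup>2 = (cos a - cos b)\<^sup>2 + (sin a - sin b)\<^sup>2"
    by (simp add: dist_norm cmod_power2)
  also have "\<dots> = ((sin a)\<^sup>2 + (cos a)\<^sup>2) + ((sin b)\<^sup>2 + (cos b)\<^sup>2) - 2 * (cos a * cos b + sin a * sin b)"
    by (simp add: power2_eq_square algebra_simps)
  also have "\<dots> = 2 - 2 * cos (a - b)" by (simp add: cos_diff)
  also have "a - b = 2 * ((a - b) / 2)" by simp
  also have "2 - 2 * cos (2 * ((a - b) / 2)) = (2 * \<bar>sin ((a - b) / 2)\<bar>)\<^sup>2"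
    by (simp only: cos_double_sin) (simp add: power2_eq_square)
  finally show ?thesis by (rule power2_eq_imp_eq) simp_all
qed

text \<open>Reals modulo 2 are represented on the unit circle by \<open>cis (pi * x)\<close>,
  because the propagation asks for values in a metric space. The factor comes from
  \<open>pi < 4\<close>.\<close>

lemma dist_cis_pi_le:
  fixes k :: int
  shows "dist (cis (pi * x)) (cis (pi * y)) \<le> 4 * \<bar>x - y - 2 * k\<bar>"
proof -
  have "cis (pi * y) = cis (pi * (y + 2 * k))"
  proof -
    have "cis (pi * (y + 2 * k)) = cis (pi * y) * cis (2 * pi * real_of_int k)" by (simp add: cis_mult algebra_simps)
    then show ?thesis by simp
  qed
  then have "dist (cis (pi * x)) (cis (pi * y)) = 2 * \<bar>sin ((pi * x - pi * (y + 2 * k)) / 2)\<bar>" by (simp add: dist_cis)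
  also have "\<dots> \<le> 2 * \<bar>(pi * x - pi * (y + 2 * k)) / 2\<bar>" by (rule mult_left_mono[OF abs_sin_x_le_abs_x]) simp
  also have "pi * x - pi * (y + 2 * k) = pi * (x - y - 2 * k)" by (simp add: algebra_simps)
  also have "2 * \<bar>pi * (x - y - 2 * k) / 2\<bar> = pi * \<bar>x - y - 2 * k\<bar>" by (simp add: abs_mult)
  also have "\<dots> \<le> 4 * \<bar>x - y - 2 * k\<bar>" using pi_less_4 by (intro mult_right_mono) auto
  finally show ?thesis .
qed

text \<open>A difference \<open>2 * h\<close> modulo 2 gives the distance
  \<open>2 * \<bar>sin (pi * h)\<bar>\<close>, which is at least 1 once \<open>\<bar>h\<bar>\<close>
  lies between \<open>1 / 6\<close> and \<open>1 / 2\<close>.\<close>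

lemma dist_cis_pi_small:
  assumes "dist (cis (pi * x)) (cis (pi * y)) \<le> 1 / 10"
  shows "\<exists>k::int. \<bar>x - y - 2 * k\<bar> \<le> 1 / 3"
proof -
  define k where "k = round ((x - y) / 2)"
  define h where "h = (x - y) / 2 - k"
  have h: "\<bar>h\<bar> \<le> 1 / 2" using of_int_round_abs_le[of "(x - y) / 2"] by (simp add: h_def k_def abs_minus_commute)
  have "2 * \<bar>sin (pi * h)\<bar> \<le> 1 / 10"
  proof -
    have "cis (pi * x) = cis (pi * (x - 2 * k))"
    proof -
      have "cis (pi * x) = cis (pi * (x - 2 * k)) * cis (2 * pi * real_of_int k)" by (simp add: cis_mult algebra_simps)
      then show ?thesis by simp
    qed
    then have "dist (cis (pi * x)) (cis (pi * y)) = 2 * \<bar>sin ((pi * (x - 2 * k) - pi * y) / 2)\<bar>" by (simp add: dist_cis)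
    also have "(pi * (x - 2 * k) - pi * y) / 2 = pi * h" by (simp add: h_def field_simps)
    finally show ?thesis using assms by simp
  qed
  moreover have "\<bar>sin (pi * \<bar>h\<bar>)\<bar> = \<bar>sin (pi * h)\<bar>" by (cases "0 \<le> h") simp_all
  ultimately have s: "\<bar>sin (pi * \<bar>h\<bar>)\<bar> < 1 / 2" by linarith
  have "\<bar>h\<bar> \<le> 1 / 6"
  proof (rule ccontr)
    assume "\<not> ?thesis"
    then have "pi / 6 \<le> pi * \<bar>h\<bar>" "pi * \<bar>h\<bar> \<le> pi / 2" using h by (auto simp: field_simps)
    then have "sin (pi / 6) \<le> sin (pi * \<bar>h\<bar>)" by (intro sin_monotone_2pi_le) auto
    then show False using s sin_30 by auto
  qed
  moreover have "x - y - 2 * k = 2 * h" by (simp add: h_def)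
  ultimately show ?thesis by (intro exI[of _ k]) (simp add: abs_mult)
qed

text \<open>\<open>small\<close> bounds the error accumulated over chains of up to
  \<open>50 * d\<close> edges. \<open>bwd_ratio\<close> records the shape of the triangles at
  \<open>Y s\<close>: the factor \<open>9 / 5\<close> lies above \<open>gr\<close> and is small
  enough to exclude a difference of three levels.\<close>

locale balanced_golden = nearly_golden +
  assumes small: "real d * e \<le> 1 / 100000"
    and bwd_ratio: "\<And>n s. N0 \<le> n \<Longrightarrow> s \<in> {1..d} \<Longrightarrow>
      Y s - pr n (Y s) \<le> (9/5) * (sc n (Y s) - Y s) \<and> sc n (Y s) - Y s \<le> (9/5) * (Y s - pr n (Y s))"
begin

lemma e_small: "e \<le> 1 / 100000"
proof -
  have "1 * e \<le> real d * e" using d_pos e(1) by (intro mult_right_mono) auto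
  then show ?thesis using small by simp
qed

definition lU :: "nat \<Rightarrow> bool \<Rightarrow> nat \<Rightarrow> real" where "lU q r i = log gr (U q r i)"

text \<open>In logarithms to base \<open>gr\<close> the next record is two levels lower and its
  partner one level lower; \<open>6 * 8 = 48\<close> is rounded up to \<open>50\<close>.\<close>

lemma ratio_logs:
  assumes "0 < v" "0 < u" "\<bar>(u - v) / v - gr\<bar> \<le> 8 * e" "v < u"
  shows "\<bar>log gr u - log gr v - 2\<bar> \<le> 50 * e" "\<bar>log gr u - log gr (u - v) - 1\<bar> \<le> 50 * e"
proof -
  have r: "(u - v) / v = u / v - 1" using assms(1) by (simp add: field_simps)
  have d: "8 * e \<le> 1 / 2" using e_small by simp
  have "\<bar>u / v - gr * gr\<bar> \<le> 8 * e" using assms(3) gr(1) r by simp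
  moreover have "1 \<le> gr * gr" using gr(1,2) by simp
  ultimately have "\<bar>log gr (u / v) - log gr (gr * gr)\<bar> \<le> 6 * (8 * e)" using d by (intro log_close)
  then show "\<bar>log gr u - log gr v - 2\<bar> \<le> 50 * e"
    using assms(1,2) log_gr(3) e(1) by (simp add: log_divide)
  define \<sigma> where "\<sigma> = (u - v) / v"
  have \<sigma>: "\<bar>\<sigma> - gr\<bar> \<le> 8 * e" using assms(3) by (simp add: \<sigma>_def)
  then have \<sigma>1: "1 \<le> \<sigma>" using gr(2) d by (auto simp: abs_le_iff)
  have "u / (u - v) = 1 + 1 / \<sigma>" using assms by (simp add: \<sigma>_def field_simps)
  moreover have "gr = 1 + 1 / gr" using gr_inv(1) by simp
  ultimately have "u / (u - v) - gr = 1 / \<sigma> - 1 / gr" by linarith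
  also have "\<dots> = (gr - \<sigma>) / (\<sigma> * gr)" using \<sigma>1 gr_inv(3) by (simp add: field_simps)
  finally have "\<bar>u / (u - v) - gr\<bar> = \<bar>gr - \<sigma>\<bar> / (\<sigma> * gr)" using \<sigma>1 gr_inv(3) by (simp add: abs_divide abs_mult)
  also have "\<dots> \<le> \<bar>gr - \<sigma>\<bar> / 1"
  proof (intro divide_left_mono)
    show "1 \<le> \<sigma> * gr" using mult_mono[of 1 \<sigma> 1 gr] \<sigma>1 gr_inv(4) by simp
    then show "0 < \<sigma> * gr * 1" by simp
  qed simp
  finally have "\<bar>u / (u - v) - gr\<bar> \<le> 8 * e" using \<sigma> by (simp add: abs_minus_commute)
  then have "\<bar>log gr (u / (u - v)) - log gr gr\<bar> \<le> 6 * (8 * e)" using d gr_inv(4) by (intro log_close) auto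
  then show "\<bar>log gr u - log gr (u - v) - 1\<bar> \<le> 50 * e"
    using assms log_gr(2) e(1) by (simp add: log_divide)
qed

lemma lU_step:
  assumes "q \<in> {1..d}"
  shows "\<bar>lU q r i - lU q r (Suc i) - 2\<bar> \<le> 50 * e" "\<bar>lU q r i - log gr (U q r i - U q r (Suc i)) - 1\<bar> \<le> 50 * e"
  using ratio_logs[OF U_shape(1)[OF assms] U_shape(1)[OF assms] U_shape(3)[OF assms] U_shape(2)[OF assms]]
  by (auto simp: lU_def)

lemma lU_decr: assumes "q \<in> {1..d}" shows "lU q r (i + k) \<le> lU q r i - (3/2) * real k"
proof (induction k)
  case (Suc k)
  have "(3/2) * real (Suc k) = (3/2) * real k + 3/2" "lU q r (i + Suc k) = lU q r (Suc (i + k))" by simp_all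
  then show ?case using Suc lU_step(1)[OF assms, of r "i + k"] e_small by linarith
qed simp

lemma lU_inj: assumes "q \<in> {1..d}" "\<bar>lU q r i - lU q r j\<bar> < 3/2" shows "i = j"
proof -
  have *: "i = j" if "i \<le> j" "\<bar>lU q r i - lU q r j\<bar> < 3/2" for i j
  proof (rule ccontr)
    assume "i \<noteq> j"
    then have "1 \<le> real (j - i)" using that by simp
    moreover have "i + (j - i) = j" using that(1) by simp
    then have "lU q r j \<le> lU q r i - (3/2) * real (j - i)"
      using lU_decr[OF assms(1), of r i "j - i"] by metis
    ultimately have "lU q r j \<le> lU q r i - 3/2" by linarith
    then show False using that(2) by linarith
  qed
  show ?thesis using *[of i j] *[of j i] assms(2) by (cases "i \<le> j") (auto simp: abs_minus_commute)
qed

text \<open>By propagation, the levels \<open>log gr U\<close>, shifted by one for right records, of all edges of a given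
  scale agree modulo 2 up to a small error.\<close>

lemma angle_close:
  "\<exists>M. \<forall>n\<ge>M. \<forall>q\<in>{1..d}. \<forall>q'\<in>{1..d}. \<forall>r r' i i'. near n (U q r i) \<longrightarrow> near n (U q' r' i') \<longrightarrow>
    (\<exists>k::int. \<bar>(lU q r i + of_bool r) - (lU q' r' i' + of_bool r') - 2 * k\<bar> \<le> 1 / 3)"
proof -
  define val where "val q r i = cis (pi * (lU q r i + of_bool r))" for q r i
  have "\<exists>M. \<forall>n\<ge>M. \<forall>q\<in>{1..d}. \<forall>q'\<in>{1..d}. \<forall>r r' i i'. near n (U q r i) \<longrightarrow> near n (U q' r' i') \<longrightarrow>
    dist (val q r i) (val q' r' i') \<le> 50 * real d * (200 * e)"
  proof (rule propagation)
    fix q r i assume q: "q \<in> {1..d}"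
    show "dist (val q r i) (val q r (Suc i)) \<le> 200 * e"
      using dist_cis_pi_le[of "lU q r i + of_bool r" "lU q r (Suc i) + of_bool r" 1] lU_step(1)[OF q, of r i]
      by (simp add: val_def)
  next
    fix q r i j assume q: "q \<in> {1..d}" and j: "U (En q r i) (\<not> r) j = U q r i - U q r (Suc i)"
    have l: "\<bar>lU q r i - lU (En q r i) (\<not> r) j - 1\<bar> \<le> 50 * e" using lU_step(2)[OF q, of r i] j by (simp add: lU_def)
    \<comment> \<open>A partner changes side and drops one level. With the shift
      \<open>of_bool r\<close> the change is close to \<open>2\<close> if \<open>r\<close> and to
      \<open>0\<close> otherwise, so it nearly vanishes modulo 2.\<close>
    note D = dist_cis_pi_le[of "lU q r i + of_bool r" "lU (En q r i) (\<not> r) j + of_bool (\<not> r)" "of_bool r"]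
    show "dist (val q r i) (val (En q r i) (\<not> r) j) \<le> 200 * e"
    proof (cases r)
      case True
      then show ?thesis using D l by (simp add: val_def)
    next
      case False
      then have "dist (val q r i) (val (En q r i) (\<not> r) j) \<le> 4 * \<bar>lU q r i - (lU (En q r i) (\<not> r) j + 1)\<bar>"
        using D by (simp add: val_def)
      moreover have "lU q r i - (lU (En q r i) (\<not> r) j + 1) = lU q r i - lU (En q r i) (\<not> r) j - 1" by simp
      ultimately have "dist (val q r i) (val (En q r i) (\<not> r) j) \<le> 4 * \<bar>lU q r i - lU (En q r i) (\<not> r) j - 1\<bar>"
        by (simp only:)
      also have "\<dots> \<le> 4 * (50 * e)" using l by (intro mult_left_mono) simp_all
      finally show ?thesis by simp
    qed
  qed (use e in auto)
  \<comment> \<open>The error over a whole chain is \<open>10000 * d * e\<close>. This is the step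
    that asks for \<open>e\<close> to be of order \<open>1 / d\<close>.\<close>
  moreover have "50 * real d * (200 * e) \<le> 1 / 10" using small by simp
  ultimately show ?thesis unfolding val_def using dist_cis_pi_small by (meson order_trans)
qed

text \<open>Approximate logarithmic lengths of the level \<open>p\<close> edges, with the right records of singularity 1 as reference.
  Even levels are right records and odd levels are left records.\<close>

definition lxJ :: "nat \<Rightarrow> nat \<Rightarrow> real" where
  "lxJ J p = (if even p then lU 1 True (J + p div 2) else lU 1 True (J + p div 2) - 1)"

lemma one_mem: "1 \<in> {1..d}" using d_pos by simp

text \<open>At the scale \<open>x\<close> of level \<open>p\<close>, the first record of length at
  most \<open>gr * x\<close> is within \<open>101 / 100\<close> of the level. By
  \<open>angle_close\<close> its deviation is an even integer up to \<open>1 / 3\<close>, and that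
  integer can only be \<open>0\<close>.\<close>

lemma aligned_exists:
  "\<exists>J. \<forall>p. \<forall>q\<in>{1..d}. \<exists>i. N1 \<le> mo q (even p) i \<and> \<bar>lU q (even p) i - lxJ J p\<bar> \<le> 1 / 3"
proof -
  obtain M where M: "\<And>n q q' r r' i i'. M \<le> n \<Longrightarrow> q \<in> {1..d} \<Longrightarrow> q' \<in> {1..d} \<Longrightarrow> near n (U q r i) \<Longrightarrow> near n (U q' r' i') \<Longrightarrow>
    (\<exists>k::int. \<bar>(lU q r i + of_bool r) - (lU q' r' i' + of_bool r') - 2 * k\<bar> \<le> 1 / 3)"
    using angle_close by blast
  obtain I where I: "\<And>q r i. q \<in> {1..d} \<Longrightarrow> I \<le> i \<Longrightarrow> N1 \<le> mo q r i" using mo_late[of N1] by blast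
  obtain \<eta> where \<eta>: "\<eta> > 0" "\<And>q r i. q \<in> {1..d} \<Longrightarrow> U q r i < \<eta> \<Longrightarrow> Suc I \<le> i"
    using U_eventually_late[of "Suc I"] by blast
  define x0 where "x0 = min (\<eta> / 2) (c / (real M + 1))"
  have x0: "x0 \<le> \<eta> / 2" "x0 \<le> c / (real M + 1)"
    unfolding x0_def by (rule min.cobounded1, rule min.cobounded2)
  have "0 < x0" using \<eta>(1) c_pos by (simp add: x0_def)
  note x0 = this x0
  have "x0 * 1 \<le> x0 * (real M + 1)" using x0(1) by (intro mult_left_mono) auto
  also have "\<dots> \<le> c" using x0(3) by (simp add: field_simps)
  finally have x0c: "x0 \<le> c" by simp
  obtain J where J: "\<And>q r i. q \<in> {1..d} \<Longrightarrow> J \<le> i \<Longrightarrow> U q r i < x0"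
    using U_eventually_small[OF x0(1)] by blast
  have "\<exists>i. N1 \<le> mo q (even p) i \<and> \<bar>lU q (even p) i - lxJ J p\<bar> \<le> 1 / 3" if q: "q \<in> {1..d}" for p q
  proof -
    let ?r = "even p" let ?j = "J + p div 2"
    define x where "x = (if even p then U 1 True ?j else U 1 True ?j / gr)"
    have U0: "0 < U 1 True ?j" "U 1 True ?j < x0" using U_shape(1)[OF one_mem] J[OF one_mem, of ?j True] by auto
    have x: "0 < x" "x < x0" "x \<le> U 1 True ?j" "U 1 True ?j \<le> gr * x"
    proof -
      have "U 1 True ?j / gr \<le> U 1 True ?j" using U0 gr_inv(4) by (simp add: field_simps)
      moreover have "1 * U 1 True ?j \<le> gr * U 1 True ?j" using U0 gr_inv(4) by (intro mult_right_mono) auto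
      ultimately show "0 < x" "x < x0" "x \<le> U 1 True ?j" "U 1 True ?j \<le> gr * x"
        using U0 gr_inv(3) by (auto simp: x_def)
    qed
    have lx: "log gr x = lxJ J p" using U0 gr_inv(3) log_gr(2) by (simp add: x_def lxJ_def lU_def log_divide)
    define n where "n = nat \<lceil>2 * c / x\<rceil>"
    have n: "2 * c \<le> real n * x" "real n * x \<le> 3 * c"
    proof -
      have "2 * c / x \<le> real n" "real n < 2 * c / x + 1" using c_pos x(1) unfolding n_def by (auto simp: le_nat_iff) linarith+
      then have "2 * c \<le> real n * x" "real n * x < 2 * c + x" using x(1) by (auto simp: field_simps)
      then show "2 * c \<le> real n * x" "real n * x \<le> 3 * c" using x(2) x0c by auto
    qed
    have nM: "M \<le> n"
    proof -
      have "(real M + 1) * x \<le> (real M + 1) * x0" using x by (intro mult_left_mono) auto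
      also have "\<dots> \<le> c" using x0(3) by (simp add: field_simps)
      also have "\<dots> \<le> real n * x" using n c_pos by linarith
      finally have "real M + 1 \<le> real n" using x(1) by simp
      then show ?thesis by simp
    qed
    define i where "i = (LEAST i. U q ?r i \<le> gr * x)"
    obtain i0 where "\<forall>i\<ge>i0. U q ?r i < gr * x" using U_eventually_small[of "gr * x"] x(1) gr_inv(3) q by (metis mult_pos_pos)
    then have "U q ?r i0 \<le> gr * x" by (simp add: less_imp_le)
    then have i: "U q ?r i \<le> gr * x" unfolding i_def by (rule LeastI)
    have gx: "gr * x \<le> (17/10) * x" using gr(3) x(1) by (intro mult_right_mono) auto
    then have "U q ?r i < \<eta>" using i x x0 by linarith
    then have iI: "Suc I \<le> i" using \<eta>(2)[OF q] by blast
    then obtain i1 where i1: "i = Suc i1" by (cases i) auto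
    have big: "gr * x < U q ?r i1"
      using not_less_Least[of i1 "\<lambda>i. U q ?r i \<le> gr * x", folded i_def] i1 by auto
    have u3: "U q ?r i1 \<le> 3 * U q ?r i" using U_ratio(2)[OF q q, of ?r i1] i1 by simp
    have low: "x / 2 \<le> U q ?r i"
    proof -
      have "(16/10) * x \<le> gr * x" using gr(2) x(1) by (intro mult_right_mono) auto
      then show ?thesis using big u3 x(1) by linarith
    qed
    have lo1: "lU q ?r i \<le> lxJ J p + 1"
    proof -
      have "log gr (U q ?r i) \<le> log gr (gr * x)" using i U_shape(1)[OF q] x(1) gr_inv by (subst log_le_cancel_iff) auto
      then show ?thesis using lx x(1) gr_inv log_gr(2) by (simp add: lU_def log_mult)
    qed
    have lo2: "lxJ J p + 1 < lU q ?r i1"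
    proof -
      have "log gr (gr * x) < log gr (U q ?r i1)" using big U_shape(1)[OF q] x(1) gr_inv by (subst log_less_cancel_iff) auto
      then show ?thesis using lx x(1) gr_inv log_gr(2) by (simp add: lU_def log_mult)
    qed
    have close: "\<bar>lU q ?r i - lxJ J p\<bar> \<le> 101 / 100"
      using lo1 lo2 lU_step(1)[OF q, of ?r i1] e_small unfolding i1 by linarith
    have nU: "near n (U q ?r i)"
    proof -
      have "real n * (x / 2) \<le> real n * U q ?r i" "real n * U q ?r i \<le> real n * ((17/10) * x)"
        using low i gx by (intro mult_left_mono; linarith)+
      then show ?thesis using n c_pos by (simp add: near_def)
    qed
    have n1: "near n (U 1 True ?j)"
    proof -
      have "real n * x \<le> real n * U 1 True ?j" "real n * U 1 True ?j \<le> real n * ((17/10) * x)"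
        using x gx by (intro mult_left_mono; linarith)+
      then show ?thesis using n c_pos by (simp add: near_def)
    qed
    obtain k :: int where k: "\<bar>(lU q ?r i + of_bool ?r) - (lU 1 True ?j + of_bool True) - 2 * real_of_int k\<bar> \<le> 1 / 3"
      using M[OF nM q one_mem nU n1] by blast
    have "(lU q ?r i + of_bool ?r) - (lU 1 True ?j + of_bool True) - 2 * real_of_int k
        = lU q ?r i - lxJ J p - 2 * real_of_int (k + (if even p then 0 else 1))"
      by (cases "even p") (simp_all add: lxJ_def)
    then have "\<bar>lU q ?r i - lxJ J p - 2 * real_of_int (k + (if even p then 0 else 1))\<bar> \<le> 1 / 3"
      using k by (simp only:)
    moreover define k' where "k' = k + (if even p then 0 else 1)"
    ultimately have k': "\<bar>lU q ?r i - lxJ J p - 2 * real_of_int k'\<bar> \<le> 1 / 3" by (simp only:)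
    then have "- 2 < 2 * real_of_int k'" "2 * real_of_int k' < 2" using close unfolding abs_le_iff by linarith+
    then have "k' = 0" by linarith
    then have "\<bar>lU q ?r i - lxJ J p\<bar> \<le> 1 / 3" using k' by simp
    then show ?thesis using I[OF q, of i ?r] iI by (intro exI[of _ i]) auto
  qed
  then show ?thesis by blast
qed

definition J0 :: nat where
  "J0 = (SOME J. \<forall>p. \<forall>q\<in>{1..d}. \<exists>i. N1 \<le> mo q (even p) i \<and> \<bar>lU q (even p) i - lxJ J p\<bar> \<le> 1 / 3)"

definition lx :: "nat \<Rightarrow> real" where "lx = lxJ J0"

definition ix :: "nat \<Rightarrow> nat \<Rightarrow> nat" where
  "ix p q = (SOME i. N1 \<le> mo q (even p) i \<and> \<bar>lU q (even p) i - lx p\<bar> \<le> 1 / 3)"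

lemma ix:
  assumes "q \<in> {1..d}"
  shows "N1 \<le> mo q (even p) (ix p q)" "\<bar>lU q (even p) (ix p q) - lx p\<bar> \<le> 1 / 3"
proof -
  have "\<exists>i. N1 \<le> mo q (even p) i \<and> \<bar>lU q (even p) i - lx p\<bar> \<le> 1 / 3"
    using someI_ex[OF aligned_exists, folded J0_def lx_def] assms by (simp add: lx_def)
  then show "N1 \<le> mo q (even p) (ix p q)" "\<bar>lU q (even p) (ix p q) - lx p\<bar> \<le> 1 / 3"
    unfolding ix_def by (metis (mono_tags, lifting) someI_ex)+
qed

text \<open>Records of one side are at least \<open>3 / 2\<close> levels apart, and
  \<open>3 / 4 + 1 / 3\<close> is less than that.\<close>

lemma ix_unique: assumes "q \<in> {1..d}" "\<bar>lU q (even p) i - lx p\<bar> \<le> 3/4" shows "i = ix p q"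
  using ix(2)[OF assms(1), of p] assms(2) by (intro lU_inj[OF assms(1), of "even p"]) linarith

lemma lx_add2: "\<bar>lx (p + 2) - lx p + 2\<bar> \<le> 50 * e"
  using lU_step(1)[OF one_mem, of True "J0 + p div 2"] by (auto simp: lx_def lxJ_def abs_le_iff)

lemma lx_Suc: "\<bar>lx (Suc p) - lx p + 1\<bar> \<le> 50 * e"
proof (cases "even p")
  case True
  then show ?thesis using e(1) by (auto simp: lx_def lxJ_def)
next
  case False
  then have "Suc p div 2 = Suc (p div 2)" by presburger
  then show ?thesis using False lU_step(1)[OF one_mem, of True "J0 + p div 2"] by (auto simp: lx_def lxJ_def abs_le_iff)
qed

lemma ix_add2: assumes "q \<in> {1..d}" shows "ix (p + 2) q = Suc (ix p q)"
proof -
  have "\<bar>lU q (even p) (Suc (ix p q)) - lx (p + 2)\<bar> \<le> 3/4"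
    using ix(2)[OF assms, of p] lx_add2[of p] lU_step(1)[OF assms, of "even p" "ix p q"] e_small by linarith
  then show ?thesis using ix_unique[OF assms, of "p + 2" "Suc (ix p q)"] by simp
qed

lemma ix_add_even: "q \<in> {1..d} \<Longrightarrow> ix (p + 2 * k) q = ix p q + k"
proof (induction k)
  case (Suc k)
  then show ?case using ix_add2[of q "p + 2 * k"] by (simp add: add.assoc)
qed simp

section \<open>The Fibonacci network of levels\<close>

definition V :: "nat \<Rightarrow> nat \<Rightarrow> real" where "V p q = U q (even p) (ix p q)"
text \<open>The weight \<open>v\<close> need not be the weight \<open>w\<close> of the locale:
  \<open>w\<close> fixes which edges have which level, and the ages of any weight can be read off
  these edges.\<close>

definition Tt :: "(nat \<Rightarrow> real) \<Rightarrow> nat \<Rightarrow> nat \<Rightarrow> real" where "Tt v p q = \<tau> v (sq q (even p) (ix p q))"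
definition E :: "nat \<Rightarrow> nat \<Rightarrow> nat" where "E p q = En q (even p) (ix p q)"

lemma E_range: "q \<in> {1..d} \<Longrightarrow> E p q \<in> {1..d}"
  by (simp only: E_def En_range)

lemma partner_ix:
  assumes "q \<in> {1..d}" "U (E p q) (\<not> even p) j = U q (even p) (ix p q) - U q (even p) (Suc (ix p q))"
  shows "j = ix (Suc p) (E p q)"
proof -
  have "lU (E p q) (\<not> even p) j = log gr (U q (even p) (ix p q) - U q (even p) (Suc (ix p q)))"
    using assms(2) by (simp add: lU_def)
  then have "\<bar>lU (E p q) (\<not> even p) j - lx (Suc p)\<bar> \<le> 3/4"
    using lU_step(2)[OF assms(1), of "even p" "ix p q"] ix(2)[OF assms(1), of p] lx_Suc[of p] e_small by linarith
  then show ?thesis using ix_unique[OF E_range[OF assms(1), of p], of "Suc p" j] by simp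
qed

text \<open>One partner record yields all three relations: the two parts have the length of the
  whole, their ages combine at the new cut point, and both parts end there, so that the two ways
  through the network reach the same singularity.\<close>

lemma net:
  assumes q: "q \<in> {1..d}"
  shows "V p q = V (p + 2) q + V (Suc p) (E p q)"
    "Tt v (p + 2) q = Tt v p q + Tt v (Suc p) (E p q)"
    "E (p + 2) q = E (Suc p) (E p q)"
proof -
  obtain j where j: "U (E p q) (\<not> even p) j = U q (even p) (ix p q) - U q (even p) (Suc (ix p q))"
    "En (E p q) (\<not> even p) j = En q (even p) (Suc (ix p q))"
    "\<And>v. \<tau> v (sq (E p q) (\<not> even p) j) = \<tau> v (sq q (even p) (Suc (ix p q))) - \<tau> v (sq q (even p) (ix p q))"
    using partner[OF q ix(1)[OF q, of p], folded E_def] by blast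
  have jx: "j = ix (Suc p) (E p q)" using partner_ix[OF q j(1)] .
  show "V p q = V (p + 2) q + V (Suc p) (E p q)" using j(1) ix_add2[OF q, of p] by (simp add: V_def jx)
  show "Tt v (p + 2) q = Tt v p q + Tt v (Suc p) (E p q)" using j(3)[of v] ix_add2[OF q, of p] by (simp add: Tt_def jx)
  show "E (p + 2) q = E (Suc p) (E p q)" using j(2) ix_add2[OF q, of p] by (simp add: E_def jx)
qed

text \<open>Inverse of \<open>ix\<close>: the records of one side, counted from its lowest level
  \<open>0\<close> or \<open>1\<close>, move two levels at a time. It is meaningful only from
  \<open>ix b q\<close> on, where the subtraction is exact.\<close>

definition lev :: "nat \<Rightarrow> bool \<Rightarrow> nat \<Rightarrow> nat" where
  "lev q r i = (let b = (if r then 0 else 1) in b + 2 * (i - ix b q))"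

lemma lev:
  assumes "q \<in> {1..d}" "ix (if r then 0 else 1) q \<le> i"
  shows "even (lev q r i) \<longleftrightarrow> r" "ix (lev q r i) q = i"
  using assms ix_add_even[OF assms(1), of "if r then 0 else 1" "i - ix (if r then 0 else 1) q"]
  by (auto simp: lev_def Let_def)

lemma lev_late: "\<exists>I. \<forall>q\<in>{1..d}. \<forall>r. \<forall>i\<ge>I. ix (if r then 0 else 1) q \<le> i \<and> P \<le> lev q r i"
proof -
  define I where "I = Max ((\<lambda>(q, b). ix b q) ` ({1..d} \<times> {0, 1})) + P"
  have "ix b q + P \<le> I" if "q \<in> {1..d}" "b \<in> {0, 1}" for q b
    unfolding I_def using that by (intro add_right_mono Max_ge) (auto simp: image_iff)
  then have "ix (if r then 0 else 1) q + P \<le> i" if "q \<in> {1..d}" "I \<le> i" for r q i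
    using that by (metis (full_types) insertCI order_trans)
  then have "ix (if r then 0 else 1) q \<le> i \<and> P \<le> lev q r i" if "q \<in> {1..d}" "I \<le> i" for q r i
  proof -
    have "ix (if r then 0 else 1) q + P \<le> i"
      using that \<open>\<And>r q i. q \<in> {1..d} \<Longrightarrow> I \<le> i \<Longrightarrow> ix (if r then 0 else 1) q + P \<le> i\<close> by blast
    then show ?thesis by (cases r) (simp_all add: lev_def)
  qed
  then show ?thesis by blast
qed

text \<open>By \<open>net\<close> every value of \<open>E\<close> at level \<open>p + 2\<close> is a
  value at level \<open>p + 1\<close>, so the images shrink.\<close>

lemma E_image_mono: assumes "1 \<le> k" "k \<le> p" shows "E p ` {1..d} \<subseteq> E k ` {1..d}"
  using assms(2)
proof (induction p rule: dec_induct)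
  case (step p)
  have "E (Suc p) q \<in> E p ` {1..d}" if q: "q \<in> {1..d}" for q
  proof -
    obtain p' where p': "p = Suc p'" using step(1) assms(1) by (cases p) auto
    show ?thesis using net(3)[OF q, of p'] E_range[OF q, of p'] p' by auto
  qed
  then show ?case using step.IH by blast
qed simp

text \<open>As the images shrink with growing level, it is enough to hit \<open>x\<close> at some
  late level. The cut point \<open>cut x n\<close> of a late time, moved to the base of its
  triangle, is a record with singularity \<open>x\<close>.\<close>

lemma E_surj: assumes "1 \<le> k" "x \<in> {1..d}" shows "x \<in> E k ` {1..d}"
proof -
  obtain I where I: "\<And>q r i. q \<in> {1..d} \<Longrightarrow> I \<le> i \<Longrightarrow> ix (if r then 0 else 1) q \<le> i \<and> k \<le> lev q r i"
    using lev_late[of k] by blast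
  obtain M where M: "\<And>n q r i. M \<le> n \<Longrightarrow> q \<in> {1..d} \<Longrightarrow> near n (U q r i) \<Longrightarrow> I \<le> i"
    using near_index_late[of I] by blast
  obtain M2 where M2: "N1 \<le> M2" "\<And>n a b. M2 \<le> n \<Longrightarrow> a \<in> C n \<Longrightarrow> b \<in> C n \<Longrightarrow> nb n a b \<Longrightarrow>
      c \<le> real n * \<bar>b - a\<bar> \<and> real n * \<bar>b - a\<bar> \<le> 20 * c"
    using near_gaps by blast
  define n where "n = max M M2"
  have n: "M \<le> n" "M2 \<le> n" "N1 \<le> n" using M2(1) by (auto simp: n_def)
  obtain lo hi p i where L: "nb n lo hi" "lo \<in> C n" "hi \<in> C n" "p \<in> {1..d}"
    "U p (lo < hi) i = \<bar>hi - lo\<bar>" "En p (lo < hi) (Suc i) = x"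
    using fwd_lift[OF n(3) assms(2)] by blast
  let ?r = "lo < hi"
  have "near n (U p ?r i)" using M2(2)[OF n(2) L(2,3,1)] L(5) c_pos by (auto simp: near_def)
  then have "I \<le> Suc i" using M[OF n(1) L(4)] by fastforce
  note l = I[OF L(4) this, of ?r] and lv = lev[OF L(4), of ?r "Suc i"]
  have "E (lev p ?r (Suc i)) p = x" using lv l L(6) by (simp add: E_def)
  then have "x \<in> E (lev p ?r (Suc i)) ` {1..d}" using L(4) by blast
  then show ?thesis using E_image_mono[OF assms(1), of "lev p ?r (Suc i)"] l by blast
qed

lemma E_bij: assumes "1 \<le> k" shows "bij_betw (E k) {1..d} {1..d}"
proof -
  have s: "{1..d} \<subseteq> E k ` {1..d}" using E_surj[OF assms] by blast
  then have "inj_on (E k) {1..d}" by (intro finite_surj_inj) auto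
  moreover have "E k ` {1..d} = {1..d}" using s E_range by blast
  ultimately show ?thesis by (simp add: bij_betw_def)
qed

section \<open>All edges have asymptotically equal product\<close>

definition \<alpha> :: "nat \<Rightarrow> nat \<Rightarrow> real" where "\<alpha> p q = gr ^ p * V p q"
definition \<beta> :: "(nat \<Rightarrow> real) \<Rightarrow> nat \<Rightarrow> nat \<Rightarrow> real" where "\<beta> v p q = Tt v p q / gr ^ p"

lemma V_\<alpha>: "V p q = \<alpha> p q / gr ^ p" and Tt_\<beta>: "Tt v p q = \<beta> v p q * gr ^ p"
  using gr_inv(3) by (auto simp: \<alpha>_def \<beta>_def)

lemma \<alpha>\<beta>_rec:
  assumes "q \<in> {1..d}"
  shows "\<alpha> p q = (1/gr)^2 * \<alpha> (p + 2) q + (1/gr) * \<alpha> (Suc p) (E p q)"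
    "\<beta> v (p + 2) q = (1/gr)^2 * \<beta> v p q + (1/gr) * \<beta> v (Suc p) (E p q)"
  using net(1)[OF assms, of p] net(2)[OF assms, of v p] gr_inv(3)
  by (simp_all add: \<alpha>_def \<beta>_def field_simps power2_eq_square)

lemma V_pos: "q \<in> {1..d} \<Longrightarrow> 0 < V p q"
  using U_shape(1) by (simp add: V_def)

lemma VTt: assumes "q \<in> {1..d}" shows "V p q * Tt w p q \<le> 2 * c" "0 < Tt w p q"
proof -
  have "V p q * Tt w p q \<le> (1 + 3 * e) * c" using U_shape(5)[OF assms, of "even p" "ix p q"] by (simp add: V_def Tt_def)
  also have "\<dots> \<le> 2 * c" using e c_pos by (intro mult_right_mono) auto
  finally show "V p q * Tt w p q \<le> 2 * c" .
  show "0 < Tt w p q" using U_shape(6)[OF assms] by (simp add: Tt_def)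
qed

lemma gr_average: "(1/gr)^2 * x + (1/gr) * x = x" for x :: real
  using gr_inv(2) by (metis distrib_right add.commute mult_1)

lemma \<beta>_upper: "\<exists>B. \<forall>p. \<forall>q\<in>{1..d}. \<beta> v p q \<le> B"
proof -
  define B where "B = Max ((\<lambda>(p, q). \<beta> v p q) ` ({0, 1} \<times> {1..d}))"
  have B: "\<beta> v p q \<le> B" if "p \<in> {0, 1}" "q \<in> {1..d}" for p q
    unfolding B_def using that by (intro Max_ge) (auto simp: image_iff)
  have "\<forall>q\<in>{1..d}. \<beta> v p q \<le> B \<and> \<beta> v (Suc p) q \<le> B" for p
  proof (induction p)
    case 0 then show ?case using B by simp
  next
    case (Suc p)
    have "\<beta> v (p + 2) q \<le> B" if q: "q \<in> {1..d}" for q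
    proof -
      have "\<beta> v (p + 2) q \<le> (1/gr)^2 * B + (1/gr) * B"
        unfolding \<alpha>\<beta>_rec(2)[OF q] using Suc q E_range[OF q] gr_inv by (intro add_mono mult_left_mono) auto
      then show ?thesis by (simp only: gr_average)
    qed
    then show ?case using Suc by simp
  qed
  then show ?thesis by blast
qed

lemma \<beta>_lower: "\<exists>b>0. \<forall>p. \<forall>q\<in>{1..d}. b \<le> \<beta> w p q"
proof -
  have pos: "0 < \<beta> w p q" if "q \<in> {1..d}" for p q using VTt(2)[OF that] gr_inv(3) by (simp add: \<beta>_def)
  define b where "b = Min ((\<lambda>(p, q). \<beta> w p q) ` ({0, 1} \<times> {1..d}))"
  have ne: "(\<lambda>(p, q). \<beta> w p q) ` ({0::nat, 1} \<times> {1..d}) \<noteq> {}" using one_mem by blast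
  have "b \<in> (\<lambda>(p, q). \<beta> w p q) ` ({0, 1} \<times> {1..d})" unfolding b_def using ne by (intro Min_in) auto
  then have "0 < b" using pos by auto
  have b: "b \<le> \<beta> w p q" if "p \<in> {0, 1}" "q \<in> {1..d}" for p q
    unfolding b_def using that by (intro Min_le) (auto simp: image_iff)
  have "\<forall>q\<in>{1..d}. b \<le> \<beta> w p q \<and> b \<le> \<beta> w (Suc p) q" for p
  proof (induction p)
    case 0 then show ?case using b by simp
  next
    case (Suc p)
    have "b \<le> \<beta> w (p + 2) q" if q: "q \<in> {1..d}" for q
    proof -
      have "(1/gr)^2 * b + (1/gr) * b \<le> \<beta> w (p + 2) q"
        unfolding \<alpha>\<beta>_rec(2)[OF q] using Suc q E_range[OF q] gr_inv by (intro add_mono mult_left_mono) auto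
      then show ?thesis by (simp only: gr_average)
    qed
    then show ?case using Suc by simp
  qed
  then show ?thesis using \<open>0 < b\<close> by blast
qed

text \<open>The recurrence for \<open>\<alpha>\<close> expresses a value by later ones, so it gives
  no bound in advance. The bound comes from the products \<open>V p q * Tt w p q \<le> 2 * c\<close>
  and the lower bound for the ages.\<close>

lemma \<alpha>_bound: "\<exists>K>0. \<forall>p. \<forall>q\<in>{1..d}. 0 \<le> \<alpha> p q \<and> \<alpha> p q \<le> K"
proof -
  obtain b where b: "b > 0" "\<And>p q. q \<in> {1..d} \<Longrightarrow> b \<le> \<beta> w p q" using \<beta>_lower by blast
  have "0 \<le> \<alpha> p q \<and> \<alpha> p q \<le> 2 * c / b" if q: "q \<in> {1..d}" for p q
  proof -
    have a: "0 \<le> \<alpha> p q" using V_pos[OF q, of p] gr_inv(3) by (simp add: \<alpha>_def)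
    have "\<alpha> p q * b \<le> \<alpha> p q * \<beta> w p q" using b(2)[OF q] a by (intro mult_left_mono)
    also have "\<dots> = V p q * Tt w p q" using gr_inv(3) by (simp add: \<alpha>_def \<beta>_def)
    also have "\<dots> \<le> 2 * c" by (rule VTt(1)[OF q])
    finally show ?thesis using a b(1) by (simp add: field_simps)
  qed
  then show ?thesis using b(1) c_pos by (intro exI[of _ "2 * c / b"]) auto
qed

lemma \<beta>_nonneg: "weight v \<Longrightarrow> 0 \<le> \<beta> v p q"
  using \<tau>_nonneg[of v] gr_inv(3) by (simp add: \<beta>_def Tt_def)

text \<open>A function of the edges that hardly changes when a late edge is cut.\<close>

definition flat :: "(nat \<Rightarrow> nat \<Rightarrow> real) \<Rightarrow> bool" where
  "flat f \<longleftrightarrow> (\<forall>\<kappa>>0. \<exists>P. \<forall>p\<ge>P. \<forall>q\<in>{1..d}. \<bar>f p q - f (p + 2) q\<bar> \<le> \<kappa> \<and> \<bar>f p q - f (Suc p) (E p q)\<bar> \<le> \<kappa>)"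

lemma flatI:
  assumes "\<And>q. q \<in> {1..d} \<Longrightarrow> (\<lambda>p. g p q) \<longlonglongrightarrow> 0"
    and "\<And>p q. q \<in> {1..d} \<Longrightarrow> \<bar>f (Suc p) q - f (Suc p + 2) q\<bar> \<le> \<bar>g p q\<bar> \<and> \<bar>f (Suc p) q - f (Suc (Suc p)) (E (Suc p) q)\<bar> \<le> \<bar>g p q\<bar>"
  shows "flat f"
  unfolding flat_def
proof (intro allI impI)
  fix \<kappa> :: real assume \<kappa>: "0 < \<kappa>"
  have "\<forall>\<^sub>F p in sequentially. \<forall>q\<in>{1..d}. \<bar>g p q\<bar> < \<kappa>"
    using assms(1) \<kappa> by (intro eventually_ball_finite) (auto simp: tendsto_iff dist_real_def)
  then obtain P where P: "\<And>p q. P \<le> p \<Longrightarrow> q \<in> {1..d} \<Longrightarrow> \<bar>g p q\<bar> < \<kappa>" unfolding eventually_sequentially by blast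
  have "\<bar>f p q - f (p + 2) q\<bar> \<le> \<kappa> \<and> \<bar>f p q - f (Suc p) (E p q)\<bar> \<le> \<kappa>" if p: "Suc P \<le> p" and q: "q \<in> {1..d}" for p q
  proof -
    obtain p' where p': "p = Suc p'" "P \<le> p'" using p by (cases p) auto
    show ?thesis using assms(2)[OF q, of p'] P[OF p'(2) q] unfolding p'(1) by linarith
  qed
  then show "\<exists>P. \<forall>p\<ge>P. \<forall>q\<in>{1..d}. \<bar>f p q - f (p + 2) q\<bar> \<le> \<kappa> \<and> \<bar>f p q - f (Suc p) (E p q)\<bar> \<le> \<kappa>" by blast
qed

lemma scaled_le: "\<bar>(1/gr) * x\<bar> \<le> \<bar>x\<bar>" "\<bar>(1/gr)^2 * x\<bar> \<le> \<bar>x\<bar>" for x :: real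
proof -
  have 1: "\<bar>(1/gr) * x\<bar> \<le> \<bar>x\<bar>" for x :: real
  proof -
    have "(1/gr) * \<bar>x\<bar> \<le> 1 * \<bar>x\<bar>" using gr_inv(4) by (intro mult_right_mono) (auto simp: field_simps)
    then show ?thesis using gr_inv(3) by (simp add: abs_mult)
  qed
  then show "\<bar>(1/gr) * x\<bar> \<le> \<bar>x\<bar>" .
  have "(1/gr)^2 * x = (1/gr) * ((1/gr) * x)" by (simp add: power2_eq_square)
  then show "\<bar>(1/gr)^2 * x\<bar> \<le> \<bar>x\<bar>" using 1[of x] 1[of "(1/gr) * x"] by linarith
qed

text \<open>Each value is an average of two later ones, so both differences are fixed multiples of
  the difference of these two, which tends to \<open>0\<close>. The shift by \<open>Suc\<close> is
  made because \<open>E k\<close> is known to be bijective for \<open>k \<ge> 1\<close>.\<close>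

lemma flat_\<alpha>: "flat \<alpha>"
proof -
  obtain K where K: "\<And>p q. q \<in> {1..d} \<Longrightarrow> 0 \<le> \<alpha> p q \<and> \<alpha> p q \<le> K" using \<alpha>_bound by blast
  define g where "g p q = \<alpha> (Suc (p + 2)) q - \<alpha> (Suc (Suc p)) (E (Suc p) q)" for p q
  show ?thesis
  proof (rule flatI[of g])
    fix q assume q: "q \<in> {1..d}"
    show "(\<lambda>p. g p q) \<longlonglongrightarrow> 0" unfolding g_def
    proof (rule backward_recurrence[where S = "{1..d}" and K = K and a = "\<lambda>p. \<alpha> (Suc p)"])
      show "bij_betw (E (Suc p)) {1..d} {1..d}" for p using E_bij by simp
      show "\<alpha> (Suc p) q = (1 / gr)\<^sup>2 * \<alpha> (Suc (p + 2)) q + 1 / gr * \<alpha> (Suc (Suc p)) (E (Suc p) q)"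
        if "q \<in> {1..d}" for p q using \<alpha>\<beta>_rec(1)[OF that, of "Suc p"] by simp
      show "\<bar>\<alpha> (Suc p) q\<bar> \<le> K" if "q \<in> {1..d}" for p q using K[OF that, of "Suc p"] by simp
    qed (use q in auto)
  next
    fix p q assume q: "q \<in> {1..d}"
    define x y z where "x = \<alpha> (Suc p) q" and "y = \<alpha> (Suc p + 2) q" and "z = \<alpha> (Suc (Suc p)) (E (Suc p) q)"
    have r: "x = (1/gr)^2 * y + (1/gr) * z" unfolding x_def y_def z_def by (rule \<alpha>\<beta>_rec(1)[OF q])
    have "x - y = (1/gr) * (z - y)" "x - z = (1/gr)^2 * (y - z)"
      using gr_average[of y] gr_average[of z] r unfolding right_diff_distrib by linarith+
    moreover have "g p q = y - z" by (simp add: g_def y_def z_def)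
    ultimately have "\<bar>x - y\<bar> \<le> \<bar>g p q\<bar> \<and> \<bar>x - z\<bar> \<le> \<bar>g p q\<bar>"
      using scaled_le(1)[of "z - y"] scaled_le(2)[of "y - z"] by (simp add: abs_minus_commute)
    then show "\<bar>\<alpha> (Suc p) q - \<alpha> (Suc p + 2) q\<bar> \<le> \<bar>g p q\<bar> \<and> \<bar>\<alpha> (Suc p) q - \<alpha> (Suc (Suc p)) (E (Suc p) q)\<bar> \<le> \<bar>g p q\<bar>"
      by (simp only: x_def y_def z_def)
  qed
qed

lemma flat_\<beta>: "flat (\<beta> v)"
proof -
  define g where "g p q = \<beta> v (Suc p) q - \<beta> v (Suc (Suc p)) (E (Suc p) q)" for p q
  show ?thesis
  proof (rule flatI[of g])
    fix q assume q: "q \<in> {1..d}"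
    show "(\<lambda>p. g p q) \<longlonglongrightarrow> 0" unfolding g_def
    proof (rule forward_recurrence[where S = "{1..d}" and b = "\<lambda>p. \<beta> v (Suc p)"])
      show "bij_betw (E (Suc p)) {1..d} {1..d}" for p using E_bij by simp
      show "\<beta> v (Suc (p + 2)) q = (1 / gr)\<^sup>2 * \<beta> v (Suc p) q + 1 / gr * \<beta> v (Suc (Suc p)) (E (Suc p) q)"
        if "q \<in> {1..d}" for p q using \<alpha>\<beta>_rec(2)[OF that, of v "Suc p"] by simp
    qed (use q in auto)
  next
    fix p q assume q: "q \<in> {1..d}"
    define x y z where "x = \<beta> v (Suc p) q" and "y = \<beta> v (Suc p + 2) q" and "z = \<beta> v (Suc (Suc p)) (E (Suc p) q)"
    have r: "y = (1/gr)^2 * x + (1/gr) * z" unfolding x_def y_def z_def by (rule \<alpha>\<beta>_rec(2)[OF q])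
    have "x - y = (1/gr) * (x - z)" using gr_average[of x] r unfolding right_diff_distrib by linarith
    moreover have "g p q = x - z" by (simp add: g_def x_def z_def)
    ultimately have "\<bar>x - y\<bar> \<le> \<bar>g p q\<bar> \<and> \<bar>x - z\<bar> \<le> \<bar>g p q\<bar>" using scaled_le(1)[of "x - z"] by simp
    then show "\<bar>\<beta> v (Suc p) q - \<beta> v (Suc p + 2) q\<bar> \<le> \<bar>g p q\<bar> \<and> \<bar>\<beta> v (Suc p) q - \<beta> v (Suc (Suc p)) (E (Suc p) q)\<bar> \<le> \<bar>g p q\<bar>"
      by (simp only: x_def y_def z_def)
  qed
qed

lemma lev_ix: "q \<in> {1..d} \<Longrightarrow> lev q (even p) (ix p q) = p"
proof (cases "even p")
  case True
  then obtain k where "p = 0 + 2 * k" by auto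
  moreover assume "q \<in> {1..d}"
  ultimately show ?thesis using ix_add_even[of q 0 k] by (simp add: lev_def)
next
  case False
  then obtain k where "p = 1 + 2 * k" by (metis oddE add.commute)
  moreover assume "q \<in> {1..d}"
  ultimately show ?thesis using ix_add_even[of q 1 k] by (simp add: lev_def)
qed

text \<open>Flatness is the hypothesis of the propagation, read on records: the next record is two
  levels on, the partner is one level on at \<open>E p q\<close>. So \<open>f\<close> is almost
  constant over all edges of one scale.\<close>

lemma levels_close:
  assumes f: "flat f" and \<kappa>: "0 < \<kappa>"
  shows "\<exists>M. \<forall>n\<ge>M. \<forall>q\<in>{1..d}. \<forall>q'\<in>{1..d}. \<forall>p p'. near n (V p q) \<longrightarrow> near n (V p' q') \<longrightarrow> \<bar>f p q - f p' q'\<bar> \<le> \<kappa>"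
proof -
  define val where "val q r i = f (lev q r i) q" for q r i
  define \<kappa>' where "\<kappa>' = \<kappa> / (50 * real d)"
  have \<kappa>': "0 < \<kappa>'" "50 * real d * \<kappa>' = \<kappa>" using \<kappa> d_pos by (auto simp: \<kappa>'_def)
  obtain P where P: "\<And>p q. P \<le> p \<Longrightarrow> q \<in> {1..d} \<Longrightarrow> \<bar>f p q - f (p + 2) q\<bar> \<le> \<kappa>' \<and> \<bar>f p q - f (Suc p) (E p q)\<bar> \<le> \<kappa>'"
    using f \<kappa>'(1) unfolding flat_def by metis
  obtain I where I: "\<And>q r i. q \<in> {1..d} \<Longrightarrow> I \<le> i \<Longrightarrow> ix (if r then 0 else 1) q \<le> i \<and> P \<le> lev q r i"
    using lev_late[of P] by blast
  have "\<exists>M. \<forall>n\<ge>M. \<forall>q\<in>{1..d}. \<forall>q'\<in>{1..d}. \<forall>r r' i i'. near n (U q r i) \<longrightarrow> near n (U q' r' i') \<longrightarrow>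
    dist (val q r i) (val q' r' i') \<le> 50 * real d * \<kappa>'"
  proof (rule propagation[of I])
    fix q r i assume q: "q \<in> {1..d}" and i: "I \<le> i"
    note l = I[OF q i, of r]
    have "lev q r (Suc i) = lev q r i + 2" using l by (simp add: lev_def Let_def Suc_diff_le)
    then show "dist (val q r i) (val q r (Suc i)) \<le> \<kappa>'" using P[of "lev q r i" q] l q by (simp add: val_def dist_real_def)
  next
    fix q r i j assume q: "q \<in> {1..d}" and i: "I \<le> i" and j: "U (En q r i) (\<not> r) j = U q r i - U q r (Suc i)"
    note l = I[OF q i, of r] and lv = lev[OF q conjunct1[OF I[OF q i, of r]]]
    define p where "p = lev q r i"
    have p: "even p \<longleftrightarrow> r" "ix p q = i" "P \<le> p" using lv l by (auto simp: p_def)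
    have Ep: "E p q = En q r i" using p by (simp add: E_def)
    have "j = ix (Suc p) (E p q)" using partner_ix[OF q, of p j] j p Ep by simp
    then have "lev (En q r i) (\<not> r) j = Suc p" using lev_ix[OF E_range[OF q, of p], of "Suc p"] p(1) Ep by simp
    then show "dist (val q r i) (val (En q r i) (\<not> r) j) \<le> \<kappa>'"
      using P[OF p(3) q] Ep by (simp add: val_def dist_real_def flip: p_def)
  qed (use \<kappa>' in simp)
  then obtain M where M: "\<And>n q q' r r' i i'. M \<le> n \<Longrightarrow> q \<in> {1..d} \<Longrightarrow> q' \<in> {1..d} \<Longrightarrow> near n (U q r i) \<Longrightarrow> near n (U q' r' i') \<Longrightarrow>
    dist (val q r i) (val q' r' i') \<le> \<kappa>" unfolding \<kappa>'(2) by blast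
  have "\<bar>f p q - f p' q'\<bar> \<le> \<kappa>"
    if "M \<le> n" "q \<in> {1..d}" "q' \<in> {1..d}" "near n (V p q)" "near n (V p' q')" for n p p' q q'
    using M[OF that(1-3), of "even p" "ix p q" "even p'" "ix p' q'"] that(4,5) lev_ix[OF that(2), of p] lev_ix[OF that(3), of p']
    by (simp add: V_def val_def dist_real_def)
  then show ?thesis by blast
qed

text \<open>The length of one edge is multiplied by the age of another, as in the areas
  \<open>fwd\<close> and \<open>bwd\<close>.\<close>

definition products :: "(nat \<Rightarrow> real) \<Rightarrow> nat \<Rightarrow> real \<Rightarrow> real \<Rightarrow> bool" where
  "products v n \<kappa> P \<longleftrightarrow> (\<forall>q\<in>{1..d}. \<forall>q'\<in>{1..d}. \<forall>p p'. near n (V p q) \<longrightarrow> near n (V p' q') \<longrightarrow>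
     \<bar>\<alpha> p q * \<beta> v p' q' - P\<bar> \<le> \<kappa>)"

lemma products_close:
  assumes v: "weight v" and \<kappa>: "0 < \<kappa>"
  shows "\<exists>M. \<forall>n\<ge>M. \<exists>P. products v n \<kappa> P"
proof -
  obtain K where K: "0 < K" "\<And>p q. q \<in> {1..d} \<Longrightarrow> 0 \<le> \<alpha> p q \<and> \<alpha> p q \<le> K" using \<alpha>_bound by blast
  obtain B0 where B0: "\<And>p q. q \<in> {1..d} \<Longrightarrow> \<beta> v p q \<le> B0" using \<beta>_upper[of v] by blast
  define B where "B = max B0 1"
  have B: "0 < B" "\<And>p q. q \<in> {1..d} \<Longrightarrow> \<beta> v p q \<le> B" using B0 by (auto simp: B_def intro: le_max_iff_disj[THEN iffD2])
  have k: "0 < \<kappa> / (2 * B)" "0 < \<kappa> / (2 * K)" using \<kappa> K B by auto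
  obtain M1 where M1: "\<And>n q q' p p'. M1 \<le> n \<Longrightarrow> q \<in> {1..d} \<Longrightarrow> q' \<in> {1..d} \<Longrightarrow> near n (V p q) \<Longrightarrow> near n (V p' q') \<Longrightarrow>
      \<bar>\<alpha> p q - \<alpha> p' q'\<bar> \<le> \<kappa> / (2 * B)"
    using levels_close[OF flat_\<alpha> k(1)] by blast
  obtain M2 where M2: "\<And>n q q' p p'. M2 \<le> n \<Longrightarrow> q \<in> {1..d} \<Longrightarrow> q' \<in> {1..d} \<Longrightarrow> near n (V p q) \<Longrightarrow> near n (V p' q') \<Longrightarrow>
      \<bar>\<beta> v p q - \<beta> v p' q'\<bar> \<le> \<kappa> / (2 * K)"
    using levels_close[OF flat_\<beta>[of v] k(2)] by blast
  have "\<exists>P. products v n \<kappa> P" if n: "max M1 M2 \<le> n" for n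
  proof (cases "\<exists>p q. q \<in> {1..d} \<and> near n (V p q)")
    case True
    then obtain p0 q0 where 0: "q0 \<in> {1..d}" "near n (V p0 q0)" by blast
    have "\<bar>\<alpha> p q * \<beta> v p' q' - \<alpha> p0 q0 * \<beta> v p0 q0\<bar> \<le> \<kappa>"
      if h: "q \<in> {1..d}" "q' \<in> {1..d}" "near n (V p q)" "near n (V p' q')" for p p' q q'
    proof -
      have "\<alpha> p q * \<beta> v p' q' - \<alpha> p0 q0 * \<beta> v p0 q0
          = (\<alpha> p q - \<alpha> p0 q0) * \<beta> v p' q' + \<alpha> p0 q0 * (\<beta> v p' q' - \<beta> v p0 q0)" by (simp add: algebra_simps)
      then have "\<bar>\<alpha> p q * \<beta> v p' q' - \<alpha> p0 q0 * \<beta> v p0 q0\<bar>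
          \<le> \<bar>\<alpha> p q - \<alpha> p0 q0\<bar> * \<bar>\<beta> v p' q'\<bar> + \<bar>\<alpha> p0 q0\<bar> * \<bar>\<beta> v p' q' - \<beta> v p0 q0\<bar>"
        by (metis abs_mult abs_triangle_ineq)
      also have "\<dots> \<le> \<kappa> / (2 * B) * B + K * (\<kappa> / (2 * K))"
      proof (intro add_mono mult_mono)
        show "\<bar>\<alpha> p q - \<alpha> p0 q0\<bar> \<le> \<kappa> / (2 * B)" using M1[OF _ h(1) 0(1) h(3) 0(2)] n by simp
        show "\<bar>\<beta> v p' q' - \<beta> v p0 q0\<bar> \<le> \<kappa> / (2 * K)" using M2[OF _ h(2) 0(1) h(4) 0(2)] n by simp
        show "\<bar>\<beta> v p' q'\<bar> \<le> B" using B(2)[OF h(2)] \<beta>_nonneg[OF v] by simp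
        show "\<bar>\<alpha> p0 q0\<bar> \<le> K" using K(2)[OF 0(1), of p0] by simp
      qed (use k K(1) in auto)
      also have "\<dots> = \<kappa>" using K(1) B(1) by (simp add: field_simps)
      finally show ?thesis .
    qed
    then show ?thesis unfolding products_def by blast
  qed (auto simp: products_def)
  then show ?thesis by blast
qed

lemma products_ratio:
  assumes "products v n \<kappa> P" "q \<in> {1..d}" "q' \<in> {1..d}" "near n (V p q)" "near n (V p' q')"
  shows "p' = Suc p \<Longrightarrow> \<bar>V p q * Tt v p' q' - gr * P\<bar> \<le> 2 * \<kappa>"
    "p = Suc p' \<Longrightarrow> \<bar>V p q * Tt v p' q' - P / gr\<bar> \<le> \<kappa>"
    "p = p' \<Longrightarrow> \<bar>V p q * Tt v p' q' - P\<bar> \<le> \<kappa>"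
proof -
  define A where "A = \<alpha> p q * \<beta> v p' q'"
  have A: "\<bar>A - P\<bar> \<le> \<kappa>" using assms unfolding products_def A_def by blast
  have pr: "V p q * Tt v p' q' = A / gr ^ p * gr ^ p'" by (simp add: V_\<alpha> Tt_\<beta> A_def)
  show "\<bar>V p q * Tt v p' q' - gr * P\<bar> \<le> 2 * \<kappa>" if "p' = Suc p"
  proof -
    have "V p q * Tt v p' q' - gr * P = gr * (A - P)" using pr that gr_inv(3) by (simp add: algebra_simps)
    then have "\<bar>V p q * Tt v p' q' - gr * P\<bar> = gr * \<bar>A - P\<bar>" using gr_inv(3) by (simp add: abs_mult)
    also have "\<dots> \<le> 2 * \<kappa>" using A gr(3) gr_inv(3) by (intro mult_mono) auto
    finally show ?thesis .
  qed
  show "\<bar>V p q * Tt v p' q' - P / gr\<bar> \<le> \<kappa>" if "p = Suc p'"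
  proof -
    have "V p q * Tt v p' q' - P / gr = (1/gr) * (A - P)" using pr that gr_inv(3) by (simp add: field_simps)
    then show ?thesis using scaled_le(1)[of "A - P"] A by linarith
  qed
  show "\<bar>V p q * Tt v p' q' - P\<bar> \<le> \<kappa>" if "p = p'" using A pr that gr_inv(3) by simp
qed

lemma sqrt5_gr: "gr * P + P / gr = sqrt 5 * P"
proof -
  have "P / gr = (gr - 1) * P" using gr_inv(1) by (metis mult.commute times_divide_eq_right mult_1_right)
  then show ?thesis by (simp add: gr(4) algebra_simps)
qed

definition good :: "nat \<Rightarrow> bool" where
  "good n \<longleftrightarrow> N1 \<le> n \<and> (\<forall>a\<in>C n. \<forall>b\<in>C n. nb n a b \<longrightarrow> c \<le> real n * \<bar>b - a\<bar> \<and> real n * \<bar>b - a\<bar> \<le> 20 * c) \<and>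
    (\<forall>q\<in>{1..d}. \<forall>r i. near n (U q r i) \<longrightarrow> ix (if r then 0 else 1) q \<le> i)"

lemma good_exists: "\<exists>M. \<forall>n\<ge>M. good n"
proof -
  obtain I where I: "\<And>q r i. q \<in> {1..d} \<Longrightarrow> I \<le> i \<Longrightarrow> ix (if r then 0 else 1) q \<le> i \<and> 0 \<le> lev q r i"
    using lev_late[of 0] by blast
  obtain M1 where M1: "\<And>n q r i. M1 \<le> n \<Longrightarrow> q \<in> {1..d} \<Longrightarrow> near n (U q r i) \<Longrightarrow> I \<le> i"
    using near_index_late[of I] by blast
  obtain M2 where M2: "N1 \<le> M2" "\<And>n a b. M2 \<le> n \<Longrightarrow> a \<in> C n \<Longrightarrow> b \<in> C n \<Longrightarrow> nb n a b \<Longrightarrow>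
      c \<le> real n * \<bar>b - a\<bar> \<and> real n * \<bar>b - a\<bar> \<le> 20 * c"
    using near_gaps by blast
  have "good n" if "max M1 M2 \<le> n" for n
    using that M1 M2 I unfolding good_def by (meson max.boundedE order_trans)
  then show ?thesis by blast
qed

lemma good_level:
  assumes "good n" "q \<in> {1..d}" "near n (U q r i)"
  shows "\<exists>p. (even p \<longleftrightarrow> r) \<and> ix p q = i \<and> V p q = U q r i \<and> (\<forall>v. Tt v p q = \<tau> v (sq q r i))"
proof -
  have "ix (if r then 0 else 1) q \<le> i" using assms unfolding good_def by blast
  note l = lev[OF assms(2) this]
  show ?thesis by (rule exI[of _ "lev q r i"]) (simp add: V_def Tt_def l)
qed

text \<open>The two edges at the apex have levels \<open>p + 2\<close> and \<open>p + 1\<close>, so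
  the mixed products are close to \<open>P / gr\<close> and \<open>gr * P\<close>, with sum
  \<open>sqrt 5 * P\<close>. The shift \<open>k\<close> of the lifted ages contributes at most one
  edge length, hence \<open>\<eta>\<close>.\<close>

lemma fwd_asymp:
  assumes v: "weight v" and g: "good n" and P: "products v n \<kappa> P" and fe: "fine n \<eta>" and q: "q \<in> {1..d}"
  shows "\<bar>fwd v n q - sqrt 5 * P\<bar> \<le> 3 * \<kappa> + \<eta>"
proof -
  define y where "y = cut q n"
  have n: "N1 \<le> n" using g by (simp add: good_def)
  have n0: "N0 \<le> n" "1 \<le> n" using n N1(1) N0 by auto
  note f = fwd_nb[OF fineN[OF n0(1)] q n0(2), folded y_def]
  from fwd_lift[OF n q, folded y_def] obtain lo hi x i where
    H: "(lo = pr n y \<and> hi = sc n y \<or> lo = sc n y \<and> hi = pr n y) \<and> ord lo < ord hi \<and> nb n lo hi \<and>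
    lo \<in> C n \<and> hi \<in> C n \<and> x \<in> {1..d} \<and>
    U x (lo < hi) i = \<bar>hi - lo\<bar> \<and> U x (lo < hi) (Suc i) = \<bar>y - lo\<bar> \<and> En x (lo < hi) (Suc i) = q \<and>
    (\<forall>v. \<exists>k. (weight v \<longrightarrow> 0 \<le> k \<and> k \<le> 1) \<and> \<tau> v (sq x (lo < hi) i) = \<tau> v hi - \<tau> v lo + k \<and>
       \<tau> v (sq x (lo < hi) (Suc i)) = \<tau> v y - \<tau> v lo + k)"
    by (elim exE) (rule that)
  have L: "lo = pr n y \<and> hi = sc n y \<or> lo = sc n y \<and> hi = pr n y" "nb n lo hi"
    "lo \<in> C n" "hi \<in> C n" "x \<in> {1..d}"
    "U x (lo < hi) i = \<bar>hi - lo\<bar>" "U x (lo < hi) (Suc i) = \<bar>y - lo\<bar>" "En x (lo < hi) (Suc i) = q"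
    using H by (safe)
  have Lt: "\<exists>k. (weight v \<longrightarrow> 0 \<le> k \<and> k \<le> 1) \<and> \<tau> v (sq x (lo < hi) i) = \<tau> v hi - \<tau> v lo + k \<and>
       \<tau> v (sq x (lo < hi) (Suc i)) = \<tau> v y - \<tau> v lo + k"
    using H by (elim conjE) (erule spec)
  obtain k where k: "0 \<le> k" "k \<le> 1" "\<tau> v (sq x (lo < hi) i) = \<tau> v hi - \<tau> v lo + k"
       "\<tau> v (sq x (lo < hi) (Suc i)) = \<tau> v y - \<tau> v lo + k" using Lt v by blast
  let ?r = "lo < hi"
  have l: "c \<le> real n * \<bar>hi - lo\<bar>" "real n * \<bar>hi - lo\<bar> \<le> 20 * c" using g L(2-4) unfolding good_def by auto
  have nU: "near n (U x ?r i)" using l L(6) c_pos by (auto simp: near_def)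
  obtain p where p: "even p \<longleftrightarrow> ?r" "ix p x = i" "V p x = U x ?r i" "Tt v p x = \<tau> v (sq x ?r i)"
    using good_level[OF g L(5) nU] by blast
  have p2: "V (p + 2) x = \<bar>y - lo\<bar>" "Tt v (p + 2) x = \<tau> v y - \<tau> v lo + k"
    using ix_add2[OF L(5), of p] p(1,2) L(7) k(4) by (auto simp: V_def Tt_def)
  let ?E = "E p x"
  have E: "?E \<in> {1..d}" using E_range[OF L(5)] .
  have yl: "\<bar>y - lo\<bar> + \<bar>y - hi\<bar> = \<bar>hi - lo\<bar>" "\<bar>y - hi\<bar> < \<eta>"
    using L(1) f(1,2) nb_fine[OF L(2) fe] by auto
  have V1: "V (Suc p) ?E = \<bar>y - hi\<bar>" using net(1)[OF L(5), of p] p(3) p2(1) L(6) yl(1) by linarith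
  have T1: "Tt v (Suc p) ?E = \<tau> v y - \<tau> v hi" using net(2)[OF L(5), of v p] p(4) p2(2) k(3) by linarith
  have s1: "\<bar>hi - lo\<bar> \<le> 3 * V (p + 2) x" "V (p + 2) x \<le> \<bar>hi - lo\<bar>" "\<bar>hi - lo\<bar> / 2 \<le> V (Suc p) ?E" "V (Suc p) ?E \<le> \<bar>hi - lo\<bar>"
    using U_ratio(2,3)[OF L(5) L(5), of ?r i] L(6,7) p2(1) V1 yl(1) by auto
  have s1n: "real n * \<bar>hi - lo\<bar> \<le> 3 * (real n * V (p + 2) x)" "real n * V (p + 2) x \<le> real n * \<bar>hi - lo\<bar>"
    "real n * \<bar>hi - lo\<bar> \<le> 2 * (real n * V (Suc p) ?E)" "real n * V (Suc p) ?E \<le> real n * \<bar>hi - lo\<bar>"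
    using mult_left_mono[OF s1(1), of "real n"] mult_left_mono[OF s1(2), of "real n"]
      mult_left_mono[OF s1(3), of "real n"] mult_left_mono[OF s1(4), of "real n"] by auto
  have nr: "near n (V (p + 2) x)" "near n (V (Suc p) ?E)" using s1n l c_pos by (auto simp: near_def)
  have "fwd v n q = \<bar>y - lo\<bar> * (\<tau> v y - \<tau> v hi) + \<bar>y - hi\<bar> * (\<tau> v y - \<tau> v lo)"
    using L(1) f(1,2) by (auto simp: fwd_def Let_def simp flip: y_def)
  also have "\<dots> = V (p + 2) x * Tt v (Suc p) ?E + V (Suc p) ?E * Tt v (p + 2) x - \<bar>y - hi\<bar> * k"
    unfolding V1 T1 p2 by (simp add: algebra_simps)
  finally have F: "fwd v n q = V (p + 2) x * Tt v (Suc p) ?E + V (Suc p) ?E * Tt v (p + 2) x - \<bar>y - hi\<bar> * k" .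
  have "0 \<le> \<bar>y - hi\<bar> * k" using k(1) by simp
  moreover have "\<bar>y - hi\<bar> * k \<le> \<bar>y - hi\<bar> * 1" using k(2) by (intro mult_left_mono) simp_all
  moreover have "\<bar>V (p + 2) x * Tt v (Suc p) ?E - P / gr\<bar> \<le> \<kappa>" using products_ratio(2)[OF P L(5) E nr] by simp
  moreover have "\<bar>V (Suc p) ?E * Tt v (p + 2) x - gr * P\<bar> \<le> 2 * \<kappa>" using products_ratio(1)[OF P E L(5) nr(2,1)] by simp
  ultimately show ?thesis using F sqrt5_gr[of P] yl(2) unfolding abs_le_iff mult_1_right by linarith
qed

lemma lx_add: "lx (p + k) \<le> lx p - (9/10) * real k"
proof (induction k)
  case (Suc k)
  moreover have "\<bar>lx (Suc (p + k)) - lx (p + k) + 1\<bar> \<le> 50 * e" by (rule lx_Suc)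
  ultimately have "lx (Suc (p + k)) \<le> lx p - (9/10) * real k - 9/10" using e_small by linarith
  moreover have "(9/10) * real (Suc k) = (9/10) * real k + 9/10" by simp
  ultimately show ?case unfolding add_Suc_right by linarith
qed simp

text \<open>\<open>gr ^ 5 = 5 * gr + 3\<close> is about 11.09 and \<open>(9/5)^4\<close> about
  10.50.\<close>

lemma log_nine_fifths: "log gr (9/5) \<le> 5/4"
proof -
  have "gr * gr * (gr * gr) * gr = 5 * gr + 3" using gr(1) by (simp add: algebra_simps)
  moreover have "(9/5)^4 \<le> 5 * gr + 3" using gr(2) by (simp add: power_numeral_reduce)
  ultimately have "(9/5)^4 \<le> gr ^ 5" by (simp add: numeral_eq_Suc mult.assoc)
  then have "log gr ((9/5)^4) \<le> log gr (gr ^ 5)" using gr_inv by (subst log_le_cancel_iff) auto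
  then show ?thesis using gr_inv log_gr(2) by (simp add: log_nat_power)
qed

text \<open>A difference of 3 or more puts the reference values \<open>lx\<close> at least
  \<open>27 / 10\<close> apart, more than \<open>5 / 4\<close> for the ratio plus
  \<open>1 / 3\<close> for each of the two edges. Odd parity then leaves a difference of
  one.\<close>

lemma adjacent_levels:
  assumes q: "q \<in> {1..d}" "q' \<in> {1..d}" and p: "odd (p + p')"
    and V: "V p q \<le> (9/5) * V p' q'" "V p' q' \<le> (9/5) * V p q"
  shows "p' = Suc p \<or> p = Suc p'"
proof -
  have *: "p' \<le> Suc p" if q: "q \<in> {1..d}" "q' \<in> {1..d}" and p: "odd (p + p')" and V: "V p q \<le> (9/5) * V p' q'" for p p' q q'
  proof (rule ccontr)
    assume "\<not> p' \<le> Suc p"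
    then have "p + 3 \<le> p'" using p by presburger
    define k where "k = p' - p"
    have k: "p' = p + k" "3 \<le> k" using \<open>p + 3 \<le> p'\<close> by (simp_all add: k_def)
    have "log gr (V p q) \<le> log gr ((9/5) * V p' q')" using V V_pos q gr_inv by (subst log_le_cancel_iff) auto
    also have "\<dots> = log gr (9/5) + log gr (V p' q')" using V_pos[OF q(2), of p'] by (subst log_mult) auto
    finally have "lU q (even p) (ix p q) \<le> 5/4 + lU q' (even p') (ix p' q')" using log_nine_fifths by (simp add: lU_def V_def)
    then have "lx p \<le> lx p' + 5/4 + 2/3" using ix(2)[OF q(1), of p] ix(2)[OF q(2), of p'] unfolding abs_le_iff by linarith
    moreover have "3 \<le> real k" using k(2) by simp
    ultimately show False using lx_add[of p k] k(1) by simp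
  qed
  have "p' \<le> Suc p" "p \<le> Suc p'" using *[OF q p V(1)] *[OF q(2,1) _ V(2)] p by (auto simp: add.commute)
  then show ?thesis using p by presburger
qed

text \<open>The left edge at \<open>Y s\<close> comes from a left record and has odd level, the
  right one has even level. By the ratio bound the levels are adjacent, and the mixed products are
  again close to \<open>gr * P\<close> and \<open>P / gr\<close>. The lifting changes the ages by at
  most \<open>2\<close> on each side.\<close>

lemma bwd_asymp:
  assumes v: "weight v" and g: "good n" and P: "products v n \<kappa> P" and fe: "fine n \<eta>" and s: "s \<in> {1..d}"
  shows "\<bar>bwd v n s - sqrt 5 * P\<bar> \<le> 3 * \<kappa> + 4 * \<eta>"
proof -
  define z a b where "z = Y s" and "a = pr n (Y s)" and "b = sc n (Y s)"
  have n: "N1 \<le> n" using g by (simp add: good_def)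
  have n0: "N0 \<le> n" using n N1(1) by auto
  note f = bwd_nb[OF fineN[OF n0] s, folded z_def a_def b_def]
  have rt: "z - a \<le> (9/5) * (b - z)" "b - z \<le> (9/5) * (z - a)"
    using bwd_ratio[OF n0 s] by (auto simp: z_def a_def b_def)
  have "c \<le> real n * \<bar>b - a\<bar> \<and> real n * \<bar>b - a\<bar> \<le> 20 * c" using g f(3,4,6) unfolding good_def by blast
  moreover have "\<bar>b - a\<bar> = b - a" using f(1,2) by simp
  ultimately have l: "c \<le> real n * (b - a)" "real n * (b - a) \<le> 20 * c" by simp_all
  have h: "b - a \<le> 4 * (z - a)" "b - a \<le> 4 * (b - z)" "z - a \<le> b - a" "b - z \<le> b - a" using rt f(1,2) by auto
  have hn: "real n * (b - a) \<le> 4 * (real n * (z - a))" "real n * (b - a) \<le> 4 * (real n * (b - z))"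
    "real n * (z - a) \<le> real n * (b - a)" "real n * (b - z) \<le> real n * (b - a)"
    using mult_left_mono[OF h(1), of "real n"] mult_left_mono[OF h(2), of "real n"]
      mult_left_mono[OF h(3), of "real n"] mult_left_mono[OF h(4), of "real n"]
    by (simp_all only: mult.left_commute[of "real n" 4] of_nat_0_le_iff)
  have nz: "near n (z - a)" "near n (b - z)" using hn l c_pos by (auto simp: near_def)
  obtain q i where q: "q \<in> {1..d}" "U q False i = z - a" "\<tau> v a \<le> \<tau> v (sq q False i)" "\<tau> v (sq q False i) \<le> \<tau> v a + 2"
    using bwd_lift_left[OF n s] v unfolding a_def z_def by blast
  obtain q' i' where q': "q' \<in> {1..d}" "U q' True i' = b - z" "\<tau> v b \<le> \<tau> v (sq q' True i')" "\<tau> v (sq q' True i') \<le> \<tau> v b + 2"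
    using bwd_lift_right[OF n s] v unfolding b_def z_def by blast
  obtain p where p: "odd p" "V p q = z - a" "Tt v p q = \<tau> v (sq q False i)"
    using good_level[OF g q(1), of False i] nz q(2) by metis
  obtain p' where p': "even p'" "V p' q' = b - z" "Tt v p' q' = \<tau> v (sq q' True i')"
    using good_level[OF g q'(1), of True i'] nz q'(2) by metis
  have nV: "near n (V p q)" "near n (V p' q')" using nz p p' by auto
  have adj: "p' = Suc p \<or> p = Suc p'" using adjacent_levels[OF q(1) q'(1), of p p'] p p' rt by simp
  define A B where "A = V p q * Tt v p' q'" and "B = V p' q' * Tt v p q"
  have AB: "\<bar>A + B - sqrt 5 * P\<bar> \<le> 3 * \<kappa>"
  proof -
    have "\<bar>A - gr * P\<bar> \<le> 2 * \<kappa> \<and> \<bar>B - P / gr\<bar> \<le> \<kappa> \<or> \<bar>A - P / gr\<bar> \<le> \<kappa> \<and> \<bar>B - gr * P\<bar> \<le> 2 * \<kappa>"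
      using adj products_ratio(1,2)[OF P q(1) q'(1) nV] products_ratio(1,2)[OF P q'(1) q(1) nV(2,1)] by (auto simp: A_def B_def)
    then show ?thesis using sqrt5_gr[of P] by linarith
  qed
  have x: "0 \<le> z - a" "0 \<le> b - z" "b - a < \<eta>" using f(1,2,5) fe by (auto simp: fine_def)
  define x1 x2 where "x1 = (z - a) * (Tt v p' q' - \<tau> v b)" and "x2 = (b - z) * (Tt v p q - \<tau> v a)"
  have AB': "A = (z - a) * \<tau> v b + x1" "B = (b - z) * \<tau> v a + x2"
    unfolding A_def B_def x1_def x2_def p(2) p'(2) by (simp_all add: right_diff_distrib)
  have x0: "0 \<le> x1" "0 \<le> x2" unfolding x1_def x2_def using x q q' p p' by (auto intro: mult_nonneg_nonneg)
  have x1: "x1 \<le> (z - a) * 2" unfolding x1_def using x q' p' by (intro mult_left_mono) auto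
  have x2: "x2 \<le> (b - z) * 2" unfolding x2_def using x q p by (intro mult_left_mono) auto
  have bw: "bwd v n s = (z - a) * \<tau> v b + (b - z) * \<tau> v a" by (simp add: bwd_def Let_def z_def a_def b_def)
  have "bwd v n s = A + B - (x1 + x2)" using bw AB' by linarith
  moreover have "x1 + x2 \<le> 4 * \<eta>" using x1 x2 x by argo
  ultimately have "bwd v n s \<le> A + B" "A + B - 4 * \<eta> \<le> bwd v n s" using x0 by linarith+
  then show ?thesis using AB unfolding abs_le_iff by linarith
qed

text \<open>All triangles have doubled area close to \<open>sqrt 5 * P\<close>, and the area
  identity for \<open>v\<close> makes their sum close to \<open>2 * \<Omega> v\<close>. This
  determines \<open>P\<close>, to which the product of every edge is close.\<close>

lemma final_products:
  assumes v: "weight v" and \<epsilon>: "0 < \<epsilon>"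
  shows "\<exists>M. \<forall>n\<ge>M. \<forall>a\<in>C n. \<forall>b\<in>C n. a \<in> cuts \<longrightarrow> nb n a b \<longrightarrow> ord a < ord b \<longrightarrow>
    \<Omega> v / (real d * sqrt 5) - \<epsilon> \<le> \<bar>b - a\<bar> * (\<tau> v b - \<tau> v a)"
proof -
  define \<sigma> where "\<sigma> = (\<Sum>i=1..Suc d. v i)"
  have v0: "\<And>i. i \<in> {1..Suc d} \<Longrightarrow> 0 \<le> v i" using weightD[OF v] by simp
  then have \<sigma>: "0 \<le> \<sigma>" unfolding \<sigma>_def by (rule sum_nonneg)
  \<comment> \<open>The errors add up to \<open>3 * \<kappa> + (4 + \<sigma>) * \<eta> \<le> 7/8 *
    \<epsilon>\<close>; division by \<open>sqrt 5 > 2\<close> leaves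
    \<open>7/16 * \<epsilon>\<close>, and another \<open>\<kappa>\<close> comes from comparing the
    edge with \<open>P\<close>.\<close>
  define \<kappa> \<eta> where "\<kappa> = \<epsilon> / 8" and "\<eta> = min lmin (\<epsilon> / (2 * (4 + \<sigma>)))"
  have lm: "0 < lmin" by (rule lmin(1))
  have pos: "0 < \<kappa>" "0 < \<eta>" using \<epsilon> \<sigma> lm by (auto simp: \<kappa>_def \<eta>_def)
  have \<eta>: "(4 + \<sigma>) * \<eta> \<le> \<epsilon> / 2"
  proof -
    have "(4 + \<sigma>) * \<eta> \<le> (4 + \<sigma>) * (\<epsilon> / (2 * (4 + \<sigma>)))" using \<sigma> by (intro mult_left_mono) (auto simp: \<eta>_def)
    also have "\<dots> = \<epsilon> / 2" using \<sigma> by (simp add: field_simps)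
    finally show ?thesis .
  qed
  obtain M1 where M1: "\<And>n. M1 \<le> n \<Longrightarrow> good n" using good_exists by blast
  obtain M2 where M2: "\<And>n. M2 \<le> n \<Longrightarrow> \<exists>P. products v n \<kappa> P" using products_close[OF v pos(1)] by blast
  obtain M3 where M3: "\<And>n. M3 \<le> n \<Longrightarrow> fine n \<eta>" using fine_exists[OF pos(2)] by blast
  have "\<Omega> v / (real d * sqrt 5) - \<epsilon> \<le> \<bar>b - a\<bar> * (\<tau> v b - \<tau> v a)"
    if n: "Max {M1, M2, M3} \<le> n" and ab: "a \<in> C n" "b \<in> C n" "a \<in> cuts" "nb n a b" "ord a < ord b" for n a b
  proof -
    have g: "good n" "fine n \<eta>" "fine (Suc n) \<eta>" using n M1 M3 by auto
    obtain P where P: "products v n \<kappa> P" using M2[of n] n by auto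
    have n1: "N1 \<le> n" "fine n lmin" using g(1) N1(1) fineN by (auto simp: good_def)
    have "\<bar>(\<Sum>q=1..d. fwd v n q) - real d * (sqrt 5 * P)\<bar> \<le> real d * (3 * \<kappa> + 4 * \<eta>)"
    proof -
      have "(\<Sum>q=1..d. fwd v n q) - real d * (sqrt 5 * P) = (\<Sum>q=1..d. fwd v n q - sqrt 5 * P)" by (simp add: sum_subtractf)
      also have "\<bar>\<dots>\<bar> \<le> (\<Sum>q=1..d. \<bar>fwd v n q - sqrt 5 * P\<bar>)" by (rule sum_abs)
      also have "\<dots> \<le> (\<Sum>q=1..d. 3 * \<kappa> + 4 * \<eta>)" 
        by (intro sum_mono order_trans[OF fwd_asymp[OF v g(1) P g(2)]]) (use pos in auto)
      finally show ?thesis by simp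
    qed
    moreover have "\<bar>(\<Sum>s=1..d. bwd v n s) - real d * (sqrt 5 * P)\<bar> \<le> real d * (3 * \<kappa> + 4 * \<eta>)"
    proof -
      have "(\<Sum>s=1..d. bwd v n s) - real d * (sqrt 5 * P) = (\<Sum>s=1..d. bwd v n s - sqrt 5 * P)" by (simp add: sum_subtractf)
      also have "\<bar>\<dots>\<bar> \<le> (\<Sum>s=1..d. \<bar>bwd v n s - sqrt 5 * P\<bar>)" by (rule sum_abs)
      also have "\<dots> \<le> (\<Sum>s=1..d. 3 * \<kappa> + 4 * \<eta>)" using bwd_asymp[OF v g(1) P g(2)] by (intro sum_mono) auto
      finally show ?thesis by simp
    qed
    moreover note area_identity[OF n1(2), of v]
    moreover have "bdry v n \<le> 2 * \<eta> * \<sigma>" using bdry_le[OF v0 g(3)] pos by (simp add: \<sigma>_def)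
    ultimately have "2 * \<Omega> v - 2 * (\<eta> * \<sigma>) \<le> 2 * (real d * (sqrt 5 * P)) + 2 * (real d * (3 * \<kappa> + 4 * \<eta>))"
      by (simp add: abs_le_iff)
    moreover have "\<eta> * \<sigma> \<le> real d * (\<eta> * \<sigma>)" using mult_right_mono[of 1 "real d" "\<eta> * \<sigma>"] d_pos pos \<sigma> by simp
    ultimately have "\<Omega> v \<le> real d * (sqrt 5 * P + (3 * \<kappa> + 4 * \<eta>) + \<eta> * \<sigma>)" by (simp add: algebra_simps)
    then have "\<Omega> v / real d \<le> sqrt 5 * P + (3 * \<kappa> + 4 * \<eta>) + \<eta> * \<sigma>" using d_pos by (simp add: field_simps)
    also have "\<dots> \<le> sqrt 5 * P + 7/8 * \<epsilon>" using \<eta> by (simp add: \<kappa>_def algebra_simps)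
    also have "\<dots> \<le> sqrt 5 * (P + 7/16 * \<epsilon>)" using \<epsilon> sqrt5_bounds mult_right_mono[of 2 "sqrt 5" "7/16 * \<epsilon>"] by (simp add: algebra_simps)
    finally have "\<Omega> v / real d / sqrt 5 \<le> P + 7/16 * \<epsilon>" by (subst pos_divide_le_eq) (auto simp: mult.commute)
    then have "\<Omega> v / (real d * sqrt 5) \<le> P + 7/16 * \<epsilon>" by (simp only: divide_divide_eq_left)
    moreover have "\<bar>\<bar>b - a\<bar> * (\<tau> v b - \<tau> v a) - P\<bar> \<le> \<kappa>"
    proof -
      have qa: "qof a \<in> {1..d}" using cuts_eq[OF ab(3)] by simp
      obtain i where i: "U (qof a) (a < b) i = \<bar>b - a\<bar>" "\<tau> v (sq (qof a) (a < b) i) = \<tau> v b - \<tau> v a"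
        using edge_record[OF n1(1) ab(1,2,4,5,3)] by blast
      have "c \<le> real n * \<bar>b - a\<bar>" "real n * \<bar>b - a\<bar> \<le> 20 * c" using g(1) ab unfolding good_def by auto
      then have nr: "near n (U (qof a) (a < b) i)" using i c_pos by (auto simp: near_def)
      obtain p where "V p (qof a) = U (qof a) (a < b) i" "Tt v p (qof a) = \<tau> v (sq (qof a) (a < b) i)"
        using good_level[OF g(1) qa nr] by blast
      then show ?thesis using products_ratio(3)[OF P qa qa, of p p] nr i by simp
    qed
    ultimately show ?thesis unfolding \<kappa>_def by linarith
  qed
  then show ?thesis by blast
qed

end

section \<open>The isolated point of the spectrum\<close>

context keane_iet
begin

lemma \<tau>_one: "\<tau> (\<lambda>_. 1) y = real (ord y)"
  by (simp add: \<tau>_def)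

text \<open>The ends of the smallest gap at time \<open>n\<close> differ in order by at most
  \<open>n\<close>, so its length times \<open>n\<close> is at least the product of the edge. A gap
  at \<open>0\<close> or \<open>\<Lambda>\<close> is pulled back one step to a gap at a
  singularity.\<close>

lemma iet_E_ge:
  assumes H: "\<And>\<epsilon>. 0 < \<epsilon> \<Longrightarrow> \<exists>M. \<forall>n\<ge>M. \<forall>a\<in>C n. \<forall>b\<in>C n. a \<in> cuts \<longrightarrow> nb n a b \<longrightarrow> ord a < ord b \<longrightarrow>
    K - \<epsilon> \<le> \<bar>b - a\<bar> * (real (ord b) - real (ord a))"
  shows "ereal (K / \<Lambda>) \<le> iet_E (Suc d) \<pi> lam"
proof -
  have gap: "\<exists>N. \<forall>n\<ge>N. K - \<epsilon> \<le> real n * gap_min n" if \<epsilon>: "0 < \<epsilon>" for \<epsilon>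
  proof -
    obtain M where M: "\<And>n a b. M \<le> n \<Longrightarrow> a \<in> C n \<Longrightarrow> b \<in> C n \<Longrightarrow> a \<in> cuts \<Longrightarrow> nb n a b \<Longrightarrow> ord a < ord b \<Longrightarrow>
      K - \<epsilon> \<le> \<bar>b - a\<bar> * (real (ord b) - real (ord a))" using H[OF \<epsilon>] by blast
    obtain M' where M': "\<And>n. M' \<le> n \<Longrightarrow> fine n lmin" using fine_exists[OF lmin(1)] by blast
    have "K - \<epsilon> \<le> real n * gap_min n" if n: "max M M' \<le> n" for n
    proof -
      have key: "K - \<epsilon> \<le> \<bar>hi - lo\<bar> * real n"
        if lh: "lo \<in> C n" "hi \<in> C n" "nb n lo hi" "ord lo < ord hi" "\<bar>hi - lo\<bar> < lmin" for lo hi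
      proof -
        have hc: "ord hi < n" using lh(2,4) by (auto simp: C_mem)
        have based: "K - \<epsilon> \<le> \<bar>hi - lo\<bar> * real n"
          if b: "x \<in> {1..d}" "hi' \<in> cuts" "ord hi' = Suc (ord hi)" "nb (Suc n) (X x) hi'" "hi' - X x = hi - lo" for x hi'
        proof -
          have "X x \<in> C (Suc n)" "ord (X x) = 0" "X x \<in> cuts" "hi' \<in> C (Suc n)"
            using X_cuts[OF b(1)] b(2,3) hc by (auto simp: C_mem)
          then have "K - \<epsilon> \<le> \<bar>hi' - X x\<bar> * (real (ord hi') - real (ord (X x)))"
            using M[of "Suc n" "X x" hi'] n b(3,4) by simp
          also have "\<dots> \<le> \<bar>hi' - X x\<bar> * real n" using hc b(3) by (intro mult_left_mono) auto
          finally show ?thesis by (simp only: b(5))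
        qed
        consider "lo \<in> cuts" | "lo = 0" | "lo = \<Lambda>" using lh(1) by (auto simp: C_mem)
        then show ?thesis
        proof cases
          case 1
          have "K - \<epsilon> \<le> \<bar>hi - lo\<bar> * (real (ord hi) - real (ord lo))" using M lh 1 n by auto
          also have "\<dots> \<le> \<bar>hi - lo\<bar> * real n" using hc by (intro mult_left_mono) auto
          finally show ?thesis .
        next
          case 2
          obtain j where j: "j \<in> {1..Suc d}" "\<pi> j = 1" using \<pi>_surj[of 1] by auto
          then have j1: "j - 1 \<in> {1..d}" using \<pi>_first by (cases "j = 1") auto
          have hp: "0 < hi" using lh(2) C_range[OF lh(2)] nb_neq[OF lh(3)] 2 by auto
          then have fr: "free n (Y (\<pi> j - 1)) hi" using lh(3) 2 j by (simp add: nb_def)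
          have sm: "hi - Y (\<pi> j - 1) < lmin" using lh(5) 2 j hp by simp
          note pu = pull_right[OF j(1) lh(2) fr sm]
          show ?thesis by (rule based[OF j1 pu(1,3) nb_free(1)[OF pu(5)]]) (use 2 j in simp)
        next
          case 3
          obtain j where j: "j \<in> {1..Suc d}" "\<pi> j = Suc d" using \<pi>_surj[of "Suc d"] by auto
          then have j1: "j \<in> {1..d}" using \<pi>_last by (cases "j = Suc d") auto
          have hp: "hi < \<Lambda>" using lh(2) C_range[OF lh(2)] nb_neq[OF lh(3)] 3 by auto
          then have fr: "free n hi (Y (\<pi> j))" using lh(3) 3 j by (simp add: nb_def Y_top)
          have sm: "Y (\<pi> j) - hi < lmin" using lh(5) 3 j hp by (simp add: Y_top)
          note pu = pull_left[OF j(1) lh(2) fr sm]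
          show ?thesis by (rule based[OF j1 pu(1,3) nb_free(2)[OF pu(5)]]) (use 3 j in \<open>simp add: Y_top\<close>)
        qed
      qed
      obtain a b where ab: "(a, b) \<in> gaps (C n)" "gap_min n = b - a" using gap_min(2)[of n] by blast
      then have ab': "a \<in> C n" "b \<in> C n" "a < b" "\<forall>y\<in>C n. y \<le> a \<or> b \<le> y" by (auto simp: gaps_def)
      have "free n a b" using ab' C_range[OF ab'(1)] C_range[OF ab'(2)] unfolding free_def by blast
      then have nb: "nb n a b" "nb n b a" using nb_free by auto
      have sm: "\<bar>b - a\<bar> < lmin" using \<open>free n a b\<close> M'[of n] n ab'(3) by (auto simp: fine_def)
      have "ord a \<noteq> ord b" using equal_ord[of a n b] ab' nb sm by fastforce
      then show ?thesis using key[OF ab'(1,2) nb(1)] key[OF ab'(2,1) nb(2)] sm ab(2) ab'(3)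
        by (cases "ord a < ord b") (auto simp: abs_minus_commute mult.commute)
    qed
    then show ?thesis by blast
  qed
  show ?thesis
    unfolding iet_E_eq le_Liminf_iff
  proof (intro allI impI)
    fix y assume "y < ereal (K / \<Lambda>)"
    then obtain r where r: "y < ereal r" "r < K / \<Lambda>" using ereal_dense2[of y "ereal (K / \<Lambda>)"] by auto
    then have "0 < K - r * \<Lambda>" using \<Lambda>_pos by (simp add: field_simps)
    then obtain N where N: "\<And>n. N \<le> n \<Longrightarrow> K - (K - r * \<Lambda>) \<le> real n * gap_min n" using gap by blast
    have "y < ereal (real n * gap_min n / \<Lambda>)" if "N \<le> n" for n
    proof -
      have "r \<le> real n * gap_min n / \<Lambda>" using N[OF that] \<Lambda>_pos by (simp add: field_simps)
      then show ?thesis using r(1) by (meson ereal_less_eq(3) less_le_trans)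
    qed
    then show "\<forall>\<^sub>F n in sequentially. y < ereal (real n * gap_min n / \<Lambda>)" unfolding eventually_sequentially by blast
  qed
qed

text \<open>Whatever the weight \<open>w\<close> of the locale, the products are evaluated for unit
  weights, where \<open>\<tau>\<close> is the order and \<open>\<Omega>\<close> the total
  length.\<close>

lemma iet_E_golden:
  assumes "balanced_golden d \<pi> lam w c e N0"
  shows "iet_E (Suc d) \<pi> lam = ereal (1 / (real d * sqrt 5))"
proof (rule antisym[OF iet_E_le])
  interpret G: balanced_golden d \<pi> lam w c e N0 by fact
  have "ereal (\<Lambda> / (real d * sqrt 5) / \<Lambda>) \<le> iet_E (Suc d) \<pi> lam"
  proof (rule iet_E_ge)
    fix \<epsilon> :: real assume "0 < \<epsilon>"
    moreover have "weight (\<lambda>_. 1)" by (simp add: weight_def)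
    ultimately show "\<exists>M. \<forall>n\<ge>M. \<forall>a\<in>C n. \<forall>b\<in>C n. a \<in> cuts \<longrightarrow> nb n a b \<longrightarrow> ord a < ord b \<longrightarrow>
        \<Lambda> / (real d * sqrt 5) - \<epsilon> \<le> \<bar>b - a\<bar> * (real (ord b) - real (ord a))"
      using G.final_products[of "\<lambda>_. 1" \<epsilon>] by (simp only: \<tau>_one \<Omega>_1)
  qed
  then show "ereal (1 / (real d * sqrt 5)) \<le> iet_E (Suc d) \<pi> lam" using \<Lambda>_pos by simp
qed

text \<open>The \<open>2 * d\<close> triangles have areas at least \<open>L\<close> and total at
  most \<open>2 * \<Omega> w\<close>, so each exceeds \<open>L\<close> by at most the whole surplus.
  The backward triangles have the smaller minimum \<open>sqrt 5 * (c - \<eta>)\<close>; for their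
  ratio a shape error of \<open>1 / 100\<close> suffices.\<close>

lemma balanced_goldenI:
  assumes w: "weight w" and c: "0 < c" and sep: "sep w c N" and \<delta>: "0 < \<delta>" "real d * \<delta> \<le> 1 / 200000"
    and \<Omega>: "2 * (\<Omega> w - real d * sqrt 5 * c) \<le> \<delta> * c"
    and ord: "\<And>y. y \<in> cuts \<Longrightarrow> real (ord y) \<le> 3 * \<tau> w y + 3"
  shows "\<exists>N0. balanced_golden d \<pi> lam w c (2 * \<delta>) N0"
proof -
  have d1: "1 \<le> real d" using d_pos by simp
  have \<delta>d: "\<delta> \<le> 1 / 200000" using mult_right_mono[OF d1, of \<delta>] \<delta> by linarith
  \<comment> \<open>Small enough that the loss \<open>\<eta>\<close> in each of the
    \<open>2 * d\<close> triangles, times \<open>sqrt 5 < 3\<close>, sums to at most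
    \<open>\<delta> * c\<close>.\<close>
  define \<eta> where "\<eta> = min lmin (\<delta> * c / (6 * real d))"
  have \<eta>: "0 < \<eta>" "\<eta> \<le> lmin" "\<eta> \<le> \<delta> * c / (6 * real d)" using lmin(1) \<delta>(1) c d1 by (auto simp: \<eta>_def)
  then have \<eta>6: "6 * real d * \<eta> \<le> \<delta> * c" using d1 by (simp add: field_simps)
  have "\<delta> * c \<le> 1 / 200000 * c" using \<delta>d c by (intro mult_right_mono) auto
  moreover have "6 * \<eta> \<le> 6 * real d * \<eta>" using d1 \<eta>(1) by (intro mult_right_mono) auto
  ultimately have \<eta>c: "\<eta> \<le> c / 1000000" using \<eta>6 c by linarith
  obtain M where M: "\<And>n. M \<le> n \<Longrightarrow> fine n \<eta>" using fine_exists[OF \<eta>(1)] by blast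
  define N0 where "N0 = Max {N, M, 1}"
  define L where "L = sqrt 5 * (c - \<eta>)"
  have n: "N \<le> n" "1 \<le> n" "fine n \<eta>" "fine n lmin" if "N0 \<le> n" for n
    using that M[of n] \<eta>(2) by (auto simp: N0_def fine_def intro: less_le_trans)
  have fL: "L \<le> fwd w n q" and bL: "L \<le> bwd w n q" if "N0 \<le> n" "q \<in> {1..d}" for n q
  proof -
    have "sqrt 5 * (c - \<eta>) \<le> sqrt 5 * c" using \<eta>(1) by (intro mult_left_mono) simp_all
    then show "L \<le> fwd w n q" using fwd_ge[OF w sep c n(1,2,4)[OF that(1)] that(2)] unfolding L_def by linarith
    show "L \<le> bwd w n q" unfolding L_def
      using bwd_ge[OF w sep c n(1,3)[OF that(1)] \<eta>(2,1) _ that(2)] \<eta>c c by simp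
  qed
  have tot: "(\<Sum>q=1..d. fwd w n q) + (\<Sum>s=1..d. bwd w n s) \<le> 2 * \<Omega> w" if "N0 \<le> n" for n
    using area_identity[OF n(4)[OF that], of w] bdry_nonneg[of w n] weightD[OF w] by simp
  have one: "f q + (real d - 1) * L \<le> (\<Sum>q=1..d. f q)" if "q \<in> {1..d}" "\<And>q. q \<in> {1..d} \<Longrightarrow> L \<le> f q" for f :: "nat \<Rightarrow> real" and q
  proof -
    have "(\<Sum>q=1..d. f q) = f q + (\<Sum>p\<in>{1..d} - {q}. f p)" using that(1) by (intro sum.remove) auto
    moreover have "real (card ({1..d} - {q})) * L \<le> (\<Sum>p\<in>{1..d} - {q}. f p)" using that(2) by (intro sum_bounded_below) auto
    moreover have "real (card ({1..d} - {q})) = real d - 1" using that(1) d_pos by (simp add: of_nat_diff)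
    ultimately show ?thesis by simp
  qed
  have all: "real d * L \<le> (\<Sum>q=1..d. f q)" if "\<And>q. q \<in> {1..d} \<Longrightarrow> L \<le> f q" for f :: "nat \<Rightarrow> real"
    using sum_bounded_below[of "{1..d}" L f] that by simp
  have up: "2 * \<Omega> w - (2 * real d - 1) * L \<le> (sqrt 5 + 2 * \<delta>) * c"
  proof -
    have "(2 * real d - 1) * (sqrt 5 * \<eta>) \<le> (2 * real d) * (3 * \<eta>)"
      using sqrt5_bounds \<eta>(1) d1 by (intro mult_mono) auto
    then have "(2 * real d - 1) * (sqrt 5 * \<eta>) \<le> \<delta> * c" using \<eta>6 by simp
    moreover have "2 * \<Omega> w - (2 * real d - 1) * L = 2 * (\<Omega> w - real d * sqrt 5 * c) + sqrt 5 * c + (2 * real d - 1) * (sqrt 5 * \<eta>)"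
      by (simp add: L_def algebra_simps)
    ultimately show ?thesis using \<Omega> by (simp add: algebra_simps)
  qed
  have fU: "fwd w n q \<le> (sqrt 5 + 2 * \<delta>) * c" and bU: "bwd w n q \<le> (sqrt 5 + 2 * \<delta>) * c" if "N0 \<le> n" "q \<in> {1..d}" for n q
  proof -
    have "fwd w n q + (2 * real d - 1) * L \<le> 2 * \<Omega> w"
      using tot[OF that(1)] one[of q "fwd w n"] all[of "bwd w n"] fL bL that by (simp add: algebra_simps)
    then show "fwd w n q \<le> (sqrt 5 + 2 * \<delta>) * c" using up by linarith
    have "bwd w n q + (2 * real d - 1) * L \<le> 2 * \<Omega> w"
      using tot[OF that(1)] one[of q "bwd w n"] all[of "fwd w n"] fL bL that by (simp add: algebra_simps)
    then show "bwd w n q \<le> (sqrt 5 + 2 * \<delta>) * c" using up by linarith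
  qed
  have ratio: "y \<le> (9/5) * x \<and> x \<le> (9/5) * y" if "0 < x" "\<bar>y / x - gr\<bar> \<le> 8 * (1 / 100)" for x y :: real
  proof -
    have "8 / 5 \<le> gr" "gr \<le> 81 / 50" using gr(2,3) by simp_all
    then have "3 / 2 \<le> y / x" "y / x \<le> 9 / 5" using that(2) unfolding abs_le_iff by linarith+
    then show ?thesis using that(1) by (simp add: field_simps)
  qed
  have br: "Y s - pr n (Y s) \<le> (9/5) * (sc n (Y s) - Y s) \<and> sc n (Y s) - Y s \<le> (9/5) * (Y s - pr n (Y s))"
    if h: "N0 \<le> n" "s \<in> {1..d}" for n s
  proof -
    define a b z where "a = pr n (Y s)" and "b = sc n (Y s)" and "z = Y s"
    note f = bwd_nb[OF n(4)[OF h(1)] h(2), folded a_def b_def z_def]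
    note g = bwd_edges[OF w sep c n(1,3)[OF h(1)] \<eta>(2) h(2), folded a_def b_def z_def]
    have c': "0 < c - \<eta>" using \<eta>c c by simp
    have pos: "0 < z - a" "0 < b - z" using f(1,2) by auto
    have "0 < (z - a) * \<tau> w a" "0 < (b - z) * \<tau> w b" using g(1,2) c' by linarith+
    then have t: "0 < \<tau> w a" "0 < \<tau> w b" using pos by (auto simp: zero_less_mult_iff)
    have ar: "(z - a) * \<tau> w b + (b - z) * \<tau> w a \<le> (sqrt 5 + 1 / 100) * (c - \<eta>)"
    proof -
      have "(z - a) * \<tau> w b + (b - z) * \<tau> w a \<le> (sqrt 5 + 2 * \<delta>) * c"
        using bU[OF h] by (simp add: bwd_def Let_def a_def b_def z_def)
      also have "\<dots> = sqrt 5 * c + 2 * (\<delta> * c)" by (simp add: algebra_simps)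
      also have "\<dots> \<le> sqrt 5 * c + c / 100000" using \<open>\<delta> * c \<le> 1 / 200000 * c\<close> by simp
      also have "\<dots> \<le> (sqrt 5 + 1 / 100) * (c - \<eta>)"
      proof -
        have "(sqrt 5 + 1 / 100) * \<eta> \<le> 3 * \<eta>" using sqrt5_bounds(2) \<eta>(1) by (intro mult_right_mono) auto
        moreover have "(sqrt 5 + 1 / 100) * (c - \<eta>) = sqrt 5 * c + c / 100 - (sqrt 5 + 1 / 100) * \<eta>"
          unfolding right_diff_distrib distrib_right by simp
        ultimately show ?thesis using \<eta>c c by simp
      qed
      finally show ?thesis .
    qed
    show ?thesis
    proof (cases "\<tau> w b \<le> \<tau> w a")
      case True
      have "c - \<eta> \<le> ((z - a) + (b - z)) * (\<tau> w a - \<tau> w b)" using g(3) True \<eta>(1) by simp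
      then have "\<bar>(b - z) / (z - a) - gr\<bar> \<le> 8 * (1 / 100)"
        by (intro triangle_shape(4)[of "c - \<eta>" _ _ "\<tau> w a" "\<tau> w b"]) (use c' pos t g ar in auto)
      then show ?thesis using ratio[OF pos(1), of "b - z"] unfolding a_def b_def z_def by blast
    next
      case False
      have "c - \<eta> \<le> ((b - z) + (z - a)) * (\<tau> w b - \<tau> w a)" using g(3) False \<eta>(1) by simp
      then have "\<bar>(z - a) / (b - z) - gr\<bar> \<le> 8 * (1 / 100)"
        by (intro triangle_shape(4)[of "c - \<eta>" _ _ "\<tau> w b" "\<tau> w a"]) (use c' pos t g ar in \<open>auto simp: add.commute\<close>)
      then show ?thesis using ratio[OF pos(2), of "z - a"] unfolding a_def b_def z_def by blast
    qed
  qed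
  have "balanced_golden d \<pi> lam w c (2 * \<delta>) N0"
  proof unfold_locales
    show "1 \<le> N0" by (simp add: N0_def)
    show "sep w c N0" using sep by (auto simp: sep_def N0_def)
    show "fine N0 lmin" using n(4) by simp
    show "2 * \<delta> \<le> 1 / 1000" using \<delta>d by simp
    show "real d * (2 * \<delta>) \<le> 1 / 100000" using \<delta>(2) by simp
  qed (use w c fU br \<delta>(1) ord in auto)
  then show ?thesis by blast
qed

theorem isolated:
  assumes "ereal (1 / (real d * sqrt 5 + 1 / (1600000 * real d))) \<le> iet_E (Suc d) \<pi> lam"
  shows "iet_E (Suc d) \<pi> lam = ereal (1 / (real d * sqrt 5))"
proof -
  have d1: "1 \<le> real d" using d_pos by simp
  \<comment> \<open>The bound is weakened from \<open>1 / (1600000 * real d)\<close> to its double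
    \<open>t\<close>, to get a value \<open>r\<close> strictly below \<open>iet_E\<close>. The
    surplus is then \<open>2 * t\<close> times the separation, and \<open>\<delta> = 2 * t\<close>
    meets the bound \<open>1 / 200000\<close> of \<open>balanced_goldenI\<close>.\<close>
  define t r where "t = 1 / (800000 * real d)" and "r = 1 / (real d * sqrt 5 + t)"
  have t: "0 < t" using d1 by (simp add: t_def)
  have den: "0 < real d * sqrt 5" using d1 by simp
  then have r: "0 < r" "r * (real d * sqrt 5 + t) = 1" using t by (simp_all add: r_def add_pos_pos)
  have rl: "r < 1 / (real d * sqrt 5 + 1 / (1600000 * real d))"
    unfolding r_def
  proof (rule divide_strict_left_mono)
    have "1 / (1600000 * real d) < t" unfolding t_def using d1 by (intro divide_strict_left_mono) auto
    then show "real d * sqrt 5 + 1 / (1600000 * real d) < real d * sqrt 5 + t" by simp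
    show "0 < (real d * sqrt 5 + t) * (real d * sqrt 5 + 1 / (1600000 * real d))"
      using den t d1 by (intro mult_pos_pos add_pos_pos) auto
  qed simp
  have "ereal r < iet_E (Suc d) \<pi> lam"
    by (rule less_le_trans[OF _ assms]) (simp only: less_ereal.simps(1) rl)
  then obtain N where N: "sep (\<lambda>_. 1) (r * \<Lambda>) N" using sep_of_iet_E r(1) by blast
  have "\<exists>N0. balanced_golden d \<pi> lam (\<lambda>_. 1) (r * \<Lambda>) (2 * (2 * t)) N0"
  proof (rule balanced_goldenI[OF _ _ N])
    have "2 * (\<Lambda> - real d * sqrt 5 * (r * \<Lambda>)) = 2 * \<Lambda> * (1 - r * (real d * sqrt 5))" by (simp add: algebra_simps)
    also have "1 - r * (real d * sqrt 5) = r * t" using r(2) by (simp add: algebra_simps)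
    also have "2 * \<Lambda> * (r * t) = 2 * t * (r * \<Lambda>)" by simp
    finally show "2 * (\<Omega> (\<lambda>_. 1) - real d * sqrt 5 * (r * \<Lambda>)) \<le> 2 * t * (r * \<Lambda>)"
      unfolding \<Omega>_1 by (rule eq_refl)
    show "real d * (2 * t) \<le> 1 / 200000" using d1 by (simp add: t_def)
  qed (use t r \<Lambda>_pos in \<open>simp_all add: weight_def \<tau>_one\<close>)
  then show ?thesis using iet_E_golden by blast
qed

end

section \<open>The golden example\<close>

text \<open>Descent by halving: modulo 2 the form vanishes only if both entries are even, and the
  halves are again a zero.\<close>

lemma golden_form_anisotropic:
  fixes m M :: int
  assumes "m * m + m * M - M * M = 0" shows "M = 0 \<and> m = 0"
  using assms
proof (induction "nat \<bar>m\<bar> + nat \<bar>M\<bar>" arbitrary: m M rule: less_induct)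
  case less
  have "even (m * m + m * M - M * M)" using less.prems by simp
  then have "even m" "even M" by auto
  then obtain m' M' where h: "m = 2 * m'" "M = 2 * M'" by (auto elim!: evenE)
  have "4 * (m' * m' + m' * M' - M' * M') = 0" using less.prems by (simp add: h algebra_simps)
  then have z: "m' * m' + m' * M' - M' * M' = 0" by simp
  show ?case
  proof (cases "m = 0 \<and> M = 0")
    case False
    then have "nat \<bar>m'\<bar> + nat \<bar>M'\<bar> < nat \<bar>m\<bar> + nat \<bar>M\<bar>" using h by auto
    then have "M' = 0 \<and> m' = 0" using z by (rule less.hyps)
    then show ?thesis using h by simp
  qed simp
qed

text \<open>\<open>\<xi>'\<close> is the conjugate of \<open>\<xi>\<close>, so
  \<open>\<xi> * \<xi>'\<close> is the norm, a nonzero integer unless \<open>\<xi> = 0\<close>; the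
  conjugate differs from \<open>\<xi>\<close> by \<open>sqrt 5 * M\<close>.\<close>

lemma golden_norm:
  fixes m M :: int
  defines "\<xi> \<equiv> gr * of_int M + of_int m"
  shows "\<xi> = 0 \<Longrightarrow> M = 0" "\<xi> \<noteq> 0 \<Longrightarrow> 1 \<le> \<bar>\<xi>\<bar> * (\<bar>\<xi>\<bar> + sqrt 5 * \<bar>of_int M\<bar>)"
proof -
  define \<xi>' where "\<xi>' = \<xi> - sqrt 5 * of_int M"
  have "\<xi> * \<xi>' = of_int m * of_int m + of_int m * of_int M - (gr * gr - gr) * (of_int M * of_int M)"
    by (simp only: \<xi>_def \<xi>'_def gr(4)) algebra
  also have "gr * gr - gr = 1" using gr(1) by simp
  finally have N: "\<xi> * \<xi>' = of_int (m * m + m * M - M * M)" by simp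
  show "M = 0" if "\<xi> = 0"
  proof -
    have "real_of_int (m * m + m * M - M * M) = 0" using N that by simp
    then have "m * m + m * M - M * M = 0" by (simp only: of_int_eq_0_iff)
    then show ?thesis using golden_form_anisotropic by blast
  qed
  show "1 \<le> \<bar>\<xi>\<bar> * (\<bar>\<xi>\<bar> + sqrt 5 * \<bar>of_int M\<bar>)" if "\<xi> \<noteq> 0"
  proof -
    have "m * m + m * M - M * M \<noteq> 0"
      using golden_form_anisotropic[of m M] that by (auto simp: \<xi>_def)
    then have "1 \<le> \<bar>m * m + m * M - M * M\<bar>" by linarith
    then have "1 \<le> \<bar>\<xi> * \<xi>'\<bar>" unfolding N by linarith
    also have "\<bar>\<xi> * \<xi>'\<bar> = \<bar>\<xi>\<bar> * \<bar>\<xi>'\<bar>" by (rule abs_mult)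
    also have "\<bar>\<xi>'\<bar> \<le> \<bar>\<xi>\<bar> + \<bar>sqrt 5 * of_int M\<bar>" unfolding \<xi>'_def by (rule abs_triangle_ineq4)
    also have "\<bar>sqrt 5 * of_int M\<bar> = sqrt 5 * \<bar>of_int M\<bar>" by (simp add: abs_mult)
    finally show ?thesis by (simp add: mult_left_mono)
  qed
qed

locale golden_lengths = interval_exchange +
  assumes \<pi>_1: "\<pi> 1 = Suc d" and lam_1: "lam 1 = gr" and lam_2: "\<And>i. i \<in> {2..Suc d} \<Longrightarrow> lam i = 1"
begin

lemma X_gr: "i \<le> d \<Longrightarrow> X (Suc i) = gr + real i"
proof (induction i)
  case 0 then show ?case using lam_1 by (simp add: X_def)
next
  case (Suc i)
  then show ?case using X_Suc[of "Suc i"] lam_2[of "Suc (Suc i)"] by simp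
qed

lemma Y_nat: "s \<le> d \<Longrightarrow> Y s = real s"
proof (induction s)
  case (Suc s)
  obtain j where j: "j \<in> {1..Suc d}" "\<pi> j = Suc s" using \<pi>_surj[of "Suc s"] Suc.prems by auto
  then have "j \<noteq> 1" using \<pi>_1 Suc.prems by auto
  then show ?case using Y_step[OF j(1)] j lam_2[of j] Suc by auto
qed simp

text \<open>\<open>T\<close> moves the first interval by the integer \<open>d\<close> and every
  other one by an integer minus \<open>gr\<close>. With weight \<open>0\<close> on the first
  interval the age therefore counts the multiples of \<open>gr\<close> in the displacement.\<close>

definition w1 :: "nat \<Rightarrow> real" where "w1 i = (if i = 1 then 0 else 1)"

lemma T_first: assumes "0 \<le> x" "x < gr" shows "T x = x + real d" "idx x = 1"
  using T_eq[of 1 x] idx_eq[of 1 x] X_gr[of 0] Y_nat[of d] \<pi>_1 assms by auto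

lemma not_first: assumes "x \<in> D" "gr \<le> x" shows "idx x \<noteq> 1"
proof -
  obtain i where i: "i \<in> {1..Suc d}" "X (i - 1) \<le> x" "x < X i" using X_interval assms(1) by metis
  then have "i \<noteq> 1" using X_gr[of 0] assms(2) by auto
  then show ?thesis using idx_eq[OF i] by simp
qed

lemma T_step: assumes "x \<in> D" shows "\<exists>m::int. T x = x - gr * w1 (idx x) + m"
proof -
  obtain i where i: "i \<in> {1..Suc d}" "X (i - 1) \<le> x" "x < X i" using X_interval assms by metis
  note T = T_eq[OF i] and id = idx_eq[OF i]
  show ?thesis
  proof (cases "i = 1")
    case True
    then show ?thesis using T id Y_nat[of d] \<pi>_1 by (intro exI[of _ "int d"]) (simp add: w1_def)
  next
    case False
    then obtain k where k: "i = Suc (Suc k)" "k \<le> d" using i(1) by (cases i; cases "i - 1") auto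
    have "\<pi> i \<in> {1..Suc d}" using \<pi>_mem i(1) by blast
    then have "Y (\<pi> i - 1) = real (\<pi> i - 1)" by (intro Y_nat) auto
    then show ?thesis using T id X_gr[of k] k by (intro exI[of _ "int (\<pi> i - 1) - int k"]) (simp add: w1_def)
  qed
qed

definition visits :: "nat \<Rightarrow> real \<Rightarrow> real" where "visits n x = (\<Sum>i<n. w1 (idx ((T ^^ i) x)))"

lemma visits_nat: "\<exists>k::nat. visits n x = real k"
proof (induction n)
  case (Suc n)
  then obtain k where "visits n x = real k" by blast
  then show ?case
    by (intro exI[of _ "if idx ((T ^^ n) x) = 1 then k else Suc k"]) (simp add: visits_def w1_def)
qed (simp add: visits_def)

lemma T_orbit: assumes "x \<in> D" shows "\<exists>m::int. (T ^^ n) x = x - gr * visits n x + m"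
proof (induction n)
  case (Suc n)
  then obtain m :: int where m: "(T ^^ n) x = x - gr * visits n x + m" by blast
  obtain k :: int where "T ((T ^^ n) x) = (T ^^ n) x - gr * w1 (idx ((T ^^ n) x)) + k"
    using T_step[OF T_pow_mem[OF assms]] by blast
  moreover have "visits (Suc n) x = visits n x + w1 (idx ((T ^^ n) x))" by (simp add: visits_def)
  ultimately have "T ((T ^^ n) x) = x - gr * visits (Suc n) x + (m + k)" using m by (simp only: distrib_left of_int_add)
  then show ?case by (intro exI[of _ "m + k"]) simp
qed (auto simp: visits_def intro: exI[of _ 0])

text \<open>The singularities differ by integers, so a connection would involve no multiple of
  \<open>gr\<close> and would have to stay in the first interval; but it starts at some
  \<open>X i\<close>, which lies outside of it.\<close>

lemma keane_golden: "keane (Suc d) \<pi> lam"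
proof -
  have False if h: "i \<in> {1..d}" "j \<in> {1..d}" "1 \<le> n" "(T ^^ n) (X i) = X j" for i j n
  proof -
    have x: "X i = gr + real (i - 1)" "X j = gr + real (j - 1)" using X_gr[of "i - 1"] X_gr[of "j - 1"] h(1,2) by auto
    have D: "X i \<in> D" using X_D[OF h(1)] .
    obtain m :: int where m: "X j = X i - gr * visits n (X i) + m" using T_orbit[OF D] h(4) by metis
    obtain k where k: "visits n (X i) = real k" using visits_nat by blast
    have "gr * of_int (int k) + of_int (int (j - 1) - int (i - 1) - m) = (0::real)" using m k x by (simp add: algebra_simps)
    then have "k = 0" using golden_norm(1)[of "int k" "int (j - 1) - int (i - 1) - m"] by simp
    moreover have "1 \<le> visits n (X i)"
    proof -
      have "idx (X i) \<noteq> 1" using not_first[OF D] x by simp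
      then have "1 = w1 (idx ((T ^^ 0) (X i)))" by (simp add: w1_def)
      also have "\<dots> \<le> visits n (X i)"
        unfolding visits_def using h(3) by (intro member_le_sum) (auto simp: w1_def)
      finally show ?thesis .
    qed
    ultimately show False using k by simp
  qed
  then show ?thesis unfolding keane_def T_def X_def singularity_def diff_Suc_1 by blast
qed

sublocale keane_iet
  by unfold_locales (rule keane_golden)

lemma weight_w1: "weight w1"
  by (simp add: weight_def w1_def)

text \<open>Three successive points cannot all be in the first interval: each visit adds
  \<open>d \<ge> 1\<close>, and \<open>gr < 2\<close>.\<close>

lemma visits_ge: assumes "x \<in> D" shows "real n \<le> 3 * visits n x + 3"
proof -
  have step: "visits n x + 1 \<le> visits (n + 3) x" for n
  proof -
    define y where "y = (T ^^ n) x"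
    have D: "y \<in> D" "T y \<in> D" "T (T y) \<in> D" using T_pow_mem[OF assms] T_mem by (auto simp: y_def)
    have "1 \<le> w1 (idx y) + w1 (idx (T y)) + w1 (idx (T (T y)))"
    proof (rule ccontr)
      assume a: "\<not> ?thesis"
      have "idx z = 1" if "z \<in> {y, T y, T (T y)}" for z using a that by (auto simp: w1_def split: if_splits)
      then have l: "y < gr" "T y < gr" "T (T y) < gr" using not_first D by (meson insertCI not_le)+
      have d1: "1 \<le> real d" using d_pos by simp
      have "T y = y + real d" "T (T y) = T y + real d" using T_first(1) l D by auto
      then have "2 \<le> T (T y)" using D(1) d1 by auto
      then show False using l(3) gr(3) by simp
    qed
    moreover have "visits (n + 3) x = visits n x + (w1 (idx y) + w1 (idx (T y)) + w1 (idx (T (T y))))"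
      by (simp add: visits_def y_def numeral_3_eq_3)
    ultimately show ?thesis by simp
  qed
  have nn: "0 \<le> visits n x" for n by (simp add: visits_def w1_def sum_nonneg)
  show ?thesis
  proof (induction n rule: less_induct)
    case (less n)
    show ?case
    proof (cases "n < 3")
      case True
      then have "real n \<le> 3" by simp
      then show ?thesis using nn[of n] by linarith
    next
      case False
      then obtain k where k: "n = k + 3" by (metis add.commute le_Suc_ex not_less)
      then show ?thesis using less.IH[of k] step[of k] by simp
    qed
  qed
qed

lemma \<tau>_visits: "\<tau> w1 y = visits (ord y) y"
  by (simp add: \<tau>_def visits_def)

lemma cuts_D: "y \<in> cuts \<Longrightarrow> y \<in> D"
  using cuts_range by force

text \<open>The orbit of a cut point reaches some \<open>X q\<close>, which is \<open>gr\<close>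
  plus an integer, so its coefficient of \<open>gr\<close> is the age plus \<open>1\<close>. The end
  \<open>\<Lambda>\<close> has the same form, and \<open>0\<close> gives
  \<open>k = 0\<close>.\<close>

lemma cut_coordinates:
  assumes "y \<in> C n"
  shows "\<exists>k m t::int. \<tau> w1 y = of_int t \<and> (k = 0 \<or> k = 1) \<and> y = gr * of_int (t + k) + of_int m"
proof -
  consider "y \<in> cuts" | "y = 0" | "y = \<Lambda>" using assms by (auto simp: C_mem)
  then show ?thesis
  proof cases
    case 1
    have q: "qof y \<in> {1..d}" "y = cut (qof y) (ord y)" using cuts_eq[OF 1] by auto
    obtain m :: int where m: "(T ^^ ord y) y = y - gr * visits (ord y) y + m" using T_orbit[OF cuts_D[OF 1]] by blast
    have "(T ^^ ord y) y = X (qof y)" using T_pow_cut(1)[OF q(1), of "ord y"] q(2) by metis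
    also have "X (qof y) = gr + real (qof y - 1)" using X_gr[of "qof y - 1"] q(1) by auto
    finally have "y = gr * (\<tau> w1 y + 1) + of_int (int (qof y - 1) - m)" using m by (simp add: \<tau>_visits algebra_simps)
    moreover obtain t where t: "\<tau> w1 y = real t" using visits_nat \<tau>_visits by metis
    ultimately have "y = gr * of_int (int t + 1) + of_int (int (qof y - 1) - m)" by simp
    moreover have "\<tau> w1 y = of_int (int t)" using t by simp
    ultimately show ?thesis by blast
  next
    case 2
    then show ?thesis by (intro exI[of _ 0]) simp
  next
    case 3
    have "\<Lambda> = gr + real d" using X_gr[of d] by (simp add: \<Lambda>_def)
    then have "y = gr * of_int (0 + 1) + of_int (int d)" using 3 by simp
    moreover have "\<tau> w1 y = of_int 0" using 3 by simp
    ultimately show ?thesis by blast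
  qed
qed

text \<open>By the norm a distance \<open>\<rho>\<close> of cut points satisfies
  \<open>\<rho> * (\<rho> + sqrt 5 * \<bar>M\<bar>) \<ge> 1\<close>, where the coefficient
  \<open>M\<close> differs from the age difference by at most one. As \<open>\<rho>\<close> tends to
  \<open>0\<close>, every \<open>c\<close> below \<open>1 / sqrt 5\<close> is reached.\<close>

lemma sep_golden: assumes "0 < c" "sqrt 5 * c < 1" shows "\<exists>N. sep w1 c N"
proof -
  \<comment> \<open>The terms \<open>\<rho> * \<rho> + sqrt 5 * \<rho>\<close> are at most
    \<open>4 * \<rho>\<close>, so they stay below \<open>1 - sqrt 5 * c\<close>.\<close>
  define \<eta> where "\<eta> = min 1 ((1 - sqrt 5 * c) / 4)"
  have "\<eta> \<le> (1 - sqrt 5 * c) / 4" unfolding \<eta>_def by (rule min.cobounded2)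
  then have \<eta>: "0 < \<eta>" "\<eta> \<le> 1" "4 * \<eta> \<le> 1 - sqrt 5 * c" using assms by (auto simp: \<eta>_def)
  obtain N where N: "\<And>n. N \<le> n \<Longrightarrow> fine n \<eta>" using fine_exists[OF \<eta>(1)] by blast
  have "c \<le> \<bar>b - a\<bar> * \<bar>\<tau> w1 a - \<tau> w1 b\<bar>" if h: "N \<le> n" "a \<in> C n" "b \<in> C n" "nb n a b" for n a b
  proof -
    define \<rho> where "\<rho> = \<bar>b - a\<bar>"
    have "\<rho> < \<eta>" using N[OF h(1)] h(4) unfolding \<rho>_def fine_def nb_def by (auto simp: min_def max_def abs_if split: if_splits)
    then have \<rho>: "0 < \<rho>" "\<rho> < \<eta>" using nb_neq[OF h(4)] by (auto simp: \<rho>_def)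
    obtain ka ma ta :: int where A: "\<tau> w1 a = of_int ta" "ka = 0 \<or> ka = 1" "a = gr * of_int (ta + ka) + of_int ma"
      using cut_coordinates[OF h(2)] by blast
    obtain kb mb tb :: int where B: "\<tau> w1 b = of_int tb" "kb = 0 \<or> kb = 1" "b = gr * of_int (tb + kb) + of_int mb"
      using cut_coordinates[OF h(3)] by blast
    define M where "M = tb + kb - (ta + ka)"
    have e: "b - a = gr * of_int M + of_int (mb - ma)" using A(3) B(3) by (simp add: M_def algebra_simps)
    have "1 \<le> \<rho> * (\<rho> + sqrt 5 * \<bar>of_int M\<bar>)"
      using golden_norm(2)[of M "mb - ma"] \<rho>(1) unfolding \<rho>_def e[symmetric] by auto
    also have "\<bar>of_int M\<bar> \<le> \<bar>\<tau> w1 a - \<tau> w1 b\<bar> + 1"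
      using A(1,2) B(1,2) by (auto simp: M_def)
    finally have "1 \<le> \<rho> * (\<rho> + sqrt 5 * (\<bar>\<tau> w1 a - \<tau> w1 b\<bar> + 1))" using \<rho>(1) by (simp add: mult_left_mono)
    then have "1 \<le> \<rho> * \<rho> + sqrt 5 * \<rho> + sqrt 5 * (\<rho> * \<bar>\<tau> w1 a - \<tau> w1 b\<bar>)" by (simp add: algebra_simps)
    moreover have "\<rho> * \<rho> \<le> 1 * \<rho>" "sqrt 5 * \<rho> \<le> 3 * \<rho>" using \<rho> \<eta>(2) sqrt5_bounds(2) by (intro mult_right_mono; simp)+
    ultimately have "sqrt 5 * c \<le> sqrt 5 * (\<rho> * \<bar>\<tau> w1 a - \<tau> w1 b\<bar>)" using \<rho>(2) \<eta>(3) by linarith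
    then show ?thesis by (simp add: \<rho>_def)
  qed
  then show ?thesis unfolding sep_def by blast
qed

lemma \<Omega>_w1: "\<Omega> w1 = real d"
proof -
  have "\<Omega> w1 = w1 1 * lam 1 + (\<Sum>i=Suc 1..Suc d. w1 i * lam i)"
    unfolding \<Omega>_def by (rule sum.atLeast_Suc_atMost) simp
  also have "(\<Sum>i=Suc 1..Suc d. w1 i * lam i) = (\<Sum>i=Suc 1..Suc d. 1)"
    by (intro sum.cong refl) (use lam_2 in \<open>auto simp: w1_def\<close>)
  also have "w1 1 * lam 1 = 0" by (simp add: w1_def)
  finally show ?thesis by simp
qed

theorem golden_iet_E: "iet_E (Suc d) \<pi> lam = ereal (1 / (real d * sqrt 5))"
proof -
  have d1: "1 \<le> real d" using d_pos by simp
  \<comment> \<open>\<open>c\<close> lies just below the critical value \<open>1 / sqrt 5\<close>,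
    with \<open>t\<close> so small that the surplus \<open>2 * (d - d * sqrt 5 * c)\<close> is at
    most \<open>\<delta> * c\<close>.\<close>
  define \<delta> t c where "\<delta> = 1 / (200000 * real d)" and "t = \<delta> / (6 * real d)" and "c = 1 / (sqrt 5 * (1 + t))"
  have \<delta>: "0 < \<delta>" "real d * \<delta> = 1 / 200000" using d1 by (auto simp: \<delta>_def)
  have t: "0 < t" "6 * real d * t = \<delta>" using \<delta>(1) d1 by (auto simp: t_def)
  have c: "0 < c" "sqrt 5 * c * (1 + t) = 1" using t(1) by (auto simp: c_def)
  have c1: "1 - sqrt 5 * c = t * (sqrt 5 * c)" using c(2) by (simp add: algebra_simps)
  have tc: "0 < t * (sqrt 5 * c)" using t c by simp
  then obtain N where N: "sep w1 c N" using sep_golden[OF c(1)] c1 by auto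
  have "\<exists>N0. balanced_golden d \<pi> lam w1 c (2 * \<delta>) N0"
  proof (rule balanced_goldenI[OF weight_w1 c(1) N \<delta>(1)])
    have "2 * (real d - real d * sqrt 5 * c) = 2 * real d * (1 - sqrt 5 * c)" by (simp add: algebra_simps)
    also have "\<dots> = 2 * real d * t * c * sqrt 5" unfolding c1 by simp
    also have "\<dots> \<le> 2 * real d * t * c * 3" using sqrt5_bounds(2) t(1) c(1) by (intro mult_left_mono) auto
    also have "\<dots> = \<delta> * c" using t(2) by (simp add: algebra_simps)
    finally show "2 * (\<Omega> w1 - real d * sqrt 5 * c) \<le> \<delta> * c" unfolding \<Omega>_w1 .
    show "real (ord y) \<le> 3 * \<tau> w1 y + 3" if "y \<in> cuts" for y
      using visits_ge[OF cuts_D[OF that]] by (simp add: \<tau>_visits)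
  qed (simp add: \<delta>)
  then show ?thesis using iet_E_golden by blast
qed

end

lemma golden_example:
  assumes "1 \<le> d" "\<pi> permutes {1..d + 1}" "\<pi> 1 = d + 1" "lam 1 = (sqrt 5 + 1) / 2" "\<forall>i\<in>{2..d + 1}. lam i = 1"
  shows "keane (d + 1) \<pi> lam" "lagrange_const (d + 1) \<pi> lam = ereal (real d * sqrt 5)"
proof -
  have "0 < lam 1" unfolding assms(4) by (intro divide_pos_pos add_pos_pos) auto
  note l1 = this
  interpret golden_lengths d \<pi> lam
  proof
    show "0 < lam i" if "i \<in> {1..Suc d}" for i
      using that assms(5) l1 by (cases "i = 1") auto
  qed (use assms in \<open>auto simp: gr_def\<close>)
  show "keane (d + 1) \<pi> lam" using keane_golden by simp
  show "lagrange_const (d + 1) \<pi> lam = ereal (real d * sqrt 5)"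
    using golden_iet_E d_pos by (simp add: lagrange_const_def)
qed

theorem theorem3:
  "(\<exists>\<epsilon>\<^sub>0::real. \<epsilon>\<^sub>0 > 0 \<and>
      (\<forall>d::nat. d \<ge> 1 \<longrightarrow>
         lagrange_spectrum d \<inter> {0 .. real d * sqrt 5 + \<epsilon>\<^sub>0 / real d} = {real d * sqrt 5})) \<and>
   (\<forall>(d::nat) (\<pi>::nat \<Rightarrow> nat) (lam::nat \<Rightarrow> real).
      d \<ge> 1 \<longrightarrow> \<pi> permutes {1..d+1} \<longrightarrow> \<pi> 1 = d + 1 \<longrightarrow>
      lam 1 = (sqrt 5 + 1) / 2 \<longrightarrow> (\<forall>i\<in>{2..d+1}. lam i = 1) \<longrightarrow>
      keane (d+1) \<pi> lam \<and> lagrange_const (d+1) \<pi> lam = ereal (real d * sqrt 5))"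
proof (intro conjI exI[of _ "1 / 1600000 :: real"] allI impI)
  fix d :: nat assume d: "1 \<le> d"
  let ?S = "lagrange_spectrum d \<inter> {0 .. real d * sqrt 5 + (1 / 1600000) / real d}"
  have "x = real d * sqrt 5" if x: "x \<in> ?S" for x
  proof -
    obtain \<pi> lam where h: "iet_data (d + 1) \<pi> lam" "keane (d + 1) \<pi> lam" "lagrange_const (d + 1) \<pi> lam = ereal x"
      using x by (auto simp: lagrange_spectrum_def)
    interpret keane_iet d \<pi> lam
      using h(1,2) d by unfold_locales (auto simp: iet_data_def)
    let ?E = "iet_E (Suc d) \<pi> lam"
    have inv: "inverse ?E = ereal x" using h(3) by (simp add: lagrange_const_def)
    have "?E \<noteq> 0" using inv by auto
    have "?E \<le> ereal (1 / (real d * sqrt 5))" by (rule iet_E_le)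
    then obtain r where r: "?E = ereal r" using iet_E_nonneg by (cases ?E) auto
    then have r0: "0 < r" using iet_E_nonneg \<open>?E \<noteq> 0\<close> by auto
    then have xr: "x = 1 / r" using inv r by (simp add: inverse_eq_divide)
    have "1 / r \<le> real d * sqrt 5 + 1 / (1600000 * real d)" using x xr by simp
    moreover have "0 < real d * sqrt 5 + 1 / (1600000 * real d)" using d by (intro add_pos_pos) auto
    ultimately have "1 / (real d * sqrt 5 + 1 / (1600000 * real d)) \<le> r" using r0 by (simp add: field_simps)
    then have "?E = ereal (1 / (real d * sqrt 5))" using isolated r by simp
    then show ?thesis using r xr by simp
  qed
  moreover have "real d * sqrt 5 \<in> ?S"
  proof -
    \<comment> \<open>Any permutation with \<open>\<pi> 1 = d + 1\<close> would serve; the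
      transposition is the simplest.\<close>
    define \<pi> where "\<pi> = Transposition.transpose 1 (d + 1)"
    define lam :: "nat \<Rightarrow> real" where "lam i = (if i = 1 then (sqrt 5 + 1) / 2 else 1)" for i
    have p: "\<pi> permutes {1..d + 1}" "\<pi> 1 = d + 1" unfolding \<pi>_def by (auto intro: permutes_swap_id)
    have l: "lam 1 = (sqrt 5 + 1) / 2" "\<forall>i\<in>{2..d + 1}. lam i = 1" by (auto simp: lam_def)
    have "iet_data (d + 1) \<pi> lam" using p d by (auto simp: iet_data_def lam_def add_pos_pos)
    then show ?thesis using golden_example[OF d p l] d by (auto simp: lagrange_spectrum_def)
  qed
  ultimately show "?S = {real d * sqrt 5}" by blast
qed (use golden_example in auto)

end
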